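(* Let $\kappa,\eta>0$ and for $f>0$ let $\mathcal J[a,b]$ be the number of resonances of $H_{\kappa,\eta,f}$ below the segment $[a,b]$ of the real axis (i.e. resonances $z$ with $\operatorname{Re}z\in[a,b]$ and $\operatorname{Im} z<0$), counted with multiplicity. If $0<a<b/2$, then $$0<\liminf_{f\downarrow 0}\frac{\mathcal J[a,b]}{1/f}\le\limsup_{f\downarrow0}\frac{\mathcal J[a,b]}{1/f}<\infty .$$
   Context: For $\kappa,\eta,f>0$, $H_{\kappa,\eta,f}=p^2+fx+\frac1\eta(\delta_\kappa+\delta_{-\kappa})$ denotes the self-adjoint realization in $L^2(\mathbb R)$, where $p=-i\frac{d}{dx}$ and $\delta_{\pm\kappa}$ is the delta function at $\pm\kappa$ (functions in the domain are continuous, with jump condition $u'(\pm\kappa+0)-u'(\pm\kappa-0)=\eta^{-1}u(\pm\kappa)$, and $H_{\kappa,\eta,f}u=-u''+fxu\in L^2$ away from $\pm\kappa$). The resonances of $H_{\kappa,\eta,f}$ are the poles in the lower half plane of the meromorphic continuation in $z$, from the upper half plane across the real axis, of the Green's functions $(H_{\kappa,\eta,f}-z)^{-1}(x,y)$. They are exactly the zeros of the entire function $$D_f(z)=1+\frac{\alpha_++\alpha_-}{\eta\mathcal W}+\frac{\beta_+(\beta_--\beta_+)}{\eta^2\mathcal W^2},$$ and the multiplicity of a resonance is its multiplicity as a zero of $D_f$. Here $A(x)=\frac1{2\pi}\int_{-\infty}^\infty e^{i(tx+t^3/3)}dt$ is the Airy function (extended to an entire function), $\omega=e^{2\pi i/3}$,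 $\zeta_\pm=-zf^{-2/3}\pm\kappa f^{1/3}$, $\alpha_\pm=A(\omega\zeta_\pm)A(\zeta_\pm)$, $\beta_\pm=A(\omega\zeta_\mp)A(\zeta_\pm)$ and $\mathcal W=f^{1/3}e^{-i\pi/6}/(2\pi)$. *)

theory Defs
  imports "HOL-Complex_Analysis.Complex_Analysis"
begin

section \<open>The Stark operator with two delta interactions\<close>

definition square_integrable :: "(real \<Rightarrow> complex) \<Rightarrow> bool" where
  "square_integrable u \<longleftrightarrow>
     u \<in> borel_measurable lborel \<and> integrable lborel (\<lambda>x. (norm (u x))\<^sup>2)"

text \<open>
  \<open>stark_delta \<kappa> \<eta> f u h\<close> says that \<open>u\<close> lies in the domain of the self-adjoint operator
  \<open>H = p\<^sup>2 + f x + (\<delta>\<^sub>\<kappa> + \<delta>\<^sub>-\<^sub>\<kappa>) / \<eta>\<close> and \<open>H u = h\<close> almost everywhere. Elements of the domain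
  are represented by their continuous representative \<open>u\<close>, and \<open>v\<close> is its derivative away from
  \<open>\<plusminus>\<kappa>\<close>. The integral equation says that \<open>v\<close> is locally absolutely continuous away from \<open>\<plusminus>\<kappa>\<close>
  with \<open>-v' + f x u = h\<close> almost everywhere.
\<close>

definition stark_delta ::
  "real \<Rightarrow> real \<Rightarrow> real \<Rightarrow> (real \<Rightarrow> complex) \<Rightarrow> (real \<Rightarrow> complex) \<Rightarrow> bool" where
  "stark_delta \<kappa> \<eta> f u h \<longleftrightarrow>
     square_integrable u \<and> square_integrable h \<and> continuous_on UNIV u \<and>
     (\<exists>v. (\<forall>x. x \<notin> {-\<kappa>, \<kappa>} \<longrightarrow> (u has_vector_derivative v x) (at x)) \<and>
          (\<forall>s t. s \<le> t \<and> {s..t} \<inter> {-\<kappa>, \<kappa>} = {} \<longrightarrow>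
             set_integrable lborel {s..t} (\<lambda>x. complex_of_real (f * x) * u x - h x) \<and>
             v t - v s = (LINT x:{s..t}|lborel. complex_of_real (f * x) * u x - h x)) \<and>
          (\<forall>c\<in>{-\<kappa>, \<kappa>}. \<exists>l r. (v \<longlongrightarrow> l) (at_left c) \<and> (v \<longlongrightarrow> r) (at_right c) \<and>
             r - l = u c / complex_of_real \<eta>))"

text \<open>
  The Green's function \<open>(H - z)\<^sup>-\<^sup>1(x, y)\<close> for \<open>Im z > 0\<close>: the continuous integral kernel of the
  resolvent, that is, if \<open>(H - z) u = g\<close> then \<open>u(x)\<close> is the integral of \<open>K(x, y) g(y)\<close> over \<open>y\<close>.
  Since \<open>H\<close> is self-adjoint, \<open>H - z\<close> maps its domain onto all of \<open>L\<^sup>2\<close>, so every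
  square-integrable \<open>g\<close> occurs here up to null sets.
\<close>

definition is_greens_function ::
  "real \<Rightarrow> real \<Rightarrow> real \<Rightarrow> complex \<Rightarrow> (real \<Rightarrow> real \<Rightarrow> complex) \<Rightarrow> bool" where
  "is_greens_function \<kappa> \<eta> f z K \<longleftrightarrow>
     continuous_on UNIV (\<lambda>(x, y). K x y) \<and>
     (\<forall>u h. stark_delta \<kappa> \<eta> f u h \<longrightarrow>
        (\<forall>x. has_bochner_integral lborel (\<lambda>y. K x y * (h y - z * u y)) (u x)))"

definition greens_function ::
  "real \<Rightarrow> real \<Rightarrow> real \<Rightarrow> complex \<Rightarrow> real \<Rightarrow> real \<Rightarrow> complex" where
  "greens_function \<kappa> \<eta> f z = (THE K. is_greens_function \<kappa> \<eta> f z K)"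

section \<open>Resonances\<close>

definition continues_greens_function ::
  "real \<Rightarrow> real \<Rightarrow> real \<Rightarrow> real \<Rightarrow> real \<Rightarrow> (complex \<Rightarrow> complex) \<Rightarrow> bool" where
  "continues_greens_function \<kappa> \<eta> f x y F \<longleftrightarrow>
     F meromorphic_on UNIV \<and> (\<forall>z. Im z > 0 \<longrightarrow> F z = greens_function \<kappa> \<eta> f z x y)"

definition is_resonance :: "real \<Rightarrow> real \<Rightarrow> real \<Rightarrow> complex \<Rightarrow> bool" where
  "is_resonance \<kappa> \<eta> f z \<longleftrightarrow>
     Im z < 0 \<and> (\<exists>x y F. continues_greens_function \<kappa> \<eta> f x y F \<and> is_pole F z)"

text \<open>
  The Airy function. The integral is only conditionally convergent; the Henstock-Kurzweil
  integral over \<open>UNIV\<close> covers this case, being the limit of the integrals over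
  \<open>[s, t]\<close> as \<open>s\<close> tends to \<open>-\<infinity>\<close> and \<open>t\<close> to \<open>\<infinity>\<close>.
\<close>

definition airy :: "complex \<Rightarrow> complex" where
  "airy = (THE A. A holomorphic_on UNIV \<and>
     (\<forall>x::real. A (complex_of_real x) =
        1 / (2 * complex_of_real pi) *
          integral UNIV (\<lambda>t::real. exp (\<i> * complex_of_real (t * x + t ^ 3 / 3)))))"

definition airy_rot :: complex where
  "airy_rot = exp (2 * complex_of_real pi * \<i> / 3)"

definition stark_zeta :: "real \<Rightarrow> complex \<Rightarrow> real \<Rightarrow> complex" where
  "stark_zeta f z x = - z * complex_of_real (f powr (-2/3)) + complex_of_real (x * f powr (1/3))"

definition stark_W :: "real \<Rightarrow> complex" where
  "stark_W f = complex_of_real (f powr (1/3)) * exp (- \<i> * complex_of_real pi / 6) /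
     (2 * complex_of_real pi)"

definition stark_D :: "real \<Rightarrow> real \<Rightarrow> real \<Rightarrow> complex \<Rightarrow> complex" where
  "stark_D \<kappa> \<eta> f z =
     (let \<zeta>p = stark_zeta f z \<kappa>;
          \<zeta>m = stark_zeta f z (-\<kappa>);
          \<alpha>p = airy (airy_rot * \<zeta>p) * airy \<zeta>p;
          \<alpha>m = airy (airy_rot * \<zeta>m) * airy \<zeta>m;
          \<beta>p = airy (airy_rot * \<zeta>m) * airy \<zeta>p;
          \<beta>m = airy (airy_rot * \<zeta>p) * airy \<zeta>m;
          W = stark_W f
      in 1 + (\<alpha>p + \<alpha>m) / (complex_of_real \<eta> * W)
           + \<beta>p * (\<beta>m - \<beta>p) / ((complex_of_real \<eta>)\<^sup>2 * W\<^sup>2))"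

definition resonance_multiplicity :: "real \<Rightarrow> real \<Rightarrow> real \<Rightarrow> complex \<Rightarrow> nat" where
  "resonance_multiplicity \<kappa> \<eta> f z = nat (zorder (stark_D \<kappa> \<eta> f) z)"

text \<open>
  The count takes values in the extended nonnegative reals, so that an infinite set of resonances
  would count as \<open>\<infinity>\<close> instead of the default value 0 of a finite sum.
\<close>

definition resonance_count :: "real \<Rightarrow> real \<Rightarrow> real \<Rightarrow> real \<Rightarrow> real \<Rightarrow> ennreal" where
  "resonance_count \<kappa> \<eta> f a b =
     (\<Sum>\<^sub>\<infinity>z\<in>{z. is_resonance \<kappa> \<eta> f z \<and> Re z \<in> {a..b}}.
        of_nat (resonance_multiplicity \<kappa> \<eta> f z))"

end

theory Submission
  imports Defs "HOL-Probability.Characteristic_Functions" "HOL-Probability.Sinc_Integral"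
begin

text \<open>
  The solutions \<open>psi_plus\<close> and \<open>psi_minus\<close> of the equation with both delta interactions that decay at
  \<open>+\<infinity>\<close> and, for \<open>Im z > 0\<close>, at \<open>-\<infinity>\<close> have Wronskian \<open>W D\<close>. The Green's function is therefore an
  entire function of \<open>z\<close> divided by \<open>W D\<close>, which has no zeros in the upper half plane because the operator is self-adjoint,
  and the resonances are the zeros of \<open>D\<close> in the lower half plane.

  Moving the contour of the Airy integral through the saddle point yields
  \<open>A(w\<^sup>2) = exp (-2 w\<^sup>3 / 3) G(w)\<close> with \<open>G(w) \<sim> 1 / (2 sqrt (\<pi> w))\<close>. Hence \<open>\<bar>D\<bar> \<le> exp (C / f)\<close> on discs of
  fixed radius, while \<open>\<bar>D\<bar> \<ge> 1/2\<close> at a fixed negative point; as \<open>D\<close> has no zeros far below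
  \<open>[a, b]\<close>, the maximum principle bounds their number by a multiple of \<open>1 / f\<close>.

  Near a point \<open>x > 0\<close> of the real axis, with \<open>k = sqrt x\<close>, the function \<open>s \<mapsto> D(x + f s)\<close> is
  asymptotically \<open>N(k) + \<phi> V(k) exp (2 i k s)\<close> for some \<open>\<phi>\<close> with \<open>\<bar>\<phi>\<bar> = 1\<close>, and
  \<open>\<bar>N(k)\<bar>\<^sup>2 = 1 + V(k)\<^sup>2\<close>. So the limit has zeros in the lower half plane whenever \<open>V(k) \<noteq> 0\<close>, and every interval of length a large multiple of \<open>f\<close>
  around such a point lies above a zero of \<open>D\<close>.
\<close>

section \<open>Integrals depending holomorphically on a parameter\<close>

text \<open>At positive energies the argument of \<open>sa\<close> lies near the negative real axis,
  where the saddle point form fails: it needs a square root well inside the right half plane. The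
  connection formula \<open>Ai_rotation\<close> therefore trades \<open>sa\<close> for the rotated
  functions \<open>sb\<close> and \<open>sc\<close>. The resulting form of \<open>D\<close> is only
  linear in the squares of \<open>sb\<close>, which isolates one dominant term far below the axis
  and gives the simple limit near it. The phase \<phi> is the limit of exp(4 i x^(3/2) / (3 f)),
  which does not converge as f tends to 0. A bound for all small f is therefore obtained by
  contradiction, along a sequence on which base point and phase converge, and the minimum modulus
  principle on a circle takes the place of Hurwitz's theorem. The Green's function is a definite
  description, so the explicit kernel must be shown to be the only continuous one; compactly
  supported continuous data separate kernels. Self-adjointness enters through the Wronskian of a
  solution with its own conjugate.\<close>

definition dominated_family :: "complex set \<Rightarrow> (complex \<Rightarrow> real \<Rightarrow> complex) \<Rightarrow> bool" where
  "dominated_family S g \<longleftrightarrow> open S \<and> (\<forall>t. (\<lambda>z. g z t) holomorphic_on S) \<and>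
     (\<forall>z\<in>S. g z \<in> borel_measurable lborel) \<and>
     (\<forall>z\<in>S. \<exists>r>0. \<exists>B. cball z r \<subseteq> S \<and> integrable lborel B \<and>
        (\<forall>w\<in>cball z r. \<forall>t. norm (g w t) \<le> B t))"

lemma dominated_family_integrable:
  assumes "dominated_family S g" "z \<in> S"
  shows "integrable lborel (g z)"
proof -
  from assms obtain r B where "r > 0" "integrable lborel B" "\<forall>w\<in>cball z r. \<forall>t. norm (g w t) \<le> B t"
    unfolding dominated_family_def by blast
  moreover have "g z \<in> borel_measurable lborel" using assms by (auto simp: dominated_family_def)
  ultimately show ?thesis
    by (intro Bochner_Integration.integrable_bound[of lborel B "g z"]) (auto intro!: AE_I2 order_trans[OF _ abs_ge_self])
qed

text \<open>Differentiation under the integral sign. As the domination is uniform on small discs,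
  Cauchy's inequality passes it on to the derivative; the derivatives form a dominated family again,
  so the lemma can be iterated, as \<open>Ai_ode\<close> does.\<close>

lemma dominated_family_deriv:
  fixes g :: "complex \<Rightarrow> real \<Rightarrow> complex"
  assumes g: "dominated_family S g"
  defines "g' \<equiv> \<lambda>z t. deriv (\<lambda>z. g z t) z"
  shows "dominated_family S g'"
    and "z \<in> S \<Longrightarrow> ((\<lambda>z. LINT t|lborel. g z t) has_field_derivative (LINT t|lborel. g' z t)) (at z)"
proof -
  have S: "open S" and hol: "\<And>t. (\<lambda>z. g z t) holomorphic_on S"
    and meas: "\<And>z. z \<in> S \<Longrightarrow> g z \<in> borel_measurable lborel"
    using g by (auto simp: dominated_family_def)
  have dom: "\<exists>r>0. \<exists>B. cball z r \<subseteq> S \<and> integrable lborel B \<and>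
        (\<forall>w\<in>cball z r. \<forall>t. norm (g w t) \<le> B t)" if "z \<in> S" for z
    using g that by (auto simp: dominated_family_def)
  have der: "((\<lambda>z. g z t) has_field_derivative g' z t) (at z)" if "z \<in> S" for z t
    unfolding g'_def by (rule holomorphic_derivI[OF hol S that])
  have bnd: "norm (g' w t) \<le> 2 * B t / r"
    if "r > 0" "cball z r \<subseteq> S" "\<forall>w\<in>cball z r. \<forall>t. norm (g w t) \<le> B t" "w \<in> cball z (r/2)"
    for z r B w t
  proof -
    have sub: "cball w (r/2) \<subseteq> cball z r"
    proof
      fix x assume "x \<in> cball w (r/2)"
      then show "x \<in> cball z r" using that(4) dist_triangle[of z x w] by auto
    qed
    have "norm ((deriv ^^ 1) (\<lambda>z. g z t) w) \<le> fact 1 * B t / (r/2) ^ 1"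
    proof (rule Cauchy_inequality)
      show "(\<lambda>z. g z t) holomorphic_on ball w (r / 2)"
        by (rule holomorphic_on_subset[OF hol]) (use sub that(2) ball_subset_cball in blast)
      show "continuous_on (cball w (r / 2)) (\<lambda>z. g z t)"
        by (rule holomorphic_on_imp_continuous_on, rule holomorphic_on_subset[OF hol])
           (use sub that(2) in blast)
      show "r / 2 > 0" using that by simp
      fix x assume "norm (w - x) = r/2"
      then have "x \<in> cball w (r/2)" by (simp add: dist_norm)
      then show "norm (g x t) \<le> B t" using sub that(3) by blast
    qed
    then show ?thesis by (simp add: g'_def mult.commute)
  qed
  have lip: "norm (g w t - g z t) \<le> 2 * B t / r * norm (w - z)"
    if "r > 0" "cball z r \<subseteq> S" "\<forall>w\<in>cball z r. \<forall>t. norm (g w t) \<le> B t" "w \<in> cball z (r/2)"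
    for z r B w t
  proof (rule field_differentiable_bound[where S="cball z (r/2)" and f'="\<lambda>w. g' w t"])
    fix x assume x: "x \<in> cball z (r/2)"
    then have "x \<in> S" using that(1,2) by (auto simp: subset_iff)
    then show "((\<lambda>z. g z t) has_field_derivative g' x t) (at x within cball z (r/2))"
      using der has_field_derivative_at_within by blast
    show "norm (g' x t) \<le> 2 * B t / r" using bnd[OF that(1,2,3) x] .
  qed (use that in auto)
  have key: "g' z \<in> borel_measurable lborel \<and>
      ((\<lambda>z. LINT t|lborel. g z t) has_field_derivative (LINT t|lborel. g' z t)) (at z)" if z: "z \<in> S" for z
  proof -
    obtain r B where r: "r > 0" "cball z r \<subseteq> S" and B: "integrable lborel B"
      and gB: "\<forall>w\<in>cball z r. \<forall>t. norm (g w t) \<le> B t" using dom[OF z] by blast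
    let ?q = "\<lambda>h t. (g (z + h) t - g z t) / h"
    have inS: "z + h \<in> S" if "h \<in> ball 0 (r/2)" for h
      using that r by (auto simp: subset_iff dist_norm)
    have qlim: "((\<lambda>h. ?q h t) \<longlongrightarrow> g' z t) (at 0)" for t
      using der[OF z, of t] by (simp add: DERIV_def)
    have qmeas: "(\<lambda>t. ?q h t) \<in> borel_measurable lborel" if "h \<in> ball 0 (r/2)" for h
      using meas[OF z] meas[OF inS[OF that]] by measurable
    have qb: "norm (?q h t) \<le> 2 * B t / r" if "h \<in> ball 0 (r/2) - {0}" for h t
      using lip[OF r gB, of "z + h" t] that by (auto simp: dist_norm norm_divide field_simps)
    \<comment> \<open>A concrete null sequence of admissible increments: \<open>g' z\<close> is
      measurable as the pointwise limit of the difference quotients along it.\<close>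
    define X where "X = (\<lambda>n::nat. complex_of_real (r / 4 / of_nat (Suc n)))"
    have Xb: "X n \<in> ball 0 (r/2) - {0}" for n
    proof -
      have "r / 4 / of_nat (Suc n) \<le> r / 4" using r by (simp add: field_simps)
      also have "\<dots> < r / 2" using r by simp
      finally have "norm (X n) < r / 2" using r unfolding X_def norm_of_real by simp
      moreover have "X n \<noteq> 0" using r unfolding X_def of_real_eq_0_iff by simp
      ultimately show ?thesis by simp
    qed
    have "(\<lambda>n. r / 4 / real (Suc n)) \<longlonglongrightarrow> 0"
      using tendsto_mult_left[OF LIMSEQ_inverse_real_of_nat, of "r / 4"]
      unfolding divide_inverse mult_zero_right .
    then have "X \<longlonglongrightarrow> of_real 0" unfolding X_def by (rule tendsto_of_real)
    then have X0: "X \<longlonglongrightarrow> 0" by simp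
    \<comment> \<open>The filter is the same, but working within the ball keeps every increment in
      the range where the dominating function \<open>2 * B t / r\<close> is valid.\<close>
    have atb: "at 0 within ball 0 (r/2) = at (0::complex)"
      using r by (intro at_within_open) auto
    have gm: "g' z \<in> borel_measurable lborel"
    proof (rule borel_measurable_LIMSEQ_metric)
      show "(\<lambda>t. ?q (X i) t) \<in> borel_measurable lborel" for i using qmeas Xb by blast
      show "(\<lambda>i. ?q (X i) t) \<longlonglongrightarrow> g' z t" for t
      proof -
        have "filterlim X (at 0) sequentially"
          using X0 Xb by (auto simp: filterlim_at)
        then show ?thesis using qlim filterlim_compose by blast
      qed
    qed
    have "((\<lambda>h. ((LINT t|lborel. g (z+h) t) - (LINT t|lborel. g z t)) / h) \<longlongrightarrow> (LINT t|lborel. g' z t)) (at 0 within ball 0 (r/2))"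
      unfolding tendsto_at_iff_sequentially
    proof (intro allI impI)
      fix Y assume Y: "\<forall>i. Y i \<in> ball 0 (r/2) - {0}" "Y \<longlonglongrightarrow> (0::complex)"
      have "(\<lambda>i. LINT t|lborel. ?q (Y i) t) \<longlonglongrightarrow> (LINT t|lborel. g' z t)"
      proof (rule integral_dominated_convergence[where w="\<lambda>t. 2 * B t / r"])
        show "AE t in lborel. (\<lambda>i. ?q (Y i) t) \<longlonglongrightarrow> g' z t"
        proof (rule AE_I2)
          fix t
          have "filterlim Y (at 0) sequentially"
            using Y by (auto simp: filterlim_at)
          then show "(\<lambda>i. ?q (Y i) t) \<longlonglongrightarrow> g' z t" using qlim filterlim_compose by blast
        qed
      qed (use gm qmeas qb Y B in auto)
      moreover have "(LINT t|lborel. ?q (Y i) t) = ((LINT t|lborel. g (z+Y i) t) - (LINT t|lborel. g z t)) / Y i" for i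
      proof -
        have "integrable lborel (g (z + Y i))" "integrable lborel (g z)"
          using dominated_family_integrable[OF g] inS Y z by auto
        then show ?thesis by simp
      qed
      ultimately show "((\<lambda>h. ((LINT t|lborel. g (z+h) t) - (LINT t|lborel. g z t)) / h) \<circ> Y) \<longlonglongrightarrow> (LINT t|lborel. g' z t)"
        by (simp only: o_def)
    qed
    then show ?thesis using gm by (simp add: DERIV_def atb)
  qed
  show "z \<in> S \<Longrightarrow> ((\<lambda>z. LINT t|lborel. g z t) has_field_derivative (LINT t|lborel. g' z t)) (at z)"
    using key by blast
  show "dominated_family S g'" unfolding dominated_family_def
  proof (intro conjI allI ballI)
    show "open S" by fact
    show "(\<lambda>z. g' z t) holomorphic_on S" for t unfolding g'_def using hol S holomorphic_deriv by blast
    show "g' z \<in> borel_measurable lborel" if "z \<in> S" for z using key that by blast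
    fix z assume z: "z \<in> S"
    obtain r B where r: "r > 0" "cball z r \<subseteq> S" and B: "integrable lborel B"
      and gB: "\<forall>w\<in>cball z r. \<forall>t. norm (g w t) \<le> B t" using dom[OF z] by blast
    show "\<exists>r>0. \<exists>B. cball z r \<subseteq> S \<and> integrable lborel B \<and> (\<forall>w\<in>cball z r. \<forall>t. norm (g' w t) \<le> B t)"
    proof (intro exI conjI)
      show "r/2 > 0" "integrable lborel (\<lambda>t. 2 * B t / r)" using r B by auto
      show "cball z (r/2) \<subseteq> S" using r by (auto simp: subset_iff)
    qed (use bnd[OF r gB] in blast)
  qed
qed

section \<open>Gaussian integrals\<close>

lemma integrable_gauss_moment:
  assumes "c > 0"
  shows "integrable lborel (\<lambda>t::real. \<bar>t\<bar> ^ k * exp (- c * t\<^sup>2))"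
proof -
  \<comment> \<open>The standard deviation for which the normal density has the exponent
    \<open>- c * x\<^sup>2\<close>.\<close>
  define s where "s = 1 / sqrt (2 * c)"
  have s: "s > 0" "2 * s\<^sup>2 = 1 / c" using assms by (auto simp: s_def power_divide)
  have "integrable lborel (\<lambda>x. normal_density 0 s x * \<bar>x - 0\<bar> ^ k)"
    by (rule integrable_normal_moment_abs[OF s(1)])
  then have "integrable lborel (\<lambda>x. sqrt (2 * pi * s\<^sup>2) * (normal_density 0 s x * \<bar>x - 0\<bar> ^ k))"
    by (rule integrable_mult_right[rotated]) 
  moreover have "sqrt (2 * pi * s\<^sup>2) * (normal_density 0 s x * \<bar>x - 0\<bar> ^ k) = \<bar>x\<bar> ^ k * exp (- c * x\<^sup>2)" for x
    using s by (simp add: normal_density_def)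
  ultimately show ?thesis by (simp only:)
qed

definition gauss_moment :: "nat \<Rightarrow> real" where
  "gauss_moment k = (LINT t|lborel. \<bar>t\<bar> ^ k * exp (- t\<^sup>2))"

lemma gauss_moment_nonneg: "gauss_moment k \<ge> 0"
  unfolding gauss_moment_def by (rule integral_nonneg_AE) auto

lemma gauss_moment_scale:
  assumes "c > 0"
  shows "(LINT t|lborel. \<bar>t\<bar> ^ k * exp (- c * t\<^sup>2)) = gauss_moment k / sqrt c ^ Suc k"
proof -
  have "(LINT t|lborel. \<bar>t\<bar> ^ k * exp (- c * t\<^sup>2))
      = \<bar>1 / sqrt c\<bar> *\<^sub>R (LINT t|lborel. \<bar>0 + (1 / sqrt c) * t\<bar> ^ k * exp (- c * (0 + (1 / sqrt c) * t)\<^sup>2))"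
    by (rule lborel_integral_real_affine) (use assms in auto)
  also have "(\<lambda>t. \<bar>0 + (1 / sqrt c) * t\<bar> ^ k * exp (- c * (0 + (1 / sqrt c) * t)\<^sup>2))
      = (\<lambda>t. (1 / sqrt c ^ k) * (\<bar>t\<bar> ^ k * exp (- t\<^sup>2)))"
    using assms by (auto simp: fun_eq_iff abs_mult power_mult_distrib power_divide abs_divide)
  finally show ?thesis using assms by (simp add: gauss_moment_def)
qed

lemma gauss_moment_zero: "gauss_moment 0 = sqrt pi"
proof -
  have "has_bochner_integral lborel (\<lambda>x. exp (- x\<^sup>2) :: real) (2 *\<^sub>R (sqrt pi / 2))"
    by (rule has_bochner_integral_even_function[OF gaussian_moment_0]) simp
  then show ?thesis by (simp add: gauss_moment_def has_bochner_integral_integral_eq)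
qed

text \<open>Used with \<open>m = 1\<close> for the Gaussian integral itself and with the cubic
  phase, which has modulus one, for \<open>Ai_amp\<close>.\<close>

lemma gauss_family:
  assumes "m \<in> borel_measurable lborel" "\<And>t. norm (m t :: complex) \<le> 1"
  shows "dominated_family {w. Re w > 0} (\<lambda>w t. exp (- w * of_real (t\<^sup>2)) * m t)"
  unfolding dominated_family_def
proof (intro conjI allI ballI)
  show "open {w. Re w > 0}" by (simp add: open_halfspace_Re_gt)
  show "(\<lambda>z. exp (- z * of_real (t\<^sup>2)) * m t) holomorphic_on {w. Re w > 0}" for t
    by (intro holomorphic_intros)
  show "(\<lambda>t. exp (- z * of_real (t\<^sup>2)) * m t) \<in> borel_measurable lborel" for z
    using assms(1) by measurable
  fix z :: complex assume "z \<in> {w. Re w > 0}"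
  then have z: "Re z > 0" by simp
  show "\<exists>r>0. \<exists>B. cball z r \<subseteq> {w. Re w > 0} \<and> integrable lborel B \<and>
      (\<forall>w\<in>cball z r. \<forall>t. norm (exp (- w * of_real (t\<^sup>2)) * m t) \<le> B t)"
  proof (intro exI conjI ballI allI)
    show "Re z / 2 > 0" using z by simp
    show "integrable lborel (\<lambda>t::real. exp (- (Re z / 2) * t\<^sup>2))"
      using integrable_gauss_moment[of "Re z / 2" 0] z by simp
    have *: "Re w \<ge> Re z / 2" if "w \<in> cball z (Re z / 2)" for w
      using that complex_Re_le_cmod[of "z - w"] by (auto simp: dist_norm)
    show "cball z (Re z / 2) \<subseteq> {w. Re w > 0}" using * z by fastforce
    fix w t assume "w \<in> cball z (Re z / 2)"
    with * have "Re z / 2 \<le> Re w" by blast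
    then have "norm (exp (- w * of_real (t\<^sup>2))) \<le> exp (- (Re z / 2) * t\<^sup>2)"
      using mult_right_mono[of "Re z / 2" "Re w" "t\<^sup>2"] by simp
    then have "norm (exp (- w * of_real (t\<^sup>2))) * norm (m t) \<le> exp (- (Re z / 2) * t\<^sup>2) * 1"
      using assms(2) by (intro mult_mono) auto
    then show "norm (exp (- w * of_real (t\<^sup>2)) * m t) \<le> exp (- (Re z / 2) * t\<^sup>2)"
      by (simp add: norm_mult)
  qed
qed

text \<open>Both sides are holomorphic in the right half plane, where the principal root has no
  branch cut, and they agree on the positive axis by scaling; the identity theorem does the
  rest.\<close>

lemma integral_complex_gauss:
  assumes "Re w > 0"
  shows "(LINT t|lborel. exp (- w * of_real (t\<^sup>2))) = of_real (sqrt pi) / csqrt w"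
proof -
  let ?S = "{w. Re w > 0}"
  let ?J = "\<lambda>w. LINT t|lborel. exp (- w * of_real (t\<^sup>2))"
  let ?F = "\<lambda>w. ?J w - of_real (sqrt pi) / csqrt w"
  have fam: "dominated_family ?S (\<lambda>w t. exp (- w * of_real (t\<^sup>2)))"
    using gauss_family[of "\<lambda>_. 1"] by simp
  have hJ: "?J holomorphic_on ?S"
    using dominated_family_deriv(2)[OF fam]
    by (intro holomorphic_onI) (auto simp: field_differentiable_def intro: has_field_derivative_at_within)
  have nz: "csqrt w \<noteq> 0" if "w \<in> ?S" for w using that by auto
  have hol: "?F holomorphic_on ?S"
    using nz by (intro holomorphic_intros hJ) (auto simp: complex_nonpos_Reals_iff)
  have "?F w = 0"
  proof (rule analytic_continuation[OF hol, where U="of_real ` {0<..}" and \<xi>=1])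
    show "open ?S" by (simp add: open_halfspace_Re_gt)
    show "connected ?S" by (intro convex_connected convex_halfspace_Re_gt)
    show "(1::complex) islimpt of_real ` {0<..}"
      unfolding islimpt_sequential
    proof (intro exI conjI allI)
      show "of_real (1 + 1 / of_nat (Suc n)) \<in> of_real ` {0<..} - {1::complex}" for n :: nat
      proof -
        have "0 < 1 + 1 / real (Suc n)" by (simp add: add_pos_nonneg)
        moreover have "complex_of_real (1 + 1 / of_nat (Suc n)) \<noteq> of_real 1"
          unfolding of_real_eq_iff by simp
        ultimately show ?thesis by (auto simp del: of_real_add of_real_divide)
      qed
      have "(\<lambda>n. 1 + 1 / real (Suc n)) \<longlonglongrightarrow> 1"
        using LIMSEQ_inverse_real_of_nat_add[of 1] by (simp add: inverse_eq_divide)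
      then have "(\<lambda>n. complex_of_real (1 + 1 / real (Suc n))) \<longlonglongrightarrow> complex_of_real 1"
        by (rule tendsto_of_real)
      then show "(\<lambda>n. complex_of_real (1 + 1 / of_nat (Suc n))) \<longlonglongrightarrow> 1"
        by (simp only: of_real_1)
    qed
    fix z :: complex assume "z \<in> of_real ` {0<..}"
    then obtain c where c: "z = of_real c" "c > 0" by auto
    have "?J z = (LINT t|lborel. complex_of_real (\<bar>t\<bar> ^ 0 * exp (- c * t\<^sup>2)))"
      unfolding c exp_of_real[symmetric] by (simp flip: exp_of_real)
    also have "\<dots> = of_real (gauss_moment 0 / sqrt c ^ Suc 0)"
      by (subst integral_complex_of_real, subst gauss_moment_scale) (use c in auto)
    also have "\<dots> = of_real (sqrt pi) / csqrt z"
      using c by (simp add: gauss_moment_zero csqrt_of_real_nonneg)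
    finally show "?F z = 0" by simp
  qed (use assms in auto)
  then show ?thesis by simp
qed

section \<open>The Airy function\<close>

definition airy_kernel :: "complex \<Rightarrow> complex \<Rightarrow> complex" where
  "airy_kernel \<tau> z = exp (\<i> * (\<tau> ^ 3 / 3 + z * \<tau>))"

text \<open>The term \<open>- (Re \<tau>)\<^sup>2 * Im \<tau>\<close> is the reason for all contour
  shifts: on a line with \<open>Im \<tau> > 0\<close> the kernel has Gaussian decay, whereas for
  real \<tau> and z its modulus is 1.\<close>

lemma norm_airy_kernel:
  "norm (airy_kernel \<tau> z) = exp (- (Re \<tau>)\<^sup>2 * Im \<tau> + Im \<tau> ^ 3 / 3 - Im (z * \<tau>))"
proof -
  have "Im (\<tau> ^ 3) = 3 * (Re \<tau>)\<^sup>2 * Im \<tau> - Im \<tau> ^ 3"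
    by (simp add: power3_eq_cube power2_eq_square algebra_simps)
  then have "Im (\<tau> ^ 3 / 3) = (Re \<tau>)\<^sup>2 * Im \<tau> - Im \<tau> ^ 3 / 3"
    by (simp add: Im_divide_numeral)
  then show ?thesis unfolding airy_kernel_def
    by (simp add: algebra_simps)
qed

text \<open>Of the exponent \<open>c * t\<^sup>2\<close>, one half pays for the shift by
  \<open>Re \<tau>\<close> and one quarter for the term linear in t, which leaves
  \<open>c / 4\<close>. Uniformity in \<tau> and z is what the dominated families need.\<close>

lemma airy_kernel_bound:
  assumes "0 < c" "c \<le> Im \<tau>" "norm \<tau> \<le> X" "norm z \<le> Z"
  shows "norm (airy_kernel (of_real t + \<tau>) z)
     \<le> exp (2 * X ^ 3 + Z * X + Z\<^sup>2 / c) * exp (- (c / 4) * t\<^sup>2)"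
proof -
  let ?y = "Im \<tau>" and ?x = "Re \<tau>"
  have X: "0 < X" "?y \<le> X" "\<bar>?x\<bar> \<le> X" "0 \<le> Z"
    using assms abs_Im_le_cmod[of \<tau>] abs_Re_le_cmod[of \<tau>] norm_ge_zero[of z] by linarith+
  have "(t + ?x)\<^sup>2 \<ge> t\<^sup>2 / 2 - ?x\<^sup>2"
    using zero_le_power2[of "t + 2 * ?x"] by (simp add: power2_eq_square algebra_simps)
  then have "(t + ?x)\<^sup>2 * ?y \<ge> (t\<^sup>2 / 2 - ?x\<^sup>2) * ?y"
    using assms by (intro mult_right_mono) auto
  moreover have "t\<^sup>2 / 2 * ?y \<ge> t\<^sup>2 / 2 * c" using assms by (intro mult_left_mono) auto
  moreover have "?x\<^sup>2 * ?y \<le> X\<^sup>2 * X"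
    using X assms by (intro mult_mono) (auto simp flip: abs_le_square_iff)
  moreover have "?y ^ 3 \<le> X ^ 3" using X assms by (intro power_mono) auto
  moreover have "X ^ 3 \<ge> 0" using X by simp
  moreover have "- Im (z * (of_real t + \<tau>)) \<le> Z * (\<bar>t\<bar> + X)"
  proof -
    have "- Im (z * (of_real t + \<tau>)) \<le> norm (z * (of_real t + \<tau>))"
      using abs_Im_le_cmod[of "z * (of_real t + \<tau>)"] by linarith
    also have "\<dots> \<le> Z * (\<bar>t\<bar> + X)" unfolding norm_mult
      using assms norm_triangle_ineq[of "of_real t" \<tau>] X by (intro mult_mono) auto
    finally show ?thesis .
  qed
  moreover have "Z * \<bar>t\<bar> \<le> c / 4 * t\<^sup>2 + Z\<^sup>2 / c"
  proof -
    have "(c / 2 * \<bar>t\<bar> - Z)\<^sup>2 \<ge> 0" by simp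
    then have "c * (Z * \<bar>t\<bar>) \<le> c * (c / 4 * t\<^sup>2 + Z\<^sup>2 / c)"
      using assms by (simp add: power2_eq_square algebra_simps)
    then show ?thesis using assms by (subst (asm) mult_le_cancel_left_pos) auto
  qed
  ultimately have "- (t + ?x)\<^sup>2 * ?y + ?y ^ 3 / 3 - Im (z * (of_real t + \<tau>))
      \<le> 2 * X ^ 3 + Z * X + Z\<^sup>2 / c + - (c / 4) * t\<^sup>2"
    by (simp add: algebra_simps power3_eq_cube power2_eq_square)
  then show ?thesis unfolding norm_airy_kernel
    by (simp flip: exp_add)
qed

lemma airy_kernel_borel [measurable]:
  "(\<lambda>t. airy_kernel (of_real t + \<tau>) z) \<in> borel_measurable borel"
  unfolding airy_kernel_def by measurable

lemma airy_kernel_DERIV_tau: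
  "((\<lambda>\<tau>. airy_kernel (c + \<tau>) z) has_field_derivative \<i> * ((c + \<tau>)\<^sup>2 + z) * airy_kernel (c + \<tau>) z) (at \<tau>)"
proof -
  have "((\<lambda>\<tau>. (c + \<tau>) ^ 3 / 3 + z * (c + \<tau>)) has_field_derivative (c + \<tau>)\<^sup>2 + z) (at \<tau>)"
    by (rule derivative_eq_intros refl | simp)+
  then have "((\<lambda>\<tau>. \<i> * ((c + \<tau>) ^ 3 / 3 + z * (c + \<tau>))) has_field_derivative \<i> * ((c + \<tau>)\<^sup>2 + z)) (at \<tau>)"
    by (rule DERIV_cmult)
  from DERIV_chain2[OF DERIV_exp this] show ?thesis
    unfolding airy_kernel_def by (simp only: mult.commute)
qed

lemma airy_kernel_family_tau:
  "dominated_family {\<tau>. Im \<tau> > 0} (\<lambda>\<tau> t. airy_kernel (of_real t + \<tau>) z)"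
  unfolding dominated_family_def
proof (intro conjI allI ballI)
  show "open {\<tau>. Im \<tau> > 0}" by (simp add: open_halfspace_Im_gt)
  show "(\<lambda>\<tau>. airy_kernel (of_real t + \<tau>) z) holomorphic_on {\<tau>. 0 < Im \<tau>}" for t
    unfolding airy_kernel_def by (intro holomorphic_intros) auto
  show "(\<lambda>t. airy_kernel (of_real t + \<tau>) z) \<in> borel_measurable lborel" for \<tau>
    by measurable
  fix \<tau> :: complex assume "\<tau> \<in> {\<tau>. Im \<tau> > 0}"
  then have y: "Im \<tau> > 0" by simp
  let ?X = "norm \<tau> + Im \<tau> / 2"
  let ?C = "exp (2 * ?X ^ 3 + norm z * ?X + (norm z)\<^sup>2 / (Im \<tau> / 2))"
  show "\<exists>r>0. \<exists>B. cball \<tau> r \<subseteq> {\<tau>. 0 < Im \<tau>} \<and> integrable lborel B \<and>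
      (\<forall>w\<in>cball \<tau> r. \<forall>t. norm (airy_kernel (of_real t + w) z) \<le> B t)"
  proof (intro exI conjI ballI allI)
    show "Im \<tau> / 2 > 0" using y by simp
    have *: "Im w \<ge> Im \<tau> / 2" if "w \<in> cball \<tau> (Im \<tau> / 2)" for w
      using that abs_Im_le_cmod[of "\<tau> - w"] by (auto simp: dist_norm)
    then show "cball \<tau> (Im \<tau> / 2) \<subseteq> {\<tau>. 0 < Im \<tau>}" using y by fastforce
    show "integrable lborel (\<lambda>t::real. ?C * exp (- (Im \<tau> / 2 / 4) * t\<^sup>2))"
      using integrable_gauss_moment[of "Im \<tau> / 2 / 4" 0] y by simp
    fix w t assume w: "w \<in> cball \<tau> (Im \<tau> / 2)"
    have "norm w \<le> ?X" using w norm_triangle_ineq2[of w \<tau>] by (simp add: dist_norm norm_minus_commute)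
    then show "norm (airy_kernel (of_real t + w) z) \<le> ?C * exp (- (Im \<tau> / 2 / 4) * t\<^sup>2)"
      using airy_kernel_bound[of "Im \<tau> / 2" w ?X z "norm z" t] * w y by simp
  qed
qed

lemma airy_kernel_family_z:
  assumes "Im \<tau> > 0"
  shows "dominated_family UNIV (\<lambda>z t. airy_kernel (of_real t + \<tau>) z)"
  unfolding dominated_family_def
proof (intro conjI allI ballI)
  show "(\<lambda>z. airy_kernel (of_real t + \<tau>) z) holomorphic_on UNIV" for t
    unfolding airy_kernel_def by (intro holomorphic_intros)
  show "(\<lambda>t. airy_kernel (of_real t + \<tau>) z) \<in> borel_measurable lborel" for z by measurable
  fix z :: complex
  let ?C = "exp (2 * norm \<tau> ^ 3 + (norm z + 1) * norm \<tau> + (norm z + 1)\<^sup>2 / Im \<tau>)"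
  show "\<exists>r>0. \<exists>B. cball z r \<subseteq> UNIV \<and> integrable lborel B \<and>
      (\<forall>w\<in>cball z r. \<forall>t. norm (airy_kernel (of_real t + \<tau>) w) \<le> B t)"
  proof (intro exI conjI ballI allI)
    show "(1::real) > 0" by simp
    show "integrable lborel (\<lambda>t::real. ?C * exp (- (Im \<tau> / 4) * t\<^sup>2))"
      using integrable_gauss_moment[of "Im \<tau> / 4" 0] assms by simp
    fix w t assume w: "w \<in> cball z 1"
    have "norm w \<le> norm z + 1" using w norm_triangle_ineq2[of w z] by (simp add: dist_norm norm_minus_commute)
    then show "norm (airy_kernel (of_real t + \<tau>) w) \<le> ?C * exp (- (Im \<tau> / 4) * t\<^sup>2)"
      using airy_kernel_bound[of "Im \<tau>" \<tau> "norm \<tau>" w "norm z + 1" t] assms by simp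
  qed auto
qed auto

text \<open>Translation invariance of Lebesgue measure makes the integral constant under real shifts
  of \<tau>. As it is holomorphic in \<tau>, its complex derivative is the derivative along the real
  direction and vanishes. So the height of the contour does not matter, and the second equation
  serves as integration by parts in \<open>Ai_ode\<close>.\<close>

lemma airy_kernel_integral_deriv:
  assumes "Im \<tau> > 0"
  shows "((\<lambda>\<tau>. LINT t|lborel. airy_kernel (of_real t + \<tau>) z) has_field_derivative 0) (at \<tau>)"
    and "(LINT t|lborel. deriv (\<lambda>\<tau>. airy_kernel (of_real t + \<tau>) z) \<tau>) = 0"
proof -
  let ?I = "\<lambda>\<tau>. LINT t|lborel. airy_kernel (of_real t + \<tau>) z"
  let ?D = "LINT t|lborel. deriv (\<lambda>\<tau>. airy_kernel (of_real t + \<tau>) z) \<tau>"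
  have D: "(?I has_field_derivative ?D) (at \<tau>)"
    using dominated_family_deriv(2)[OF airy_kernel_family_tau] assms by simp
  have tr: "?I (\<tau> + of_real x) = ?I \<tau>" for x :: real
  proof -
    have "?I \<tau> = \<bar>1\<bar> *\<^sub>R (LINT t|lborel. airy_kernel (of_real (x + 1 * t) + \<tau>) z)"
      by (rule lborel_integral_real_affine) simp
    then show ?thesis by (simp add: add_ac)
  qed
  have "((\<lambda>x::real. \<tau> + of_real x) has_vector_derivative 1) (at 0)"
    by (auto intro!: derivative_eq_intros simp: has_vector_derivative_def scaleR_conv_of_real)
  from field_vector_diff_chain_at[OF this, of ?I ?D] D
  have "((\<lambda>x::real. ?I \<tau>) has_vector_derivative ?D) (at 0)"
    by (simp add: o_def tr)
  moreover have "((\<lambda>x::real. ?I \<tau>) has_vector_derivative 0) (at 0)" by (rule has_vector_derivative_const)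
  ultimately show "?D = 0" by (rule vector_derivative_unique_at)
  with D show "(?I has_field_derivative 0) (at \<tau>)" by simp
qed

lemma airy_kernel_integral_const:
  assumes "Im \<tau> > 0" "Im \<tau>' > 0"
  shows "(LINT t|lborel. airy_kernel (of_real t + \<tau>) z) = (LINT t|lborel. airy_kernel (of_real t + \<tau>') z)"
proof -
  have "\<exists>c. \<forall>\<tau>\<in>{\<tau>. Im \<tau> > 0}. (LINT t|lborel. airy_kernel (of_real t + \<tau>) z) = c"
    by (rule has_field_derivative_zero_constant)
       (auto intro: convex_halfspace_Im_gt has_field_derivative_at_within airy_kernel_integral_deriv)
  then show ?thesis using assms by auto
qed

text \<open>An absolutely convergent version of the Airy integral. The height 1 of the contour is
  arbitrary by the preceding lemma; agreement with \<open>airy\<close> is shown in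
  \<open>airy_eq_Ai\<close>.\<close>

definition Ai :: "complex \<Rightarrow> complex" where
  "Ai z = 1 / (2 * of_real pi) * (LINT t|lborel. airy_kernel (of_real t + \<i>) z)"

lemma Ai_eq_integral:
  assumes "Im \<tau> > 0"
  shows "Ai z = 1 / (2 * of_real pi) * (LINT t|lborel. airy_kernel (of_real t + \<tau>) z)"
  unfolding Ai_def using airy_kernel_integral_const[of \<i> \<tau>] assms by simp

lemma Ai_holomorphic: "Ai holomorphic_on S"
proof -
  have "((\<lambda>z. LINT t|lborel. airy_kernel (of_real t + \<i>) z) has_field_derivative 
     (LINT t|lborel. deriv (\<lambda>z. airy_kernel (of_real t + \<i>) z) z)) (at z)" for z
    using dominated_family_deriv(2)[OF airy_kernel_family_z[of \<i>]] by simp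
  then have "(\<lambda>z. LINT t|lborel. airy_kernel (of_real t + \<i>) z) holomorphic_on S"
    by (intro holomorphic_onI) (auto simp: field_differentiable_def intro: has_field_derivative_at_within)
  then show ?thesis unfolding Ai_def[abs_def] by (intro holomorphic_intros)
qed

lemma Ai_field_differentiable [simp]: "Ai field_differentiable (at z)"
  using Ai_holomorphic[of UNIV] by (simp add: holomorphic_on_def)

lemma Ai_has_field_derivative: "(Ai has_field_derivative deriv Ai z) (at z)"
  by (simp add: field_differentiable_derivI)

text \<open>Two derivatives in z bring down \<open>- \<tau>\<^sup>2\<close>, and
  \<open>\<i> * (\<tau>\<^sup>2 + z)\<close> times the kernel is a total derivative in \<tau>, so
  its integral is zero.\<close>

lemma Ai_ode: "(deriv Ai has_field_derivative z * Ai z) (at z)"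
proof -
  let ?k = "\<lambda>z t. airy_kernel (of_real t + \<i>) z"
  let ?c = "1 / (2 * of_real pi) :: complex"
  have fam: "dominated_family UNIV ?k" by (rule airy_kernel_family_z) simp
  have d1: "deriv (\<lambda>z. ?k z t) = (\<lambda>z. \<i> * (of_real t + \<i>) * ?k z t)" for t
    unfolding airy_kernel_def
    by (rule ext, rule DERIV_imp_deriv) (auto intro!: derivative_eq_intros)
  have d2: "deriv (\<lambda>z. \<i> * (of_real t + \<i>) * ?k z t) z = - (of_real t + \<i>)\<^sup>2 * ?k z t" for t z
    unfolding airy_kernel_def
    by (rule DERIV_imp_deriv) (auto intro!: derivative_eq_intros simp: power2_eq_square algebra_simps)
  have "(Ai has_field_derivative ?c * (LINT t|lborel. \<i> * (of_real t + \<i>) * ?k z t)) (at z)" for z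
    using dominated_family_deriv(2)[OF fam, of z] unfolding d1 Ai_def[abs_def]
    by (intro DERIV_cmult) simp
  then have dA: "deriv Ai = (\<lambda>z. ?c * (LINT t|lborel. \<i> * (of_real t + \<i>) * ?k z t))"
    by (intro ext DERIV_imp_deriv)
  have fam2: "dominated_family UNIV (\<lambda>z t. \<i> * (of_real t + \<i>) * ?k z t)"
    using dominated_family_deriv(1)[OF fam] unfolding d1 .
  have fam3: "dominated_family UNIV (\<lambda>z t. - (of_real t + \<i>)\<^sup>2 * ?k z t)"
    using dominated_family_deriv(1)[OF fam2] unfolding d2 .
  have "(deriv Ai has_field_derivative ?c * (LINT t|lborel. - (of_real t + \<i>)\<^sup>2 * ?k z t)) (at z)"
    using dominated_family_deriv(2)[OF fam2, of z] unfolding d2 dA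
    by (intro DERIV_cmult) simp
  moreover have "(LINT t|lborel. - (of_real t + \<i>)\<^sup>2 * ?k z t) = z * (LINT t|lborel. ?k z t)"
  proof -
    have dt: "deriv (\<lambda>\<tau>. airy_kernel (of_real t + \<tau>) z) \<i> = \<i> * (of_real t + \<i>)\<^sup>2 * ?k z t + \<i> * z * ?k z t" for t
      using DERIV_imp_deriv[OF airy_kernel_DERIV_tau[of "of_real t" z \<i>]]
      by (simp only: distrib_left distrib_right)
    have lin: "A = z * B" if "0 = - \<i> * A + \<i> * z * B" for A B
    proof -
      have "\<i> * A = \<i> * (z * B)" using that by (simp add: algebra_simps)
      then show ?thesis by simp
    qed
    have i1: "integrable lborel (\<lambda>t. - (of_real t + \<i>)\<^sup>2 * ?k z t)" and i2: "integrable lborel (\<lambda>t. ?k z t)"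
      using dominated_family_integrable[OF fam3] dominated_family_integrable[OF fam] by auto
    have "0 = (LINT t|lborel. \<i> * (of_real t + \<i>)\<^sup>2 * ?k z t + \<i> * z * ?k z t)"
      using airy_kernel_integral_deriv(2)[of \<i> z] unfolding dt by simp
    also have "\<dots> = (LINT t|lborel. - \<i> * (- (of_real t + \<i>)\<^sup>2 * ?k z t) + \<i> * z * ?k z t)"
      by (rule Bochner_Integration.integral_cong) (auto simp: algebra_simps)
    also have "\<dots> = - \<i> * (LINT t|lborel. - (of_real t + \<i>)\<^sup>2 * ?k z t) + \<i> * z * (LINT t|lborel. ?k z t)"
      using i1 i2 by (subst Bochner_Integration.integral_add) (auto simp del: mult_minus_left)
    finally show ?thesis using lin by blast
  qed
  ultimately show ?thesis by (simp only: Ai_def mult.left_commute)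
qed

text \<open>The substitution \<open>\<tau> = t + i w\<close> moves the contour through the saddle point of the phase.\<close>

definition Ai_amp :: "complex \<Rightarrow> complex" where
  "Ai_amp w = 1 / (2 * of_real pi) * (LINT t|lborel. exp (- w * of_real (t\<^sup>2)) * exp (\<i> * of_real (t ^ 3 / 3)))"

lemma Ai_square:
  assumes "Re w > 0"
  shows "Ai (w\<^sup>2) = exp (- (2/3) * w ^ 3) * Ai_amp w"
proof -
  have "airy_kernel (of_real t + \<i> * w) (w\<^sup>2)
      = exp (- (2/3) * w ^ 3) * (exp (- w * of_real (t\<^sup>2)) * exp (\<i> * of_real (t ^ 3 / 3)))" for t
  proof -
    \<comment> \<open>No term linear in t remains, because \<open>\<i> * w\<close> is a critical
      point of the phase \<open>\<tau> ^ 3 / 3 + w\<^sup>2 * \<tau>\<close>.\<close>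
    have "\<i> * ((of_real t + \<i> * w) ^ 3 / 3 + w\<^sup>2 * (of_real t + \<i> * w))
       = - (2/3) * w ^ 3 + (- w * of_real (t\<^sup>2) + \<i> * of_real (t ^ 3 / 3))"
      by (simp add: power3_eq_cube power2_eq_square field_simps)
    then show ?thesis unfolding airy_kernel_def by (simp only: exp_add)
  qed
  then show ?thesis using assms Ai_eq_integral[of "\<i> * w" "w\<^sup>2"] by (simp add: Ai_amp_def)
qed

lemma Ai_amp_family:
  "dominated_family {w. Re w > 0} (\<lambda>w t. exp (- w * of_real (t\<^sup>2)) * exp (\<i> * of_real (t ^ 3 / 3)))"
  by (rule gauss_family) (auto simp: norm_exp_eq_Re)

section \<open>Size and asymptotics of the amplitude \<open>Ai_amp\<close>\<close>

lemma norm_integral_gauss_le: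
  assumes w: "Re w > 0" and meas: "m \<in> borel_measurable lborel"
    and m: "\<And>t. norm (m t :: complex) \<le> \<bar>t\<bar> ^ k"
  shows "integrable lborel (\<lambda>t. exp (- w * of_real (t\<^sup>2)) * m t)"
    and "norm (LINT t|lborel. exp (- w * of_real (t\<^sup>2)) * m t) \<le> gauss_moment k / sqrt (Re w) ^ Suc k"
proof -
  have le: "norm (exp (- w * of_real (t\<^sup>2)) * m t) \<le> \<bar>t\<bar> ^ k * exp (- Re w * t\<^sup>2)" for t
    using mult_right_mono[OF m[of t], of "exp (- Re w * t\<^sup>2)"] by (simp add: norm_mult mult.commute)
  have int: "integrable lborel (\<lambda>t. \<bar>t\<bar> ^ k * exp (- Re w * t\<^sup>2))"
    by (rule integrable_gauss_moment[OF w])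
  show i: "integrable lborel (\<lambda>t. exp (- w * of_real (t\<^sup>2)) * m t)"
    by (rule Bochner_Integration.integrable_bound[OF int]) (use meas le in \<open>auto intro!: AE_I2 order_trans[OF _ abs_ge_self]\<close>)
  have "norm (LINT t|lborel. exp (- w * of_real (t\<^sup>2)) * m t)
      \<le> (LINT t|lborel. norm (exp (- w * of_real (t\<^sup>2)) * m t))"
    by (rule integral_norm_bound)
  also have "\<dots> \<le> (LINT t|lborel. \<bar>t\<bar> ^ k * exp (- Re w * t\<^sup>2))"
    by (rule integral_mono[OF integrable_norm[OF i] int le])
  also have "\<dots> = gauss_moment k / sqrt (Re w) ^ Suc k"
    by (rule gauss_moment_scale[OF w])
  finally show "norm (LINT t|lborel. exp (- w * of_real (t\<^sup>2)) * m t) \<le> gauss_moment k / sqrt (Re w) ^ Suc k" .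
qed

lemma norm_over_two_pi:
  "norm X \<le> Y \<Longrightarrow> norm (1 / (2 * of_real pi) * X :: complex) \<le> 1 / (2 * pi) * Y"
  using mult_left_mono[of "norm X" Y "1 / (2 * pi)"] by (simp add: norm_mult norm_divide)

lemma norm_Ai_amp_le:
  assumes "Re w > 0"
  shows "norm (Ai_amp w) \<le> 1 / sqrt (Re w)"
proof -
  have "norm (LINT t|lborel. exp (- w * of_real (t\<^sup>2)) * exp (\<i> * of_real (t ^ 3 / 3)))
      \<le> gauss_moment 0 / sqrt (Re w) ^ Suc 0"
    by (rule norm_integral_gauss_le(2)) (use assms in \<open>auto simp: norm_exp_eq_Re\<close>)
  then have "norm (Ai_amp w) \<le> 1 / (2 * pi) * (sqrt pi / sqrt (Re w))"
    unfolding Ai_amp_def using norm_over_two_pi by (simp only: gauss_moment_zero power_Suc0_right)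
  also have "\<dots> \<le> 1 * (1 / sqrt (Re w))"
  proof -
    have "1 \<le> sqrt pi" using pi_ge_two by simp
    from mult_left_mono[OF this, of "sqrt pi"] have "sqrt pi \<le> sqrt pi * sqrt pi" by simp
    then have "sqrt pi \<le> pi" by simp
    then have "sqrt pi \<le> 2 * pi" using pi_gt_zero by linarith
    then show ?thesis using assms pi_gt_zero by (simp add: field_simps)
  qed
  finally show ?thesis by simp
qed

definition Ai_amp' :: "complex \<Rightarrow> complex" where
  "Ai_amp' w = deriv Ai_amp w"

lemma Ai_amp_DERIV:
  assumes "Re w > 0"
  shows "(Ai_amp has_field_derivative Ai_amp' w) (at w)"
    and "norm (Ai_amp' w) \<le> gauss_moment 2 / sqrt (Re w) ^ 3"
proof -
  let ?g = "\<lambda>w t. exp (- w * of_real (t\<^sup>2)) * exp (\<i> * of_real (t ^ 3 / 3))"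
  have d: "deriv (\<lambda>w. ?g w t) w = exp (- w * of_real (t\<^sup>2)) * (- of_real (t\<^sup>2) * exp (\<i> * of_real (t ^ 3 / 3)))" for w t
    by (rule DERIV_imp_deriv) (auto intro!: derivative_eq_intros)
  let ?c = "1 / (2 * of_real pi) :: complex"
  let ?D = "?c * (LINT t|lborel. exp (- w * of_real (t\<^sup>2)) * (- of_real (t\<^sup>2) * exp (\<i> * of_real (t ^ 3 / 3))))"
  have D: "(Ai_amp has_field_derivative ?D) (at w)"
    using dominated_family_deriv(2)[OF Ai_amp_family, of w] assms
    unfolding d Ai_amp_def[abs_def] by (intro DERIV_cmult) simp
  then have eq: "Ai_amp' w = ?D" unfolding Ai_amp'_def by (rule DERIV_imp_deriv)
  from D eq show "(Ai_amp has_field_derivative Ai_amp' w) (at w)" by simp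
  have "norm (LINT t|lborel. exp (- w * of_real (t\<^sup>2)) * (- of_real (t\<^sup>2) * exp (\<i> * of_real (t ^ 3 / 3))))
      \<le> gauss_moment 2 / sqrt (Re w) ^ Suc 2"
    by (rule norm_integral_gauss_le(2)) (use assms in \<open>auto simp: norm_exp_eq_Re norm_mult norm_power\<close>)
  then have "norm (Ai_amp' w) \<le> 1 / (2 * pi) * (gauss_moment 2 / sqrt (Re w) ^ 3)"
    unfolding eq using norm_over_two_pi by (simp only: numeral_3_eq_3 numeral_2_eq_2)
  also have "\<dots> \<le> 1 * (gauss_moment 2 / sqrt (Re w) ^ 3)"
    using pi_ge_two gauss_moment_nonneg[of 2] assms by (intro mult_right_mono) auto
  finally show "norm (Ai_amp' w) \<le> gauss_moment 2 / sqrt (Re w) ^ 3" by simp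
qed

text \<open>Replacing the cubic phase by 1 costs at most \<open>\<bar>t\<bar> ^ 3\<close>, hence a
  third Gaussian moment of order \<open>1 / (Re w)\<^sup>2\<close>, against a main term of order
  |w|^(-1/2). In the sector \<open>Re w\<close> may be replaced by |w|/4, whence the factor 16. The
  sector is wide enough for all points supplied by \<open>sector_rot6\<close>.\<close>

lemma Ai_amp_asymp:
  "\<exists>C>0. \<forall>w. w \<noteq> 0 \<and> Re w \<ge> norm w / 4 \<longrightarrow>
     norm (Ai_amp w * (2 * of_real (sqrt pi) * csqrt w) - 1) \<le> C / (norm w * sqrt (norm w))"
proof (intro exI conjI allI impI)
  let ?C = "16 * gauss_moment 3 + 1"
  show "?C > 0" using gauss_moment_nonneg[of 3] by simp
  fix w :: complex assume w: "w \<noteq> 0 \<and> Re w \<ge> norm w / 4"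
  then have n: "norm w > 0" and Re: "Re w > 0" by (auto intro: less_le_trans[of 0 "norm w / 4"])
  let ?e = "\<lambda>t. exp (- w * of_real (t\<^sup>2))" and ?m = "\<lambda>t. exp (\<i> * of_real (t ^ 3 / 3)) :: complex"
  have m1: "norm (?m t - 1) \<le> \<bar>t\<bar> ^ 3" for t
  proof -
    have "norm (?m t - 1) \<le> \<bar>t ^ 3 / 3\<bar>"
      using iexp_approx1[of "t ^ 3 / 3" 0] by simp
    also have "\<dots> \<le> \<bar>t\<bar> ^ 3" by (simp add: power_abs)
    finally show ?thesis .
  qed
  have i1: "integrable lborel (\<lambda>t. ?e t * ?m t)" 
    by (rule norm_integral_gauss_le(1)[where k=0]) (use Re in \<open>auto simp: norm_exp_eq_Re\<close>)
  have i2: "integrable lborel (\<lambda>t. ?e t)"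
    using norm_integral_gauss_le(1)[of w "\<lambda>_. 1" 0] Re by simp
  have "norm (LINT t|lborel. ?e t * (?m t - 1)) \<le> gauss_moment 3 / sqrt (Re w) ^ Suc 3"
    by (rule norm_integral_gauss_le(2)) (use Re m1 in auto)
  also have "(LINT t|lborel. ?e t * (?m t - 1)) = (LINT t|lborel. ?e t * ?m t) - of_real (sqrt pi) / csqrt w"
    using i1 i2 integral_complex_gauss[OF Re] by (simp add: algebra_simps)
  also have "(LINT t|lborel. ?e t * ?m t) = 2 * of_real pi * Ai_amp w" by (simp add: Ai_amp_def)
  also have "sqrt (Re w) ^ Suc 3 = (Re w)\<^sup>2"
    using Re by (simp add: power2_eq_square flip: power_even_eq[of "sqrt (Re w)" 2, simplified]) 
  finally have b: "norm (2 * of_real pi * Ai_amp w - of_real (sqrt pi) / csqrt w) \<le> gauss_moment 3 / (Re w)\<^sup>2" .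
  have sp: "complex_of_real pi = of_real (sqrt pi) * of_real (sqrt pi)"
    by (simp flip: of_real_mult)
  have "Ai_amp w * (2 * of_real (sqrt pi) * csqrt w) - 1
      = csqrt w / of_real (sqrt pi) * (2 * of_real pi * Ai_amp w - of_real (sqrt pi) / csqrt w)"
    using w by (simp add: sp field_simps)
  then have "norm (Ai_amp w * (2 * of_real (sqrt pi) * csqrt w) - 1)
      = norm (csqrt w / of_real (sqrt pi)) * norm (2 * of_real pi * Ai_amp w - of_real (sqrt pi) / csqrt w)"
    by (simp only: norm_mult)
  also have "\<dots> \<le> sqrt (norm w) * (gauss_moment 3 / (Re w)\<^sup>2)"
  proof (intro mult_mono b)
    have "sqrt (norm w) / sqrt pi \<le> sqrt (norm w) / 1" using pi_ge_two by (intro divide_left_mono) auto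
    then show "norm (csqrt w / of_real (sqrt pi)) \<le> sqrt (norm w)" by (simp add: norm_divide)
  qed auto
  also have "\<dots> \<le> sqrt (norm w) * (gauss_moment 3 / (norm w / 4)\<^sup>2)"
    using w n Re gauss_moment_nonneg[of 3]
    by (intro mult_left_mono divide_left_mono power_mono mult_pos_pos zero_less_power) auto
  also have "\<dots> = 16 * gauss_moment 3 / (norm w * sqrt (norm w))"
    using n by (simp add: power2_eq_square divide_simps)
  also have "\<dots> \<le> ?C / (norm w * sqrt (norm w))" using n by (intro divide_right_mono) auto
  finally show "norm (Ai_amp w * (2 * of_real (sqrt pi) * csqrt w) - 1) \<le> ?C / (norm w * sqrt (norm w))" .
qed

lemma deriv_Ai_square:
  assumes "Re w > 0"
  shows "deriv Ai (w\<^sup>2) = exp (- (2/3) * w ^ 3) * (- w * Ai_amp w + Ai_amp' w / (2 * w))"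
proof -
  have w: "w \<noteq> 0" using assms by auto
  have "((\<lambda>w. Ai (w\<^sup>2)) has_field_derivative deriv Ai (w\<^sup>2) * (2 * w)) (at w)"
    by (rule DERIV_chain2[OF Ai_has_field_derivative]) (auto intro!: derivative_eq_intros)
  moreover have "((\<lambda>w. Ai (w\<^sup>2)) has_field_derivative
      exp (- (2/3) * w ^ 3) * (- 2 * w\<^sup>2) * Ai_amp w + Ai_amp' w * exp (- (2/3) * w ^ 3)) (at w)"
  proof (rule has_field_derivative_transform_within_open)
    show "((\<lambda>w. exp (- (2/3) * w ^ 3) * Ai_amp w) has_field_derivative
      exp (- (2/3) * w ^ 3) * (- 2 * w\<^sup>2) * Ai_amp w + Ai_amp' w * exp (- (2/3) * w ^ 3)) (at w)"
      by (rule DERIV_mult[OF _ Ai_amp_DERIV(1)[OF assms]]) (auto intro!: derivative_eq_intros)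
    show "open {w. Re w > 0}" by (simp add: open_halfspace_Re_gt)
  qed (use assms Ai_square in auto)
  ultimately have "deriv Ai (w\<^sup>2) * (2 * w) =
      exp (- (2/3) * w ^ 3) * (- 2 * w\<^sup>2) * Ai_amp w + Ai_amp' w * exp (- (2/3) * w ^ 3)"
    by (rule DERIV_unique)
  also have "\<dots> = exp (- (2/3) * w ^ 3) * (- w * Ai_amp w + Ai_amp' w / (2 * w)) * (2 * w)"
    using w by (simp add: field_simps power2_eq_square)
  finally show ?thesis using w by simp
qed

text \<open>The line at height 1 is moved down to the real axis. With a primitive P of the kernel,
  the truncated integrals on the two lines differ by two vertical sides, and a side at abscissa T
  contributes at most a multiple of \<open>1 / T\<^sup>2\<close>. So the conditionally convergent
  integral takes the value of the absolutely convergent one.\<close>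

lemma Ai_has_integral:
  "((\<lambda>t. exp (\<i> * complex_of_real (t * x + t ^ 3 / 3))) has_integral 2 * of_real pi * Ai (of_real x)) UNIV"
proof -
  let ?z = "complex_of_real x"
  let ?e = "\<lambda>t::real. airy_kernel (of_real t) ?z" and ?h = "\<lambda>t::real. airy_kernel (of_real t + \<i>) ?z"
  have "(\<lambda>\<tau>. airy_kernel \<tau> ?z) holomorphic_on UNIV"
    unfolding airy_kernel_def by (intro holomorphic_intros) auto
  then obtain P where P: "\<And>\<tau>. (P has_field_derivative airy_kernel \<tau> ?z) (at \<tau>)"
    using holomorphic_convex_primitive'[of UNIV "\<lambda>\<tau>. airy_kernel \<tau> ?z"] by auto
  \<comment> \<open>One rule for both directions: \<open>u = 1\<close> gives the horizontal
    segments, \<open>u = \<i>\<close> the vertical ones.\<close>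
  have line: "((\<lambda>t. P (u * of_real t + v)) has_vector_derivative u * airy_kernel (u * of_real t + v) ?z) (at t within S)" for u v t S
  proof -
    have "((\<lambda>t. u * of_real t + v) has_vector_derivative u) (at t within S)"
      by (auto intro!: derivative_eq_intros simp: has_vector_derivative_def scaleR_conv_of_real)
    from field_vector_diff_chain_within[OF this has_field_derivative_at_within[OF P]]
    show ?thesis by (simp add: o_def)
  qed
  have e1: "(?e has_integral P (of_real b) - P (of_real a)) {a..b}" if "a \<le> b" for a b
    using fundamental_theorem_of_calculus[OF that line[of 1 0]] by simp
  have e2: "(?h has_integral P (of_real b + \<i>) - P (of_real a + \<i>)) {a..b}" if "a \<le> b" for a b
    using fundamental_theorem_of_calculus[OF that line[of 1 \<i>]] by simp
  define C where "C = exp (1 / 3 + \<bar>x\<bar>)"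
  have side: "norm (P (of_real T + \<i>) - P (of_real T)) \<le> C / T\<^sup>2" if "T \<noteq> 0" for T
  proof -
    have i1: "((\<lambda>y. \<i> * airy_kernel (\<i> * of_real y + of_real T) ?z) has_integral P (\<i> + of_real T) - P (of_real T)) {0..1}"
      using fundamental_theorem_of_calculus[OF _ line[of \<i> "of_real T"], of 0 1] by simp
    have "((\<lambda>y. C * exp (- K * y)) has_integral (- C * exp (- K * 1) / K) - (- C * exp (- K * 0) / K)) {0..1}"
      if "K \<noteq> 0" for K
      by (rule fundamental_theorem_of_calculus)
         (use that in \<open>auto intro!: derivative_eq_intros simp: has_real_derivative_iff_has_vector_derivative[symmetric]\<close>)
    from this[of "T\<^sup>2"] that
    have i2: "((\<lambda>y. C * exp (- T\<^sup>2 * y)) has_integral (- C * exp (- T\<^sup>2 * 1) / T\<^sup>2) - (- C * exp (- T\<^sup>2 * 0) / T\<^sup>2)) {0..1}"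
      by simp
    have "norm (\<i> * airy_kernel (\<i> * of_real y + of_real T) ?z) \<le> C * exp (- T\<^sup>2 * y)" if y: "y \<in> {0..1}" for y
    proof -
      have "y ^ 3 \<le> 1" using y by (auto intro: power_le_one)
      moreover have "\<bar>x * y\<bar> \<le> \<bar>x\<bar> * 1" unfolding abs_mult using y by (intro mult_left_mono) auto
      then have "- (x * y) \<le> \<bar>x\<bar>" by linarith
      ultimately show ?thesis unfolding C_def norm_mult norm_airy_kernel
        by (simp flip: exp_add)
    qed
    then have "norm (P (\<i> + of_real T) - P (of_real T)) \<le> (- C * exp (- T\<^sup>2 * 1) / T\<^sup>2) - (- C * exp (- T\<^sup>2 * 0) / T\<^sup>2)"
      unfolding has_integral_iff[THEN iffD1, OF i1, THEN conjunct2, symmetric]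
        has_integral_iff[THEN iffD1, OF i2, THEN conjunct2, symmetric]
      by (intro integral_norm_bound_integral has_integral_integrable[OF i1] has_integral_integrable[OF i2])
    also have "\<dots> \<le> C / T\<^sup>2" by (simp add: C_def)
    finally show ?thesis by (simp add: add.commute)
  qed
  have C: "C > 0" by (simp add: C_def)
  have hI: "(?h has_integral 2 * of_real pi * Ai ?z) UNIV"
    using has_integral_integral_lborel[OF dominated_family_integrable[OF airy_kernel_family_z[of \<i>]], of ?z]
    by (simp add: Ai_def)
  have "(?e has_integral 2 * of_real pi * Ai ?z) UNIV"
    unfolding has_integral_alt'
  proof (intro conjI allI impI)
    show "(\<lambda>t. if t \<in> UNIV then ?e t else 0) integrable_on cbox a b" for a b
      using e1[of a b] by (cases "a \<le> b") (auto simp: integrable_on_def)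
    fix e :: real assume e: "e > 0"
    with hI obtain B1 where B1: "B1 > 0" "\<And>a b. ball 0 B1 \<subseteq> cbox a b \<Longrightarrow> norm (integral (cbox a b) ?h - 2 * of_real pi * Ai ?z) < e / 2"
      unfolding has_integral_alt' by (auto dest: spec[of _ "e/2"])
    \<comment> \<open>The summand \<open>4 * C / e\<close> makes each vertical side at most e/4; the
      others ensure that B is at least B1 and at least 1.\<close>
    define B where "B = B1 + 1 + 4 * C / e"
    have B: "B > 0" "B \<ge> B1" "B \<ge> 1" using B1 C e by (auto simp: B_def add_pos_pos)
    show "\<exists>B>0. \<forall>a b. ball 0 B \<subseteq> cbox a b \<longrightarrow>
        norm (integral (cbox a b) (\<lambda>t. if t \<in> UNIV then ?e t else 0) - 2 * of_real pi * Ai ?z) < e"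
    proof (intro exI conjI allI impI)
      show "B > 0" by fact
      fix a b :: real assume ab: "ball 0 B \<subseteq> cbox a b"
      \<comment> \<open>The open ball misses the points -B and B; its closure contains them, which
        yields a \<le> -B and B \<le> b.\<close>
      then have "closure (ball 0 B) \<subseteq> cbox a b" by (rule closure_minimal) simp
      then have "cball 0 B \<subseteq> cbox a b" using B by (simp add: closure_ball)
      then have "- B \<in> cbox a b" "B \<in> cbox a b" using B by (auto simp: subset_iff dist_norm)
      then have abB: "a \<le> - B" "B \<le> b" by auto
      then have le: "a \<le> b" using B by linarith
      have small: "C / T\<^sup>2 \<le> e / 4" if "\<bar>T\<bar> \<ge> B" for T
      proof -
        have "4 * C / e \<le> \<bar>T\<bar>" using that B1 by (simp add: B_def)
        also have "\<dots> \<le> \<bar>T\<bar> * \<bar>T\<bar>" using that B mult_left_mono[of 1 "\<bar>T\<bar>" "\<bar>T\<bar>"] by linarith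
        finally have "4 * C \<le> T\<^sup>2 * e" using e by (simp add: field_simps power2_eq_square)
        then show ?thesis using e that B by (simp add: field_simps)
      qed
      have "norm (integral (cbox a b) ?h - 2 * of_real pi * Ai ?z) < e / 2"
        using B1(2) ab B(2) by (meson order_trans subset_ball)
      moreover have "integral (cbox a b) ?h = P (of_real b + \<i>) - P (of_real a + \<i>)"
        using e2[OF le] by (simp add: integral_unique)
      moreover have "integral (cbox a b) ?e = P (of_real b) - P (of_real a)"
        using e1[OF le] by (simp add: integral_unique)
      moreover have "norm (P (of_real b + \<i>) - P (of_real b)) \<le> e / 4" "norm (P (of_real a + \<i>) - P (of_real a)) \<le> e / 4"
        using order_trans[OF side[of b] small[of b]] order_trans[OF side[of a] small[of a]] abB B by auto
      moreover have tri: "norm (Eb - Ea - I) < e" if "norm (Hb - Ha - I) < e / 2" "norm (Hb - Eb) \<le> e / 4" "norm (Ha - Ea) \<le> e / 4"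
        for Ea Eb Ha Hb I :: complex
      proof -
        have eq: "Eb - Ea - I = (Hb - Ha - I) - (Hb - Eb) + (Ha - Ea)" by simp
        have "norm (Eb - Ea - I) \<le> norm (Hb - Ha - I) + norm (Hb - Eb) + norm (Ha - Ea)"
          unfolding eq by (rule order_trans[OF norm_triangle_ineq add_right_mono[OF norm_triangle_ineq4]])
        then show ?thesis using that by linarith
      qed
      ultimately have "norm (integral (cbox a b) ?e - 2 * of_real pi * Ai ?z) < e"
        by (simp add: tri)
      then show "norm (integral (cbox a b) (\<lambda>t. if t \<in> UNIV then ?e t else 0) - 2 * of_real pi * Ai ?z) < e"
        by simp
    qed
  qed
  then show ?thesis by (simp add: airy_kernel_def algebra_simps)
qed

text \<open>\<open>airy\<close> is a definite description, so uniqueness is part of the claim; it is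
  the identity theorem applied on the real axis.\<close>

lemma airy_eq_Ai: "airy = Ai"
  unfolding airy_def
proof (rule the_equality, intro conjI allI)
  show "Ai holomorphic_on UNIV" by (rule Ai_holomorphic)
  show "Ai (complex_of_real x) = 1 / (2 * complex_of_real pi) *
          integral UNIV (\<lambda>t::real. exp (\<i> * complex_of_real (t * x + t ^ 3 / 3)))" for x
    using integral_unique[OF Ai_has_integral[of x]] by simp
  fix A assume A: "A holomorphic_on UNIV \<and>
     (\<forall>x::real. A (complex_of_real x) = 1 / (2 * complex_of_real pi) *
          integral UNIV (\<lambda>t::real. exp (\<i> * complex_of_real (t * x + t ^ 3 / 3))))"
  have eq: "A (of_real x) = Ai (of_real x)" for x
    using A integral_unique[OF Ai_has_integral[of x]] by simp
  have "A z - Ai z = 0" for z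
  proof (rule analytic_continuation[where f="\<lambda>z. A z - Ai z" and S=UNIV and U="range of_real" and \<xi>=0])
    show "(\<lambda>z. A z - Ai z) holomorphic_on UNIV" using A Ai_holomorphic by (intro holomorphic_intros) auto
    show "(0::complex) islimpt range of_real"
      unfolding islimpt_sequential
    proof (intro exI conjI allI)
      show "of_real (inverse (real (Suc n))) \<in> range of_real - {0::complex}" for n
        unfolding of_real_eq_0_iff by (auto simp del: of_real_inverse of_real_of_nat_eq simp: of_real_eq_0_iff)
      have "(\<lambda>n. complex_of_real (inverse (real (Suc n)))) \<longlonglongrightarrow> of_real 0"
        by (intro tendsto_of_real LIMSEQ_inverse_real_of_nat)
      then show "(\<lambda>n. complex_of_real (inverse (real (Suc n)))) \<longlonglongrightarrow> 0" by simp
    qed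
  qed (auto simp: eq)
  then show "A = Ai" by (auto simp: fun_eq_iff)
qed

text \<open>The equation expresses the derivative of order m + 2 at 0 through derivatives of order
  at most m, so all Taylor coefficients vanish.\<close>

lemma airy_ode_unique:
  assumes f: "f holomorphic_on UNIV" and ode: "\<And>z. (deriv f has_field_derivative z * f z) (at z)"
    and "f 0 = 0" "deriv f 0 = 0"
  shows "f z = 0"
proof (rule holomorphic_fun_eq_0_on_connected[OF f])
  have d2: "deriv (deriv f) = (\<lambda>z. z * f z)"
    using ode by (auto intro!: ext DERIV_imp_deriv)
  show "(deriv ^^ n) f 0 = 0" for n
  proof (induction n rule: less_induct)
    case (less n)
    show ?case
    proof (cases "n < 2")
      case True
      then have "n = 0 \<or> n = 1" by auto
      then show ?thesis using assms by auto
    next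
      case False
      then obtain m where m: "n = m + 2" by (metis add.commute le_add_diff_inverse not_less)
      have "(deriv ^^ n) f = (deriv ^^ m) (\<lambda>z. z * f z)"
        unfolding m funpow_add by (simp add: numeral_2_eq_2 d2)
      then have "(deriv ^^ n) f 0 = (deriv ^^ m) (\<lambda>z. z * f z) 0" by simp
      also have "\<dots> = (\<Sum>i = 0..m. of_nat (m choose i) * (deriv ^^ i) (\<lambda>z. z) 0 * (deriv ^^ (m - i)) f 0)"
        by (rule higher_deriv_mult[where S=UNIV]) (use f in auto)
      also have "\<dots> = 0" by (rule sum.neutral) (use less m in auto)
      finally show ?thesis .
    qed
  qed
qed auto

section \<open>Rotated Airy functions: connection formula and Wronskian\<close>

lemma airy_rot_cubed: "airy_rot ^ 3 = 1"
proof -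
  have "airy_rot ^ 3 = exp (of_nat 3 * (2 * complex_of_real pi * \<i> / 3))"
    unfolding airy_rot_def by (rule exp_of_nat_mult[symmetric])
  also have "of_nat 3 * (2 * complex_of_real pi * \<i> / 3) = 2 * complex_of_real pi * \<i>" by simp
  finally show ?thesis by (simp add: exp_eq_1)
qed

lemma airy_rot_eq: "airy_rot = Complex (- 1 / 2) (sqrt 3 / 2)"
proof -
  have "2 * complex_of_real pi * \<i> / 3 = \<i> * of_real (2 * pi / 3)" by simp
  then show ?thesis unfolding airy_rot_def
    by (simp only: cis_conv_exp[symmetric]) (simp add: complex_eq_iff cos_120 sin_120)
qed

lemma airy_rot_sum: "1 + airy_rot + airy_rot\<^sup>2 = 0"
  by (simp add: airy_rot_eq complex_eq_iff power2_eq_square)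

lemma airy_rot_nz [simp]: "airy_rot \<noteq> 0"
  by (simp add: airy_rot_def)

lemma airy_rot_powers: "airy_rot * airy_rot\<^sup>2 = 1" "airy_rot\<^sup>2 * airy_rot\<^sup>2 = airy_rot"
    "airy_rot\<^sup>2 * airy_rot = 1"
proof -
  show *: "airy_rot * airy_rot\<^sup>2 = 1" using airy_rot_cubed by (simp add: power3_eq_cube power2_eq_square mult.assoc)
  then show "airy_rot\<^sup>2 * airy_rot = 1" by (simp add: mult.commute)
  show "airy_rot\<^sup>2 * airy_rot\<^sup>2 = airy_rot" using *
    by (metis mult.assoc mult.right_neutral power2_eq_square mult.commute)
qed

lemma Ai_scaled_DERIV:
  assumes "r ^ 3 = 1"
  shows "((\<lambda>z. Ai (r * z)) has_field_derivative r * deriv Ai (r * z)) (at z)"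
    and "((\<lambda>z. r * deriv Ai (r * z)) has_field_derivative z * Ai (r * z)) (at z)"
proof -
  have l: "((\<lambda>z. r * z) has_field_derivative r) (at z)" by (auto intro!: derivative_eq_intros)
  from DERIV_chain2[OF Ai_has_field_derivative l]
  show "((\<lambda>z. Ai (r * z)) has_field_derivative r * deriv Ai (r * z)) (at z)" by (simp add: mult.commute)
  have "((\<lambda>z. r * deriv Ai (r * z)) has_field_derivative r * (r * z * Ai (r * z) * r)) (at z)"
    by (rule DERIV_cmult[OF DERIV_chain2[OF Ai_ode l]])
  also have "r * (r * z * Ai (r * z) * r) = r ^ 3 * (z * Ai (r * z))" by (simp add: power3_eq_cube)
  finally show "((\<lambda>z. r * deriv Ai (r * z)) has_field_derivative z * Ai (r * z)) (at z)"
    using assms by simp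
qed

lemma power_mult_cubed: "(x\<^sup>2) ^ 3 = (x ^ 3)\<^sup>2" for x :: complex
  by (simp only: power_mult[symmetric] mult.commute)

text \<open>The sum of the three terms solves the Airy equation, and its value and its derivative at
  0 carry the factor \<open>1 + airy_rot + airy_rot\<^sup>2 = 0\<close>. The formula trades an
  argument near the negative axis, which \<open>Ai_amp_asymp\<close> does not reach, for two
  arguments that it does reach.\<close>

lemma Ai_rotation: "Ai z = - airy_rot * Ai (airy_rot * z) - airy_rot\<^sup>2 * Ai (airy_rot\<^sup>2 * z)"
proof -
  let ?w = "airy_rot"
  define S where "S = (\<lambda>z. Ai z + ?w * Ai (?w * z) + ?w\<^sup>2 * Ai (?w\<^sup>2 * z))"
  have w3: "?w ^ 3 = 1" "(?w\<^sup>2) ^ 3 = 1" "(1::complex) ^ 3 = 1"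
    by (simp_all only: power_mult_cubed airy_rot_cubed power_one)
  have D1: "(S has_field_derivative deriv Ai z + ?w * (?w * deriv Ai (?w * z)) + ?w\<^sup>2 * (?w\<^sup>2 * deriv Ai (?w\<^sup>2 * z))) (at z)" for z
    unfolding S_def by (intro DERIV_add DERIV_cmult Ai_scaled_DERIV w3 Ai_has_field_derivative)
  then have dS: "deriv S = (\<lambda>z. deriv Ai z + ?w * (?w * deriv Ai (?w * z)) + ?w\<^sup>2 * (?w\<^sup>2 * deriv Ai (?w\<^sup>2 * z)))"
    by (auto intro!: ext DERIV_imp_deriv)
  have D2: "(deriv S has_field_derivative z * Ai z + ?w * (z * Ai (?w * z)) + ?w\<^sup>2 * (z * Ai (?w\<^sup>2 * z))) (at z)" for z
    unfolding dS by (intro DERIV_add DERIV_cmult Ai_scaled_DERIV w3 Ai_ode)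
  have "S z = 0"
  proof (rule airy_ode_unique[of S])
    show "S holomorphic_on UNIV"
      using D1 by (intro holomorphic_onI) (auto simp: field_differentiable_def)
    show "(deriv S has_field_derivative z * S z) (at z)" for z
      using D2[of z] by (simp add: S_def algebra_simps)
    have "S 0 = (1 + ?w + ?w\<^sup>2) * Ai 0" by (simp add: S_def algebra_simps)
    then show "S 0 = 0" by (simp add: airy_rot_sum)
    have "deriv S 0 = (1 + ?w\<^sup>2 + ?w\<^sup>2 * ?w\<^sup>2) * deriv Ai 0"
      by (simp add: dS algebra_simps power2_eq_square)
    also have "1 + ?w\<^sup>2 + ?w\<^sup>2 * ?w\<^sup>2 = 1 + ?w + ?w\<^sup>2" by (simp only: airy_rot_powers(2)) simp
    finally show "deriv S 0 = 0" by (simp add: airy_rot_sum)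
  qed
  then show ?thesis unfolding S_def by (simp add: algebra_simps eq_neg_iff_add_eq_0)
qed

text \<open>Constant in z by the Airy equation, so it may be evaluated along z = x^2 as x tends to
  infinity. There \<open>airy_rot * z\<close> is the square of exp(i pi/3) x, a point of the right
  half plane with cube -x^3; the exponentials of the two factors cancel and only the leading
  amplitudes contribute.\<close>

lemma Ai_wronskian:
  "Ai z * (airy_rot * deriv Ai (airy_rot * z)) - deriv Ai z * Ai (airy_rot * z)
     = exp (- \<i> * of_real (pi / 6)) / (2 * of_real pi)"
proof -
  let ?r = "airy_rot"
  let ?wr = "\<lambda>z. Ai z * (?r * deriv Ai (?r * z)) - deriv Ai z * Ai (?r * z)"
  have "(?wr has_field_derivative 0) (at z)" for z
  proof -
    have "(?wr has_field_derivative
      (deriv Ai z * (?r * deriv Ai (?r * z)) + z * Ai (?r * z) * Ai z)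
       - (z * Ai z * Ai (?r * z) + ?r * deriv Ai (?r * z) * deriv Ai z)) (at z)"
      by (intro DERIV_diff DERIV_mult Ai_has_field_derivative Ai_ode Ai_scaled_DERIV airy_rot_cubed)
    then show ?thesis by (simp add: algebra_simps)
  qed
  then have "\<exists>c. \<forall>z\<in>UNIV. ?wr z = c"
    by (intro has_field_derivative_zero_constant) auto
  then obtain c where c: "\<And>z. ?wr z = c" by auto
  let ?e = "exp (\<i> * of_real (pi / 3))" and ?h = "exp (\<i> * of_real (pi / 6))"
  have hh: "?h * ?h = ?e" by (simp only: exp_add[symmetric]) (simp add: field_simps)
  have s1: "2 * complex_of_real pi * \<i> / 3 + \<i> * of_real (pi / 3) = of_real pi * \<i>"
    and s2: "\<i> * of_real (pi / 3) + \<i> * of_real (pi / 3) = 2 * complex_of_real pi * \<i> / 3"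
    by (simp_all add: complex_eq_iff)
  have er: "?r * ?e = -1"
    unfolding airy_rot_def exp_add[symmetric] s1 by (rule exp_pi_i)
  have ee: "?e\<^sup>2 = ?r"
    unfolding airy_rot_def power2_eq_square exp_add[symmetric] s2 ..
  have e3: "?e ^ 3 = - 1"
    using ee er by (simp add: power3_eq_cube power2_eq_square)
  have Ree: "Re ?e = 1 / 2" by (simp add: Re_exp cos_60)
  let ?w = "\<lambda>x::real. complex_of_real x" and ?v = "\<lambda>x::real. ?e * of_real x"
  let ?E1 = "\<lambda>x. Ai_amp (?w x) * (?r * (Ai_amp' (?v x) / (2 * ?v x)))"
  let ?E2 = "\<lambda>x. Ai_amp' (?w x) / (2 * ?w x) * Ai_amp (?v x)"
  have Rev: "Re (?v x) = x / 2" for x using Ree by simp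
  \<comment> \<open>The two leading terms add up instead of cancelling because
    \<open>airy_rot * exp (\<i> * of_real (pi / 3)) = - 1\<close>; \<open>?E1\<close> and
    \<open>?E2\<close> collect the terms with \<open>Ai_amp'\<close>, which vanish in the
    limit.\<close>
  have form: "c = 2 * ?w x * (Ai_amp (?w x) * Ai_amp (?v x)) + ?E1 x - ?E2 x" if x: "x > 0" for x
  proof -
    have v2: "?r * (?w x)\<^sup>2 = (?v x)\<^sup>2" using ee by (simp add: power_mult_distrib)
    have v3: "(?v x) ^ 3 = - ((?w x) ^ 3)" using e3 by (simp add: power_mult_distrib)
    let ?p = "exp (- (2/3) * (?w x) ^ 3)" and ?q = "exp (- (2/3) * (?v x) ^ 3)"
    have pq: "?p * ?q = 1" unfolding v3 by (simp flip: exp_add)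
    have "c = ?wr ((?w x)\<^sup>2)" by (rule c[symmetric])
    also have "\<dots> = (?p * Ai_amp (?w x)) * (?r * (?q * (- ?v x * Ai_amp (?v x) + Ai_amp' (?v x) / (2 * ?v x))))
       - ?p * (- ?w x * Ai_amp (?w x) + Ai_amp' (?w x) / (2 * ?w x)) * (?q * Ai_amp (?v x))"
      unfolding v2 using x Rev[of x] by (simp only: Ai_square deriv_Ai_square Re_complex_of_real half_gt_zero_iff)
    also have "\<dots> = (?p * ?q) * ((?w x - ?r * ?e * ?w x) * (Ai_amp (?w x) * Ai_amp (?v x)) + ?E1 x - ?E2 x)"
      by (simp add: algebra_simps)
    finally show ?thesis unfolding pq er by simp
  qed
  have amp_n: "norm (Ai_amp (?w x)) \<le> 1 / sqrt (x / 2)" "norm (Ai_amp (?v x)) \<le> 1 / sqrt (x / 2)"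
    "norm (Ai_amp' (?w x)) \<le> gauss_moment 2 / sqrt (x / 2) ^ 3" "norm (Ai_amp' (?v x)) \<le> gauss_moment 2 / sqrt (x / 2) ^ 3"
    if x: "x > 0" for x
  proof -
    show "norm (Ai_amp (?v x)) \<le> 1 / sqrt (x / 2)" using norm_Ai_amp_le[of "?v x", unfolded Rev] x by simp
    show "norm (Ai_amp' (?v x)) \<le> gauss_moment 2 / sqrt (x / 2) ^ 3"
      using Ai_amp_DERIV(2)[of "?v x", unfolded Rev] x by simp
    have "1 / sqrt x \<le> 1 / sqrt (x / 2)" using x by (intro divide_left_mono) auto
    then show "norm (Ai_amp (?w x)) \<le> 1 / sqrt (x / 2)" using norm_Ai_amp_le[of "?w x"] x by simp
    have "gauss_moment 2 / sqrt x ^ 3 \<le> gauss_moment 2 / sqrt (x / 2) ^ 3"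
      using x gauss_moment_nonneg[of 2] by (intro divide_left_mono power_mono mult_pos_pos zero_less_power) auto
    then show "norm (Ai_amp' (?w x)) \<le> gauss_moment 2 / sqrt (x / 2) ^ 3" using Ai_amp_DERIV(2)[of "?w x"] x by simp
  qed
  have lim0: "((\<lambda>x. gauss_moment 2 / sqrt (x / 2) ^ 3 / (2 * x) * (1 / sqrt (x / 2))) \<longlongrightarrow> 0) at_top"
    by real_asymp
  have ne: "norm ?e = 1" "norm ?r = 1" by (auto simp: norm_exp_eq_Re airy_rot_def)
  have E1: "(?E1 \<longlongrightarrow> 0) at_top"
  proof (rule Lim_null_comparison[OF _ lim0])
    show "\<forall>\<^sub>F x in at_top. norm (?E1 x) \<le> gauss_moment 2 / sqrt (x / 2) ^ 3 / (2 * x) * (1 / sqrt (x / 2))"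
      using eventually_gt_at_top[of 0]
    proof eventually_elim
      case (elim x)
      have "norm (?E1 x) = norm (Ai_amp' (?v x)) / (2 * x) * norm (Ai_amp (?w x))"
        using elim ne by (simp add: norm_mult norm_divide)
      also have "\<dots> \<le> gauss_moment 2 / sqrt (x / 2) ^ 3 / (2 * x) * (1 / sqrt (x / 2))"
        using elim amp_n[OF elim] gauss_moment_nonneg[of 2]
        by (intro mult_mono divide_right_mono divide_nonneg_nonneg) auto
      finally show ?case .
    qed
  qed
  have E2: "(?E2 \<longlongrightarrow> 0) at_top"
  proof (rule Lim_null_comparison[OF _ lim0])
    show "\<forall>\<^sub>F x in at_top. norm (?E2 x) \<le> gauss_moment 2 / sqrt (x / 2) ^ 3 / (2 * x) * (1 / sqrt (x / 2))"
      using eventually_gt_at_top[of 0]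
    proof eventually_elim
      case (elim x)
      have "norm (?E2 x) = norm (Ai_amp' (?w x)) / (2 * x) * norm (Ai_amp (?v x))"
        using elim ne by (simp add: norm_mult norm_divide)
      also have "\<dots> \<le> gauss_moment 2 / sqrt (x / 2) ^ 3 / (2 * x) * (1 / sqrt (x / 2))"
        using elim amp_n[OF elim] gauss_moment_nonneg[of 2]
        by (intro mult_mono divide_right_mono divide_nonneg_nonneg) auto
      finally show ?case .
    qed
  qed
  obtain C where C: "C > 0" "\<And>w. w \<noteq> 0 \<and> Re w \<ge> norm w / 4 \<Longrightarrow>
     norm (Ai_amp w * (2 * of_real (sqrt pi) * csqrt w) - 1) \<le> C / (norm w * sqrt (norm w))"
    using Ai_amp_asymp by blast
  have limC: "((\<lambda>x. C / (x * sqrt x)) \<longlongrightarrow> 0) at_top" by real_asymp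
  have N: "((\<lambda>x. Ai_amp (u * of_real x) * (2 * of_real (sqrt pi) * csqrt (u * of_real x))) \<longlongrightarrow> 1) at_top"
    if u: "norm u = 1" "Re u \<ge> 1/2" for u
  proof (rule LIM_zero_cancel, rule Lim_null_comparison[OF _ limC])
    show "\<forall>\<^sub>F x in at_top. norm (Ai_amp (u * of_real x) * (2 * of_real (sqrt pi) * csqrt (u * of_real x)) - 1) \<le> C / (x * sqrt x)"
      using eventually_gt_at_top[of 0]
    proof eventually_elim
      case (elim x)
      have "u * of_real x \<noteq> 0 \<and> Re (u * of_real x) \<ge> norm (u * of_real x) / 4"
        using u elim mult_right_mono[of "1/2" "Re u" x] by (auto simp: norm_mult)
      from C(2)[OF this] show ?case using u elim by (simp add: norm_mult)
    qed
  qed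
  \<comment> \<open>The principal root of exp(i pi/3) x is exp(i pi/6) sqrt x; this is the origin of
    the phase exp(-i pi/6) in the result.\<close>
  have sq: "csqrt (?w x) * csqrt (?v x) = ?h * of_real x" if "x > 0" for x
  proof -
    have "(?h * of_real (sqrt x))\<^sup>2 = (?h * ?h) * of_real (sqrt x * sqrt x)"
      by (simp only: power2_eq_square of_real_mult mult_ac)
    also have "\<dots> = ?v x" unfolding hh using that by simp
    finally have "csqrt (?v x) = csqrt ((?h * of_real (sqrt x))\<^sup>2)" by simp
    also have "\<dots> = ?h * of_real (sqrt x)"
      by (rule csqrt_square) (use that in \<open>auto simp: Re_exp cos_30\<close>)
    finally show ?thesis using that by (simp add: csqrt_of_real_nonneg mult_ac flip: of_real_mult)
  qed
  have t1: "((\<lambda>x. (Ai_amp (1 * of_real x) * (2 * of_real (sqrt pi) * csqrt (1 * of_real x))) *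
      (Ai_amp (?v x) * (2 * of_real (sqrt pi) * csqrt (?v x)))) \<longlongrightarrow> 1 * 1) at_top"
    by (intro tendsto_mult N) (use Ree ne in auto)
  have t2: "(Ai_amp (1 * of_real x) * (2 * of_real (sqrt pi) * csqrt (1 * of_real x))) *
      (Ai_amp (?v x) * (2 * of_real (sqrt pi) * csqrt (?v x))) = 2 * of_real pi * ?h * (2 * ?w x * (Ai_amp (?w x) * Ai_amp (?v x)))"
    if "x > 0" for x
  proof -
    have "(Ai_amp (1 * of_real x) * (2 * of_real (sqrt pi) * csqrt (1 * of_real x))) *
      (Ai_amp (?v x) * (2 * of_real (sqrt pi) * csqrt (?v x))) =
      4 * (of_real (sqrt pi) * of_real (sqrt pi)) * (csqrt (?w x) * csqrt (?v x)) * (Ai_amp (?w x) * Ai_amp (?v x))"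
      by (simp add: mult_ac)
    also have "complex_of_real (sqrt pi) * of_real (sqrt pi) = of_real pi" by (simp flip: of_real_mult)
    finally show ?thesis unfolding sq[OF that] by (simp add: mult_ac)
  qed
  have "((\<lambda>x. 2 * of_real pi * ?h * (2 * ?w x * (Ai_amp (?w x) * Ai_amp (?v x)))) \<longlongrightarrow> 1 * 1) at_top"
    by (rule Lim_transform_eventually[OF t1], rule eventually_mono[OF eventually_gt_at_top[of 0]], rule t2)
  then have main: "((\<lambda>x. 2 * of_real pi * ?h * (2 * ?w x * (Ai_amp (?w x) * Ai_amp (?v x)))) \<longlongrightarrow> 1) at_top"
    by (simp only: mult_1_left)
  have "((\<lambda>x. 2 * of_real pi * ?h * (2 * ?w x * (Ai_amp (?w x) * Ai_amp (?v x))) + 2 * of_real pi * ?h * (?E1 x - ?E2 x)) \<longlongrightarrow>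
      1 + 2 * of_real pi * ?h * (0 - 0)) at_top"
    by (intro tendsto_add main tendsto_mult tendsto_const tendsto_diff E1 E2)
  moreover have "eventually (\<lambda>x. 2 * of_real pi * ?h * (2 * ?w x * (Ai_amp (?w x) * Ai_amp (?v x))) + 2 * of_real pi * ?h * (?E1 x - ?E2 x)
      = 2 * of_real pi * ?h * c) at_top"
    using eventually_gt_at_top[of 0]
  proof eventually_elim
    case (elim x)
    show ?case by (subst form[OF elim]) (simp only: distrib_left right_diff_distrib add_diff_eq)
  qed
  ultimately have "((\<lambda>x::real. 2 * of_real pi * ?h * c) \<longlongrightarrow> 1 + 2 * of_real pi * ?h * (0 - 0)) at_top"
    by (rule Lim_transform_eventually)
  then have "2 * of_real pi * ?h * c = 1 + 2 * of_real pi * ?h * (0 - 0)"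
    by (subst (asm) tendsto_const_iff) simp_all
  then have h1: "2 * of_real pi * ?h * c = 1" by (simp only: diff_self mult_zero_right add_0_right)
  have h2: "exp (- \<i> * of_real (pi / 6)) * ?h = 1"
    by (simp only: exp_add[symmetric]) simp
  have "c = u / (2 * of_real pi)" if "2 * of_real pi * h * c = 1" "u * h = 1" for h u
  proof -
    have "u * (2 * of_real pi * h * c) = u" using that by simp
    then have "(u * h) * (2 * of_real pi * c) = u" by (simp only: mult_ac)
    then have "2 * of_real pi * c = u" by (simp only: that mult_1_left)
    then show ?thesis by (simp add: eq_divide_eq mult_ac)
  qed
  from this[OF h1 h2] have "c = exp (- \<i> * of_real (pi / 6)) / (2 * of_real pi)" .
  then show ?thesis using c by simp
qed

text \<open>The contour height c = sqrt(1 + |z|) makes \<open>c ^ 3 / 3\<close> and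
  \<open>norm z * c\<close> comparable; the term linear in t is absorbed by half of the Gaussian
  exponent. The order 3/2 in |z| later yields exp(C / f), since the arguments are of size
  f^(-2/3).\<close>

lemma Ai_growth: "\<exists>C>0. \<forall>z. norm (Ai z) \<le> C * exp (2 * sqrt (1 + norm z) ^ 3)"
proof (intro exI conjI allI)
  let ?C = "1 + (LINT t|lborel. \<bar>t::real\<bar> ^ 0 * exp (- (1/2) * t\<^sup>2))"
  have nn: "(LINT t|lborel. \<bar>t::real\<bar> ^ 0 * exp (- (1/2) * t\<^sup>2)) \<ge> 0" by (rule integral_nonneg_AE) auto
  then show "?C > 0" by linarith
  fix z :: complex
  define c where "c = sqrt (1 + norm z)"
  have c: "c \<ge> 1" "norm z \<le> c\<^sup>2" by (auto simp: c_def)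
  have k: "norm (airy_kernel (of_real t + \<i> * of_real c) z) \<le> exp (2 * c ^ 3) * (\<bar>t\<bar> ^ 0 * exp (- (1/2) * t\<^sup>2))" for t
  proof -
    have "- Im (z * (of_real t + \<i> * of_real c)) \<le> norm z * norm (of_real t + \<i> * of_real c)"
      using abs_Im_le_cmod[of "z * (of_real t + \<i> * of_real c)"] by (simp only: norm_mult abs_le_iff)
    also have "\<dots> \<le> c\<^sup>2 * (\<bar>t\<bar> + c)"
      using c norm_triangle_ineq[of "of_real t" "\<i> * of_real c"] by (intro mult_mono) (auto simp: norm_mult)
    finally have 1: "- Im (z * (of_real t + \<i> * of_real c)) \<le> c\<^sup>2 * \<bar>t\<bar> + c ^ 3"
      by (simp add: algebra_simps power2_eq_square power3_eq_cube)
    have "c * (\<bar>t\<bar> - c)\<^sup>2 \<ge> 0" using c by simp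
    then have 2: "c\<^sup>2 * \<bar>t\<bar> \<le> t\<^sup>2 * c / 2 + c ^ 3 / 2"
      by (simp add: algebra_simps power2_eq_square power3_eq_cube)
    have 3: "t\<^sup>2 \<le> t\<^sup>2 * c" using c mult_left_mono[of 1 c "t\<^sup>2"] by simp
    have 4: "c ^ 3 \<ge> 0" using c by simp
    have "- t\<^sup>2 * c + c ^ 3 / 3 - Im (z * (of_real t + \<i> * of_real c)) \<le> 2 * c ^ 3 + - (1/2) * t\<^sup>2"
      using 1 2 3 4 by linarith
    then show ?thesis unfolding norm_airy_kernel by (simp flip: exp_add)
  qed
  have i1: "integrable lborel (\<lambda>t. airy_kernel (of_real t + \<i> * of_real c) z)"
    using dominated_family_integrable[OF airy_kernel_family_z[of "\<i> * of_real c"]] c by simp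
  have i2: "integrable lborel (\<lambda>t. exp (2 * c ^ 3) * (\<bar>t\<bar> ^ 0 * exp (- (1/2) * t\<^sup>2)))"
    by (intro integrable_mult_right integrable_gauss_moment) simp
  have "norm (LINT t|lborel. airy_kernel (of_real t + \<i> * of_real c) z) \<le> (LINT t|lborel. norm (airy_kernel (of_real t + \<i> * of_real c) z))"
    by (rule integral_norm_bound)
  also have "\<dots> \<le> (LINT t|lborel. exp (2 * c ^ 3) * (\<bar>t\<bar> ^ 0 * exp (- (1/2) * t\<^sup>2)))"
    by (rule integral_mono[OF integrable_norm[OF i1] i2 k])
  also have "\<dots> = exp (2 * c ^ 3) * (LINT t|lborel. \<bar>t::real\<bar> ^ 0 * exp (- (1/2) * t\<^sup>2))"
    by (rule integral_mult_right_zero)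
  also have "\<dots> \<le> exp (2 * c ^ 3) * ?C" by (intro mult_left_mono) auto
  finally have "norm (LINT t|lborel. airy_kernel (of_real t + \<i> * of_real c) z) \<le> exp (2 * c ^ 3) * ?C" .
  from norm_over_two_pi[OF this]
  have "norm (Ai z) \<le> 1 / (2 * pi) * (exp (2 * c ^ 3) * ?C)"
    using Ai_eq_integral[of "\<i> * of_real c" z] c by simp
  also have "\<dots> \<le> 1 * (exp (2 * c ^ 3) * ?C)"
    using pi_ge_two nn by (intro mult_right_mono) auto
  finally show "norm (Ai z) \<le> ?C * exp (2 * sqrt (1 + norm z) ^ 3)" by (simp add: c_def mult.commute)
qed

section \<open>Wronskian identities for the Stark equation\<close>

lemma set_lint_FTC:
  fixes F :: "real \<Rightarrow> complex"
  assumes "a \<le> b" "\<And>x. x \<in> {a..b} \<Longrightarrow> (F has_vector_derivative f x) (at x within {a..b})" "continuous_on {a..b} f"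
  shows "(LINT x:{a..b}|lborel. f x) = F b - F a"
  unfolding set_lebesgue_integral_def using assms by (intro integral_FTC_atLeastAtMost) auto

lemma bounded_on_Icc:
  fixes g :: "real \<Rightarrow> complex"
  assumes "continuous_on {a..b} g"
  shows "\<exists>B. \<forall>y\<in>{a..b}. norm (g y) \<le> B"
  using compact_imp_bounded[OF compact_continuous_image[OF assms compact_Icc]] by (auto simp: bounded_iff)

lemma set_integrable_continuous:
  fixes f :: "real \<Rightarrow> complex"
  shows "continuous_on {a..b} f \<Longrightarrow> set_integrable lborel {a..b} f"
  by (rule borel_integrable_atLeastAtMost')

text \<open>Integration by parts when \<open>v\<close> is only absolutely continuous; the proof exchanges the order
  of integration over the triangle \<open>r \<le> y\<close>.\<close>

lemma set_lint_by_parts: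
  fixes \<psi> \<xi> v k :: "real \<Rightarrow> complex"
  assumes pq: "p \<le> q" and k: "set_integrable lborel {p..q} k" and \<xi>: "continuous_on {p..q} \<xi>"
    and \<psi>: "\<And>y. y \<in> {p..q} \<Longrightarrow> (\<psi> has_vector_derivative \<xi> y) (at y within {p..q})"
    and v: "\<And>y. y \<in> {p..q} \<Longrightarrow> v y = v p + (LINT r:{p..y}|lborel. k r)"
  shows "continuous_on {p..q} v"
    and "(LINT y:{p..q}|lborel. \<psi> y * k y + \<xi> y * v y) = \<psi> q * v q - \<psi> p * v p"
proof -
  have khk: "k integrable_on {p..q}"
    using k by (rule set_borel_integral_eq_integral(1))
  have veq: "v y = v p + integral {p..y} k" if "y \<in> {p..q}" for y
  proof -
    have "set_integrable lborel {p..y} k" by (rule set_integrable_subset[OF k]) (use that in auto)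
    from set_borel_integral_eq_integral(2)[OF this] v[OF that] show ?thesis by simp
  qed
  have "continuous_on {p..q} (\<lambda>y. v p + integral {p..y} k)"
    by (intro continuous_intros indefinite_integral_continuous_1 khk)
  then show vc: "continuous_on {p..q} v"
    by (subst continuous_on_cong[OF refl veq])
  have \<psi>c: "continuous_on {p..q} \<psi>"
    by (rule continuous_on_vector_derivative[OF \<psi>])
  define X where "X = (\<lambda>y. indicator {p..q} y *\<^sub>R \<xi> y)"
  define K where "K = (\<lambda>r. indicator {p..q} r *\<^sub>R k r)"
  have X: "integrable lborel X" using set_integrable_continuous[OF \<xi>] by (simp add: set_integrable_def X_def)
  have K: "integrable lborel K" using k by (simp add: set_integrable_def K_def)
  have Xm: "X \<in> borel_measurable borel" and Km: "K \<in> borel_measurable borel"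
    using X K borel_measurable_integrable by auto
  have F: "integrable (lborel \<Otimes>\<^sub>M lborel) (\<lambda>(y, r). X y * K r)"
  proof (rule lborel_pair.Fubini_integrable)
    show "(\<lambda>(y, r). X y * K r) \<in> borel_measurable (lborel \<Otimes>\<^sub>M lborel)"
      using Xm Km by measurable
    show "integrable lborel (\<lambda>y. LINT r|lborel. norm (case (y, r) of (y, r) \<Rightarrow> X y * K r))"
      using X by (simp add: norm_mult)
    show "AE y in lborel. integrable lborel (\<lambda>r. case (y, r) of (y, r) \<Rightarrow> X y * K r)"
      using K by simp
  qed
  have F2: "integrable (lborel \<Otimes>\<^sub>M lborel) (\<lambda>(y, r). if r \<le> y then X y * K r else 0)"
  proof (rule Bochner_Integration.integrable_bound[OF F])
    show "(\<lambda>(y, r). if r \<le> y then X y * K r else 0) \<in> borel_measurable (lborel \<Otimes>\<^sub>M lborel)"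
      using Xm Km by measurable
  qed (auto intro!: AE_I2)
  \<comment> \<open>The kernel on the triangle is integrated in both orders: over r first it gives
    increments of v, over y first increments of \<psi>.\<close>
  have in1: "(LINT r|lborel. (if r \<le> y then X y * K r else 0)) = X y * (v y - v p)" for y
  proof (cases "y \<in> {p..q}")
    case True
    have "(LINT r|lborel. (if r \<le> y then X y * K r else 0)) = (LINT r|lborel. X y * (indicator {p..y} r *\<^sub>R k r))"
      by (rule Bochner_Integration.integral_cong) (use True in \<open>auto simp: K_def indicator_def\<close>)
    also have "\<dots> = X y * (LINT r:{p..y}|lborel. k r)"
      unfolding set_lebesgue_integral_def by (rule integral_mult_right_zero)
    finally show ?thesis using v[OF True] by simp
  next
    case False
    then have "X y = 0" by (auto simp: X_def)
    then show ?thesis by (simp cong: if_cong)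
  qed
  have in2: "(LINT y|lborel. (if r \<le> y then X y * K r else 0)) = K r * (\<psi> q - \<psi> r)" for r
  proof (cases "r \<in> {p..q}")
    case True
    have "(LINT y|lborel. (if r \<le> y then X y * K r else 0)) = (LINT y|lborel. K r * (indicator {r..q} y *\<^sub>R \<xi> y))"
      by (rule Bochner_Integration.integral_cong) (use True in \<open>auto simp: X_def indicator_def\<close>)
    also have "\<dots> = K r * (LINT y:{r..q}|lborel. \<xi> y)"
      unfolding set_lebesgue_integral_def by (rule integral_mult_right_zero)
    also have "(LINT y:{r..q}|lborel. \<xi> y) = \<psi> q - \<psi> r"
    proof (rule set_lint_FTC)
      show "(\<psi> has_vector_derivative \<xi> x) (at x within {r..q})" if "x \<in> {r..q}" for x
        by (rule has_vector_derivative_within_subset[OF \<psi>]) (use that True in auto)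
      show "continuous_on {r..q} \<xi>" by (rule continuous_on_subset[OF \<xi>]) (use True in auto)
    qed (use True in auto)
    finally show ?thesis .
  next
    case False
    then have "K r = 0" by (auto simp: K_def)
    then show ?thesis by (simp cong: if_cong)
  qed
  have fub: "(LINT r|lborel. K r * (\<psi> q - \<psi> r)) = (LINT y|lborel. X y * (v y - v p))"
    using lborel_pair.Fubini_integral[OF F2] unfolding in1 in2 .
  have i1: "integrable lborel (\<lambda>r. K r * \<psi> r)"
  proof -
    obtain B where "\<And>y. y \<in> {p..q} \<Longrightarrow> norm (\<psi> y) \<le> B"
      using bounded_on_Icc[OF \<psi>c] by blast
    then have B: "norm (K r * \<psi> r) \<le> norm (K r * of_real B)" for r
      by (cases "r \<in> {p..q}") (auto simp: K_def norm_mult intro!: mult_left_mono order_trans[OF _ abs_ge_self])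
    have "(\<lambda>r. K r * (indicator {p..q} r *\<^sub>R \<psi> r)) \<in> borel_measurable lborel"
      using Km borel_measurable_continuous_on_indicator[OF _ \<psi>c] by measurable
    moreover have "(\<lambda>r. K r * (indicator {p..q} r *\<^sub>R \<psi> r)) = (\<lambda>r. K r * \<psi> r)"
      by (auto simp: K_def indicator_def fun_eq_iff)
    ultimately have m: "(\<lambda>r. K r * \<psi> r) \<in> borel_measurable lborel" by simp
    have "integrable lborel (\<lambda>r. K r * of_real B)" using K by simp
    from Bochner_Integration.integrable_bound[OF this m] B show ?thesis by auto
  qed
  have i2: "integrable lborel (\<lambda>y. X y * v y)"
  proof -
    have "set_integrable lborel {p..q} (\<lambda>y. \<xi> y * v y)"
      by (intro set_integrable_continuous continuous_intros \<xi> vc)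
    then show ?thesis by (simp add: set_integrable_def X_def)
  qed
  have iK: "(LINT r|lborel. K r) = v q - v p"
    using v[of q] pq by (simp add: K_def set_lebesgue_integral_def)
  have iX: "(LINT y|lborel. X y) = \<psi> q - \<psi> p"
    using set_lint_FTC[OF pq \<psi> \<xi>] by (simp add: X_def set_lebesgue_integral_def)
  have "(LINT r|lborel. K r * (\<psi> q - \<psi> r)) = (v q - v p) * \<psi> q - (LINT r|lborel. K r * \<psi> r)"
    using K i1 iK by (simp add: right_diff_distrib)
  moreover have "(LINT y|lborel. X y * (v y - v p)) = (LINT y|lborel. X y * v y) - (\<psi> q - \<psi> p) * v p"
    using X i2 iX by (simp add: right_diff_distrib)
  ultimately have e: "(v q - v p) * \<psi> q - (LINT r|lborel. K r * \<psi> r) = (LINT y|lborel. X y * v y) - (\<psi> q - \<psi> p) * v p"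
    using fub by (simp only:)
  have "A + B = a + d" if "a - A = B - d" for a d A B :: complex
    using that by (simp add: algebra_simps)
  from this[OF e] have "(LINT r|lborel. K r * \<psi> r) + (LINT y|lborel. X y * v y) = \<psi> q * v q - \<psi> p * v p"
    by (simp add: algebra_simps)
  moreover have "(LINT y:{p..q}|lborel. \<psi> y * k y + \<xi> y * v y) = (LINT y|lborel. K y * \<psi> y + X y * v y)"
    unfolding set_lebesgue_integral_def
    by (rule Bochner_Integration.integral_cong) (auto simp: K_def X_def scaleR_add_right mult.commute)
  ultimately show "(LINT y:{p..q}|lborel. \<psi> y * k y + \<xi> y * v y) = \<psi> q * v q - \<psi> p * v p"
    using i1 i2 by simp
qed

locale stark =
  fixes \<kappa> \<eta> f :: real
  assumes pos: "\<kappa> > 0" "\<eta> > 0" "f > 0"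
begin

text \<open>At \<open>\<plusminus>\<kappa>\<close> the derivative \<open>v\<close> is represented by its left limit, which makes the Wronskian of two
  solutions continuous on the whole line.\<close>

definition jump :: "(real \<Rightarrow> complex) \<Rightarrow> (real \<Rightarrow> complex) \<Rightarrow> bool" where
  "jump u v \<longleftrightarrow> (\<forall>c\<in>{-\<kappa>, \<kappa>}. (v \<longlongrightarrow> v c) (at_left c) \<and> (v \<longlongrightarrow> v c + u c / of_real \<eta>) (at_right c))"

definition weak_sol :: "(real \<Rightarrow> complex) \<Rightarrow> (real \<Rightarrow> complex) \<Rightarrow> (real \<Rightarrow> complex) \<Rightarrow> bool" where
  "weak_sol u v h \<longleftrightarrow> continuous_on UNIV u \<and> jump u v \<and>
     (\<forall>x. x \<notin> {-\<kappa>, \<kappa>} \<longrightarrow> (u has_vector_derivative v x) (at x)) \<and>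
     (\<forall>s t. s \<le> t \<and> {s..t} \<inter> {-\<kappa>, \<kappa>} = {} \<longrightarrow>
        set_integrable lborel {s..t} (\<lambda>x. complex_of_real (f * x) * u x - h x) \<and>
        v t - v s = (LINT x:{s..t}|lborel. complex_of_real (f * x) * u x - h x))"

lemma weak_solD:
  assumes "weak_sol u v h" "s \<le> t" "{s..t} \<inter> {-\<kappa>, \<kappa>} = {}"
  shows "set_integrable lborel {s..t} (\<lambda>x. complex_of_real (f * x) * u x - h x)"
    and "v t - v s = (LINT x:{s..t}|lborel. complex_of_real (f * x) * u x - h x)"
  using assms unfolding weak_sol_def by blast+

text \<open>Two notions are needed: \<open>weak_sol\<close> fits elements of the operator domain,
  whose right-hand side is not continuous in general, and this classical one fits the explicit
  solutions built from Airy functions.\<close>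

definition strong_sol :: "(real \<Rightarrow> complex) \<Rightarrow> (real \<Rightarrow> complex) \<Rightarrow> (real \<Rightarrow> complex) \<Rightarrow> bool" where
  "strong_sol u v h \<longleftrightarrow> continuous_on UNIV u \<and> continuous_on UNIV h \<and> jump u v \<and>
     (\<forall>x. x \<notin> {-\<kappa>, \<kappa>} \<longrightarrow> (u has_vector_derivative v x) (at x) \<and>
        (v has_vector_derivative complex_of_real (f * x) * u x - h x) (at x))"

lemma strong_imp_weak_sol:
  assumes "strong_sol u v h"
  shows "weak_sol u v h"
  unfolding weak_sol_def
proof (intro conjI allI impI)
  fix s t :: real assume st: "s \<le> t \<and> {s..t} \<inter> {-\<kappa>, \<kappa>} = {}"
  have c: "continuous_on {s..t} (\<lambda>x. complex_of_real (f * x) * u x - h x)"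
    using assms unfolding strong_sol_def
    by (intro continuous_intros) (auto intro: continuous_on_subset)
  show "set_integrable lborel {s..t} (\<lambda>x. complex_of_real (f * x) * u x - h x)"
    by (rule set_integrable_continuous[OF c])
  show "v t - v s = (LINT x:{s..t}|lborel. complex_of_real (f * x) * u x - h x)"
  proof (rule set_lint_FTC[symmetric, OF _ _ c])
    fix x assume "x \<in> {s..t}"
    then have "x \<notin> {-\<kappa>, \<kappa>}" using st by blast
    then show "(v has_vector_derivative complex_of_real (f * x) * u x - h x) (at x within {s..t})"
      using assms by (auto simp: strong_sol_def intro: has_vector_derivative_at_within)
  qed (use st in auto)
qed (use assms in \<open>auto simp: strong_sol_def\<close>)

definition wronskian :: "(real \<Rightarrow> complex) \<Rightarrow> (real \<Rightarrow> complex) \<Rightarrow> (real \<Rightarrow> complex) \<Rightarrow> (real \<Rightarrow> complex) \<Rightarrow> real \<Rightarrow> complex" where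
  "wronskian \<psi> \<xi> u v x = \<psi> x * v x - \<xi> x * u x"

text \<open>Formally the derivative of the Wronskian is
  \<open>\<psi> * (f * x * u - h) - (f * x - z) * \<psi> * u\<close>, where the potential cancels.
  The product \<open>\<psi> * v\<close> requires \<open>set_lint_by_parts\<close> since v is only
  absolutely continuous; \<open>\<xi> * u\<close> is differentiable in the classical sense.\<close>

lemma wronskian_increment_local:
  assumes \<psi>: "strong_sol \<psi> \<xi> (\<lambda>x. z * \<psi> x)" and u: "weak_sol u v h"
    and st: "s \<le> t" "{s..t} \<inter> {-\<kappa>, \<kappa>} = {}"
  shows "wronskian \<psi> \<xi> u v t - wronskian \<psi> \<xi> u v s = - (LINT x:{s..t}|lborel. \<psi> x * (h x - z * u x))"
    and "continuous_on {s..t} v"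
proof -
  let ?k = "\<lambda>x. complex_of_real (f * x) * u x - h x"
  have off: "x \<notin> {-\<kappa>, \<kappa>}" if "x \<in> {s..t}" for x using that st by blast
  have k: "set_integrable lborel {s..t} ?k" by (rule weak_solD(1)[OF u st])
  have d\<psi>: "(\<psi> has_vector_derivative \<xi> x) (at x within {s..t})" if "x \<in> {s..t}" for x
    using \<psi> off[OF that] by (auto simp: strong_sol_def intro: has_vector_derivative_at_within)
  have d\<xi>: "(\<xi> has_vector_derivative (complex_of_real (f * x) - z) * \<psi> x) (at x within {s..t})" if "x \<in> {s..t}" for x
    using \<psi> off[OF that] by (auto simp: strong_sol_def left_diff_distrib intro: has_vector_derivative_at_within)
  have du: "(u has_vector_derivative v x) (at x within {s..t})" if "x \<in> {s..t}" for x
    using u off[OF that] by (auto simp: weak_sol_def intro: has_vector_derivative_at_within)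
  have c\<xi>: "continuous_on {s..t} \<xi>" by (rule continuous_on_vector_derivative[OF d\<xi>])
  have c\<psi>: "continuous_on {s..t} \<psi>" by (rule continuous_on_vector_derivative[OF d\<psi>])
  have cu: "continuous_on {s..t} u" by (rule continuous_on_vector_derivative[OF du])
  have veq: "v y = v s + (LINT r:{s..y}|lborel. ?k r)" if "y \<in> {s..t}" for y
  proof -
    have "v y - v s = (LINT r:{s..y}|lborel. ?k r)"
      by (rule weak_solD(2)[OF u]) (use that st in auto)
    then show ?thesis by (simp add: diff_eq_eq add.commute)
  qed
  note bp = set_lint_by_parts[OF st(1) k c\<xi> d\<psi> veq]
  show cv: "continuous_on {s..t} v" by (rule bp(1))
  let ?g = "\<lambda>x. (complex_of_real (f * x) - z) * \<psi> x * u x + \<xi> x * v x"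
  have cg: "continuous_on {s..t} ?g" by (intro continuous_intros c\<xi> c\<psi> cu cv)
  have "(LINT x:{s..t}|lborel. ?g x) = \<xi> t * u t - \<xi> s * u s"
  proof (rule set_lint_FTC[OF st(1) _ cg])
    fix x assume x: "x \<in> {s..t}"
    from has_vector_derivative_mult[OF d\<xi>[OF x] du[OF x]]
    show "((\<lambda>x. \<xi> x * u x) has_vector_derivative ?g x) (at x within {s..t})" by (simp add: add.commute)
  qed
  moreover have "set_integrable lborel {s..t} (\<lambda>y. \<psi> y * ?k y + \<xi> y * v y)"
  proof -
    obtain B where B: "\<And>y. y \<in> {s..t} \<Longrightarrow> norm (\<psi> y) \<le> B"
      using bounded_on_Icc[OF c\<psi>] by blast
    have "set_integrable lborel {s..t} (\<lambda>y. \<psi> y * ?k y)"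
    proof (rule set_integrable_bound[where f="\<lambda>y. of_real B * ?k y"])
      show "set_integrable lborel {s..t} (\<lambda>y. of_real B * ?k y)" using k by (rule set_integrable_mult_right)
      have "(\<lambda>x. (indicator {s..t} x *\<^sub>R \<psi> x) * (indicator {s..t} x *\<^sub>R ?k x)) \<in> borel_measurable lborel"
        using k borel_measurable_continuous_on_indicator[OF _ c\<psi>] unfolding set_integrable_def
        by (intro borel_measurable_times) auto
      moreover have "(\<lambda>x. (indicator {s..t} x *\<^sub>R \<psi> x) * (indicator {s..t} x *\<^sub>R ?k x)) = (\<lambda>x. indicator {s..t} x *\<^sub>R (\<psi> x * ?k x))"
        by (auto simp: indicator_def fun_eq_iff)
      ultimately show "set_borel_measurable lborel {s..t} (\<lambda>y. \<psi> y * ?k y)"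
        by (simp add: set_borel_measurable_def)
      show "AE x in lborel. x \<in> {s..t} \<longrightarrow> norm (\<psi> x * ?k x) \<le> norm (of_real B * ?k x)"
        using B by (auto intro!: AE_I2 mult_right_mono order_trans[OF _ abs_ge_self] simp: norm_mult)
    qed
    moreover have "set_integrable lborel {s..t} (\<lambda>y. \<xi> y * v y)"
      by (intro set_integrable_continuous continuous_intros c\<xi> cv)
    ultimately show ?thesis by (rule set_integral_add(1))
  qed
  ultimately have "(LINT x:{s..t}|lborel. (\<psi> x * ?k x + \<xi> x * v x) - ?g x) = (\<psi> t * v t - \<psi> s * v s) - (\<xi> t * u t - \<xi> s * u s)"
    using bp(2) set_integrable_continuous[OF cg] by (subst set_integral_diff(2)) auto
  also have "(LINT x:{s..t}|lborel. (\<psi> x * ?k x + \<xi> x * v x) - ?g x) = (LINT x:{s..t}|lborel. - (\<psi> x * (h x - z * u x)))"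
    by (rule arg_cong[where f="\<lambda>g. set_lebesgue_integral lborel {s..t} g"]) (auto simp: fun_eq_iff algebra_simps)
  also have "\<dots> = - (LINT x:{s..t}|lborel. \<psi> x * (h x - z * u x))"
    by (simp add: set_lebesgue_integral_def)
  finally show "wronskian \<psi> \<xi> u v t - wronskian \<psi> \<xi> u v s = - (LINT x:{s..t}|lborel. \<psi> x * (h x - z * u x))"
    by (simp add: wronskian_def)
qed

lemma delta_free_neighbourhood:
  fixes x :: real
  assumes "x \<notin> {-\<kappa>, \<kappa>}"
  obtains d where "d > 0" "{x - d..x + d} \<inter> {-\<kappa>, \<kappa>} = {}"
proof -
  let ?d = "min \<bar>x - \<kappa>\<bar> \<bar>x + \<kappa>\<bar> / 2"
  have d: "?d > 0" using assms by auto
  have "?d \<le> \<bar>x - \<kappa>\<bar> / 2" "?d \<le> \<bar>x - (- \<kappa>)\<bar> / 2" by simp_all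
  moreover have "\<not> (x - e / 2 \<le> c \<and> c \<le> x + e / 2)" if "e > 0" "e \<le> \<bar>x - c\<bar> / 2" for e c
  proof
    assume "x - e / 2 \<le> c \<and> c \<le> x + e / 2"
    then have "x - c \<le> e / 2" "c - x \<le> e / 2" by (auto simp: algebra_simps)
    moreover have "\<bar>x - c\<bar> = x - c \<or> \<bar>x - c\<bar> = c - x" by auto
    ultimately show False using that by auto
  qed
  ultimately have "\<kappa> \<notin> {x - ?d / 2..x + ?d / 2}" "- \<kappa> \<notin> {x - ?d / 2..x + ?d / 2}"
    using d unfolding atLeastAtMost_iff by blast+
  then have "?d / 2 > 0" "{x - ?d / 2..x + ?d / 2} \<inter> {-\<kappa>, \<kappa>} = {}" using d by (simp, blast)
  then show ?thesis by (rule that)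
qed

text \<open>The jumps at \<plusminus>\<kappa> cancel: \<psi> times the jump of v and u times the
  jump of \<xi> both equal \<open>\<psi> * u / \<eta>\<close>.\<close>

lemma wronskian_continuous:
  assumes \<psi>: "strong_sol \<psi> \<xi> (\<lambda>x. z * \<psi> x)" and u: "weak_sol u v h"
  shows "continuous_on UNIV (wronskian \<psi> \<xi> u v)"
proof (rule continuous_at_imp_continuous_on, rule ballI)
  fix x :: real
  have c\<psi>: "isCont \<psi> x" and cu: "isCont u x"
    using \<psi> u by (auto simp: strong_sol_def weak_sol_def continuous_on_eq_continuous_at)
  show "isCont (wronskian \<psi> \<xi> u v) x"
  proof (cases "x \<in> {-\<kappa>, \<kappa>}")
    case False
    then obtain d where d: "d > 0" "{x - d..x + d} \<inter> {-\<kappa>, \<kappa>} = {}" by (rule delta_free_neighbourhood)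
    have "continuous_on {x-d..x+d} v" by (rule wronskian_increment_local(2)[OF \<psi> u _ d(2)]) (use d in auto)
    then have "isCont v x" by (rule continuous_on_interior) (use d in auto)
    moreover have "isCont \<xi> x" using \<psi> False unfolding strong_sol_def
      by (auto dest: has_vector_derivative_continuous)
    ultimately show ?thesis unfolding wronskian_def[abs_def] using c\<psi> cu by (intro continuous_intros)
  next
    case True
    have tl: "(\<psi> \<longlongrightarrow> \<psi> x) (at x within S)" "(u \<longlongrightarrow> u x) (at x within S)" for S
      using c\<psi> cu by (auto simp: isCont_def intro: tendsto_within_subset)
    have jl: "(\<xi> \<longlongrightarrow> \<xi> x) (at_left x)" "(v \<longlongrightarrow> v x) (at_left x)"
      "(\<xi> \<longlongrightarrow> \<xi> x + \<psi> x / of_real \<eta>) (at_right x)" "(v \<longlongrightarrow> v x + u x / of_real \<eta>) (at_right x)"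
      using \<psi> u True unfolding strong_sol_def weak_sol_def jump_def by blast+
    have "(wronskian \<psi> \<xi> u v \<longlongrightarrow> wronskian \<psi> \<xi> u v x) (at_left x)"
      unfolding wronskian_def[abs_def] by (intro tendsto_intros tl jl)
    moreover have "(wronskian \<psi> \<xi> u v \<longlongrightarrow> \<psi> x * (v x + u x / of_real \<eta>) - (\<xi> x + \<psi> x / of_real \<eta>) * u x) (at_right x)"
      unfolding wronskian_def[abs_def] by (intro tendsto_intros tl jl)
    ultimately show ?thesis
      by (simp add: isCont_def filterlim_at_split wronskian_def algebra_simps)
  qed
qed

text \<open>Lagrange's identity across the two deltas. The local version covers only intervals that
  avoid them; continuity of the Wronskian bridges the gap.\<close>

lemma wronskian_increment:
  assumes \<psi>: "strong_sol \<psi> \<xi> (\<lambda>x. z * \<psi> x)" and u: "weak_sol u v h"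
    and h: "\<And>s t. set_integrable lborel {s..t} h" and st: "s \<le> t"
  shows "set_integrable lborel {s..t} (\<lambda>x. \<psi> x * (h x - z * u x))"
    and "wronskian \<psi> \<xi> u v t - wronskian \<psi> \<xi> u v s = - (LINT x:{s..t}|lborel. \<psi> x * (h x - z * u x))"
proof -
  let ?G = "\<lambda>x. \<psi> x * (h x - z * u x)"
  have c\<psi>: "continuous_on S \<psi>" and cu: "continuous_on S u" for S
    using \<psi> u unfolding strong_sol_def weak_sol_def by (auto intro: continuous_on_subset)
  have G: "set_integrable lborel {s..t} ?G" for s t
  proof -
    obtain B where B: "\<And>y. y \<in> {s..t} \<Longrightarrow> norm (\<psi> y) \<le> B"
      using bounded_on_Icc[OF c\<psi>] by blast
    have k: "set_integrable lborel {s..t} (\<lambda>x. h x - z * u x)"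
      by (intro set_integral_diff h set_integrable_continuous continuous_intros cu)
    show ?thesis
    proof (rule set_integrable_bound[where f="\<lambda>y. of_real B * (h y - z * u y)"])
      show "set_integrable lborel {s..t} (\<lambda>y. of_real B * (h y - z * u y))" using k by (rule set_integrable_mult_right)
      have "(\<lambda>x. (indicator {s..t} x *\<^sub>R \<psi> x) * (indicator {s..t} x *\<^sub>R (h x - z * u x))) \<in> borel_measurable lborel"
        using k borel_measurable_continuous_on_indicator[OF _ c\<psi>] unfolding set_integrable_def
        by (intro borel_measurable_times) auto
      moreover have "(\<lambda>x. (indicator {s..t} x *\<^sub>R \<psi> x) * (indicator {s..t} x *\<^sub>R (h x - z * u x))) = (\<lambda>x. indicator {s..t} x *\<^sub>R ?G x)"
        by (auto simp: indicator_def fun_eq_iff)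
      ultimately show "set_borel_measurable lborel {s..t} ?G"
        by (simp add: set_borel_measurable_def)
      show "AE x in lborel. x \<in> {s..t} \<longrightarrow> norm (?G x) \<le> norm (of_real B * (h x - z * u x))"
        using B by (auto intro!: AE_I2 mult_right_mono order_trans[OF _ abs_ge_self] simp: norm_mult)
    qed
  qed
  then show "set_integrable lborel {s..t} ?G" .
  have Ghk: "?G integrable_on {s..t}" "integral {s..t} ?G = (LINT x:{s..t}|lborel. ?G x)" for s t
    using set_borel_integral_eq_integral[OF G[of s t]] by auto
  \<comment> \<open>Continuous, and constant near every point other than \<plusminus>\<kappa>;
    finitely many exceptional points do no harm, so it is constant.\<close>
  let ?\<Phi> = "\<lambda>x. wronskian \<psi> \<xi> u v x + integral {s..x} ?G"
  have "?\<Phi> t = ?\<Phi> s"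
  proof (rule has_derivative_zero_unique_strong_interval[where a=s and b=t and f="?\<Phi>" and k="{-\<kappa>, \<kappa>}"])
    show "continuous_on {s..t} ?\<Phi>"
      by (intro continuous_intros indefinite_integral_continuous_1 Ghk continuous_on_subset[OF wronskian_continuous[OF \<psi> u]]) auto
    fix x assume x: "x \<in> {s..t} - {-\<kappa>, \<kappa>}"
    then have "x \<notin> {-\<kappa>, \<kappa>}" by blast
    then obtain d where d: "d > 0" "{x - d..x + d} \<inter> {-\<kappa>, \<kappa>} = {}" by (rule delta_free_neighbourhood)
    have inc: "?\<Phi> y' = ?\<Phi> y" if "y \<le> y'" "y \<in> {s..t}" "y' \<in> {s..t}" "y \<in> {x-d..x+d}" "y' \<in> {x-d..x+d}" for y y'
    proof -
      have "{y..y'} \<subseteq> {x-d..x+d}" using that by auto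
      then have "{y..y'} \<inter> {-\<kappa>, \<kappa>} = {}" using d(2) by blast
      from wronskian_increment_local(1)[OF \<psi> u that(1) this]
      have "wronskian \<psi> \<xi> u v y' - wronskian \<psi> \<xi> u v y = - integral {y..y'} ?G" using Ghk by simp
      moreover have "integral {s..y} ?G + integral {y..y'} ?G = integral {s..y'} ?G"
        by (rule Henstock_Kurzweil_Integration.integral_combine) (use that Ghk in auto)
      moreover have "W' + B = W + A" if "W' - W = - I" "A + I = B" for W W' A B I :: complex
        using that by (metis add.commute add.left_commute add_diff_cancel_left' diff_add_cancel uminus_add_conv_diff)
      ultimately show ?thesis by blast
    qed
    have const: "?\<Phi> y = ?\<Phi> x" if "y \<in> {s..t}" "dist y x < d" for y
      using inc[of x y] inc[of y x] that x d by (cases "x \<le> y") (auto simp: dist_real_def abs_if split: if_splits)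
    show "(?\<Phi> has_derivative (\<lambda>h. 0)) (at x within {s..t})"
      by (rule has_derivative_transform_within[OF has_derivative_const[of "?\<Phi> x"] d(1)])
         (use x const in auto)
  qed (use st in auto)
  then show "wronskian \<psi> \<xi> u v t - wronskian \<psi> \<xi> u v s = - (LINT x:{s..t}|lborel. ?G x)"
    using Ghk[of s t] by (simp add: algebra_simps)
qed

end

section \<open>Decay of the Airy solutions\<close>

text \<open>A polynomial prefactor does no harm to decay; \<open>1 + norm w\<close> makes room for
  the term \<open>w * Ai_amp w\<close> in the derivative.\<close>

lemma Ai_square_bound:
  "\<exists>C>0. \<forall>w. Re w \<ge> 1 \<longrightarrow> norm (Ai (w\<^sup>2)) \<le> C * (1 + norm w) * exp (- (2/3) * Re (w ^ 3)) \<and>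
     norm (deriv Ai (w\<^sup>2)) \<le> C * (1 + norm w) * exp (- (2/3) * Re (w ^ 3))"
proof (intro exI conjI allI impI)
  let ?C = "1 + gauss_moment 2"
  have g: "gauss_moment 2 \<ge> 0" by (rule gauss_moment_nonneg)
  then show "?C > 0" by simp
  fix w :: complex assume w: "Re w \<ge> 1"
  then have w0: "Re w > 0" and sq: "sqrt (Re w) \<ge> 1" by auto
  have nw: "norm w \<ge> 1" using w complex_Re_le_cmod[of w] by linarith
  have e: "norm (exp (- (2/3) * w ^ 3)) = exp (- (2/3) * Re (w ^ 3))" by simp
  have "1 / sqrt (Re w) \<le> 1" using sq by simp
  then have a1: "norm (Ai_amp w) \<le> 1" using norm_Ai_amp_le[OF w0] by linarith
  have "gauss_moment 2 / sqrt (Re w) ^ 3 \<le> gauss_moment 2 / 1"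
    using sq g by (intro divide_left_mono) auto
  then have a2: "norm (Ai_amp' w) \<le> gauss_moment 2" using Ai_amp_DERIV(2)[OF w0] by linarith
  have c: "1 \<le> ?C * (1 + norm w)"
    using mult_mono[of 1 ?C 1 "1 + norm w"] g nw by simp
  have "norm (Ai_amp w) \<le> ?C * (1 + norm w)" using a1 c by linarith
  from mult_right_mono[OF this, of "exp (- (2/3) * Re (w ^ 3))"]
  show "norm (Ai (w\<^sup>2)) \<le> ?C * (1 + norm w) * exp (- (2/3) * Re (w ^ 3))"
    unfolding Ai_square[OF w0] norm_mult e by (simp add: mult.commute)
  have "norm (- w * Ai_amp w + Ai_amp' w / (2 * w)) \<le> norm w * 1 + gauss_moment 2 / (2 * norm w)"
    using a1 a2 nw by (intro order_trans[OF norm_triangle_ineq] add_mono)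
      (auto simp: norm_mult norm_divide intro!: mult_left_le divide_right_mono)
  also have "gauss_moment 2 / (2 * norm w) \<le> gauss_moment 2 / 1"
    using nw g by (intro divide_left_mono) auto
  also have "norm w * 1 + gauss_moment 2 / 1 \<le> ?C * (1 + norm w)" using g nw by (simp add: algebra_simps)
  finally have "norm (- w * Ai_amp w + Ai_amp' w / (2 * w)) \<le> ?C * (1 + norm w)" by simp
  from mult_right_mono[OF this, of "exp (- (2/3) * Re (w ^ 3))"]
  show "norm (deriv Ai (w\<^sup>2)) \<le> ?C * (1 + norm w) * exp (- (2/3) * Re (w ^ 3))"
    unfolding deriv_Ai_square[OF w0] norm_mult e by (simp add: mult.commute)
qed

lemma csqrt_parts:
  assumes "X > 0" "Re \<zeta> = X"
  defines "w \<equiv> csqrt \<zeta>"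
  shows "Re w \<ge> sqrt X" "2 * Re w * Im w = Im \<zeta>" "(Re w)\<^sup>2 - (Im w)\<^sup>2 = X" "Re w > 0"
proof -
  have ww: "w\<^sup>2 = \<zeta>" by (simp add: w_def)
  then show e1: "2 * Re w * Im w = Im \<zeta>" by (metis Im_power2)
  from ww show e2: "(Re w)\<^sup>2 - (Im w)\<^sup>2 = X" using assms by (metis Re_power2)
  have "Re w \<ge> 0" using csqrt_principal[of \<zeta>] by (auto simp: w_def)
  have "(Re w)\<^sup>2 \<ge> X" using e2 by (simp add: diff_eq_eq)
  then show "Re w \<ge> sqrt X" using \<open>Re w \<ge> 0\<close> by (intro real_le_lsqrt) auto
  moreover have "sqrt X > 0" using assms by simp
  ultimately show "Re w > 0" by linarith
qed

text \<open>The values exp(i pi/6) and exp(-i pi/6) are square roots of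
  \<open>- (airy_rot\<^sup>2)\<close> and \<open>- airy_rot\<close>. With \<zeta> = -k^2 f^(-2/3)
  they turn the rotated Airy arguments into squares, see \<open>zeta_square\<close>.\<close>

definition rot6 :: complex where "rot6 = exp (\<i> * of_real (pi / 6))"
definition rot6' :: complex where "rot6' = exp (- \<i> * of_real (pi / 6))"

lemma rot6_eq: "rot6 = Complex (sqrt 3 / 2) (1 / 2)"
  unfolding rot6_def cis_conv_exp[symmetric] by (simp add: complex_eq_iff cos_30 sin_30)

lemma rot6'_eq: "rot6' = Complex (sqrt 3 / 2) (- 1 / 2)"
proof -
  have "rot6' = cnj rot6" unfolding rot6_def rot6'_def by (simp add: exp_cnj)
  then show ?thesis by (simp add: rot6_eq complex_eq_iff)
qed

lemma norm_rot6 [simp]: "norm rot6 = 1" "norm rot6' = 1"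
  unfolding rot6_def rot6'_def by (simp_all add: norm_exp_eq_Re)

lemma rot6_facts: "rot6 * rot6' = 1" "rot6\<^sup>2 = - (airy_rot\<^sup>2)" "rot6'\<^sup>2 = - airy_rot" "rot6 ^ 3 = \<i>" "rot6' ^ 3 = - \<i>"
  by (simp_all add: rot6_eq rot6'_eq airy_rot_eq complex_eq_iff power2_eq_square power3_eq_cube field_simps)

context stark
begin

text \<open>Two solutions of the equation without deltas: \<open>sa\<close> decays at +infinity for
  every z, \<open>sb\<close> at -infinity when \<open>Im z > 0\<close>. A prime denotes the
  derivative in x, hence the factor f^(1/3).\<close>

definition sa :: "complex \<Rightarrow> real \<Rightarrow> complex" where "sa z x = Ai (stark_zeta f z x)"
definition sb :: "complex \<Rightarrow> real \<Rightarrow> complex" where "sb z x = Ai (airy_rot * stark_zeta f z x)"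
definition sa' :: "complex \<Rightarrow> real \<Rightarrow> complex" where
  "sa' z x = of_real (f powr (1/3)) * deriv Ai (stark_zeta f z x)"
definition sb' :: "complex \<Rightarrow> real \<Rightarrow> complex" where
  "sb' z x = of_real (f powr (1/3)) * (airy_rot * deriv Ai (airy_rot * stark_zeta f z x))"

definition W where "W = stark_W f"

lemma W_nz [simp]: "W \<noteq> 0" using pos by (simp add: W_def stark_W_def)

lemma powr_thirds: "f powr (1/3) * f powr (1/3) * f powr (-2/3) = 1" "f powr (1/3) * f powr (1/3) * f powr (1/3) = f"
  "(f powr (1/3)) ^ 3 = f" "f powr (-2/3) = 1 / (f powr (1/3))\<^sup>2" "f powr (1/3) > 0" "f powr (-2/3) = (f powr (-1/3))\<^sup>2"
  "f powr (-1/3) = 1 / f powr (1/3)"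
proof -
  have p: "f powr (1/3) > 0" using pos by simp
  show "f powr (1/3) * f powr (1/3) * f powr (-2/3) = 1" "f powr (1/3) * f powr (1/3) * f powr (1/3) = f"
    using pos by (simp_all flip: powr_add)
  then show "(f powr (1/3)) ^ 3 = f" "f powr (-2/3) = 1 / (f powr (1/3))\<^sup>2" "f powr (1/3) > 0"
    using p by (simp_all add: power3_eq_cube power2_eq_square field_simps)
  show "f powr (-2/3) = (f powr (-1/3))\<^sup>2" unfolding power2_eq_square powr_add[symmetric] by simp
  show "f powr (-1/3) = 1 / f powr (1/3)" using pos by (simp add: powr_minus_divide[of f "1/3", simplified])
qed

lemma zeta_ode: "of_real (f powr (1/3)) * (of_real (f powr (1/3)) * stark_zeta f z x) = complex_of_real (f * x) - z"
proof -
  have "of_real (f powr (1/3)) * (of_real (f powr (1/3)) * stark_zeta f z x)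
     = of_real (f powr (1/3) * f powr (1/3) * f powr (1/3)) * of_real x - of_real (f powr (1/3) * f powr (1/3) * f powr (-2/3)) * z"
    unfolding stark_zeta_def of_real_mult by (simp add: algebra_simps)
  then show ?thesis unfolding powr_thirds(1,2) by simp
qed

lemma zeta_deriv: "((\<lambda>x. stark_zeta f z x) has_vector_derivative of_real (f powr (1/3))) (at x)"
  unfolding stark_zeta_def by (auto intro!: derivative_eq_intros simp: has_vector_derivative_def scaleR_conv_of_real)

lemma sa_deriv: "(sa z has_vector_derivative sa' z x) (at x)" 
    "(sa' z has_vector_derivative (complex_of_real (f * x) - z) * sa z x) (at x)"
proof -
  show "(sa z has_vector_derivative sa' z x) (at x)"
    using field_vector_diff_chain_at[OF zeta_deriv Ai_has_field_derivative] by (simp add: sa_def[abs_def] sa'_def o_def)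
  have "((\<lambda>x. of_real (f powr (1/3)) * deriv Ai (stark_zeta f z x)) has_vector_derivative
     of_real (f powr (1/3)) * (of_real (f powr (1/3)) * (stark_zeta f z x * Ai (stark_zeta f z x)))) (at x)"
    using field_vector_diff_chain_at[OF zeta_deriv Ai_ode, of z x]
    by (intro has_vector_derivative_mult_right) (simp add: o_def)
  then show "(sa' z has_vector_derivative (complex_of_real (f * x) - z) * sa z x) (at x)"
    unfolding sa_def sa'_def[abs_def] zeta_ode[symmetric] by (simp only: mult.assoc)
qed

lemma sb_deriv: "(sb z has_vector_derivative sb' z x) (at x)" 
    "(sb' z has_vector_derivative (complex_of_real (f * x) - z) * sb z x) (at x)"
proof -
  show "(sb z has_vector_derivative sb' z x) (at x)"
    using field_vector_diff_chain_at[OF zeta_deriv Ai_scaled_DERIV(1)[OF airy_rot_cubed]]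
    by (simp add: sb_def[abs_def] sb'_def o_def)
  have "((\<lambda>x. of_real (f powr (1/3)) * (airy_rot * deriv Ai (airy_rot * stark_zeta f z x))) has_vector_derivative
     of_real (f powr (1/3)) * (of_real (f powr (1/3)) * (stark_zeta f z x * Ai (airy_rot * stark_zeta f z x)))) (at x)"
    using field_vector_diff_chain_at[OF zeta_deriv Ai_scaled_DERIV(2)[OF airy_rot_cubed], of z x]
    by (intro has_vector_derivative_mult_right) (simp add: o_def)
  then show "(sb' z has_vector_derivative (complex_of_real (f * x) - z) * sb z x) (at x)"
    unfolding sb_def sb'_def[abs_def] zeta_ode[symmetric] by (simp only: mult.assoc)
qed

lemma sab_wronskian: "sa z x * sb' z x - sa' z x * sb z x = W"
proof -
  have "sa z x * sb' z x - sa' z x * sb z x = of_real (f powr (1/3)) * 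
    (Ai (stark_zeta f z x) * (airy_rot * deriv Ai (airy_rot * stark_zeta f z x)) - deriv Ai (stark_zeta f z x) * Ai (airy_rot * stark_zeta f z x))"
    by (simp add: sa_def sb_def sa'_def sb'_def algebra_simps)
  then show ?thesis unfolding Ai_wronskian W_def stark_W_def by simp
qed

lemma stark_D_eq:
  "stark_D \<kappa> \<eta> f z = 1 + (sa z \<kappa> * sb z \<kappa> + sa z (-\<kappa>) * sb z (-\<kappa>)) / (of_real \<eta> * W)
     + sb z (-\<kappa>) * sa z \<kappa> * (sb z \<kappa> * sa z (-\<kappa>) - sb z (-\<kappa>) * sa z \<kappa>) / ((of_real \<eta>)\<^sup>2 * W\<^sup>2)"
  by (simp add: stark_D_def Let_def airy_eq_Ai sa_def sb_def W_def mult.commute add.commute)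

text \<open>Here k is the local momentum sqrt(z - f x). The cubes feed the exponents of
  \<open>Ai_square\<close>; in them the fractional powers of f combine to
  \<open>1 / f\<close>.\<close>

lemma zeta_square:
  assumes "k\<^sup>2 = z - of_real (f * x)"
  shows "stark_zeta f z x = - (k\<^sup>2) * of_real ((f powr (-1/3))\<^sup>2)"
    and "airy_rot * stark_zeta f z x = (rot6' * k * of_real (f powr (-1/3)))\<^sup>2"
    and "airy_rot\<^sup>2 * stark_zeta f z x = (rot6 * k * of_real (f powr (-1/3)))\<^sup>2"
    and "(rot6' * k * of_real (f powr (-1/3))) ^ 3 = - \<i> * k ^ 3 / of_real f"
    and "(rot6 * k * of_real (f powr (-1/3))) ^ 3 = \<i> * k ^ 3 / of_real f"
proof -
  have "f powr (1/3) = f * (f powr (-1/3))\<^sup>2"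
    using powr_thirds(3,5) unfolding powr_thirds(7) by (simp add: power2_eq_square power3_eq_cube field_simps)
  then show 1: "stark_zeta f z x = - (k\<^sup>2) * of_real ((f powr (-1/3))\<^sup>2)"
    unfolding stark_zeta_def assms powr_thirds(6) by (simp add: algebra_simps)
  show "airy_rot * stark_zeta f z x = (rot6' * k * of_real (f powr (-1/3)))\<^sup>2"
    "airy_rot\<^sup>2 * stark_zeta f z x = (rot6 * k * of_real (f powr (-1/3)))\<^sup>2"
    unfolding 1 power_mult_distrib rot6_facts by simp_all
  have "(f powr (-1/3)) ^ 3 = 1 / f" unfolding powr_thirds(7) power_divide powr_thirds(3) by simp
  then have 3: "complex_of_real (f powr (-1/3)) ^ 3 = 1 / of_real f"
    by (simp flip: of_real_power)
  show "(rot6' * k * of_real (f powr (-1/3))) ^ 3 = - \<i> * k ^ 3 / of_real f"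
    "(rot6 * k * of_real (f powr (-1/3))) ^ 3 = \<i> * k ^ 3 / of_real f"
    unfolding power_mult_distrib rot6_facts 3 by simp_all
qed

text \<open>The cubic weight matches the growth bound of \<open>weak_sol_growth\<close> for elements
  of the domain, so that boundary terms of Wronskians vanish; it also gives square
  integrability.\<close>

definition decays :: "(real \<Rightarrow> complex) \<Rightarrow> real filter \<Rightarrow> bool" where
  "decays u F \<longleftrightarrow> ((\<lambda>x. of_real (x ^ 3) * u x) \<longlongrightarrow> 0) F"

lemma sa_decays: "decays (sa z) at_top" "decays (sa' z) at_top"
proof -
  obtain C where C: "C > 0" "\<And>w. Re w \<ge> 1 \<Longrightarrow> norm (Ai (w\<^sup>2)) \<le> C * (1 + norm w) * exp (- (2/3) * Re (w ^ 3))"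
     "\<And>w. Re w \<ge> 1 \<Longrightarrow> norm (deriv Ai (w\<^sup>2)) \<le> C * (1 + norm w) * exp (- (2/3) * Re (w ^ 3))"
    using Ai_square_bound by blast
  define p where "p = f powr (1/3)"
  \<comment> \<open>Y is the modulus of the imaginary part of \<zeta> and X its real part; only X
    depends on x, so \<zeta> runs to infinity along a horizontal line.\<close>
  define Y where "Y = \<bar>Im z * f powr (-2/3)\<bar>"
  define X where "X = (\<lambda>x. - Re z * f powr (-2/3) + x * p)"
  have p: "p > 0" using pos by (simp add: p_def)
  have "filterlim X at_top at_top" unfolding X_def using p by real_asymp
  then have evX: "\<forall>\<^sub>F x in at_top. X x \<ge> max 1 (Y\<^sup>2)" unfolding filterlim_at_top by blast
  have bound: "norm (Ai (stark_zeta f z x)) \<le> C * (2 + X x + Y) * exp (- (1/3) * (X x - 1))"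
     "norm (deriv Ai (stark_zeta f z x)) \<le> C * (2 + X x + Y) * exp (- (1/3) * (X x - 1))" if x: "X x \<ge> max 1 (Y\<^sup>2)" for x
  proof -
    define \<zeta> where "\<zeta> = stark_zeta f z x"
    define w where "w = csqrt \<zeta>"
    have X1: "X x \<ge> 1" and XY: "Y\<^sup>2 \<le> X x" using x by auto
    have Re: "Re \<zeta> = X x" and Im: "\<bar>Im \<zeta>\<bar> = Y" by (auto simp: \<zeta>_def stark_zeta_def X_def Y_def p_def abs_mult)
    have ww: "w\<^sup>2 = \<zeta>" by (simp add: w_def)
    note cp = csqrt_parts[of "X x" \<zeta>, folded w_def]
    have sX: "sqrt (X x) \<ge> 1" using X1 by simp
    have R: "Re w \<ge> sqrt (X x)" "2 * Re w * Im w = Im \<zeta>" "(Re w)\<^sup>2 - (Im w)\<^sup>2 = X x" "Re w > 0"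
      using cp X1 Re by auto
    have R1: "Re w \<ge> 1" using R sX by linarith
    have "(2 * Re w * Im w)\<^sup>2 = Y\<^sup>2" using R(2) Im by (metis power2_abs)
    then have "4 * ((Re w)\<^sup>2 * (Im w)\<^sup>2) = Y\<^sup>2" by (simp add: power_mult_distrib)
    moreover have "(Re w)\<^sup>2 \<ge> X x" using R(3) zero_le_power2[of "Im w"] by linarith
    then have "X x * (Im w)\<^sup>2 \<le> (Re w)\<^sup>2 * (Im w)\<^sup>2" by (intro mult_right_mono) auto
    ultimately have "X x * (4 * (Im w)\<^sup>2) \<le> X x * 1" using XY by linarith
    \<comment> \<open>The threshold \<open>Y\<^sup>2\<close> for X keeps the imaginary part of the
      root at most 1/2 in modulus, so that the real part of its cube grows at least linearly in
      X.\<close>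
    then have I: "4 * (Im w)\<^sup>2 \<le> 1" using X1 by (subst (asm) mult_le_cancel_left_pos) auto
    have "Re (w ^ 3) = Re w * ((Re w)\<^sup>2 - 3 * (Im w)\<^sup>2)"
      by (simp add: power3_eq_cube power2_eq_square algebra_simps)
    also have "(Re w)\<^sup>2 - 3 * (Im w)\<^sup>2 = X x - 2 * (Im w)\<^sup>2" using R(3) by linarith
    also have "Re w * (X x - 2 * (Im w)\<^sup>2) \<ge> 1 * (X x - 2 * (Im w)\<^sup>2)" using R1 I X1 by (intro mult_right_mono) auto
    finally have "X x - 2 * (Im w)\<^sup>2 \<le> Re (w ^ 3)" by simp
    moreover have "(1/2) * (a - 1) \<le> r" if "a - 2 * i \<le> r" "4 * i \<le> 1" "1 \<le> a" for a i r :: real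
      using that by (simp add: field_simps)
    ultimately have w3: "Re (w ^ 3) \<ge> (1/2) * (X x - 1)" using I X1 by blast
    have "norm w \<le> 1 + (norm w)\<^sup>2" using zero_le_power2[of "norm w - 1/2"] by (simp add: power2_eq_square algebra_simps)
    also have "(norm w)\<^sup>2 = norm \<zeta>" using ww by (simp flip: norm_power)
    also have "norm \<zeta> \<le> X x + Y" using cmod_le[of \<zeta>] Re Im X1 by simp
    finally have nw: "1 + norm w \<le> 2 + X x + Y" by simp
    have le: "C * (1 + norm w) * exp (- (2/3) * Re (w ^ 3)) \<le> C * (2 + X x + Y) * exp (- (1/3) * (X x - 1))"
      using nw w3 C(1) by (intro mult_mono mult_left_mono) (auto intro: add_nonneg_nonneg order_trans[OF norm_ge_zero] simp: Y_def X1 order_trans[OF zero_le_one X1])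
    show "norm (Ai (stark_zeta f z x)) \<le> C * (2 + X x + Y) * exp (- (1/3) * (X x - 1))"
     "norm (deriv Ai (stark_zeta f z x)) \<le> C * (2 + X x + Y) * exp (- (1/3) * (X x - 1))"
      using C(2,3)[OF R1] le ww by (auto simp: \<zeta>_def)
  qed
  have lim: "((\<lambda>x. \<bar>x\<bar> ^ 3 * (K * (C * (2 + X x + Y) * exp (- (1/3) * (X x - 1))))) \<longlongrightarrow> 0) at_top" for K
    unfolding X_def using p by real_asymp
  show "decays (sa z) at_top" unfolding decays_def
  proof (rule Lim_null_comparison[OF _ lim[of 1]])
    show "\<forall>\<^sub>F x in at_top. norm (of_real (x ^ 3) * sa z x) \<le> \<bar>x\<bar> ^ 3 * (1 * (C * (2 + X x + Y) * exp (- (1/3) * (X x - 1))))"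
      using evX by eventually_elim (use bound in \<open>auto simp: norm_mult norm_power sa_def intro!: mult_left_mono\<close>)
  qed
  show "decays (sa' z) at_top" unfolding decays_def
  proof (rule Lim_null_comparison[OF _ lim[of p]])
    show "\<forall>\<^sub>F x in at_top. norm (of_real (x ^ 3) * sa' z x) \<le> \<bar>x\<bar> ^ 3 * (p * (C * (2 + X x + Y) * exp (- (1/3) * (X x - 1))))"
      using evX by eventually_elim (use bound p in \<open>auto simp: norm_mult norm_power sa'_def p_def[symmetric] intro!: mult_left_mono\<close>)
  qed
qed

text \<open>On the left the solutions oscillate and decay comes from \<open>Im z > 0\<close> alone:
  with k = sqrt(z - f x) one has \<open>2 * Re k * Im k = Im z\<close>, which forces Im(k^3) to grow
  at least like sqrt |x|. The exponential of this beats every power of x.\<close>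

lemma sb_decays: 
  assumes "Im z > 0"
  shows "decays (sb z) at_bot" "decays (sb' z) at_bot"
proof -
  obtain C where C: "C > 0" "\<And>w. Re w \<ge> 1 \<Longrightarrow> norm (Ai (w\<^sup>2)) \<le> C * (1 + norm w) * exp (- (2/3) * Re (w ^ 3))"
     "\<And>w. Re w \<ge> 1 \<Longrightarrow> norm (deriv Ai (w\<^sup>2)) \<le> C * (1 + norm w) * exp (- (2/3) * Re (w ^ 3))"
    using Ai_square_bound by blast
  define p where "p = f powr (1/3)"
  define m where "m = f powr (-1/3)"
  define y where "y = Im z"
  define X where "X = (\<lambda>x. Re z - f * x)"
  have p: "p > 0" "m > 0" "y > 0" using pos assms by (auto simp: p_def m_def y_def)
  have "filterlim X at_top at_bot" unfolding X_def using pos by real_asymp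
  \<comment> \<open>The threshold \<open>(4 / m)\<^sup>2\<close> ensures
    \<open>Re w \<ge> 1\<close>, as \<open>Ai_square_bound\<close> requires.\<close>
  then have evX: "\<forall>\<^sub>F x in at_bot. X x \<ge> max 1 ((4 / m)\<^sup>2)" unfolding filterlim_at_top by blast
  have bound: "norm (Ai (airy_rot * stark_zeta f z x)) \<le> C * (1 + m * (1 + X x + y)) * exp (- (2/3) * (y * sqrt (X x) / f))"
     "norm (deriv Ai (airy_rot * stark_zeta f z x)) \<le> C * (1 + m * (1 + X x + y)) * exp (- (2/3) * (y * sqrt (X x) / f))"
     if x: "X x \<ge> max 1 ((4 / m)\<^sup>2)" for x
  proof -
    define k where "k = csqrt (z - of_real (f * x))"
    define w where "w = rot6' * k * of_real m"
    have k2: "k\<^sup>2 = z - of_real (f * x)" by (simp add: k_def)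
    have X1: "X x \<ge> 1" "X x \<ge> (4/m)\<^sup>2" using x by auto
    have Re: "Re (z - of_real (f * x)) = X x" and Im: "Im (z - of_real (f * x)) = y" by (auto simp: X_def y_def)
    have R: "Re k \<ge> sqrt (X x)" "2 * Re k * Im k = y" "(Re k)\<^sup>2 - (Im k)\<^sup>2 = X x" "Re k > 0"
      using csqrt_parts[of "X x" "z - of_real (f * x)", folded k_def] X1 Re Im by auto
    have Imk: "Im k \<ge> 0" using R(2,4) p by (metis less_eq_real_def mult_pos_pos zero_less_mult_pos zero_less_numeral)
    have w2: "w\<^sup>2 = airy_rot * stark_zeta f z x" using zeta_square(2)[OF k2] by (simp add: w_def m_def)
    have w3: "w ^ 3 = - \<i> * k ^ 3 / of_real f" using zeta_square(4)[OF k2] by (simp add: w_def m_def)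
    have "sqrt (X x) \<ge> 4 / m" using X1 p by (intro real_le_rsqrt) auto
    then have km: "Re k * m \<ge> 4" using R(1) p by (simp add: field_simps order_trans)
    have "sqrt 3 \<ge> 1" by simp
    then have "sqrt 3 / 2 * (Re k * m) \<ge> 1 / 2 * (Re k * m)" using km by (intro mult_right_mono) auto
    moreover have "Re w = sqrt 3 / 2 * (Re k * m) + Im k * m / 2" by (simp add: w_def rot6'_eq algebra_simps)
    moreover have "Im k * m \<ge> 0" using Imk p by simp
    ultimately have R1: "Re w \<ge> 1" using km by linarith
    have "Im (k ^ 3) = Im k * (3 * (Re k)\<^sup>2 - (Im k)\<^sup>2)"
      by (simp add: power3_eq_cube power2_eq_square algebra_simps)
    also have "3 * (Re k)\<^sup>2 - (Im k)\<^sup>2 = 2 * (Re k)\<^sup>2 + X x" using R(3) by linarith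
    also have "Im k * (2 * (Re k)\<^sup>2 + X x) \<ge> Im k * (2 * (Re k)\<^sup>2)" using Imk X1 by (intro mult_left_mono) auto
    also have "Im k * (2 * (Re k)\<^sup>2) = Re k * (2 * Re k * Im k)" by (simp add: power2_eq_square)
    also have "\<dots> = Re k * y" by (simp only: R)
    also have "\<dots> \<ge> sqrt (X x) * y" using R p by (intro mult_right_mono) auto
    finally have "Im (k ^ 3) \<ge> y * sqrt (X x)" by (simp add: mult.commute)
    moreover have "Re (w ^ 3) = Im (k ^ 3) / f"
      unfolding w3 by simp
    ultimately have Rew: "Re (w ^ 3) \<ge> y * sqrt (X x) / f" using pos by (simp add: divide_right_mono)
    have "norm k \<le> 1 + (norm k)\<^sup>2" using zero_le_power2[of "norm k - 1/2"] by (simp add: power2_eq_square algebra_simps)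
    also have "(norm k)\<^sup>2 = norm (z - of_real (f * x))" using k2 by (simp flip: norm_power)
    also have "\<dots> \<le> X x + y" using cmod_le[of "z - of_real (f * x)"] Re Im X1 p by simp
    finally have "norm k \<le> 1 + X x + y" by simp
    then have nw: "1 + norm w \<le> 1 + m * (1 + X x + y)" using p by (simp add: w_def norm_mult mult.commute)
    have le: "C * (1 + norm w) * exp (- (2/3) * Re (w ^ 3)) \<le> C * (1 + m * (1 + X x + y)) * exp (- (2/3) * (y * sqrt (X x) / f))"
      using nw Rew C(1) order_trans[OF norm_ge_zero, of w "m * (1 + X x + y)"] by (intro mult_mono mult_left_mono) auto
    show "norm (Ai (airy_rot * stark_zeta f z x)) \<le> C * (1 + m * (1 + X x + y)) * exp (- (2/3) * (y * sqrt (X x) / f))"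
     "norm (deriv Ai (airy_rot * stark_zeta f z x)) \<le> C * (1 + m * (1 + X x + y)) * exp (- (2/3) * (y * sqrt (X x) / f))"
      using C(2,3)[OF R1] le w2 by auto
  qed
  have lim: "((\<lambda>x. \<bar>x\<bar> ^ 3 * (K * (C * (1 + m * (1 + X x + y)) * exp (- (2/3) * (y * sqrt (X x) / f))))) \<longlongrightarrow> 0) at_bot" for K
    unfolding X_def using p pos by real_asymp
  show "decays (sb z) at_bot" unfolding decays_def
  proof (rule Lim_null_comparison[OF _ lim[of 1]])
    show "\<forall>\<^sub>F x in at_bot. norm (of_real (x ^ 3) * sb z x) \<le> \<bar>x\<bar> ^ 3 * (1 * (C * (1 + m * (1 + X x + y)) * exp (- (2/3) * (y * sqrt (X x) / f))))"
      using evX by eventually_elim (use bound in \<open>auto simp: norm_mult norm_power sb_def intro!: mult_left_mono\<close>)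
  qed
  have nr: "norm airy_rot = 1" by (simp add: airy_rot_def)
  show "decays (sb' z) at_bot" unfolding decays_def
  proof (rule Lim_null_comparison[OF _ lim[of p]])
    show "\<forall>\<^sub>F x in at_bot. norm (of_real (x ^ 3) * sb' z x) \<le> \<bar>x\<bar> ^ 3 * (p * (C * (1 + m * (1 + X x + y)) * exp (- (2/3) * (y * sqrt (X x) / f))))"
      using evX by eventually_elim (use bound p nr in \<open>auto simp: norm_mult norm_power sb'_def p_def[symmetric] intro!: mult_left_mono\<close>)
  qed
qed

end

context stark
begin

section \<open>Solutions of the equation with both delta interactions\<close>

text \<open>The first two pieces include their right end points, so a glued derivative takes its
  left limit at \<plusminus>\<kappa>, the convention of \<open>jump\<close>.\<close>

definition glue :: "(real \<Rightarrow> complex) \<Rightarrow> (real \<Rightarrow> complex) \<Rightarrow> (real \<Rightarrow> complex) \<Rightarrow> real \<Rightarrow> complex" where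
  "glue g1 g2 g3 x = (if x \<le> -\<kappa> then g1 x else if x \<le> \<kappa> then g2 x else g3 x)"

lemma strong_sol_glue:
  assumes g: "\<And>i x. i < 3 \<Longrightarrow> (g i has_vector_derivative g' i x) (at x)"
    and g': "\<And>i x. i < 3 \<Longrightarrow> (g' i has_vector_derivative (complex_of_real (f * x) - z) * g i x) (at x)"
    and m: "g 0 (-\<kappa>) = g 1 (-\<kappa>)" "g' 1 (-\<kappa>) = g' 0 (-\<kappa>) + g 0 (-\<kappa>) / of_real \<eta>"
    and p: "g 1 \<kappa> = g 2 \<kappa>" "g' 2 \<kappa> = g' 1 \<kappa> + g 1 \<kappa> / of_real \<eta>"
  shows "strong_sol (glue (g 0) (g 1) (g (2::nat))) (glue (g' 0) (g' 1) (g' 2)) (\<lambda>x. z * glue (g 0) (g 1) (g 2) x)"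
proof -
  let ?u = "glue (g 0) (g 1) (g 2)" and ?v = "glue (g' 0) (g' 1) (g' 2)"
  have ig: "isCont (g i) x" if "i < 3" for i x using g[OF that, of x] by (rule has_vector_derivative_continuous)
  have ig': "isCont (g' i) x" if "i < 3" for i x using g'[OF that, of x] by (rule has_vector_derivative_continuous)
  have cg: "continuous_on S (g i)" if "i < 3" for i S using ig[OF that] by (simp add: continuous_at_imp_continuous_on)
  have c: "continuous_on UNIV ?u" unfolding glue_def
    by (intro continuous_on_cases_le cg continuous_intros) (use m p pos in auto)
  have tl: "(h \<longlongrightarrow> h c) (at c within S)" if "isCont h c" for h :: "real \<Rightarrow> complex" and c S
    using that by (auto simp: isCont_def intro: tendsto_within_subset)
  have l1: "(?v \<longlongrightarrow> g' 0 (-\<kappa>)) (at_left (-\<kappa>))"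
    by (rule Lim_transform_eventually[OF tl[OF ig'[of 0]]])
       (auto simp: eventually_at_filter glue_def intro!: always_eventually)
  have l2: "(?v \<longlongrightarrow> g' 1 (-\<kappa>)) (at_right (-\<kappa>))"
  proof (rule Lim_transform_eventually[OF tl[OF ig'[of 1]]])
    show "\<forall>\<^sub>F x in at_right (- \<kappa>). g' 1 x = ?v x"
      using eventually_at_right_real[of "-\<kappa>" \<kappa>] pos by (auto elim!: eventually_mono simp: glue_def)
  qed auto
  have l3: "(?v \<longlongrightarrow> g' 1 \<kappa>) (at_left \<kappa>)"
  proof (rule Lim_transform_eventually[OF tl[OF ig'[of 1]]])
    show "\<forall>\<^sub>F x in at_left \<kappa>. g' 1 x = ?v x"
      using eventually_at_left_real[of "-\<kappa>" \<kappa>] pos by (auto elim!: eventually_mono simp: glue_def)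
  qed auto
  have l4: "(?v \<longlongrightarrow> g' 2 \<kappa>) (at_right \<kappa>)"
    by (rule Lim_transform_eventually[OF tl[OF ig'[of 2]]])
       (use pos in \<open>auto simp: eventually_at_filter glue_def intro!: always_eventually\<close>)
  have j: "jump ?u ?v" unfolding jump_def using l1 l2 l3 l4 m p pos by (auto simp: glue_def)
  have d: "(?u has_vector_derivative ?v x) (at x) \<and>
        (?v has_vector_derivative complex_of_real (f * x) * ?u x - z * ?u x) (at x)" if "x \<notin> {-\<kappa>, \<kappa>}" for x
  proof -
    have "\<exists>i<3. \<exists>T. open T \<and> x \<in> T \<and> (\<forall>y\<in>T. ?u y = g i y \<and> ?v y = g' i y)"
    proof -
      consider "x < -\<kappa>" | "-\<kappa> < x" "x < \<kappa>" | "\<kappa> < x" using \<open>x \<notin> {-\<kappa>, \<kappa>}\<close> by fastforce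
      then show ?thesis
      proof cases
        case 1
        then show ?thesis by (intro exI[of _ 0] exI[of _ "{..<-\<kappa>}"] conjI) (auto simp: glue_def)
      next
        case 2
        then show ?thesis by (intro exI[of _ 1] exI[of _ "{-\<kappa><..<\<kappa>}"] conjI) (auto simp: glue_def)
      next
        case 3
        then show ?thesis using pos by (intro exI[of _ 2] exI[of _ "{\<kappa><..}"] conjI) (auto simp: glue_def)
      qed
    qed
    then obtain i T where i: "i < 3" and T: "open T" "x \<in> T" "\<And>y. y \<in> T \<Longrightarrow> ?u y = g i y \<and> ?v y = g' i y" by blast
    have "(?u has_vector_derivative g' i x) (at x)"
      by (rule has_vector_derivative_transform_within_open[OF g[OF i] T(1,2)]) (use T(3) in auto)
    moreover have "(?v has_vector_derivative (complex_of_real (f * x) - z) * g i x) (at x)"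
      by (rule has_vector_derivative_transform_within_open[OF g'[OF i] T(1,2)]) (use T(3) in auto)
    ultimately show ?thesis using T(2,3) by (auto simp: left_diff_distrib)
  qed
  show ?thesis unfolding strong_sol_def using c j d by (auto intro: continuous_intros)
qed

text \<open>Crossing a delta at c changes (P, Q) by a multiple of \<open>(sb z c, - sa z c)\<close>:
  this keeps the value at c and changes the derivative by G(c) / \<eta> up to sign, because the
  Wronskian of \<open>sa\<close> and \<open>sb\<close> is W. The first two equations cross from
  right to left, the last two from left to right.\<close>

lemma step_solution:
  fixes P Q z :: complex
  defines "G c \<equiv> P * sa z c + Q * sb z c" and "e \<equiv> of_real \<eta> * W"
  shows "(P + G c * sb z c / e) * sa z c + (Q - G c * sa z c / e) * sb z c = G c"
    and "(P + G c * sb z c / e) * sa' z c + (Q - G c * sa z c / e) * sb' z c = P * sa' z c + Q * sb' z c - G c / of_real \<eta>"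
    and "(P - G c * sb z c / e) * sa z c + (Q + G c * sa z c / e) * sb z c = G c"
    and "(P - G c * sb z c / e) * sa' z c + (Q + G c * sa z c / e) * sb' z c = P * sa' z c + Q * sb' z c + G c / of_real \<eta>"
proof -
  show "(P + G c * sb z c / e) * sa z c + (Q - G c * sa z c / e) * sb z c = G c"
    "(P - G c * sb z c / e) * sa z c + (Q + G c * sa z c / e) * sb z c = G c"
    by (simp_all add: G_def algebra_simps)
  have 1: "(P + G c * sb z c / e) * sa' z c + (Q - G c * sa z c / e) * sb' z c
     = P * sa' z c + Q * sb' z c - G c * (sa z c * sb' z c - sa' z c * sb z c) / e"
    "(P - G c * sb z c / e) * sa' z c + (Q + G c * sa z c / e) * sb' z c
     = P * sa' z c + Q * sb' z c + G c * (sa z c * sb' z c - sa' z c * sb z c) / e"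
    by (simp_all add: algebra_simps diff_divide_distrib add_divide_distrib)
  show "(P + G c * sb z c / e) * sa' z c + (Q - G c * sa z c / e) * sb' z c = P * sa' z c + Q * sb' z c - G c / of_real \<eta>"
    "(P - G c * sb z c / e) * sa' z c + (Q + G c * sa z c / e) * sb' z c = P * sa' z c + Q * sb' z c + G c / of_real \<eta>"
    unfolding 1 sab_wronskian by (simp_all add: e_def)
qed

text \<open>\<open>psi_plus\<close> equals \<open>P\<^sub>i sa + Q\<^sub>i sb\<close> on the \<open>i\<close>-th of the three intervals cut out by \<open>\<plusminus>\<kappa>\<close>, with
  \<open>(P\<^sub>3, Q\<^sub>3) = (1, 0)\<close> and the other coefficients forced by the jump conditions; likewise \<open>psi_minus\<close>,
  starting from \<open>(P\<^sub>1, Q\<^sub>1) = (0, 1)\<close>.\<close>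

definition P2p where "P2p z = 1 + sa z \<kappa> * sb z \<kappa> / (of_real \<eta> * W)"
definition Q2p where "Q2p z = - (sa z \<kappa> * sa z \<kappa> / (of_real \<eta> * W))"
definition Gp where "Gp z = P2p z * sa z (-\<kappa>) + Q2p z * sb z (-\<kappa>)"
definition P1p where "P1p z = P2p z + Gp z * sb z (-\<kappa>) / (of_real \<eta> * W)"
definition Q1p where "Q1p z = Q2p z - Gp z * sa z (-\<kappa>) / (of_real \<eta> * W)"
definition P2m where "P2m z = - (sb z (-\<kappa>) * sb z (-\<kappa>) / (of_real \<eta> * W))"
definition Q2m where "Q2m z = 1 + sb z (-\<kappa>) * sa z (-\<kappa>) / (of_real \<eta> * W)"
definition Gm where "Gm z = P2m z * sa z \<kappa> + Q2m z * sb z \<kappa>"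
definition P3m where "P3m z = P2m z - Gm z * sb z \<kappa> / (of_real \<eta> * W)"
definition Q3m where "Q3m z = Q2m z + Gm z * sa z \<kappa> / (of_real \<eta> * W)"

definition D where "D = stark_D \<kappa> \<eta> f"

text \<open>So D is the coefficient of \<open>sa\<close> in \<open>psi_plus\<close> left of
  -\<kappa>, and of \<open>sb\<close> in \<open>psi_minus\<close> right of \<kappa>. Where it
  vanishes, \<open>psi_plus\<close> is a multiple of \<open>sb\<close> on the left.\<close>

lemma P1p_eq: "P1p z = D z" and Q3m_eq: "Q3m z = D z"
proof -
  have e: "of_real \<eta> * W \<noteq> 0" using pos by simp
  have s: "(of_real \<eta>)\<^sup>2 * W\<^sup>2 = (of_real \<eta> * W)\<^sup>2" by (simp add: power_mult_distrib)
  show "P1p z = D z" unfolding P1p_def Gp_def P2p_def Q2p_def D_def stark_D_eq s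
    using e by (simp add: field_simps power2_eq_square)
  show "Q3m z = D z" unfolding Q3m_def Gm_def P2m_def Q2m_def D_def stark_D_eq s
    using e by (simp add: field_simps power2_eq_square)
qed

definition comb :: "complex \<Rightarrow> complex \<Rightarrow> complex \<Rightarrow> real \<Rightarrow> complex" where
  "comb z P Q x = P * sa z x + Q * sb z x"
definition comb' :: "complex \<Rightarrow> complex \<Rightarrow> complex \<Rightarrow> real \<Rightarrow> complex" where
  "comb' z P Q x = P * sa' z x + Q * sb' z x"

definition psi_plus :: "complex \<Rightarrow> real \<Rightarrow> complex" where
  "psi_plus z = glue (comb z (P1p z) (Q1p z)) (comb z (P2p z) (Q2p z)) (comb z 1 0)"
definition psi_plus' :: "complex \<Rightarrow> real \<Rightarrow> complex" where
  "psi_plus' z = glue (comb' z (P1p z) (Q1p z)) (comb' z (P2p z) (Q2p z)) (comb' z 1 0)"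
definition psi_minus :: "complex \<Rightarrow> real \<Rightarrow> complex" where
  "psi_minus z = glue (comb z 0 1) (comb z (P2m z) (Q2m z)) (comb z (P3m z) (Q3m z))"
definition psi_minus' :: "complex \<Rightarrow> real \<Rightarrow> complex" where
  "psi_minus' z = glue (comb' z 0 1) (comb' z (P2m z) (Q2m z)) (comb' z (P3m z) (Q3m z))"

lemma comb_deriv: "(comb z P Q has_vector_derivative comb' z P Q x) (at x)"
    "(comb' z P Q has_vector_derivative (complex_of_real (f * x) - z) * comb z P Q x) (at x)"
proof -
  show "(comb z P Q has_vector_derivative comb' z P Q x) (at x)"
    unfolding comb_def[abs_def] comb'_def by (intro has_vector_derivative_add has_vector_derivative_mult_right sa_deriv sb_deriv)
  have "(comb' z P Q has_vector_derivative P * ((complex_of_real (f * x) - z) * sa z x) + Q * ((complex_of_real (f * x) - z) * sb z x)) (at x)"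
    unfolding comb'_def[abs_def] by (intro has_vector_derivative_add has_vector_derivative_mult_right sa_deriv sb_deriv)
  then show "(comb' z P Q has_vector_derivative (complex_of_real (f * x) - z) * comb z P Q x) (at x)"
    by (simp add: comb_def algebra_simps)
qed

lemma psi_plus_strong_sol: "strong_sol (psi_plus z) (psi_plus' z) (\<lambda>x. z * psi_plus z x)"
proof -
  let ?g = "\<lambda>i::nat. if i = 0 then comb z (P1p z) (Q1p z) else if i = 1 then comb z (P2p z) (Q2p z) else comb z 1 0"
  let ?g' = "\<lambda>i::nat. if i = 0 then comb' z (P1p z) (Q1p z) else if i = 1 then comb' z (P2p z) (Q2p z) else comb' z 1 0"
  have "strong_sol (glue (?g 0) (?g 1) (?g 2)) (glue (?g' 0) (?g' 1) (?g' 2)) (\<lambda>x. z * glue (?g 0) (?g 1) (?g 2) x)"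
  proof (rule strong_sol_glue)
    note s1 = step_solution(1,2)[of "P2p z" z "-\<kappa>" "Q2p z", folded Gp_def, folded P1p_def Q1p_def]
    note s2 = step_solution(1,2)[of 1 z \<kappa> 0, simplified, folded P2p_def Q2p_def]
    show "?g 0 (-\<kappa>) = ?g 1 (-\<kappa>)" using s1(1) by (simp add: comb_def Gp_def)
    show "?g' 1 (-\<kappa>) = ?g' 0 (-\<kappa>) + ?g 0 (-\<kappa>) / of_real \<eta>" using s1 by (simp add: comb_def comb'_def)
    show "?g 1 \<kappa> = ?g 2 \<kappa>" using s2(1) by (simp add: comb_def P2p_def Q2p_def)
    show "?g' 2 \<kappa> = ?g' 1 \<kappa> + ?g 1 \<kappa> / of_real \<eta>" using s2 by (simp add: comb_def comb'_def P2p_def Q2p_def)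
  qed (auto intro: comb_deriv comb_deriv[unfolded of_real_mult])
  then show ?thesis unfolding psi_plus_def psi_plus'_def by simp
qed

lemma psi_minus_strong_sol: "strong_sol (psi_minus z) (psi_minus' z) (\<lambda>x. z * psi_minus z x)"
proof -
  let ?g = "\<lambda>i::nat. if i = 0 then comb z 0 1 else if i = 1 then comb z (P2m z) (Q2m z) else comb z (P3m z) (Q3m z)"
  let ?g' = "\<lambda>i::nat. if i = 0 then comb' z 0 1 else if i = 1 then comb' z (P2m z) (Q2m z) else comb' z (P3m z) (Q3m z)"
  have "strong_sol (glue (?g 0) (?g 1) (?g 2)) (glue (?g' 0) (?g' 1) (?g' 2)) (\<lambda>x. z * glue (?g 0) (?g 1) (?g 2) x)"
  proof (rule strong_sol_glue)
    note s1 = step_solution(3,4)[of "P2m z" z \<kappa> "Q2m z", folded Gm_def, folded P3m_def Q3m_def]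
    note s2 = step_solution(3,4)[of 0 z "-\<kappa>" 1, simplified]
    show "?g 0 (-\<kappa>) = ?g 1 (-\<kappa>)" using s2(1) by (simp add: comb_def P2m_def Q2m_def)
    show "?g' 1 (-\<kappa>) = ?g' 0 (-\<kappa>) + ?g 0 (-\<kappa>) / of_real \<eta>" using s2 by (simp add: comb_def comb'_def P2m_def Q2m_def)
    show "?g 1 \<kappa> = ?g 2 \<kappa>" using s1(1) by (simp add: comb_def Gm_def)
    show "?g' 2 \<kappa> = ?g' 1 \<kappa> + ?g 1 \<kappa> / of_real \<eta>" using s1 by (simp add: comb_def comb'_def Gm_def)
  qed (auto intro: comb_deriv comb_deriv[unfolded of_real_mult])
  then show ?thesis unfolding psi_minus_def psi_minus'_def by simp
qed

lemma psi_plus_right: "x > \<kappa> \<Longrightarrow> psi_plus z x = sa z x" "x > \<kappa> \<Longrightarrow> psi_plus' z x = sa' z x"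
  and psi_minus_left: "x \<le> -\<kappa> \<Longrightarrow> psi_minus z x = sb z x" "x \<le> -\<kappa> \<Longrightarrow> psi_minus' z x = sb' z x"
  and psi_plus_left: "x \<le> -\<kappa> \<Longrightarrow> psi_plus z x = D z * sa z x + Q1p z * sb z x" "x \<le> -\<kappa> \<Longrightarrow> psi_plus' z x = D z * sa' z x + Q1p z * sb' z x"
  using pos by (auto simp: psi_plus_def psi_plus'_def psi_minus_def psi_minus'_def glue_def comb_def comb'_def P1p_eq)

text \<open>The Wronskian is constant, and beyond \<kappa> only the component
  \<open>D z * sb z\<close> of \<open>psi_minus\<close> contributes against
  \<open>psi_plus = sa\<close>.\<close>

lemma psi_plus_psi_minus_wronskian: "wronskian (psi_plus z) (psi_plus' z) (psi_minus z) (psi_minus' z) x = W * D z"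
proof -
  let ?w = "wronskian (psi_plus z) (psi_plus' z) (psi_minus z) (psi_minus' z)"
  have inc: "?w t = ?w s" if "s \<le> t" for s t
  proof -
    have c: "continuous_on UNIV (\<lambda>x. z * psi_minus z x)" using psi_minus_strong_sol[of z] by (auto simp: strong_sol_def)
    have "set_integrable lborel {s..t} (\<lambda>x. z * psi_minus z x)" for s t
      by (rule set_integrable_continuous, rule continuous_on_subset[OF c]) auto
    from wronskian_increment(2)[OF psi_plus_strong_sol[of z] strong_imp_weak_sol[OF psi_minus_strong_sol[of z]] this that]
    show ?thesis by (simp add: set_lebesgue_integral_def)
  qed
  let ?X = "\<bar>x\<bar> + \<kappa> + 1"
  have "?X > \<kappa>" by simp
  then have X: "psi_plus z ?X = sa z ?X" "psi_plus' z ?X = sa' z ?X" "psi_minus z ?X = P3m z * sa z ?X + D z * sb z ?X"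
     "psi_minus' z ?X = P3m z * sa' z ?X + D z * sb' z ?X"
    using pos by (auto simp: psi_plus_right psi_minus_def psi_minus'_def glue_def comb_def comb'_def Q3m_eq)
  have "?w x = ?w ?X" using inc[of x ?X] pos by (simp add: abs_if)
  also have "\<dots> = D z * (sa z ?X * sb' z ?X - sa' z ?X * sb z ?X)"
    unfolding wronskian_def X by (simp add: algebra_simps)
  finally show ?thesis unfolding sab_wronskian by (simp add: mult.commute)
qed

lemma decays_cong: "eventually (\<lambda>x. u x = v x) F \<Longrightarrow> decays u F \<Longrightarrow> decays v F"
  unfolding decays_def by (rule Lim_transform_eventually) (auto elim: eventually_mono)

lemma psi_plus_decays: "decays (psi_plus z) at_top" "decays (psi_plus' z) at_top"
proof -
  have ev: "eventually (\<lambda>x. x > \<kappa>) at_top" by (rule eventually_gt_at_top)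
  show "decays (psi_plus z) at_top" by (rule decays_cong[OF _ sa_decays(1)]) (use ev in eventually_elim, simp add: psi_plus_right)
  show "decays (psi_plus' z) at_top" by (rule decays_cong[OF _ sa_decays(2)]) (use ev in eventually_elim, simp add: psi_plus_right)
qed

lemma psi_minus_decays: 
  assumes "Im z > 0" 
  shows "decays (psi_minus z) at_bot" "decays (psi_minus' z) at_bot"
proof -
  have ev: "eventually (\<lambda>x. x \<le> -\<kappa>) at_bot" by (rule eventually_le_at_bot)
  show "decays (psi_minus z) at_bot" by (rule decays_cong[OF _ sb_decays(1)[OF assms]]) (use ev in eventually_elim, simp add: psi_minus_left)
  show "decays (psi_minus' z) at_bot" by (rule decays_cong[OF _ sb_decays(2)[OF assms]]) (use ev in eventually_elim, simp add: psi_minus_left)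
qed

lemma strong_sol_cnj:
  assumes "strong_sol u v h"
  shows "strong_sol (\<lambda>x. cnj (u x)) (\<lambda>x. cnj (v x)) (\<lambda>x. cnj (h x))"
proof -
  have j: "((\<lambda>x. cnj (v x)) \<longlongrightarrow> cnj (v c) + cnj (u c) / of_real \<eta>) (at_right c)"
    if "(v \<longlongrightarrow> v c + u c / of_real \<eta>) (at_right c)" for c
    using tendsto_cnj[OF that] by simp
  have d: "((\<lambda>x. cnj (u x)) has_vector_derivative cnj a) (at x)" if "(u has_vector_derivative a) (at x)" for u a x
    using that by (rule has_vector_derivative_cnj)
  have "((\<lambda>x. cnj (v x)) has_vector_derivative complex_of_real (f * x) * cnj (u x) - cnj (h x)) (at x)" if "x \<notin> {-\<kappa>, \<kappa>}" for x
    using assms that d[of v "complex_of_real (f * x) * u x - h x" x] by (auto simp: strong_sol_def)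
  then show ?thesis using assms j d unfolding strong_sol_def jump_def
    by (auto intro!: continuous_intros tendsto_cnj)
qed

lemma decays_imp_tendsto: 
  assumes "decays u F" "F = at_top \<or> F = at_bot"
  shows "(u \<longlongrightarrow> 0) F"
proof (rule Lim_null_comparison)
  show "((\<lambda>x. norm (of_real (x ^ 3) * u x)) \<longlongrightarrow> 0) F" using assms(1) by (auto simp: decays_def intro: tendsto_norm_zero)
  have "eventually (\<lambda>x. \<bar>x\<bar> \<ge> 1) F" using assms(2)
    by (auto intro: eventually_mono[OF eventually_ge_at_top[of "1::real"]] eventually_mono[OF eventually_le_at_bot[of "-1::real"]])
  then show "\<forall>\<^sub>F x in F. norm (u x) \<le> norm (of_real (x ^ 3) * u x)"
  proof eventually_elim
    case (elim x)
    have "1 * norm (u x) \<le> \<bar>x\<bar> ^ 3 * norm (u x)" using elim by (intro mult_right_mono) auto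
    then show ?case by (simp add: norm_mult norm_power power_abs)
  qed
qed

text \<open>A zero would make \<open>psi_plus\<close> decay at both ends: an eigenfunction with a
  non-real eigenvalue. Its Wronskian with its own conjugate then vanishes at both ends, while the
  increments are \<open>2 * \<i> * Im z\<close> times the integral of |psi_plus|^2. So
  \<open>psi_plus\<close> would be zero, contradicting \<open>W \<noteq> 0\<close>.\<close>

lemma D_nonzero_upper:
  assumes z: "Im z > 0"
  shows "D z \<noteq> 0"
proof
  assume D0: "D z = 0"
  let ?\<psi> = "psi_plus z" and ?\<xi> = "psi_plus' z"
  let ?w = "wronskian ?\<psi> ?\<xi> (\<lambda>x. cnj (?\<psi> x)) (\<lambda>x. cnj (?\<xi> x))"
  have ev: "eventually (\<lambda>x. x \<le> -\<kappa>) at_bot" by (rule eventually_le_at_bot)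
  have db: "((\<lambda>x. Q1p z * sb z x) \<longlongrightarrow> Q1p z * 0) at_bot" "((\<lambda>x. Q1p z * sb' z x) \<longlongrightarrow> Q1p z * 0) at_bot"
    by (intro tendsto_mult tendsto_const decays_imp_tendsto sb_decays z; simp)+
  have "(?\<psi> \<longlongrightarrow> Q1p z * 0) at_bot" "(?\<xi> \<longlongrightarrow> Q1p z * 0) at_bot"
    by (rule Lim_transform_eventually[OF db(1)], use ev in eventually_elim, simp add: psi_plus_left D0)
       (rule Lim_transform_eventually[OF db(2)], use ev in eventually_elim, simp add: psi_plus_left D0)
  then have bot: "(?\<psi> \<longlongrightarrow> 0) at_bot" "(?\<xi> \<longlongrightarrow> 0) at_bot" by simp_all
  have top: "(?\<psi> \<longlongrightarrow> 0) at_top" "(?\<xi> \<longlongrightarrow> 0) at_top" using psi_plus_decays decays_imp_tendsto by blast+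
  have wlim: "(?w \<longlongrightarrow> 0 * cnj 0 - 0 * cnj 0) F" if "(?\<psi> \<longlongrightarrow> 0) F" "(?\<xi> \<longlongrightarrow> 0) F" for F
    unfolding wronskian_def[abs_def] by (intro tendsto_intros tendsto_cnj that)
  note sc = strong_sol_cnj[OF psi_plus_strong_sol[of z]]
  have c\<psi>: "continuous_on S ?\<psi>" for S using psi_plus_strong_sol[of z] by (auto simp: strong_sol_def intro: continuous_on_subset)
  let ?N = "\<lambda>s t. LINT x:{s..t}|lborel. (norm (?\<psi> x))\<^sup>2"
  have Ni: "set_integrable lborel {s..t} (\<lambda>x. (norm (?\<psi> x))\<^sup>2)" for s t
    by (intro borel_integrable_atLeastAtMost' continuous_intros c\<psi>)
  have inc: "?w t - ?w s = 2 * \<i> * of_real (Im z) * of_real (?N s t)" if st: "s \<le> t" for s t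
  proof -
    have "set_integrable lborel {s..t} (\<lambda>x. cnj (z * ?\<psi> x))" for s t
      by (intro set_integrable_continuous continuous_intros c\<psi>)
    from wronskian_increment(2)[OF psi_plus_strong_sol strong_imp_weak_sol[OF sc] this st]
    have "?w t - ?w s = - (LINT x:{s..t}|lborel. ?\<psi> x * (cnj (z * ?\<psi> x) - z * cnj (?\<psi> x)))" .
    also have "(\<lambda>x. ?\<psi> x * (cnj (z * ?\<psi> x) - z * cnj (?\<psi> x))) = (\<lambda>x. (cnj z - z) * complex_of_real ((norm (?\<psi> x))\<^sup>2))"
      unfolding complex_norm_square by (auto simp: algebra_simps)
    also have "(LINT x:{s..t}|lborel. (cnj z - z) * complex_of_real ((norm (?\<psi> x))\<^sup>2)) = (cnj z - z) * of_real (?N s t)"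
      by (simp only: set_integral_mult_right set_integral_complex_of_real)
    also have "cnj z - z = - (2 * \<i> * of_real (Im z))" by (simp add: complex_eq_iff)
    finally show ?thesis by simp
  qed
  have zero: "?N s t = 0" if st: "s \<le> t" for s t
  proof -
    have nn: "?N s' t' \<ge> 0" for s' t' unfolding set_lebesgue_integral_def by (rule integral_nonneg_AE) auto
    have lim: "((\<lambda>n::real. ?w n - ?w (-n)) \<longlongrightarrow> 0 - 0) at_top"
      by (rule tendsto_diff) (use wlim[OF top] filterlim_compose[OF wlim[OF bot] filterlim_uminus_at_bot_at_top] in simp_all)
    have "((\<lambda>n::real. 2 * Im z * ?N s t) \<longlongrightarrow> 0) at_top"
    proof (rule Lim_null_comparison)
      show "((\<lambda>n. norm (?w n - ?w (-n))) \<longlongrightarrow> 0) at_top" using lim tendsto_norm_zero by force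
      show "\<forall>\<^sub>F n in at_top. norm (2 * Im z * ?N s t) \<le> norm (?w n - ?w (-n))"
        using eventually_ge_at_top[of "\<bar>s\<bar> + \<bar>t\<bar>"]
      proof eventually_elim
        case (elim n)
        then have n: "-n \<le> n" "-n \<le> s" "t \<le> n" by auto
        have "?N s t \<le> ?N (-n) n"
          unfolding set_lebesgue_integral_def
          by (rule integral_mono) (use Ni n in \<open>auto simp: set_integrable_def indicator_def\<close>)
        then show ?case using inc[OF n(1)] z nn[of s t] nn[of "-n" n] by (simp add: norm_mult)
      qed
    qed
    then show ?thesis using z by (simp add: tendsto_const_iff)
  qed
  have van: "?\<psi> x = 0" for x
  proof -
    let ?s = "x - 1" and ?t = "x + 1"
    have "((\<lambda>x. (norm (?\<psi> x))\<^sup>2) has_integral 0) {?s..?t}"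
      using set_borel_integral_eq_integral[OF Ni[of ?s ?t]] zero[of ?s ?t] by (auto simp: has_integral_iff)
    then have "(norm (?\<psi> x))\<^sup>2 = 0"
      by (intro has_integral_0_cbox_imp_0[of ?s ?t "\<lambda>x. (norm (?\<psi> x))\<^sup>2" x]) (auto intro!: continuous_intros c\<psi>)
    then show ?thesis by simp
  qed
  have sa0: "sa z y = 0" if "y \<in> {\<kappa><..}" for y using van[of y] psi_plus_right(1)[of y z] that by simp
  let ?x = "\<kappa> + 1"
  have "((\<lambda>_. 0) has_vector_derivative sa' z ?x) (at ?x)"
    by (rule has_vector_derivative_transform_within_open[OF sa_deriv(1), where S="{\<kappa><..}"]) (use sa0 in auto)
  then have "sa' z ?x = 0" using vector_derivative_unique_at has_vector_derivative_const by blast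
  then show False using sab_wronskian[of z ?x] sa0[of ?x] by simp
qed

end

section \<open>The Green's function\<close>

lemma square_integrable_L1:
  assumes "square_integrable h"
  shows "set_integrable lborel {s..t::real} h"
proof -
  have h: "h \<in> borel_measurable lborel" "integrable lborel (\<lambda>x. (norm (h x))\<^sup>2)"
    using assms by (auto simp: square_integrable_def)
  have i: "integrable lborel (\<lambda>x. indicator {s..t} x *\<^sub>R (1::real))"
    using borel_integrable_atLeastAtMost'[of s t "\<lambda>_. 1::real"] by (simp add: set_integrable_def)
  have "integrable lborel (\<lambda>x. indicator {s..t} x *\<^sub>R (1::real) + (norm (h x))\<^sup>2)"
    by (rule Bochner_Integration.integrable_add[OF i h(2)])
  then show ?thesis unfolding set_integrable_def
  proof (rule Bochner_Integration.integrable_bound)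
    show "(\<lambda>x. indicator {s..t} x *\<^sub>R h x) \<in> borel_measurable lborel" using h by measurable
    have "norm (h x) \<le> 1 + (norm (h x))\<^sup>2" for x
      using zero_le_power2[of "norm (h x) - 1/2"] by (simp add: power2_eq_square algebra_simps)
    then show "AE x in lborel. norm (indicator {s..t} x *\<^sub>R h x) \<le> norm (indicator {s..t} x *\<^sub>R (1::real) + (norm (h x))\<^sup>2)"
      by (intro AE_I2) (auto simp: indicator_def)
  qed
qed

lemma square_integrable_lincomb:
  assumes "square_integrable g" "square_integrable h"
  shows "square_integrable (\<lambda>x. g x - c * h x)"
  unfolding square_integrable_def
proof
  have gh: "g \<in> borel_measurable lborel" "h \<in> borel_measurable lborel"
    and i: "integrable lborel (\<lambda>x. (norm (g x))\<^sup>2)" "integrable lborel (\<lambda>x. (norm (h x))\<^sup>2)"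
    using assms by (auto simp: square_integrable_def)
  show m: "(\<lambda>x. g x - c * h x) \<in> borel_measurable lborel" using gh by measurable
  have "integrable lborel (\<lambda>x. 2 * (norm (g x))\<^sup>2 + 2 * (norm c)\<^sup>2 * (norm (h x))\<^sup>2)" using i by simp
  then show "integrable lborel (\<lambda>x. (norm (g x - c * h x))\<^sup>2)"
  proof (rule Bochner_Integration.integrable_bound)
    show "(\<lambda>x. (norm (g x - c * h x))\<^sup>2) \<in> borel_measurable lborel" using m by measurable
    have "(norm (g x - c * h x))\<^sup>2 \<le> 2 * (norm (g x))\<^sup>2 + 2 * (norm c)\<^sup>2 * (norm (h x))\<^sup>2" for x
    proof -
      have "(norm (g x - c * h x))\<^sup>2 \<le> (norm (g x) + norm (c * h x))\<^sup>2"
        by (intro power_mono norm_triangle_ineq4) auto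
      also have "\<dots> \<le> 2 * (norm (g x))\<^sup>2 + 2 * (norm (c * h x))\<^sup>2"
        using zero_le_power2[of "norm (g x) - norm (c * h x)"] by (simp add: power2_eq_square algebra_simps)
      finally show ?thesis by (simp add: norm_mult power_mult_distrib)
    qed
    then show "AE x in lborel. norm ((norm (g x - c * h x))\<^sup>2) \<le> norm (2 * (norm (g x))\<^sup>2 + 2 * (norm c)\<^sup>2 * (norm (h x))\<^sup>2)"
      by (intro AE_I2) simp
  qed
qed

lemma square_integrable_mult:
  assumes "square_integrable g" "square_integrable h"
  shows "integrable lborel (\<lambda>x. g x * h x)"
proof -
  have gh: "g \<in> borel_measurable lborel" "h \<in> borel_measurable lborel"
    and i: "integrable lborel (\<lambda>x. (norm (g x))\<^sup>2)" "integrable lborel (\<lambda>x. (norm (h x))\<^sup>2)"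
    using assms by (auto simp: square_integrable_def)
  have "integrable lborel (\<lambda>x. (norm (g x))\<^sup>2 + (norm (h x))\<^sup>2)" using i by simp
  then show ?thesis
  proof (rule Bochner_Integration.integrable_bound)
    show "(\<lambda>x. g x * h x) \<in> borel_measurable lborel" using gh by measurable
    have "norm (g x) * norm (h x) \<le> (norm (g x))\<^sup>2 + (norm (h x))\<^sup>2" for x
    proof -
      have "2 * (norm (g x) * norm (h x)) \<le> (norm (g x))\<^sup>2 + (norm (h x))\<^sup>2"
        using zero_le_power2[of "norm (g x) - norm (h x)"] by (simp add: power2_eq_square algebra_simps)
      moreover have "norm (g x) * norm (h x) \<ge> 0" by simp
      ultimately show ?thesis by linarith
    qed
    then show "AE x in lborel. norm (g x * h x) \<le> norm ((norm (g x))\<^sup>2 + (norm (h x))\<^sup>2)"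
      by (intro AE_I2) (simp add: norm_mult)
  qed
qed

context stark
begin

lemma decays_square_integrable:
  assumes c: "continuous_on UNIV k" and top: "decays k at_top" and bot: "decays k at_bot"
  shows "square_integrable k"
  unfolding square_integrable_def
proof
  show m: "k \<in> borel_measurable lborel" using c by (simp add: borel_measurable_continuous_onI)
  have "eventually (\<lambda>x. norm (of_real (x ^ 3) * k x) < 1) at_top" "eventually (\<lambda>x. norm (of_real (x ^ 3) * k x) < 1) at_bot"
    using tendsto_norm_zero[OF top[unfolded decays_def]] tendsto_norm_zero[OF bot[unfolded decays_def]]
    by (auto dest!: order_tendstoD(2)[where a=1])
  then obtain M N where MN: "\<And>x. x \<ge> M \<Longrightarrow> norm (of_real (x ^ 3) * k x) < 1" "\<And>x. x \<le> N \<Longrightarrow> norm (of_real (x ^ 3) * k x) < 1"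
    unfolding eventually_at_top_linorder eventually_at_bot_linorder by blast
  define Y where "Y = 1 + \<bar>M\<bar> + \<bar>N\<bar>"
  have Y: "Y \<ge> 1" by (simp add: Y_def)
  have far: "norm (of_real (x ^ 3) * k x) < 1" if "\<bar>x\<bar> \<ge> Y" for x
    using that MN[of x] by (cases "x \<ge> 0") (auto simp: Y_def)
  obtain B where B: "\<And>x. x \<in> {-Y..Y} \<Longrightarrow> norm (k x) \<le> B"
    using bounded_on_Icc[OF continuous_on_subset[OF c, of "{-Y..Y}"]] by blast
  \<comment> \<open>The first summand serves the interval on which k is merely bounded, the 2 serves
    the range where \<open>\<bar>x\<bar> * norm (k x) \<le> 1\<close> and
    \<open>x\<^sup>2 \<ge> 1\<close>.\<close>
  define C where "C = B\<^sup>2 * (1 + Y\<^sup>2) + 2"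
  have bd: "(norm (k x))\<^sup>2 \<le> C * inverse (1 + x\<^sup>2)" for x
  proof (cases "\<bar>x\<bar> \<ge> Y")
    case True
    then have x1: "\<bar>x\<bar> \<ge> 1" using Y by linarith
    then have "x\<^sup>2 \<ge> 1" using power_mono[of 1 "\<bar>x\<bar>" 2] by simp
    have "\<bar>x\<bar> * norm (k x) \<le> \<bar>x\<bar> ^ 3 * norm (k x)"
      using power_increasing[of 1 3 "\<bar>x\<bar>"] x1 by (intro mult_right_mono) auto
    also have "\<dots> < 1" using far[OF True] by (simp add: norm_mult norm_power power_abs)
    finally have "(\<bar>x\<bar> * norm (k x))\<^sup>2 \<le> 1" by (simp add: abs_square_le_1)
    then have "x\<^sup>2 * (norm (k x))\<^sup>2 \<le> 1" by (simp add: power_mult_distrib)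
    moreover have "1 * (norm (k x))\<^sup>2 \<le> x\<^sup>2 * (norm (k x))\<^sup>2" using \<open>x\<^sup>2 \<ge> 1\<close> by (intro mult_right_mono) auto
    ultimately have "(norm (k x))\<^sup>2 * (1 + x\<^sup>2) \<le> 2" by (simp add: algebra_simps)
    also have "2 \<le> C" by (simp add: C_def)
    finally show ?thesis by (simp add: field_simps add_pos_nonneg)
  next
    case False
    then have "x \<in> {-Y..Y}" by (auto simp: abs_if split: if_splits)
    then have "norm (k x) \<le> B" by (rule B)
    then have 1: "(norm (k x))\<^sup>2 \<le> B\<^sup>2" by (intro power_mono) auto
    have 2: "x\<^sup>2 \<le> Y\<^sup>2" using False Y by (simp flip: abs_le_square_iff)
    have "(norm (k x))\<^sup>2 * (1 + x\<^sup>2) \<le> B\<^sup>2 * (1 + Y\<^sup>2)" by (rule mult_mono) (use 1 2 in auto)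
    also have "\<dots> \<le> C" by (simp add: C_def)
    finally show ?thesis by (simp add: field_simps add_pos_nonneg)
  qed
  have e: "einterval (-\<infinity>) \<infinity> = (UNIV :: real set)" by (auto simp: einterval_def)
  have "integrable lborel (\<lambda>x::real. C * inverse (1 + x\<^sup>2))"
    using integrable_inverse_1_plus_square by (simp add: set_integrable_def e)
  then show "integrable lborel (\<lambda>x. (norm (k x))\<^sup>2)"
  proof (rule Bochner_Integration.integrable_bound)
    show "(\<lambda>x. (norm (k x))\<^sup>2) \<in> borel_measurable lborel" using m by measurable
    show "AE x in lborel. norm ((norm (k x))\<^sup>2) \<le> norm (C * inverse (1 + x\<^sup>2))"
      using bd by (intro AE_I2) (auto intro: order_trans[OF _ abs_ge_self])
  qed
qed

lemma decays_mult_const: "decays u F \<Longrightarrow> decays (\<lambda>x. u x * c) F"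
  unfolding decays_def using tendsto_mult_right[of "\<lambda>x. of_real (x ^ 3) * u x" 0 F c] by (simp add: mult.assoc)

text \<open>\<open>stark_delta\<close> says nothing about v at \<plusminus>\<kappa> themselves;
  resetting it there to its left limits leaves the integral equation intact, as that only concerns
  intervals avoiding these points.\<close>

lemma stark_delta_weak_sol:
  assumes "stark_delta \<kappa> \<eta> f u h"
  obtains v where "weak_sol u v h"
proof -
  from assms obtain v where v: "continuous_on UNIV u"
     "\<And>x. x \<notin> {-\<kappa>, \<kappa>} \<Longrightarrow> (u has_vector_derivative v x) (at x)"
     "\<And>s t. s \<le> t \<and> {s..t} \<inter> {-\<kappa>, \<kappa>} = {} \<Longrightarrow> set_integrable lborel {s..t} (\<lambda>x. complex_of_real (f * x) * u x - h x) \<and>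
             v t - v s = (LINT x:{s..t}|lborel. complex_of_real (f * x) * u x - h x)"
     "\<forall>c\<in>{-\<kappa>, \<kappa>}. \<exists>l r. (v \<longlongrightarrow> l) (at_left c) \<and> (v \<longlongrightarrow> r) (at_right c) \<and> r - l = u c / complex_of_real \<eta>"
    unfolding stark_delta_def by blast
  obtain l r where lr: "\<And>c. c \<in> {-\<kappa>, \<kappa>} \<Longrightarrow> (v \<longlongrightarrow> l c) (at_left c) \<and> (v \<longlongrightarrow> r c) (at_right c) \<and> r c - l c = u c / complex_of_real \<eta>"
    using v(4) by metis
  define w where "w = (\<lambda>x. if x \<in> {-\<kappa>, \<kappa>} then l x else v x)"
  have w: "w x = v x" if "x \<notin> {-\<kappa>, \<kappa>}" for x using that by (auto simp: w_def)
  have ev: "eventually (\<lambda>x. v x = w x) (at c within S)" for c S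
    using eventually_neq_at_within[of "-\<kappa>" c S] eventually_neq_at_within[of \<kappa> c S]
    by eventually_elim (simp add: w)
  have "jump u w" unfolding jump_def
  proof
    fix c assume c: "c \<in> {-\<kappa>, \<kappa>}"
    have "r c = l c + u c / complex_of_real \<eta>" using lr[OF c] by (metis add.commute diff_add_cancel)
    then have "w c = l c" "r c = w c + u c / complex_of_real \<eta>" using c by (auto simp: w_def)
    then show "(w \<longlongrightarrow> w c) (at_left c) \<and> (w \<longlongrightarrow> w c + u c / complex_of_real \<eta>) (at_right c)"
      using lr[OF c] Lim_transform_eventually[OF _ ev] by metis
  qed
  moreover have "set_integrable lborel {s..t} (\<lambda>x. complex_of_real (f * x) * u x - h x) \<and>
             w t - w s = (LINT x:{s..t}|lborel. complex_of_real (f * x) * u x - h x)"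
    if st: "s \<le> t \<and> {s..t} \<inter> {-\<kappa>, \<kappa>} = {}" for s t
  proof -
    have "s \<in> {s..t}" "t \<in> {s..t}" using st by auto
    then have "w s = v s" "w t = v t" using st w by blast+
    then show ?thesis using v(3)[OF st] by simp
  qed
  moreover have "(u has_vector_derivative w x) (at x)" if "x \<notin> {-\<kappa>, \<kappa>}" for x
    using v(2)[OF that] w[OF that] by simp
  ultimately have "weak_sol u w h" unfolding weak_sol_def using v(1) by blast
  then show ?thesis by (rule that)
qed

text \<open>Square integrability controls u and h only on average: on [-M, M] the integral of
  \<open>f * \<bar>x\<bar> * norm (u x) + norm (h x)\<close> is of order M^2, by r \<le> 1 + r^2.
  Integrating once bounds v by a multiple of x^2, integrating again bounds u by a multiple of
  |x|^3.\<close>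

lemma weak_sol_growth:
  assumes u: "weak_sol u v h" and L2: "square_integrable u" "square_integrable h"
  obtains C where "C \<ge> 0" "\<And>x. \<bar>x\<bar> \<ge> \<kappa> + 1 \<Longrightarrow> norm (v x) \<le> C * \<bar>x\<bar> ^ 3 \<and> norm (u x) \<le> C * \<bar>x\<bar> ^ 3"
proof -
  let ?U = "LINT x|lborel. (norm (u x))\<^sup>2" and ?H = "LINT x|lborel. (norm (h x))\<^sup>2"
  have i: "integrable lborel (\<lambda>x. (norm (u x))\<^sup>2)" "integrable lborel (\<lambda>x. (norm (h x))\<^sup>2)"
    using L2 by (auto simp: square_integrable_def)
  have UH: "?U \<ge> 0" "?H \<ge> 0" by (rule integral_nonneg_AE; simp)+
  define C1 where "C1 = f * (2 + ?U) + 2 + ?H"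
  have C1: "C1 \<ge> 0" using pos UH by (simp add: C1_def)
  have inc: "norm (v t - v s) \<le> C1 * M\<^sup>2"
    if st: "s \<le> t" "{s..t} \<inter> {-\<kappa>, \<kappa>} = {}" and M: "\<bar>s\<bar> \<le> M" "\<bar>t\<bar> \<le> M" "M \<ge> 1" for s t M
  proof -
    let ?k = "\<lambda>x. complex_of_real (f * x) * u x - h x"
    have k: "set_integrable lborel {s..t} ?k" and eq: "v t - v s = (LINT x:{s..t}|lborel. ?k x)"
      using weak_solD[OF u st] by auto
    have i1: "integrable lborel (\<lambda>x. indicator {s..t} x * (f * M + 1))"
      using borel_integrable_atLeastAtMost'[of s t "\<lambda>_. f * M + 1"] by (simp add: set_integrable_def)
    have "norm (v t - v s) \<le> (LINT x|lborel. norm (indicator {s..t} x *\<^sub>R ?k x))"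
      unfolding eq set_lebesgue_integral_def by (rule integral_norm_bound)
    also have "\<dots> \<le> (LINT x|lborel. indicator {s..t} x * (f * M + 1) + (f * M * (norm (u x))\<^sup>2 + (norm (h x))\<^sup>2))"
    proof (rule integral_mono)
      show "integrable lborel (\<lambda>x. norm (indicator {s..t} x *\<^sub>R ?k x))"
        by (rule integrable_norm, use k in \<open>simp only: set_integrable_def\<close>)
      show "integrable lborel (\<lambda>x. indicator {s..t} x * (f * M + 1) + (f * M * (norm (u x))\<^sup>2 + (norm (h x))\<^sup>2))"
        using i1 i by simp
      fix x
      show "norm (indicator {s..t} x *\<^sub>R ?k x) \<le> indicator {s..t} x * (f * M + 1) + (f * M * (norm (u x))\<^sup>2 + (norm (h x))\<^sup>2)"
      proof (cases "x \<in> {s..t}")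
        case True
        have sq: "r \<le> 1 + r\<^sup>2" for r :: real using zero_le_power2[of "r - 1/2"] by (simp add: power2_eq_square algebra_simps)
        have "norm (?k x) \<le> norm (complex_of_real (f * x) * u x) + norm (h x)" by (rule norm_triangle_ineq4)
        also have "norm (complex_of_real (f * x) * u x) \<le> f * M * (1 + (norm (u x))\<^sup>2)"
          unfolding norm_mult norm_of_real using pos True M sq[of "norm (u x)"] by (intro mult_mono) (auto simp: abs_mult)
        also have "norm (h x) \<le> 1 + (norm (h x))\<^sup>2" by (rule sq)
        finally show ?thesis using True by (simp add: algebra_simps)
      next
        case False
        then show ?thesis using pos M by simp
      qed
    qed
    also have "\<dots> = (LINT x|lborel. indicator {s..t} x * (f * M + 1)) + (f * M * ?U + ?H)"
      using i1 i by simp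
    also have "(LINT x|lborel. indicator {s..t} x * (f * M + 1)) = (t - s) * (f * M + 1)"
      using st by simp
    also have "\<dots> \<le> (2 * M) * (f * M + 1)" using M pos by (intro mult_right_mono) auto
    also have "2 * M * (f * M + 1) + (f * M * ?U + ?H) \<le> C1 * M\<^sup>2"
    proof -
      have MM: "M \<le> M\<^sup>2" "1 \<le> M\<^sup>2"
        using M mult_left_mono[of 1 M M] one_le_power[of M 2] by (auto simp: power2_eq_square)
      have "f * M * ?U \<le> f * M\<^sup>2 * ?U" using MM pos UH by (intro mult_right_mono mult_left_mono) auto
      moreover have "?H * 1 \<le> ?H * M\<^sup>2" using MM UH by (intro mult_left_mono) auto
      ultimately show ?thesis using MM by (simp add: C1_def algebra_simps power2_eq_square)
    qed
    finally show ?thesis by simp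
  qed
  \<comment> \<open>Base points outside the two deltas, one on each side, so that increments from
    them to x never cross \<plusminus>\<kappa>.\<close>
  let ?c = "\<kappa> + 1"
  define C2 where "C2 = C1 + norm (v ?c) + norm (v (- ?c))"
  have C2: "C2 \<ge> 0" using C1 by (simp add: C2_def)
  have vb: "norm (v x) \<le> C2 * \<bar>x\<bar>\<^sup>2" if x: "\<bar>x\<bar> \<ge> ?c" for x
  proof -
    have ex: "\<exists>c\<in>{?c, -?c}. norm (v x) \<le> norm (v c) + C1 * \<bar>x\<bar>\<^sup>2"
    proof (cases "x \<ge> 0")
      case True
      then have "norm (v x - v ?c) \<le> C1 * \<bar>x\<bar>\<^sup>2" using x pos by (intro inc) auto
      then show ?thesis using norm_triangle_ineq[of "v x - v ?c" "v ?c"] by auto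
    next
      case False
      then have "norm (v (-?c) - v x) \<le> C1 * \<bar>x\<bar>\<^sup>2" using x pos by (intro inc) auto
      then show ?thesis using norm_triangle_ineq4[of "v (-?c)" "v (-?c) - v x"] by auto
    qed
    have "\<bar>x\<bar>\<^sup>2 \<ge> 1" by (intro one_le_power) (use x pos in linarith)
    then have le: "norm (v ?c) + norm (v (- ?c)) \<le> (norm (v ?c) + norm (v (- ?c))) * \<bar>x\<bar>\<^sup>2"
      using mult_left_mono[of 1 "\<bar>x\<bar>\<^sup>2" "norm (v ?c) + norm (v (- ?c))"] by simp
    have "norm (v c) \<le> norm (v ?c) + norm (v (- ?c))" if "c \<in> {?c, -?c}" for c using that by auto
    with ex have "norm (v x) \<le> norm (v ?c) + norm (v (- ?c)) + C1 * \<bar>x\<bar>\<^sup>2" by (meson add_right_mono order_trans)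
    with le show ?thesis unfolding C2_def distrib_right by linarith
  qed
  have uinc: "norm (u t - u s) \<le> C2 * M\<^sup>2 * (t - s)"
    if st: "s \<le> t" and far: "\<And>y. y \<in> {s..t} \<Longrightarrow> \<bar>y\<bar> \<ge> ?c" and M: "\<bar>s\<bar> \<le> M" "\<bar>t\<bar> \<le> M" for s t M
  proof -
    have "(v has_integral u t - u s) {s..t}"
    proof (rule fundamental_theorem_of_calculus[OF st])
      fix x assume "x \<in> {s..t}"
      then have "x \<notin> {-\<kappa>, \<kappa>}" using far[of x] pos by auto
      then show "(u has_vector_derivative v x) (at x within {s..t})"
        using u by (auto simp: weak_sol_def intro: has_vector_derivative_at_within)
    qed
    moreover have "norm (v y) \<le> C2 * M\<^sup>2" if "y \<in> {s..t}" for y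
    proof -
      have "\<bar>y\<bar>\<^sup>2 \<le> M\<^sup>2" using that M by (intro power_mono) auto
      then show ?thesis using vb[OF far[OF that]] C2 by (meson mult_left_mono order_trans)
    qed
    ultimately have "norm (u t - u s) \<le> C2 * M\<^sup>2 * measure lborel {s..t}"
      by (intro has_integral_bound_real[where S="{}" and f=v]) (use C2 in auto)
    then show ?thesis using st by simp
  qed
  define C where "C = C2 + norm (u ?c) + norm (u (- ?c))"
  show ?thesis
  proof (rule that[of C])
    show "C \<ge> 0" using C2 by (simp add: C_def)
    fix x assume x: "\<bar>x\<bar> \<ge> ?c"
    have x1: "\<bar>x\<bar> \<ge> 1" using x pos by simp
    have "\<bar>x\<bar>\<^sup>2 \<le> \<bar>x\<bar> ^ 3" using x1 by (intro power_increasing) auto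
    then have "C2 * \<bar>x\<bar>\<^sup>2 \<le> C2 * \<bar>x\<bar> ^ 3" using C2 by (rule mult_left_mono)
    moreover have "C2 * \<bar>x\<bar> ^ 3 \<le> C * \<bar>x\<bar> ^ 3" by (intro mult_right_mono) (auto simp: C_def)
    ultimately have v: "norm (v x) \<le> C * \<bar>x\<bar> ^ 3" using vb[OF x] by linarith
    have ex: "\<exists>c\<in>{?c, -?c}. norm (u x) \<le> norm (u c) + C2 * \<bar>x\<bar>\<^sup>2 * \<bar>x\<bar>"
    proof (cases "x \<ge> 0")
      case True
      then have "norm (u x - u ?c) \<le> C2 * \<bar>x\<bar>\<^sup>2 * (x - ?c)" using x pos by (intro uinc) auto
      also have "\<dots> \<le> C2 * \<bar>x\<bar>\<^sup>2 * \<bar>x\<bar>" using C2 pos True by (intro mult_left_mono) auto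
      finally show ?thesis using norm_triangle_ineq[of "u x - u ?c" "u ?c"] by auto
    next
      case False
      then have "norm (u (-?c) - u x) \<le> C2 * \<bar>x\<bar>\<^sup>2 * (-?c - x)" using x pos by (intro uinc) auto
      also have "\<dots> \<le> C2 * \<bar>x\<bar>\<^sup>2 * \<bar>x\<bar>" using C2 pos False by (intro mult_left_mono) auto
      finally show ?thesis using norm_triangle_ineq4[of "u (-?c)" "u (-?c) - u x"] by auto
    qed
    have "\<bar>x\<bar> ^ 3 \<ge> 1" using x1 by (rule one_le_power)
    then have le: "norm (u ?c) + norm (u (- ?c)) \<le> (norm (u ?c) + norm (u (- ?c))) * \<bar>x\<bar> ^ 3"
      using mult_left_mono[of 1 "\<bar>x\<bar> ^ 3" "norm (u ?c) + norm (u (- ?c))"] by simp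
    have eq: "C2 * \<bar>x\<bar>\<^sup>2 * \<bar>x\<bar> = C2 * \<bar>x\<bar> ^ 3" by (simp only: power3_eq_cube power2_eq_square mult.assoc)
    have "norm (u c) \<le> norm (u ?c) + norm (u (- ?c))" if "c \<in> {?c, -?c}" for c using that by auto
    with ex have "norm (u x) \<le> norm (u ?c) + norm (u (- ?c)) + C2 * \<bar>x\<bar> ^ 3" unfolding eq by (meson add_right_mono order_trans)
    with le have "norm (u x) \<le> C * \<bar>x\<bar> ^ 3" unfolding C_def distrib_right by linarith
    with v show "norm (v x) \<le> C * \<bar>x\<bar> ^ 3 \<and> norm (u x) \<le> C * \<bar>x\<bar> ^ 3" by simp
  qed
qed

lemma wronskian_vanishes:
  assumes u: "weak_sol u v h" "square_integrable u" "square_integrable h"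
    and d: "decays \<psi> F" "decays \<xi> F" "F = at_top \<or> F = at_bot"
  shows "(wronskian \<psi> \<xi> u v \<longlongrightarrow> 0) F"
proof -
  obtain C where C: "C \<ge> 0" "\<And>x. \<bar>x\<bar> \<ge> \<kappa> + 1 \<Longrightarrow> norm (v x) \<le> C * \<bar>x\<bar> ^ 3 \<and> norm (u x) \<le> C * \<bar>x\<bar> ^ 3"
    using weak_sol_growth[OF u] by blast
  have ev: "eventually (\<lambda>x. \<bar>x\<bar> \<ge> \<kappa> + 1) F" using d(3) pos
    by (auto intro: eventually_mono[OF eventually_ge_at_top[of "\<kappa> + 1"]] eventually_mono[OF eventually_le_at_bot[of "-\<kappa> - 1"]])
  have "((\<lambda>x. C * norm (of_real (x ^ 3) * \<psi> x) + C * norm (of_real (x ^ 3) * \<xi> x)) \<longlongrightarrow> C * norm (0::complex) + C * norm (0::complex)) F"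
    by (intro tendsto_intros) (use d in \<open>auto simp: decays_def\<close>)
  then have "((\<lambda>x. C * norm (of_real (x ^ 3) * \<psi> x) + C * norm (of_real (x ^ 3) * \<xi> x)) \<longlongrightarrow> 0) F" by simp
  then show ?thesis
  proof (rule Lim_null_comparison[rotated])
    show "\<forall>\<^sub>F x in F. norm (wronskian \<psi> \<xi> u v x) \<le> C * norm (of_real (x ^ 3) * \<psi> x) + C * norm (of_real (x ^ 3) * \<xi> x)"
      using ev
    proof eventually_elim
      case (elim x)
      have "norm (wronskian \<psi> \<xi> u v x) \<le> norm (\<psi> x) * norm (v x) + norm (\<xi> x) * norm (u x)"
        unfolding wronskian_def using norm_triangle_ineq4[of "\<psi> x * v x" "\<xi> x * u x"] by (simp add: norm_mult)
      also have "\<dots> \<le> norm (\<psi> x) * (C * \<bar>x\<bar> ^ 3) + norm (\<xi> x) * (C * \<bar>x\<bar> ^ 3)"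
        using C(2)[OF elim] by (intro add_mono mult_left_mono) auto
      finally show ?case by (simp add: norm_mult norm_power power_abs mult_ac)
    qed
  qed
qed

definition greenK :: "complex \<Rightarrow> real \<Rightarrow> real \<Rightarrow> complex" where
  "greenK z x y = psi_plus z (max x y) * psi_minus z (min x y) / (W * D z)"

lemma psi_plus_cont: "continuous_on S (psi_plus z)" and psi_minus_cont: "continuous_on S (psi_minus z)"
  using psi_plus_strong_sol[of z] psi_minus_strong_sol[of z] by (auto simp: strong_sol_def intro: continuous_on_subset)

lemma greenK_cont: "continuous_on UNIV (\<lambda>(x, y). greenK z x y)"
proof -
  have "continuous_on UNIV (\<lambda>p::real \<times> real. psi_plus z (max (fst p) (snd p)))" "continuous_on UNIV (\<lambda>p::real \<times> real. psi_minus z (min (fst p) (snd p)))"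
    by (rule continuous_on_compose2[OF psi_plus_cont[of UNIV]] continuous_on_compose2[OF psi_minus_cont[of UNIV]],
        intro continuous_intros, simp)+
  then have "continuous_on UNIV (\<lambda>p::real \<times> real. psi_plus z (max (fst p) (snd p)) * psi_minus z (min (fst p) (snd p)) * inverse (W * D z))"
    by (intro continuous_intros)
  then show ?thesis by (simp add: split_def greenK_def divide_inverse)
qed

lemma greenK_square_integrable:
  assumes "Im z > 0"
  shows "square_integrable (greenK z x)"
proof (rule decays_square_integrable)
  show "continuous_on UNIV (greenK z x)"
    using continuous_on_compose2[OF greenK_cont[of z], of UNIV "\<lambda>y. (x, y)"] by (simp add: continuous_intros)
  show "decays (greenK z x) at_top"
  proof (rule decays_cong[OF _ decays_mult_const[OF psi_plus_decays(1), of z "psi_minus z x / (W * D z)"]])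
    show "\<forall>\<^sub>F y in at_top. psi_plus z y * (psi_minus z x / (W * D z)) = greenK z x y"
      using eventually_ge_at_top[of x] by eventually_elim (simp add: greenK_def max_def min_def)
  qed
  show "decays (greenK z x) at_bot"
  proof (rule decays_cong[OF _ decays_mult_const[OF psi_minus_decays(1)[OF assms], of "psi_plus z x / (W * D z)"]])
    show "\<forall>\<^sub>F y in at_bot. psi_minus z y * (psi_plus z x / (W * D z)) = greenK z x y"
      using eventually_le_at_bot[of x] by eventually_elim (simp add: greenK_def max_def min_def)
  qed
qed

text \<open>Lagrange's identity with \<open>psi_minus\<close> on [-n, x] and with
  \<open>psi_plus\<close> on [x, n]. The boundary terms at \<plusminus>n vanish in the limit; at x
  the terms with v cancel and leave u(x) times the Wronskian \<open>W * D z\<close>.\<close>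

lemma greenK_reproduces:
  assumes z: "Im z > 0" and "stark_delta \<kappa> \<eta> f u h"
  shows "has_bochner_integral lborel (\<lambda>y. greenK z x y * (h y - z * u y)) (u x)"
proof -
  have L2: "square_integrable u" "square_integrable h" using assms by (auto simp: stark_delta_def)
  obtain v where u: "weak_sol u v h" using stark_delta_weak_sol[OF assms(2)] .
  let ?g = "\<lambda>y. h y - z * u y" and ?c = "W * D z"
  let ?G = "\<lambda>y. greenK z x y * ?g y"
  have cnz: "?c \<noteq> 0" using D_nonzero_upper[OF z] by simp
  have int: "integrable lborel ?G"
    by (rule square_integrable_mult[OF greenK_square_integrable[OF z] square_integrable_lincomb[OF L2(2,1)]])
  have hl: "set_integrable lborel {s..t} h" for s t by (rule square_integrable_L1[OF L2(2)])
  let ?wp = "wronskian (psi_plus z) (psi_plus' z) u v" and ?wm = "wronskian (psi_minus z) (psi_minus' z) u v"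
  note ip = wronskian_increment[OF psi_plus_strong_sol[of z] u hl]
  note im = wronskian_increment[OF psi_minus_strong_sol[of z] u hl]
  \<comment> \<open>The integral over the line as a limit over bounded intervals; the integrand is
    absolutely integrable as a product of two square-integrable functions.\<close>
  have lim: "(\<lambda>n::nat. LINT y:{- real n..real n}|lborel. ?G y) \<longlonglongrightarrow> (LINT y|lborel. ?G y)"
    unfolding set_lebesgue_integral_def
  proof (rule integral_dominated_convergence[where w="\<lambda>y. norm (?G y)"])
    show "AE y in lborel. (\<lambda>n. indicator {- real n..real n} y *\<^sub>R ?G y) \<longlonglongrightarrow> ?G y"
    proof (rule AE_I2, rule tendsto_eventually)
      fix y
      obtain N :: nat where N: "\<bar>y\<bar> \<le> real N" using real_arch_simple by blast
      show "\<forall>\<^sub>F n in sequentially. indicator {- real n..real n} y *\<^sub>R ?G y = ?G y"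
        using eventually_ge_at_top[of N]
      proof eventually_elim
        case (elim n)
        then have "real N \<le> real n" by simp
        then have "y \<in> {- real n..real n}" using N by auto
        then show ?case by simp
      qed
    qed
  qed (use int in \<open>auto simp: indicator_def borel_measurable_integrable intro!: AE_I2\<close>)
  have val: "(LINT y:{- n..n}|lborel. ?G y) =
      (- psi_plus z x * (?wm x - ?wm (-n)) - psi_minus z x * (?wp n - ?wp x)) / ?c" if n: "n \<ge> \<bar>x\<bar>" for n
  proof -
    have le: "-n \<le> x" "x \<le> n" using n by auto
    have si: "set_integrable lborel S ?G" if "S \<in> sets lborel" for S unfolding set_integrable_def using int that by (rule integrable_mult_indicator[rotated])
    note hk = set_borel_integral_eq_integral[OF si]
    have "(LINT y:{-n..n}|lborel. ?G y) = integral {-n..n} ?G" by (rule hk(2)) simp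
    also have "\<dots> = integral {-n..x} ?G + integral {x..n} ?G"
      by (rule Henstock_Kurzweil_Integration.integral_combine[symmetric]) (use le hk(1) in auto)
    also have "integral {-n..x} ?G = (LINT y:{-n..x}|lborel. ?G y)" by (rule hk(2)[symmetric]) simp
    also have "\<dots> = (LINT y:{-n..x}|lborel. psi_plus z x / ?c * (psi_minus z y * ?g y))"
      by (rule set_lebesgue_integral_cong) (auto simp: greenK_def max_def min_def)
    also have "\<dots> = psi_plus z x / ?c * (LINT y:{-n..x}|lborel. psi_minus z y * ?g y)" by (rule set_integral_mult_right)
    also have "(LINT y:{-n..x}|lborel. psi_minus z y * ?g y) = - (?wm x - ?wm (-n))" using im(2)[OF le(1)] by simp
    also have "integral {x..n} ?G = (LINT y:{x..n}|lborel. ?G y)" by (rule hk(2)[symmetric]) simp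
    also have "\<dots> = (LINT y:{x..n}|lborel. psi_minus z x / ?c * (psi_plus z y * ?g y))"
      by (rule set_lebesgue_integral_cong) (auto simp: greenK_def max_def min_def)
    also have "\<dots> = psi_minus z x / ?c * (LINT y:{x..n}|lborel. psi_plus z y * ?g y)" by (rule set_integral_mult_right)
    also have "(LINT y:{x..n}|lborel. psi_plus z y * ?g y) = - (?wp n - ?wp x)" using ip(2)[OF le(2)] by simp
    also have "a / c * - A + b / c * - B = (- a * A - b * B) / c" for a b c A B :: complex
      by (simp add: diff_divide_distrib)
    finally show ?thesis .
  qed
  have wp: "(?wp \<longlongrightarrow> 0) at_top" by (rule wronskian_vanishes[OF u L2 psi_plus_decays]) simp
  have wm: "(?wm \<longlongrightarrow> 0) at_bot" by (rule wronskian_vanishes[OF u L2 psi_minus_decays[OF z]]) simp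
  have r: "filterlim (\<lambda>n::nat. real n) at_top sequentially" by (rule filterlim_real_sequentially)
  have wp': "(\<lambda>n. ?wp (real n)) \<longlonglongrightarrow> 0" by (rule filterlim_compose[OF wp r])
  have wm': "(\<lambda>n. ?wm (- real n)) \<longlonglongrightarrow> 0"
    by (rule filterlim_compose[OF wm]) (use r in \<open>simp add: filterlim_uminus_at_bot\<close>)
  have "(\<lambda>n. (- psi_plus z x * (?wm x - ?wm (- real n)) - psi_minus z x * (?wp (real n) - ?wp x)) / ?c) \<longlonglongrightarrow>
     (- psi_plus z x * (?wm x - 0) - psi_minus z x * (0 - ?wp x)) / ?c"
    by (intro tendsto_intros wp' wm' cnz)
  moreover have "\<forall>\<^sub>F n::nat in sequentially. (- psi_plus z x * (?wm x - ?wm (- real n)) - psi_minus z x * (?wp (real n) - ?wp x)) / ?c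
     = (LINT y:{- real n..real n}|lborel. ?G y)"
  proof -
    obtain N :: nat where N: "\<bar>x\<bar> \<le> real N" using real_arch_simple by blast
    show ?thesis using eventually_ge_at_top[of N] by eventually_elim (subst val, use N in auto)
  qed
  ultimately have "(\<lambda>n::nat. LINT y:{- real n..real n}|lborel. ?G y) \<longlonglongrightarrow> (- psi_plus z x * (?wm x - 0) - psi_minus z x * (0 - ?wp x)) / ?c"
    by (rule Lim_transform_eventually)
  from LIMSEQ_unique[OF lim this]
  have "(LINT y|lborel. ?G y) = (- psi_plus z x * (?wm x - 0) - psi_minus z x * (0 - ?wp x)) / ?c" .
  also have "- psi_plus z x * (?wm x - 0) - psi_minus z x * (0 - ?wp x) = wronskian (psi_plus z) (psi_plus' z) (psi_minus z) (psi_minus' z) x * u x"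
    by (simp add: wronskian_def algebra_simps)
  also have "\<dots> / ?c = u x" unfolding psi_plus_psi_minus_wronskian using cnz by simp
  finally show ?thesis using int by (simp add: has_bochner_integral_iff)
qed

end

text \<open>The oriented interval integral makes this valid on both sides of the base point
  p.\<close>

lemma antiderivative_on_line:
  fixes g :: "real \<Rightarrow> complex"
  assumes "continuous_on UNIV g"
  shows "((\<lambda>u. LBINT y=ereal p..ereal u. g y) has_vector_derivative g x) (at x)"
proof -
  let ?a = "min p x - 1" and ?b = "max p x + 1"
  have "((\<lambda>u. LBINT y=ereal p..ereal u. g y) has_vector_derivative g x) (at x within {?a..?b})"
    by (rule interval_integral_FTC2) (auto intro: continuous_on_subset[OF assms])
  moreover have "at x within {?a..?b} = at x"
    by (rule at_within_interior) auto
  ultimately show ?thesis by simp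
qed

lemma constant_of_zero_derivative:
  fixes F :: "real \<Rightarrow> complex"
  assumes d: "\<And>y. (F has_vector_derivative F' y) (at y)" and "a \<le> b" and 0: "\<And>y. a < y \<Longrightarrow> y < b \<Longrightarrow> F' y = 0"
  shows "F a = F b"
proof -
  have "F b = F a"
  proof (rule has_derivative_zero_unique_strong_interval[where k="{a, b}" and a=a and b=b])
    show "continuous_on {a..b} F"
      by (intro continuous_at_imp_continuous_on ballI has_vector_derivative_continuous[OF d])
    show "(F has_derivative (\<lambda>h. 0)) (at y within {a..b})" if "y \<in> {a..b} - {a, b}" for y
      using d[of y] 0[of y] that by (auto simp: has_vector_derivative_def intro: has_derivative_at_withinI)
  qed (use assms in auto)
  then show ?thesis by simp
qed

context stark
begin

section \<open>The resolvent on compactly supported data, and uniqueness of the kernel\<close>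

lemma strong_sol_imp_stark_delta:
  assumes s: "strong_sol u v h" and L2: "square_integrable u" "square_integrable h"
  shows "stark_delta \<kappa> \<eta> f u h"
proof -
  have w: "weak_sol u v h" by (rule strong_imp_weak_sol[OF s])
  have "\<exists>l r. (v \<longlongrightarrow> l) (at_left c) \<and> (v \<longlongrightarrow> r) (at_right c) \<and> r - l = u c / complex_of_real \<eta>" if "c \<in> {-\<kappa>, \<kappa>}" for c
    using w that unfolding weak_sol_def jump_def
    by (intro exI[of _ "v c"] exI[of _ "v c + u c / complex_of_real \<eta>"]) auto
  then show ?thesis using w L2 unfolding stark_delta_def weak_sol_def
    by (intro conjI exI[of _ v]) auto
qed

text \<open>Variation of constants. As g vanishes outside [p, q], F is zero left of p and H is zero
  right of q, so u is a multiple of \<open>psi_minus\<close> on the far left and of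
  \<open>psi_plus\<close> on the far right and decays. These data are rich enough to separate
  continuous kernels.\<close>

lemma resolvent_exists:
  assumes z: "Im z > 0" and g: "continuous_on UNIV g" and supp: "\<And>x. x \<notin> {p..q} \<Longrightarrow> g x = 0" and pq: "p \<le> q"
  obtains u where "stark_delta \<kappa> \<eta> f u (\<lambda>x. z * u x + g x)"
proof -
  let ?c = "W * D z"
  have cnz: "?c \<noteq> 0" using D_nonzero_upper[OF z] by simp
  define F where "F x = (LBINT y=ereal p..ereal x. psi_minus z y * g y)" for x
  define H where "H x = - (LBINT y=ereal q..ereal x. psi_plus z y * g y)" for x
  have dF: "(F has_vector_derivative psi_minus z x * g x) (at x)" for x
    unfolding F_def by (rule antiderivative_on_line[OF continuous_on_mult[OF psi_minus_cont g]])
  have dH: "(H has_vector_derivative - (psi_plus z x * g x)) (at x)" for x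
    unfolding H_def by (intro has_vector_derivative_minus antiderivative_on_line[OF continuous_on_mult[OF psi_plus_cont g]])
  have F0: "F x = F p" if "x \<le> p" for x
    by (rule constant_of_zero_derivative[OF dF that]) (use supp in auto)
  have Fq: "F x = F q" if "q \<le> x" for x
    by (rule constant_of_zero_derivative[OF dF that, symmetric]) (use supp in auto)
  have H0: "H x = H p" if "x \<le> p" for x
    by (rule constant_of_zero_derivative[OF dH that]) (use supp in auto)
  have Hq: "H x = H q" if "q \<le> x" for x
    by (rule constant_of_zero_derivative[OF dH that, symmetric]) (use supp in auto)
  have Fp: "F p = 0" by (simp add: F_def)
  have Hq0: "H q = 0" by (simp add: H_def)
  define u where "u x = (psi_plus z x * F x + psi_minus z x * H x) / ?c" for x
  define v where "v x = (psi_plus' z x * F x + psi_minus' z x * H x) / ?c" for x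
  have cF: "isCont F x" and cH: "isCont H x" for x
    by (rule has_vector_derivative_continuous[OF dF] has_vector_derivative_continuous[OF dH])+
  have cu: "continuous_on UNIV u" unfolding u_def
    by (intro continuous_intros psi_plus_cont psi_minus_cont continuous_at_imp_continuous_on ballI cF cH) (use cnz in auto)
  note sp = psi_plus_strong_sol[of z, unfolded strong_sol_def] and sm = psi_minus_strong_sol[of z, unfolded strong_sol_def]
  have "jump u v" unfolding jump_def
  proof
    fix c assume c: "c \<in> {-\<kappa>, \<kappa>}"
    have tl: "(F \<longlongrightarrow> F c) (at c within S)" "(H \<longlongrightarrow> H c) (at c within S)" for S
      using cF[of c] cH[of c] by (auto simp: isCont_def intro: tendsto_within_subset)
    have jp: "(psi_plus' z \<longlongrightarrow> psi_plus' z c) (at_left c)" "(psi_plus' z \<longlongrightarrow> psi_plus' z c + psi_plus z c / complex_of_real \<eta>) (at_right c)"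
      and jm: "(psi_minus' z \<longlongrightarrow> psi_minus' z c) (at_left c)" "(psi_minus' z \<longlongrightarrow> psi_minus' z c + psi_minus z c / complex_of_real \<eta>) (at_right c)"
      using sp sm c unfolding jump_def by blast+
    have "(v \<longlongrightarrow> v c) (at_left c)" unfolding v_def
      by (intro tendsto_intros tl jp jm) (use cnz in auto)
    moreover have "(v \<longlongrightarrow> ((psi_plus' z c + psi_plus z c / complex_of_real \<eta>) * F c + (psi_minus' z c + psi_minus z c / complex_of_real \<eta>) * H c) / ?c) (at_right c)"
      unfolding v_def by (intro tendsto_intros tl jp jm) (use cnz in auto)
    moreover have "((psi_plus' z c + psi_plus z c / complex_of_real \<eta>) * F c + (psi_minus' z c + psi_minus z c / complex_of_real \<eta>) * H c) / ?c = v c + u c / complex_of_real \<eta>"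
      using cnz pos by (simp add: u_def v_def field_simps)
    ultimately show "(v \<longlongrightarrow> v c) (at_left c) \<and> (v \<longlongrightarrow> v c + u c / complex_of_real \<eta>) (at_right c)" by simp
  qed
  moreover have "(u has_vector_derivative v x) (at x) \<and>
        (v has_vector_derivative complex_of_real (f * x) * u x - (z * u x + g x)) (at x)" if x: "x \<notin> {-\<kappa>, \<kappa>}" for x
  proof
    have dp: "(psi_plus z has_vector_derivative psi_plus' z x) (at x)" "(psi_plus' z has_vector_derivative complex_of_real (f * x) * psi_plus z x - z * psi_plus z x) (at x)"
      and dm: "(psi_minus z has_vector_derivative psi_minus' z x) (at x)" "(psi_minus' z has_vector_derivative complex_of_real (f * x) * psi_minus z x - z * psi_minus z x) (at x)"
      using sp sm x by blast+
    have "(u has_vector_derivative ((psi_plus z x * (psi_minus z x * g x) + psi_plus' z x * F x) + (psi_minus z x * - (psi_plus z x * g x) + psi_minus' z x * H x)) / ?c) (at x)"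
      unfolding u_def by (intro has_vector_derivative_divide has_vector_derivative_add has_vector_derivative_mult dp dm dF dH)
    then show "(u has_vector_derivative v x) (at x)" by (simp add: v_def algebra_simps)
    have wr: "psi_plus z x * psi_minus' z x - psi_plus' z x * psi_minus z x = ?c" using psi_plus_psi_minus_wronskian[of z x] by (simp add: wronskian_def)
    have "(v has_vector_derivative ((psi_plus' z x * (psi_minus z x * g x) + (complex_of_real (f * x) * psi_plus z x - z * psi_plus z x) * F x)
       + (psi_minus' z x * - (psi_plus z x * g x) + (complex_of_real (f * x) * psi_minus z x - z * psi_minus z x) * H x)) / ?c) (at x)"
      unfolding v_def by (intro has_vector_derivative_divide has_vector_derivative_add has_vector_derivative_mult dp dm dF dH)
    also have "(psi_plus' z x * (psi_minus z x * g x) + (complex_of_real (f * x) * psi_plus z x - z * psi_plus z x) * F x)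
       + (psi_minus' z x * - (psi_plus z x * g x) + (complex_of_real (f * x) * psi_minus z x - z * psi_minus z x) * H x)
       = (complex_of_real (f * x) - z) * (psi_plus z x * F x + psi_minus z x * H x) - (psi_plus z x * psi_minus' z x - psi_plus' z x * psi_minus z x) * g x"
      by (simp add: algebra_simps)
    also have "\<dots> / ?c = complex_of_real (f * x) * u x - (z * u x + g x)"
      unfolding wr u_def using cnz by (simp add: field_simps)
    finally show "(v has_vector_derivative complex_of_real (f * x) * u x - (z * u x + g x)) (at x)" .
  qed
  ultimately have s: "strong_sol u v (\<lambda>x. z * u x + g x)"
    unfolding strong_sol_def using cu g by (auto intro!: continuous_intros)
  have top: "decays u at_top"
  proof (rule decays_cong[OF _ decays_mult_const[OF psi_plus_decays(1), of z "F q / ?c"]])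
    show "\<forall>\<^sub>F x in at_top. psi_plus z x * (F q / ?c) = u x"
      using eventually_ge_at_top[of q]
    proof eventually_elim
      case (elim x)
      have "F x = F q" "H x = 0" using Fq[OF elim] Hq[OF elim] Hq0 by auto
      then show ?case by (simp add: u_def)
    qed
  qed
  have bot: "decays u at_bot"
  proof (rule decays_cong[OF _ decays_mult_const[OF psi_minus_decays(1)[OF z], of "H p / ?c"]])
    show "\<forall>\<^sub>F x in at_bot. psi_minus z x * (H p / ?c) = u x"
      using eventually_le_at_bot[of p]
    proof eventually_elim
      case (elim x)
      have "H x = H p" "F x = 0" using F0[OF elim] H0[OF elim] Fp by auto
      then show ?case by (simp add: u_def)
    qed
  qed
  have "square_integrable (\<lambda>x. z * u x + g x)"
  proof (rule decays_square_integrable)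
    show "continuous_on UNIV (\<lambda>x. z * u x + g x)" using cu g by (intro continuous_intros)
    show "decays (\<lambda>x. z * u x + g x) at_top"
    proof (rule decays_cong[OF _ decays_mult_const[OF top, of z]])
      show "\<forall>\<^sub>F x in at_top. u x * z = z * u x + g x"
        using eventually_gt_at_top[of q] by eventually_elim (use supp in auto)
    qed
    show "decays (\<lambda>x. z * u x + g x) at_bot"
    proof (rule decays_cong[OF _ decays_mult_const[OF bot, of z]])
      show "\<forall>\<^sub>F x in at_bot. u x * z = z * u x + g x"
        using eventually_le_at_bot[of "p - 1"] by eventually_elim (use supp in auto)
    qed
  qed
  then have "stark_delta \<kappa> \<eta> f u (\<lambda>x. z * u x + g x)"
    by (intro strong_sol_imp_stark_delta[OF s] decays_square_integrable[OF cu top bot])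
  then show ?thesis by (rule that)
qed

text \<open>For fixed x0 the difference k of the kernels annihilates all data of
  \<open>resolvent_exists\<close>. Testing with \<open>cnj (k y)\<close> times a bump at y0 gives a
  vanishing integral of a continuous nonnegative function with value
  \<open>(norm (k y0))\<^sup>2\<close> at y0.\<close>

lemma greens_function_unique:
  assumes z: "Im z > 0" and K: "is_greens_function \<kappa> \<eta> f z K1" "is_greens_function \<kappa> \<eta> f z K2"
  shows "K1 = K2"
proof (intro ext)
  fix x0 y0
  have cont: "continuous_on UNIV (K x0)" if "is_greens_function \<kappa> \<eta> f z K" for K
  proof -
    have "continuous_on UNIV (\<lambda>(x, y). K x y)" using that by (simp add: is_greens_function_def)
    from continuous_on_compose2[OF this, of UNIV "\<lambda>y. (x0, y)"]
    show ?thesis by (simp add: continuous_intros)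
  qed
  define k where "k y = K1 x0 y - K2 x0 y" for y
  have ck: "continuous_on S k" for S unfolding k_def
    by (rule continuous_on_subset[of UNIV]) (intro continuous_intros cont K, simp)
  define bump where "bump y = max 0 (1 - \<bar>y - y0\<bar>)" for y :: real
  have cb: "continuous_on S bump" for S unfolding bump_def by (intro continuous_intros)
  define g where "g y = cnj (k y) * of_real (bump y)" for y
  have cg: "continuous_on UNIV g" unfolding g_def by (intro continuous_intros ck cb)
  have "g y = 0" if "y \<notin> {y0 - 1..y0 + 1}" for y using that by (auto simp: g_def bump_def)
  then obtain u where u: "stark_delta \<kappa> \<eta> f u (\<lambda>x. z * u x + g x)"
    using resolvent_exists[OF z cg, of "y0 - 1" "y0 + 1"] by auto
  have "has_bochner_integral lborel (\<lambda>y. K x0 y * g y) (u x0)" if "is_greens_function \<kappa> \<eta> f z K" for K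
    using that u by (fastforce simp: is_greens_function_def)
  from has_bochner_integral_diff[OF this[OF K(1)] this[OF K(2)]]
  have "has_bochner_integral lborel (\<lambda>y. k y * g y) 0" by (simp add: k_def left_diff_distrib)
  moreover have "k y * g y = of_real ((norm (k y))\<^sup>2 * bump y)" for y
    unfolding g_def of_real_mult complex_norm_square by simp
  ultimately have "has_bochner_integral lborel (\<lambda>y. complex_of_real ((norm (k y))\<^sup>2 * bump y)) 0" by simp
  then have 0: "integrable lborel (\<lambda>y. (norm (k y))\<^sup>2 * bump y)" "(LINT y|lborel. (norm (k y))\<^sup>2 * bump y) = 0"
    by (auto simp: has_bochner_integral_iff complex_of_real_integrable_eq simp del: of_real_mult of_real_power)
  let ?F = "\<lambda>y. (norm (k y))\<^sup>2 * bump y"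
  have "(?F has_integral 0) UNIV" using has_integral_integral_lborel[OF 0(1)] 0(2) by simp
  moreover have "?F = (\<lambda>y. if y \<in> cbox (y0 - 1) (y0 + 1) then ?F y else 0)" by (auto simp: fun_eq_iff bump_def)
  ultimately have "((\<lambda>y. if y \<in> cbox (y0 - 1) (y0 + 1) then ?F y else 0) has_integral 0) UNIV" by simp
  then have "(?F has_integral 0) (cbox (y0 - 1) (y0 + 1))" by (simp only: has_integral_restrict_UNIV)
  then have "?F y0 = 0"
    by (intro has_integral_0_cbox_imp_0[of "y0 - 1" "y0 + 1" ?F y0]) (auto intro!: continuous_intros ck cb simp: bump_def)
  then show "K1 x0 y0 = K2 x0 y0" by (simp add: bump_def k_def)
qed

lemma greens_function_eq:
  assumes z: "Im z > 0"
  shows "greens_function \<kappa> \<eta> f z = greenK z"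
proof -
  have "is_greens_function \<kappa> \<eta> f z (greenK z)"
    unfolding is_greens_function_def using greenK_cont greenK_reproduces[OF z] by blast
  then show ?thesis unfolding greens_function_def
    using greens_function_unique[OF z] by (intro the_equality) auto
qed

section \<open>Resonances are the zeros of the determinant\<close>

lemma sa_holomorphic: "(\<lambda>z. sa z x) holomorphic_on S" and sb_holomorphic: "(\<lambda>z. sb z x) holomorphic_on S"
proof -
  have l: "(\<lambda>z. stark_zeta f z x) holomorphic_on S" "(\<lambda>z. airy_rot * stark_zeta f z x) holomorphic_on S"
    unfolding stark_zeta_def by (intro holomorphic_intros)+
  show "(\<lambda>z. sa z x) holomorphic_on S" "(\<lambda>z. sb z x) holomorphic_on S"
    using holomorphic_on_compose[OF l(1) Ai_holomorphic] holomorphic_on_compose[OF l(2) Ai_holomorphic]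
    by (simp_all add: sa_def sb_def o_def)
qed

lemma D_holomorphic: "D holomorphic_on S"
proof -
  have "(\<lambda>z. Q3m z) holomorphic_on S"
    unfolding Q3m_def Gm_def P2m_def Q2m_def
    by (intro holomorphic_intros sa_holomorphic sb_holomorphic) (use pos in auto)
  then show ?thesis by (simp add: Q3m_eq[abs_def] Q3m_eq)
qed

lemma psi_plus_holomorphic: "(\<lambda>z. psi_plus z x) holomorphic_on S" and psi_minus_holomorphic: "(\<lambda>z. psi_minus z x) holomorphic_on S"
proof -
  have a: "(\<lambda>z. comb z (P1p z) (Q1p z) x) holomorphic_on S" "(\<lambda>z. comb z (P2p z) (Q2p z) x) holomorphic_on S"
    "(\<lambda>z. comb z 1 0 x) holomorphic_on S" "(\<lambda>z. comb z (P3m z) (Q3m z) x) holomorphic_on S"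
    "(\<lambda>z. comb z (P2m z) (Q2m z) x) holomorphic_on S" "(\<lambda>z. comb z 0 1 x) holomorphic_on S"
    unfolding comb_def P1p_def Q1p_def Gp_def P2p_def Q2p_def Q3m_def P3m_def Gm_def P2m_def Q2m_def
    by (intro holomorphic_intros sa_holomorphic sb_holomorphic; use pos in auto)+
  show "(\<lambda>z. psi_plus z x) holomorphic_on S" "(\<lambda>z. psi_minus z x) holomorphic_on S"
    unfolding psi_plus_def psi_minus_def glue_def by (cases "x \<le> -\<kappa>"; cases "x \<le> \<kappa>"; simp add: a)+
qed

lemma D_not_zero_everywhere: "\<exists>z. D z \<noteq> 0"
  using D_nonzero_upper[of \<i>] by auto

text \<open>The continuation F is arbitrary, not the explicit kernel. It satisfies
  \<open>F w * (W * D w) = ?N w\<close> with an entire numerator, first in the upper half plane and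
  then, away from isolated points, everywhere; so F has a finite limit wherever D is
  nonzero.\<close>

lemma is_resonance_imp_zero:
  assumes "is_resonance \<kappa> \<eta> f z"
  shows "D z = 0"
proof (rule ccontr)
  assume Dz: "D z \<noteq> 0"
  obtain x y F where F: "F meromorphic_on UNIV" "\<And>z. Im z > 0 \<Longrightarrow> F z = greens_function \<kappa> \<eta> f z x y" "is_pole F z"
    using assms unfolding is_resonance_def continues_greens_function_def by blast
  let ?N = "\<lambda>w. psi_plus w (max x y) * psi_minus w (min x y)"
  let ?E = "\<lambda>w. ?N w - F w * (W * D w)"
  have hN: "?N holomorphic_on UNIV" by (intro holomorphic_intros psi_plus_holomorphic psi_minus_holomorphic)
  have hD: "(\<lambda>w. W * D w) holomorphic_on UNIV" by (intro holomorphic_intros D_holomorphic)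
  have mero: "?E meromorphic_on UNIV"
    by (intro meromorphic_intros F(1) analytic_on_imp_meromorphic_on) (use hN hD in \<open>simp_all add: analytic_on_open\<close>)
  have E0: "?E w = 0" if "Im w > 0" for w
    using F(2)[OF that] greens_function_eq[OF that] D_nonzero_upper[OF that] by (simp add: greenK_def)
  \<comment> \<open>A meromorphic F may have arbitrary values at its singular points; removing the
    singularities gives the normal form to which the identity theorem applies.\<close>
  have "remove_sings ?E w = 0" for w
  proof (rule frequently_eq_meromorphic_imp_constant[of "remove_sings ?E" 0 \<i> UNIV])
    show "remove_sings ?E nicely_meromorphic_on UNIV" by (rule remove_sings_nicely_meromorphic[OF mero])
  next
    have an: "?E analytic_on {w}" if "Im w > 0" for w
    proof -
      have "(\<lambda>_. 0) analytic_on {w}" by simp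
      moreover have "\<forall>\<^sub>F v in nhds w. v \<in> {w. Im w > 0}"
        using that by (intro eventually_nhds_in_open) (auto simp: open_halfspace_Im_gt)
      then have "\<forall>\<^sub>F v in nhds w. ?E v = 0" by eventually_elim (rule E0, simp)
      ultimately show ?thesis using analytic_at_cong[of ?E "\<lambda>_. 0" w w] by simp
    qed
    have "eventually (\<lambda>w. w \<in> {w. Im w > 0}) (at \<i>)"
      by (rule eventually_at_in_open') (auto simp: open_halfspace_Im_gt)
    then have "eventually (\<lambda>w. remove_sings ?E w = 0) (at \<i>)"
      by eventually_elim (use an E0 in auto)
    then show "frequently (\<lambda>w. remove_sings ?E w = 0) (at \<i>)"
      by (rule eventually_frequently[rotated]) simp
  qed auto
  moreover have "isolated_singularity_at ?E z"
    using mero by (simp add: meromorphic_on_altdef)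
  ultimately have "eventually (\<lambda>w. ?E w = 0) (at z)"
    using eventually_remove_sings_eq_at[of ?E z] by simp
  moreover have "eventually (\<lambda>w. D w \<noteq> 0) (at z)"
  proof -
    have "isCont D z" using holomorphic_on_imp_continuous_on[OF D_holomorphic[of UNIV]] by (simp add: continuous_on_eq_continuous_at)
    then show ?thesis using Dz by (auto simp: isCont_def intro: tendsto_imp_eventually_ne)
  qed
  ultimately have ev: "eventually (\<lambda>w. F w = ?N w / (W * D w)) (at z)"
    by eventually_elim (simp add: field_simps)
  have "isCont (\<lambda>w. ?N w / (W * D w)) z"
    using holomorphic_on_imp_continuous_on[OF hN] holomorphic_on_imp_continuous_on[OF hD] Dz
    by (intro isCont_divide) (auto simp: continuous_on_eq_continuous_at)
  then have "((\<lambda>w. ?N w / (W * D w)) \<longlongrightarrow> ?N z / (W * D z)) (at z)" by (simp add: isCont_def)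
  then have "(F \<longlongrightarrow> ?N z / (W * D z)) (at z)"
    by (rule Lim_transform_eventually) (use ev in \<open>auto elim: eventually_mono\<close>)
  moreover have "filterlim F at_infinity (at z)" using F(3) by (simp add: is_pole_def)
  ultimately show False using not_tendsto_and_filterlim_at_infinity[of "at z" F] by auto
qed

text \<open>A solution that vanished on a half line would vanish there with its derivative, against
  the nonzero Wronskian W.\<close>

lemma sa_nontrivial: "\<exists>x>\<kappa>. sa z x \<noteq> 0" and sb_nontrivial: "\<exists>x\<le>-\<kappa>. sb z x \<noteq> 0"
proof -
  show "\<exists>x>\<kappa>. sa z x \<noteq> 0"
  proof (rule ccontr)
    assume "\<not> ?thesis"
    then have 0: "sa z y = 0" if "y > \<kappa>" for y using that by auto
    have "((\<lambda>_. 0) has_vector_derivative sa' z (\<kappa> + 1)) (at (\<kappa> + 1))"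
      by (rule has_vector_derivative_transform_within_open[OF sa_deriv(1), where S="{\<kappa><..}"]) (use 0 in auto)
    then have "sa' z (\<kappa> + 1) = 0" using vector_derivative_unique_at has_vector_derivative_const by blast
    then show False using sab_wronskian[of z "\<kappa> + 1"] 0[of "\<kappa> + 1"] by simp
  qed
  show "\<exists>x\<le>-\<kappa>. sb z x \<noteq> 0"
  proof (rule ccontr)
    assume "\<not> ?thesis"
    then have 0: "sb z y = 0" if "y < -\<kappa>" for y using that by auto
    have "((\<lambda>_. 0) has_vector_derivative sb' z (-\<kappa> - 1)) (at (-\<kappa> - 1))"
      by (rule has_vector_derivative_transform_within_open[OF sb_deriv(1), where S="{..<-\<kappa>}"]) (use 0 in auto)
    then have "sb' z (-\<kappa> - 1) = 0" using vector_derivative_unique_at has_vector_derivative_const by blast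
    then show False using sab_wronskian[of z "-\<kappa> - 1"] 0[of "-\<kappa> - 1"] by simp
  qed
qed

text \<open>For unlucky pairs of points the numerator could cancel a zero of D. For the pair chosen
  by the preceding lemma it is \<open>sa z x * sb z y \<noteq> 0\<close>, so this Green's function
  does have a pole.\<close>

lemma zero_imp_is_resonance:
  assumes "D z = 0" "Im z < 0"
  shows "is_resonance \<kappa> \<eta> f z"
proof -
  obtain x y where xy: "x > \<kappa>" "sa z x \<noteq> 0" "y \<le> -\<kappa>" "sb z y \<noteq> 0" using sa_nontrivial sb_nontrivial by blast
  have mx: "max x y = x" "min x y = y" using xy pos by auto
  let ?F = "\<lambda>w. greenK w x y"
  have cont: "continues_greens_function \<kappa> \<eta> f x y ?F"
    unfolding continues_greens_function_def
  proof (intro conjI allI impI)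
    show "?F meromorphic_on UNIV" unfolding greenK_def
      by (intro meromorphic_intros analytic_on_imp_meromorphic_on)
         (simp_all add: analytic_on_open psi_plus_holomorphic psi_minus_holomorphic D_holomorphic)
    show "greenK w x y = greens_function \<kappa> \<eta> f w x y" if "Im w > 0" for w
      using greens_function_eq[OF that] by simp
  qed
  have "is_pole (\<lambda>w. (psi_plus w x * psi_minus w y) / (W * D w)) z"
  proof (rule is_pole_divide)
    have "continuous_on UNIV (\<lambda>w. psi_plus w x * psi_minus w y)"
      by (intro holomorphic_on_imp_continuous_on holomorphic_intros psi_plus_holomorphic psi_minus_holomorphic)
    then show "isCont (\<lambda>w. psi_plus w x * psi_minus w y) z" by (simp add: continuous_on_eq_continuous_at)
    show "psi_plus z x * psi_minus z y \<noteq> 0" using xy by (simp add: psi_plus_right psi_minus_left)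
    have hW: "(\<lambda>w. W * D w) holomorphic_on UNIV" by (intro holomorphic_intros D_holomorphic)
    have "isCont (\<lambda>w. W * D w) z"
      using holomorphic_on_imp_continuous_on[OF hW] by (simp add: continuous_on_eq_continuous_at)
    then have "((\<lambda>w. W * D w) \<longlongrightarrow> 0) (at z)" using assms by (simp add: isCont_def)
    moreover have "eventually (\<lambda>w. W * D w \<noteq> 0) (at z)"
    proof -
      obtain w0 where "D w0 \<noteq> 0" using D_not_zero_everywhere by blast
      then have "eventually (\<lambda>w. D w \<noteq> 0) (at z)"
        using non_zero_neighbour_alt[of D UNIV z w0] D_holomorphic by auto
      then show ?thesis by simp
    qed
    ultimately show "filterlim (\<lambda>w. W * D w) (at 0) (at z)"
      by (auto simp: filterlim_at elim: eventually_mono)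
  qed
  then have "is_pole ?F z" by (simp add: greenK_def mx)
  with cont assms(2) show ?thesis unfolding is_resonance_def by blast
qed

lemma is_resonance_iff: "is_resonance \<kappa> \<eta> f z \<longleftrightarrow> Im z < 0 \<and> D z = 0"
  using is_resonance_imp_zero zero_imp_is_resonance by (auto simp: is_resonance_def)

end

section \<open>Upper bound for the number of resonances\<close>

text \<open>Dividing out the zeros and applying the maximum principle replaces Jensen's formula.\<close>

lemma zero_count_bound:
  fixes g :: "complex \<Rightarrow> complex"
  assumes g: "g holomorphic_on UNIV" and gc: "g c \<noteq> 0" and \<rho>: "\<rho> > 0"
    and M: "\<And>w. norm (w - c) = \<rho> \<Longrightarrow> norm (g w) \<le> M"
    and Z: "finite Z" "\<And>z. z \<in> Z \<Longrightarrow> g z = 0" "\<And>z. z \<in> Z \<Longrightarrow> norm (c - z) \<le> \<rho> / 3"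
  shows "norm (g c) * 2 ^ (\<Sum>z\<in>Z. nat (zorder g z)) \<le> M"
proof -
  let ?n = "\<lambda>z. nat (zorder g z)" and ?p = "zor_poly g"
  define N where "N = (\<Sum>z\<in>Z. ?n z)"
  define H where "H w = (if w \<in> Z then ?p w w / (\<Prod>z\<in>Z-{w}. (w - z) ^ ?n z) else g w / (\<Prod>z\<in>Z. (w - z) ^ ?n z))" for w
  have zp: "\<exists>r>0. ?p z holomorphic_on cball z r \<and> (\<forall>w\<in>cball z r. g w = ?p z w * (w - z) ^ ?n z)" for z
    using zorder_exist_zero[OF g, of z] gc by auto
  have "H field_differentiable at w" for w
  proof (cases "w \<in> Z")
    case False
    have op: "open (- Z)" using Z(1) by (simp add: finite_imp_closed open_Compl)
    have "(\<lambda>w. g w / (\<Prod>z\<in>Z. (w - z) ^ ?n z)) holomorphic_on - Z"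
      by (intro holomorphic_intros holomorphic_on_subset[OF g]) (use Z(1) in auto)
    then have "H holomorphic_on - Z" by (rule holomorphic_transform) (auto simp: H_def)
    then show ?thesis using op False by (simp add: holomorphic_on_imp_differentiable_at)
  next
    case True
    obtain r where r: "r > 0" "?p w holomorphic_on cball w r" "\<And>v. v \<in> cball w r \<Longrightarrow> g v = ?p w v * (v - w) ^ ?n w"
      using zp by blast
    let ?T = "ball w r - (Z - {w})"
    have op: "open ?T" using Z(1) by (intro open_Diff) (auto simp: finite_imp_closed)
    have "(\<lambda>v. ?p w v / (\<Prod>z\<in>Z-{w}. (v - z) ^ ?n z)) holomorphic_on ?T"
      by (intro holomorphic_intros holomorphic_on_subset[OF r(2)]) (use Z(1) in auto)
    then have "H holomorphic_on ?T"
    proof (rule holomorphic_transform)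
      fix v assume v: "v \<in> ?T"
      show "?p w v / (\<Prod>z\<in>Z-{w}. (v - z) ^ ?n z) = H v"
      proof (cases "v = w")
        case True
        then show ?thesis using \<open>w \<in> Z\<close> by (simp add: H_def)
      next
        case False
        then have "v \<notin> Z" using v by auto
        then have "H v = g v / (\<Prod>z\<in>Z. (v - z) ^ ?n z)" by (simp add: H_def)
        also have "(\<Prod>z\<in>Z. (v - z) ^ ?n z) = (v - w) ^ ?n w * (\<Prod>z\<in>Z-{w}. (v - z) ^ ?n z)"
          by (rule prod.remove[OF Z(1) \<open>w \<in> Z\<close>])
        also have "g v = ?p w v * (v - w) ^ ?n w" using r(3)[of v] v by auto
        finally show ?thesis using False by simp
      qed
    qed
    then show ?thesis using op True r(1) by (intro holomorphic_on_imp_differentiable_at[of _ ?T]) auto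
  qed
  then have H: "H holomorphic_on S" for S by (simp add: holomorphic_on_def field_differentiable_at_within)
  have "norm (H c) \<le> M / (2 * \<rho> / 3) ^ N"
  proof (rule maximum_modulus_frontier[where S="ball c \<rho>" and f=H and \<xi>=c])
    show "continuous_on (closure (ball c \<rho>)) H" by (intro holomorphic_on_imp_continuous_on H)
    fix w assume "w \<in> frontier (ball c \<rho>)"
    then have w: "norm (w - c) = \<rho>" using \<rho> by (simp add: frontier_ball dist_norm norm_minus_commute)
    \<comment> \<open>On the circle each zero is at distance at least 2\<rho>/3, from the centre at
      most \<rho>/3; every zero thus gains a factor 2 in the maximum principle.\<close>
    have far: "norm (w - z) \<ge> 2 * \<rho> / 3" if "z \<in> Z" for z
      using Z(3)[OF that] w norm_triangle_ineq2[of "w - c" "z - c"] by (simp add: norm_minus_commute)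
    then have "w \<notin> Z" using \<rho> by fastforce
    then have "norm (H w) = norm (g w) / (\<Prod>z\<in>Z. norm (w - z) ^ ?n z)"
      by (simp add: H_def norm_divide prod_norm[symmetric] norm_power)
    also have "\<dots> \<le> M / (\<Prod>z\<in>Z. (2 * \<rho> / 3) ^ ?n z)"
    proof (rule frac_le)
      show "norm (g w) \<le> M" by (rule M[OF w])
      then show "0 \<le> M" using norm_ge_zero order_trans by blast
      show "0 < (\<Prod>z\<in>Z. (2 * \<rho> / 3) ^ ?n z)" using \<rho> by (intro prod_pos) auto
      show "(\<Prod>z\<in>Z. (2 * \<rho> / 3) ^ ?n z) \<le> (\<Prod>z\<in>Z. norm (w - z) ^ ?n z)"
        using far \<rho> by (intro prod_mono) (auto intro!: power_mono)
    qed
    also have "(\<Prod>z\<in>Z. (2 * \<rho> / 3) ^ ?n z) = (2 * \<rho> / 3) ^ N" by (simp add: N_def power_sum)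
    finally show "norm (H w) \<le> M / (2 * \<rho> / 3) ^ N" .
  qed (use H \<rho> in auto)
  moreover have "norm (H c) \<ge> norm (g c) / (\<rho> / 3) ^ N"
  proof -
    have "c \<notin> Z" using Z(2) gc by blast
    then have "norm (H c) = norm (g c) / (\<Prod>z\<in>Z. norm (c - z) ^ ?n z)"
      by (simp add: H_def norm_divide prod_norm[symmetric] norm_power)
    moreover have "(\<Prod>z\<in>Z. norm (c - z) ^ ?n z) \<le> (\<Prod>z\<in>Z. (\<rho> / 3) ^ ?n z)"
      using Z(3) by (intro prod_mono) (auto intro!: power_mono)
    moreover have "(\<Prod>z\<in>Z. (\<rho> / 3) ^ ?n z) = (\<rho> / 3) ^ N" by (simp add: N_def power_sum)
    moreover have "0 < (\<Prod>z\<in>Z. norm (c - z) ^ ?n z)"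
      by (intro prod_pos ballI zero_less_power) (use \<open>c \<notin> Z\<close> in auto)
    ultimately show ?thesis by (simp add: frac_le)
  qed
  ultimately have "norm (g c) / (\<rho> / 3) ^ N \<le> M / (2 * \<rho> / 3) ^ N" by linarith
  also have "(2 * \<rho> / 3) ^ N = 2 ^ N * (\<rho> / 3) ^ N" by (simp flip: power_mult_distrib)
  finally have "norm (g c) / (\<rho> / 3) ^ N \<le> M / 2 ^ N / (\<rho> / 3) ^ N" by simp
  then have "norm (g c) \<le> M / 2 ^ N" using \<rho> by (subst (asm) divide_le_cancel) auto
  then show ?thesis by (simp add: N_def field_simps)
qed

section \<open>Size of the determinant: growth on discs and a lower bound at one negative
  energy\<close>

context stark
begin

text \<open>The large parameter of the limit: on bounded sets of energies the Airy arguments are at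
  most of order mf^2 and the exponents at most of order mf^3 = 1 / f.\<close>

abbreviation (input) "mf \<equiv> f powr (-1/3)"

lemma norm_airy_rot [simp]: "norm airy_rot = 1"
  by (simp add: airy_rot_def)

lemma norm_W: "norm W = 1 / (2 * pi * mf)" "norm W > 0"
proof -
  have "norm (exp (- \<i> * complex_of_real pi / 6)) = 1" by (simp add: norm_exp_eq_Re)
  then have "norm W = f powr (1/3) / (2 * pi)"
    unfolding W_def stark_W_def norm_divide norm_mult by simp
  then show "norm W = 1 / (2 * pi * mf)" "norm W > 0" using pos powr_thirds(5,7) by simp_all
qed

lemma mf_facts: "mf > 0" "mf ^ 3 = 1 / f" "f \<le> 1 \<Longrightarrow> mf \<ge> 1"
proof -
  show p: "mf > 0" using pos by simp
  show c: "mf ^ 3 = 1 / f" unfolding powr_thirds(7) power_divide powr_thirds(3) by simp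
  assume "f \<le> 1"
  then have "mf ^ 3 \<ge> 1" using c pos by simp
  then show "mf \<ge> 1" using p power_less_one_iff[of mf 3] by (simp add: not_less[symmetric])
qed

lemma D_eq: 
  "D z = 1 + (sa z \<kappa> * sb z \<kappa> + sa z (-\<kappa>) * sb z (-\<kappa>)) / (of_real \<eta> * W)
     + ((sa z \<kappa> * sb z \<kappa>) * (sa z (-\<kappa>) * sb z (-\<kappa>)) - (sb z (-\<kappa>) * sa z \<kappa>)\<^sup>2) / (of_real \<eta> * W)\<^sup>2"
  unfolding D_def stark_D_eq by (simp add: power_mult_distrib algebra_simps power2_eq_square)

lemma norm_e: "norm (of_real \<eta> * W) = \<eta> / (2 * pi * mf)"
  using pos by (simp add: norm_mult norm_W)

end

text \<open>The Airy arguments are at most a constant times f^(-2/3), so \<open>Ai_growth\<close>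
  gives exponents of order 1 / f, uniformly on the disc.\<close>

lemma D_growth:
  assumes "\<kappa> > 0" "\<eta> > 0" "\<rho> > 0"
  shows "\<exists>C>0. \<forall>f z. 0 < f \<and> f \<le> 1 \<and> norm z \<le> \<rho> \<longrightarrow> norm (stark_D \<kappa> \<eta> f z) \<le> exp (C / f)"
proof -
  obtain C0 where C0: "C0 > 0" "\<And>z. norm (Ai z) \<le> C0 * exp (2 * sqrt (1 + norm z) ^ 3)"
    using Ai_growth by blast
  define s where "s = sqrt (1 + (\<rho> + \<kappa>))"
  define K where "K = C0\<^sup>2 * (2 * pi / \<eta>)"
  have K: "K > 0" using C0 assms by (simp add: K_def)
  have s: "s \<ge> 0" using assms by (simp add: s_def)
  \<comment> \<open>D is bounded by the square of
    \<open>(1 + 2 * K) * exp ((4 * s ^ 3 + 1) / f)\<close>: two Airy functions contribute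
    \<open>2 * s ^ 3\<close> each, and the 1 absorbs the factor f^(-1/3) from \<open>1 / W\<close>.
    The logarithm turns the constant into an exponential, which may be divided by f as f \<le>
    1.\<close>
  define C where "C = 2 * (4 * s ^ 3 + 1) + 2 * ln (1 + 2 * K)"
  have "ln (1 + 2 * K) \<ge> 0" using K by simp
  moreover have "s ^ 3 \<ge> 0" using s by simp
  moreover have "0 < 2 * (4 * c + 1) + 2 * l" if "0 \<le> l" "0 \<le> c" for c l :: real using that by simp
  ultimately have "C > 0" unfolding C_def by blast
  moreover have "norm (stark_D \<kappa> \<eta> f z) \<le> exp (C / f)" if f: "0 < f" "f \<le> 1" and z: "norm z \<le> \<rho>" for f z
  proof -
    interpret stark \<kappa> \<eta> f using assms f by unfold_locales auto
    note m = mf_facts(1,2) mf_facts(3)[OF f(2)]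
    have zb: "norm (stark_zeta f z x) \<le> mf\<^sup>2 * (\<rho> + \<kappa>)" if "\<bar>x\<bar> \<le> \<kappa>" for x
    proof -
      have "norm (stark_zeta f z x) \<le> norm z * mf\<^sup>2 + \<bar>x\<bar> * f powr (1/3)"
        unfolding stark_zeta_def powr_thirds(6) using norm_triangle_ineq[of "- z * of_real (mf\<^sup>2)" "of_real (x * f powr (1/3))"]
        by (simp add: norm_mult abs_mult norm_power)
      also have "f powr (1/3) \<le> mf\<^sup>2"
      proof -
        have "f powr (1/3) \<le> 1" using f by (simp add: powr_le1)
        then show ?thesis using one_le_power[OF m(3), of 2] by linarith
      qed
      then have "\<bar>x\<bar> * f powr (1/3) \<le> \<kappa> * mf\<^sup>2" using that by (intro mult_mono) auto
      finally show ?thesis using mult_right_mono[OF z, of "mf\<^sup>2"] by (simp add: algebra_simps)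
    qed
    have ab: "norm (Ai \<zeta>) \<le> C0 * exp (2 * s ^ 3 / f)" if "norm \<zeta> \<le> mf\<^sup>2 * (\<rho> + \<kappa>)" for \<zeta>
    proof -
      have "1 + norm \<zeta> \<le> mf\<^sup>2 * (1 + (\<rho> + \<kappa>))"
        using that one_le_power[OF m(3), of 2] by (simp add: algebra_simps)
      then have "sqrt (1 + norm \<zeta>) \<le> mf * s"
        using m unfolding s_def by (metis real_sqrt_le_iff real_sqrt_mult real_sqrt_unique less_imp_le)
      then have "sqrt (1 + norm \<zeta>) ^ 3 \<le> (mf * s) ^ 3" by (intro power_mono) auto
      also have "\<dots> = s ^ 3 / f" unfolding power_mult_distrib m(2) by simp
      finally have "exp (2 * sqrt (1 + norm \<zeta>) ^ 3) \<le> exp (2 * s ^ 3 / f)" by simp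
      then show ?thesis by (rule order_trans[OF C0(2)[of \<zeta>] mult_left_mono[OF _ less_imp_le[OF C0(1)]]])
    qed
    let ?A = "C0 * exp (2 * s ^ 3 / f)"
    have sab: "norm (sa z x) \<le> ?A" "norm (sb z x) \<le> ?A" if "\<bar>x\<bar> \<le> \<kappa>" for x
      using ab zb[OF that] by (auto simp: sa_def sb_def norm_mult)
    have A: "?A \<ge> 0" using C0 by simp
    define X where "X = 1 / norm (of_real \<eta> * W)"
    have X: "X \<ge> 0" by (simp add: X_def)
    have nd: "norm (A / (of_real \<eta> * W)) = norm A * X" "norm (A / (of_real \<eta> * W)\<^sup>2) = norm A * X\<^sup>2" for A
      unfolding X_def
      by (simp_all only: norm_divide norm_power power_divide power_one times_divide_eq_right mult_1_right)
    have two: "norm (sa z x * sb z y) \<le> ?A\<^sup>2" if "\<bar>x\<bar> \<le> \<kappa>" "\<bar>y\<bar> \<le> \<kappa>" for x y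
      unfolding norm_mult power2_eq_square using sab that A by (intro mult_mono) auto
    have k: "\<bar>\<kappa>\<bar> \<le> \<kappa>" "\<bar>- \<kappa>\<bar> \<le> \<kappa>" using assms by auto
    have t1: "norm ((sa z \<kappa> * sb z \<kappa> + sa z (-\<kappa>) * sb z (-\<kappa>)) / (of_real \<eta> * W)) \<le> 2 * ?A\<^sup>2 * X"
    proof -
      have "norm (sa z \<kappa> * sb z \<kappa> + sa z (-\<kappa>) * sb z (-\<kappa>)) \<le> 2 * ?A\<^sup>2"
        using norm_triangle_ineq[of "sa z \<kappa> * sb z \<kappa>" "sa z (-\<kappa>) * sb z (-\<kappa>)"] two[OF k(1,1)] two[OF k(2,2)] by linarith
      then show ?thesis unfolding nd by (rule mult_right_mono[OF _ X])
    qed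
    have t2: "norm (((sa z \<kappa> * sb z \<kappa>) * (sa z (-\<kappa>) * sb z (-\<kappa>)) - (sb z (-\<kappa>) * sa z \<kappa>)\<^sup>2) / (of_real \<eta> * W)\<^sup>2) \<le> 2 * (?A\<^sup>2)\<^sup>2 * X\<^sup>2"
    proof -
      have "norm ((sa z \<kappa> * sb z \<kappa>) * (sa z (-\<kappa>) * sb z (-\<kappa>))) \<le> ?A\<^sup>2 * ?A\<^sup>2"
        unfolding norm_mult[of "sa z \<kappa> * sb z \<kappa>"] using two[OF k(1,1)] two[OF k(2,2)] by (intro mult_mono) auto
      moreover have "norm ((sb z (-\<kappa>) * sa z \<kappa>)\<^sup>2) \<le> (?A\<^sup>2)\<^sup>2"
        unfolding norm_power using two[OF k(1,2)] by (intro power_mono) (auto simp: mult.commute)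
      ultimately have "norm ((sa z \<kappa> * sb z \<kappa>) * (sa z (-\<kappa>) * sb z (-\<kappa>)) - (sb z (-\<kappa>) * sa z \<kappa>)\<^sup>2) \<le> 2 * (?A\<^sup>2)\<^sup>2"
        using norm_triangle_ineq4[of "(sa z \<kappa> * sb z \<kappa>) * (sa z (-\<kappa>) * sb z (-\<kappa>))" "(sb z (-\<kappa>) * sa z \<kappa>)\<^sup>2"]
        unfolding power2_eq_square[of "?A\<^sup>2"] by linarith
      then show ?thesis unfolding nd by (rule mult_right_mono) simp
    qed
    have "norm (D z) \<le> 1 + 2 * ?A\<^sup>2 * X + 2 * (?A\<^sup>2)\<^sup>2 * X\<^sup>2"
      unfolding D_eq by (intro order_trans[OF norm_triangle_ineq] add_mono t1 t2) simp
    also have "\<dots> \<le> (1 + 2 * (?A\<^sup>2 * X))\<^sup>2"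
    proof -
      have "1 + 2 * y + 2 * y\<^sup>2 \<le> (1 + 2 * y)\<^sup>2" if "0 \<le> y" for y :: real
        using that by (simp add: power2_eq_square algebra_simps)
      from this[of "?A\<^sup>2 * X"] X show ?thesis by (simp only: power_mult_distrib mult.assoc zero_le_mult_iff zero_le_power2 simp_thms)
    qed
    also have "\<dots> \<le> ((1 + 2 * K) * exp ((4 * s ^ 3 + 1) / f))\<^sup>2"
    proof (rule power_mono)
      have "X = 2 * pi * mf / \<eta>" unfolding X_def norm_e by simp
      also have "mf \<le> 1 / f" using power_increasing[of 1 3 mf] m by simp
      also have "1 / f \<le> exp (1 / f)" using exp_ge_add_one_self[of "1 / f"] by linarith
      finally have "X \<le> 2 * pi / \<eta> * exp (1 / f)" using assms by (simp add: field_simps)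
      then have "?A\<^sup>2 * X \<le> ?A\<^sup>2 * (2 * pi / \<eta> * exp (1 / f))" by (intro mult_left_mono) auto
      also have "\<dots> = K * (exp (2 * s ^ 3 / f) * exp (2 * s ^ 3 / f) * exp (1 / f))"
        by (simp add: K_def power2_eq_square)
      also have "exp (2 * s ^ 3 / f) * exp (2 * s ^ 3 / f) * exp (1 / f) = exp ((4 * s ^ 3 + 1) / f)"
        unfolding exp_add[symmetric] by (simp add: add_divide_distrib)
      finally have "?A\<^sup>2 * X \<le> K * exp ((4 * s ^ 3 + 1) / f)" .
      moreover have "1 \<le> exp ((4 * s ^ 3 + 1) / f)" using s f by simp
      moreover have "1 + 2 * y \<le> (1 + 2 * K) * e" if "y \<le> K * e" "1 \<le> e" for y e
        using that by (simp add: algebra_simps)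
      ultimately show "1 + 2 * (?A\<^sup>2 * X) \<le> (1 + 2 * K) * exp ((4 * s ^ 3 + 1) / f)" by blast
      show "0 \<le> 1 + 2 * (?A\<^sup>2 * X)" using X by (simp add: add_nonneg_nonneg)
    qed
    also have "\<dots> = (1 + 2 * K)\<^sup>2 * exp (2 * ((4 * s ^ 3 + 1) / f))"
      unfolding power_mult_distrib exp_double ..
    also have "(1 + 2 * K)\<^sup>2 = exp (2 * ln (1 + 2 * K))" unfolding exp_double using K by simp
    also have "\<dots> \<le> exp (2 * ln (1 + 2 * K) / f)"
    proof -
      have "2 * ln (1 + 2 * K) * f \<le> 2 * ln (1 + 2 * K) * 1" using f K by (intro mult_left_mono) auto
      then show ?thesis using f by (simp add: le_divide_eq)
    qed
    also have "exp (2 * ln (1 + 2 * K) / f) * exp (2 * ((4 * s ^ 3 + 1) / f)) = exp (C / f)"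
      unfolding exp_add[symmetric] C_def by (simp add: add_divide_distrib)
    finally show ?thesis by (simp add: D_def)
  qed
  ultimately show ?thesis by blast
qed

text \<open>At a very negative energy both Airy arguments are squares of points with positive real
  part, so \<open>Ai_square\<close> applies directly. In products of \<open>sa\<close> at x with
  \<open>sb\<close> at some y \<le> x, the growing exponential of \<open>sb\<close> is compensated
  by the decaying one of \<open>sa\<close>, and D is close to 1.\<close>

lemma D_centre:
  assumes "\<kappa> > 0" "\<eta> > 0"
  shows "\<exists>E>0. \<forall>f. 0 < f \<and> f \<le> 1 \<longrightarrow> norm (stark_D \<kappa> \<eta> f (- of_real E)) \<ge> 1 / 2"
proof -
  \<comment> \<open>With this R each product, divided by |\<eta> W|, is at most 1/5, whence |D - 1|
    \<le> 2/5 + 2/25 < 1/2. The choice of E below gives \<open>E + f * x \<ge> R\<^sup>2\<close> for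
    |x| \<le> \<kappa>.\<close>
  define R where "R = 20 * pi / \<eta>"
  have R: "R > 0" using assms by (simp add: R_def)
  define E where "E = \<kappa> + R\<^sup>2"
  have "E > 0" using assms R by (simp add: E_def add_pos_pos)
  moreover have "norm (stark_D \<kappa> \<eta> f (- of_real E)) \<ge> 1 / 2" if f: "0 < f" "f \<le> 1" for f
  proof -
    interpret stark \<kappa> \<eta> f using assms f by unfold_locales auto
    note m = mf_facts(1,2) mf_facts(3)[OF f(2)]
    let ?z = "- complex_of_real E"
    define w where "w x = sqrt (E + f * x) * mf" for x
    define w0 where "w0 = R * mf"
    have w0: "w0 > 0" using R m by (simp add: w0_def)
    have sz: "norm (sa ?z x) \<le> exp (- (2/3) * w x ^ 3) / sqrt (w0 / 2)"
      "norm (sb ?z x) \<le> exp ((2/3) * w x ^ 3) / sqrt (w0 / 2)" if x: "\<bar>x\<bar> \<le> \<kappa>" for x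
    proof -
      have "f * \<bar>x\<bar> \<le> 1 * \<kappa>" using f x by (intro mult_mono) auto
      then have ex: "E + f * x \<ge> R\<^sup>2" using f assms(1) unfolding E_def by (cases "x \<ge> 0") (auto simp: abs_if)
      then have exp0: "E + f * x > 0" using zero_less_power[OF R, of 2] by linarith
      have wx: "w x \<ge> w0" unfolding w_def w0_def using ex R m by (intro mult_right_mono real_le_rsqrt) auto
      define k where "k = \<i> * of_real (sqrt (E + f * x))"
      have k2: "k\<^sup>2 = ?z - of_real (f * x)" 
      proof -
        have "(complex_of_real (sqrt (E + f * x)))\<^sup>2 = of_real (E + f * x)"
          using exp0 by (simp only: of_real_power[symmetric] real_sqrt_pow2 less_imp_le)
        then show ?thesis by (simp add: k_def power_mult_distrib)
      qed
      have k3: "k ^ 3 = - \<i> * of_real (sqrt (E + f * x) ^ 3)"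
      proof -
        have "\<i> ^ 3 = - \<i>" by (simp add: power3_eq_cube)
        then show ?thesis unfolding k_def power_mult_distrib of_real_power by (simp only:)
      qed
      have zx: "stark_zeta f ?z x = (of_real (w x))\<^sup>2"
      proof -
        have "(w x)\<^sup>2 = (E + f * x) * mf\<^sup>2" using exp0 by (simp add: w_def power_mult_distrib)
        then have "(complex_of_real (w x))\<^sup>2 = of_real ((E + f * x) * mf\<^sup>2)" by (simp only: of_real_power[symmetric])
        then show ?thesis unfolding zeta_square(1)[OF k2] k2 by simp
      qed
      have Rw: "Re (of_real (w x)) > 0" using wx w0 by simp
      have w03: "sqrt (w0 / 2) \<le> sqrt (w x)" using wx w0 by simp
      have "norm (Ai_amp (of_real (w x))) \<le> 1 / sqrt (w x)" using norm_Ai_amp_le[OF Rw] by simp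
      also have "\<dots> \<le> 1 / sqrt (w0 / 2)" using w03 w0 by (intro divide_left_mono) auto
      finally have am: "norm (Ai_amp (of_real (w x))) \<le> 1 / sqrt (w0 / 2)" .
      have "norm (exp (- (2/3) * complex_of_real (w x) ^ 3)) = exp (- (2/3) * w x ^ 3)"
        by (simp flip: of_real_power)
      then have "norm (sa ?z x) = exp (- (2/3) * w x ^ 3) * norm (Ai_amp (of_real (w x)))"
        unfolding sa_def zx Ai_square[OF Rw] norm_mult by simp
      then show "norm (sa ?z x) \<le> exp (- (2/3) * w x ^ 3) / sqrt (w0 / 2)"
        using mult_left_mono[OF am, of "exp (- (2/3) * w x ^ 3)"] by simp
      let ?v = "rot6' * k * of_real mf"
      have v: "airy_rot * stark_zeta f ?z x = ?v\<^sup>2" by (rule zeta_square(2)[OF k2])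
      have "mf ^ 3 = 1 / f" by (rule m(2))
      then have w3: "w x ^ 3 = sqrt (E + f * x) ^ 3 / f" unfolding w_def power_mult_distrib by simp
      have v3: "?v ^ 3 = - of_real (w x ^ 3)"
        unfolding zeta_square(4)[OF k2] k3 w3 by simp
      have Rv: "Re ?v = w x / 2" unfolding k_def w_def by (simp add: rot6'_eq)
      then have Rv0: "Re ?v > 0" using wx w0 by simp
      have "norm (Ai_amp ?v) \<le> 1 / sqrt (w x / 2)" using norm_Ai_amp_le[OF Rv0] unfolding Rv .
      also have "\<dots> \<le> 1 / sqrt (w0 / 2)" using wx w0 by (intro divide_left_mono) auto
      finally have am': "norm (Ai_amp ?v) \<le> 1 / sqrt (w0 / 2)" .
      have "norm (exp (- (2/3) * ?v ^ 3)) = exp ((2/3) * w x ^ 3)"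
        unfolding v3 by (simp flip: of_real_power)
      then have "norm (sb ?z x) = exp ((2/3) * w x ^ 3) * norm (Ai_amp ?v)"
        unfolding sb_def v Ai_square[OF Rv0] norm_mult by simp
      then show "norm (sb ?z x) \<le> exp ((2/3) * w x ^ 3) / sqrt (w0 / 2)"
        using mult_left_mono[OF am', of "exp ((2/3) * w x ^ 3)"] by simp
    qed
    have two: "norm (sa ?z x * sb ?z y) \<le> 2 / w0" if xy: "\<bar>x\<bar> \<le> \<kappa>" "\<bar>y\<bar> \<le> \<kappa>" "y \<le> x" for x y
    proof -
      have "w y \<le> w x" unfolding w_def using xy f m by (intro mult_right_mono real_sqrt_le_mono) auto
      moreover have "E + f * y \<ge> 0"
      proof -
        have "f * \<bar>y\<bar> \<le> 1 * \<kappa>" using f xy by (intro mult_mono) auto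
        then have "\<bar>f * y\<bar> \<le> \<kappa>" using f by (simp add: abs_mult)
        then show ?thesis unfolding E_def using zero_le_power2[of R] by linarith
      qed
      then have "w y \<ge> 0" using m by (simp add: w_def)
      ultimately have "w y ^ 3 \<le> w x ^ 3" by (intro power_mono) auto
      then have e: "exp (- (2/3) * w x ^ 3) * exp ((2/3) * w y ^ 3) \<le> 1" by (simp flip: exp_add)
      have "norm (sa ?z x * sb ?z y) \<le> (exp (- (2/3) * w x ^ 3) / sqrt (w0 / 2)) * (exp ((2/3) * w y ^ 3) / sqrt (w0 / 2))"
        unfolding norm_mult using sz xy w0 by (intro mult_mono) auto
      also have "\<dots> = exp (- (2/3) * w x ^ 3) * exp ((2/3) * w y ^ 3) * (2 / w0)"
        using w0 by (simp add: field_simps)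
      also have "\<dots> \<le> 1 * (2 / w0)" using e w0 by (intro mult_right_mono) auto
      finally show ?thesis by simp
    qed
    have k: "\<bar>\<kappa>\<bar> \<le> \<kappa>" "\<bar>- \<kappa>\<bar> \<le> \<kappa>" "- \<kappa> \<le> \<kappa>" using assms by auto
    define X where "X = 1 / norm (of_real \<eta> * W)"
    have X: "X \<ge> 0" by (simp add: X_def)
    have nd: "norm (A / (of_real \<eta> * W)) = norm A * X" "norm (A / (of_real \<eta> * W)\<^sup>2) = norm A * X\<^sup>2" for A
      unfolding X_def
      by (simp_all only: norm_divide norm_power power_divide power_one times_divide_eq_right mult_1_right)
    have tau: "2 / w0 * X = 1 / 5"
      unfolding X_def norm_e w0_def R_def using m assms by (simp add: field_simps)
    let ?t1 = "(sa ?z \<kappa> * sb ?z \<kappa> + sa ?z (-\<kappa>) * sb ?z (-\<kappa>)) / (of_real \<eta> * W)"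
    let ?t2 = "((sa ?z \<kappa> * sb ?z \<kappa>) * (sa ?z (-\<kappa>) * sb ?z (-\<kappa>)) - (sb ?z (-\<kappa>) * sa ?z \<kappa>)\<^sup>2) / (of_real \<eta> * W)\<^sup>2"
    have t1: "norm ?t1 \<le> 2 / 5"
    proof -
      have "norm (sa ?z \<kappa> * sb ?z \<kappa> + sa ?z (-\<kappa>) * sb ?z (-\<kappa>)) \<le> 2 * (2 / w0)"
        using norm_triangle_ineq[of "sa ?z \<kappa> * sb ?z \<kappa>" "sa ?z (-\<kappa>) * sb ?z (-\<kappa>)"] two[OF k(1,1)] two[OF k(2,2)] by simp
      from mult_right_mono[OF this X] show ?thesis using tau unfolding nd by simp
    qed
    have t2: "norm ?t2 \<le> 2 / 25"
    proof -
      have "norm ((sa ?z \<kappa> * sb ?z \<kappa>) * (sa ?z (-\<kappa>) * sb ?z (-\<kappa>))) \<le> (2 / w0) * (2 / w0)"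
        unfolding norm_mult[of "sa ?z \<kappa> * sb ?z \<kappa>"] using two[OF k(1,1)] two[OF k(2,2)] w0 by (intro mult_mono) auto
      moreover have "norm ((sb ?z (-\<kappa>) * sa ?z \<kappa>)\<^sup>2) \<le> (2 / w0)\<^sup>2"
        unfolding norm_power using two[OF k(1,2,3)] by (intro power_mono) (auto simp: mult.commute)
      ultimately have "norm ((sa ?z \<kappa> * sb ?z \<kappa>) * (sa ?z (-\<kappa>) * sb ?z (-\<kappa>)) - (sb ?z (-\<kappa>) * sa ?z \<kappa>)\<^sup>2) \<le> 2 * (2 / w0)\<^sup>2"
        using norm_triangle_ineq4[of "(sa ?z \<kappa> * sb ?z \<kappa>) * (sa ?z (-\<kappa>) * sb ?z (-\<kappa>))" "(sb ?z (-\<kappa>) * sa ?z \<kappa>)\<^sup>2"]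
        unfolding power2_eq_square[of "2 / w0"] by linarith
      then have "norm ?t2 \<le> 2 * (2 / w0)\<^sup>2 * X\<^sup>2" unfolding nd by (rule mult_right_mono) simp
      also have "\<dots> = 2 * (2 / w0 * X)\<^sup>2" by (simp only: power_mult_distrib mult.assoc)
      finally have "norm ?t2 \<le> 2 * (2 / w0 * X)\<^sup>2" .
      then show ?thesis unfolding tau by (simp add: power2_eq_square)
    qed
    have "D ?z = 1 + ?t1 + ?t2" by (rule D_eq)
    moreover have "1 \<le> norm d + norm t + norm t'" if "d = 1 + t + t'" for d t t' :: complex
    proof -
      have "norm (d - t - t') \<le> norm d + norm t + norm t'"
        by (rule order_trans[OF norm_triangle_ineq4 add_right_mono[OF norm_triangle_ineq4]])
      then show ?thesis using that by simp
    qed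
    ultimately have "1 \<le> norm (D ?z) + norm ?t1 + norm ?t2" by blast
    then have "norm (D ?z) \<ge> 1 / 2" using t1 t2 by linarith
    then show ?thesis by (simp only: D_def)
  qed
  ultimately show ?thesis by blast
qed

text \<open>Here \<open>a1\<close>, \<open>b1\<close>, \<open>c1\<close> stand for
  \<open>sa\<close>, \<open>sb\<close>, \<open>sc\<close> at \<kappa> and \<open>a2\<close>,
  \<open>b2\<close>, \<open>c2\<close> for their values at -\<kappa>. After inserting the connection
  formula the contributions \<open>b1\<^sup>2 * b2\<^sup>2\<close> of the two products cancel; only
  first powers of the large squares remain.\<close>

lemma determinant_identity:
  fixes w b1 c1 b2 c2 a1 a2 e :: complex
  assumes w: "w ^ 3 = 1" and e: "e \<noteq> 0" and a: "a1 = - w * b1 - w\<^sup>2 * c1" "a2 = - w * b2 - w\<^sup>2 * c2"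
  defines "P \<equiv> w\<^sup>2 * (b1 * c1) / e" and "Q \<equiv> w\<^sup>2 * (b2 * c2) / e"
  shows "1 + (a1 * b1 + a2 * b2) / e + ((a1 * b1) * (a2 * b2) - (b2 * a1)\<^sup>2) / e\<^sup>2
    = (1 - P) * (1 - Q) - w * (b2 * c1)\<^sup>2 / e\<^sup>2 - (w * b2\<^sup>2 / e) * (1 + P) - (w * b1\<^sup>2 / e) * (1 - Q)"
proof -
  \<comment> \<open>Turns the claim into a polynomial identity modulo
    \<open>w ^ 3 = 1\<close>.\<close>
  define u where "u = 1 / e"
  have d: "x / e = x * u" "x / e\<^sup>2 = x * u\<^sup>2" for x by (simp_all add: u_def power_divide)
  show ?thesis unfolding P_def Q_def a d using w by algebra
qed

text \<open>Rotation by 30 degrees takes the sector of half-angle 45 degrees into the one of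
  half-angle 75 degrees, whose cosine exceeds 1/4; this is the sector of
  \<open>Ai_amp_asymp\<close>. In the proof 173/100 bounds sqrt 3 from below and 143/100 bounds sqrt
  2 from above.\<close>

lemma sector_rot6:
  assumes k: "Re k > 0" "\<bar>Im k\<bar> \<le> Re k" and m: "m > 0" and r: "r \<in> {rot6, rot6'}"
  shows "r * k * of_real m \<noteq> 0" "Re (r * k * of_real m) \<ge> norm (r * k * of_real m) / 4"
    "Re (r * k * of_real m) > 0" "norm (r * k * of_real m) = m * norm k"
proof -
  have n: "norm (r * k * of_real m) = m * norm k" using r m by (auto simp: norm_mult)
  show "norm (r * k * of_real m) = m * norm k" by (rule n)
  have knz: "norm k > 0" using k by auto
  then show "r * k * of_real m \<noteq> 0" using n m by (metis mult_pos_pos norm_eq_zero order_less_irrefl)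
  have s3: "sqrt 3 \<ge> 173/100" by (rule real_le_rsqrt) (simp add: power2_eq_square)
  have "(norm k)\<^sup>2 \<le> (143/100 * Re k)\<^sup>2"
  proof -
    have "(Im k)\<^sup>2 \<le> (Re k)\<^sup>2" using k by (simp add: abs_le_square_iff[symmetric])
    then have "(norm k)\<^sup>2 \<le> 2 * (Re k)\<^sup>2" by (simp add: cmod_power2)
    also have "\<dots> \<le> (143/100)\<^sup>2 * (Re k)\<^sup>2" by (intro mult_right_mono) (auto simp: power2_eq_square)
    finally show ?thesis unfolding power_mult_distrib .
  qed
  then have nk: "norm k \<le> 143/100 * Re k" by (rule power2_le_imp_le) (use k in simp)
  have "Re (r * k) = sqrt 3 / 2 * Re k - 1/2 * Im k \<or> Re (r * k) = sqrt 3 / 2 * Re k + 1/2 * Im k"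
    using r by (auto simp: rot6_eq rot6'_eq)
  moreover have "sqrt 3 / 2 * Re k \<ge> 173/200 * Re k" using s3 k by (intro mult_right_mono) auto
  moreover have "Im k \<le> Re k" "- Im k \<le> Re k" using k by auto
  ultimately have "Re (r * k) \<ge> 1/4 * norm k" using nk by linarith
  then have "Re (r * k) * m \<ge> 1/4 * norm k * m" using m by (intro mult_right_mono) auto
  moreover have "Re (r * k * of_real m) = Re (r * k) * m" by (simp add: algebra_simps)
  ultimately show "Re (r * k * of_real m) \<ge> norm (r * k * of_real m) / 4" unfolding n by (simp only: mult_ac)
  moreover have "norm (r * k * of_real m) / 4 > 0" unfolding n using mult_pos_pos[OF m knz] by simp
  ultimately show "Re (r * k * of_real m) > 0" by linarith
qed

section \<open>The determinant in terms of the rotated Airy functions\<close>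

context stark
begin

definition sc :: "complex \<Rightarrow> real \<Rightarrow> complex" where "sc z x = Ai (airy_rot\<^sup>2 * stark_zeta f z x)"

lemma sa_eq: "sa z x = - airy_rot * sb z x - airy_rot\<^sup>2 * sc z x"
  unfolding sa_def sb_def sc_def by (rule Ai_rotation)

definition eW :: complex where "eW = of_real \<eta> * W"
definition tP where "tP z = airy_rot\<^sup>2 * (sb z \<kappa> * sc z \<kappa>) / eW"
definition tQ where "tQ z = airy_rot\<^sup>2 * (sb z (-\<kappa>) * sc z (-\<kappa>)) / eW"

lemma eW_nz [simp]: "eW \<noteq> 0" using pos by (simp add: eW_def)

text \<open>In this form every factor except \<open>sb\<^sup>2\<close> stays bounded as \<open>f\<close> tends to 0.\<close>

lemma D_alt: "D z = (1 - tP z) * (1 - tQ z) - airy_rot * (sb z (-\<kappa>) * sc z \<kappa>)\<^sup>2 / eW\<^sup>2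
    - (airy_rot * (sb z (-\<kappa>))\<^sup>2 / eW) * (1 + tP z) - (airy_rot * (sb z \<kappa>)\<^sup>2 / eW) * (1 - tQ z)"
  unfolding D_eq eW_def[symmetric] tP_def tQ_def
  by (rule determinant_identity[OF airy_rot_cubed eW_nz sa_eq sa_eq])

text \<open>At the same point \<open>sb\<close> and \<open>sc\<close> carry reciprocal exponentials,
  so these cancel in the product, while the square of \<open>sb\<close> is exponentially large where
  Im(k^3) is negative.\<close>

lemma sb_sc_form:
  assumes k: "k\<^sup>2 = z - of_real (f * x)" "Re k > 0" "\<bar>Im k\<bar> \<le> Re k"
  shows "sb z x = exp (2/3 * \<i> * k ^ 3 / of_real f) * Ai_amp (rot6' * k * of_real mf)"
    and "sc z x = exp (- (2/3) * \<i> * k ^ 3 / of_real f) * Ai_amp (rot6 * k * of_real mf)"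
proof -
  note s = sector_rot6(3)[OF k(2,3) mf_facts(1)]
  have "sb z x = exp (- (2/3) * (rot6' * k * of_real mf) ^ 3) * Ai_amp (rot6' * k * of_real mf)"
    unfolding sb_def zeta_square(2)[OF k(1)] by (rule Ai_square) (use s in simp)
  also have "- (2/3) * (rot6' * k * of_real mf) ^ 3 = 2/3 * \<i> * k ^ 3 / of_real f"
    unfolding zeta_square(4)[OF k(1)] by simp
  finally show "sb z x = exp (2/3 * \<i> * k ^ 3 / of_real f) * Ai_amp (rot6' * k * of_real mf)" .
  have "sc z x = exp (- (2/3) * (rot6 * k * of_real mf) ^ 3) * Ai_amp (rot6 * k * of_real mf)"
    unfolding sc_def zeta_square(3)[OF k(1)] by (rule Ai_square) (use s in simp)
  also have "- (2/3) * (rot6 * k * of_real mf) ^ 3 = - (2/3) * \<i> * k ^ 3 / of_real f"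
    unfolding zeta_square(5)[OF k(1)] by simp
  finally show "sc z x = exp (- (2/3) * \<i> * k ^ 3 / of_real f) * Ai_amp (rot6 * k * of_real mf)" .
qed

text \<open>With s = k1 + k2 and d = k1 - k2 this follows from 4 (k1^3 - k2^3) = 3 d s^2 + d^3 and d
  s = -2 \<kappa> f. The exponents k^3 / f at the two deltas thus differ only by about -(3/2)
  \<kappa> s, with no factor 1 / f left.\<close>

lemma k_diff:
  fixes z k1 k2 :: complex
  assumes k: "k1\<^sup>2 = z - of_real (f * \<kappa>)" "k2\<^sup>2 = z - of_real (f * (-\<kappa>))" and s: "k1 + k2 \<noteq> 0"
  shows "k1 ^ 3 - k2 ^ 3 = - of_real (2 * \<kappa> * f) * (3/4 * (k1 + k2) + of_real ((\<kappa> * f)\<^sup>2) / (k1 + k2) ^ 3)"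
    and "k1 - k2 = - of_real (2 * \<kappa> * f) / (k1 + k2)"
proof -
  define c where "c = complex_of_real (2 * \<kappa> * f)"
  have c2: "complex_of_real ((\<kappa> * f)\<^sup>2) = c\<^sup>2 / 4" by (simp add: c_def power2_eq_square)
  have "(k1 - k2) * (k1 + k2) = k1\<^sup>2 - k2\<^sup>2" by (simp add: power2_eq_square algebra_simps)
  also have "\<dots> = - c" unfolding k c_def by (simp add: mult_ac)
  finally have ds: "(k1 - k2) * (k1 + k2) = - c" .
  then show "k1 - k2 = - of_real (2 * \<kappa> * f) / (k1 + k2)"
    unfolding c_def[symmetric] by (rule nonzero_eq_divide_eq[THEN iffD2, OF s])
  have gen: "k1 ^ 3 - k2 ^ 3 = - c * (3/4 * s + (c\<^sup>2 / 4) / s ^ 3)"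
    if s0: "s \<noteq> 0" and d: "d * s = - c" and sd: "k1 + k2 = s" "k1 - k2 = d" for s d
  proof -
    have 1: "4 * (k1 ^ 3 - k2 ^ 3) = 3 * ((k1 - k2) * (k1 + k2)) * (k1 + k2) + (k1 - k2) ^ 3" by algebra
    have "d = - c / s" using d by (rule nonzero_eq_divide_eq[THEN iffD2, OF s0])
    then have d3: "d ^ 3 = - (c ^ 3 / s ^ 3)" by (simp add: power_divide)
    have "4 * (k1 ^ 3 - k2 ^ 3) = - (3 * c * s) - c ^ 3 / s ^ 3" unfolding 1 sd d d3 by simp
    also have "\<dots> = 4 * (- c * (3/4 * s + (c\<^sup>2 / 4) / s ^ 3))"
      by (simp add: distrib_left power3_eq_cube power2_eq_square)
    finally show ?thesis by (rule mult_left_cancel[THEN iffD1, rotated]) simp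
  qed
  show "k1 ^ 3 - k2 ^ 3 = - of_real (2 * \<kappa> * f) * (3/4 * (k1 + k2) + of_real ((\<kappa> * f)\<^sup>2) / (k1 + k2) ^ 3)"
    unfolding c2 c_def[symmetric] by (rule gen[OF s ds refl refl])
qed

end

text \<open>For k^2 = \<zeta> one has 2 (Im k)^2 = |\<zeta>| - Re \<zeta>, here at least 2 r^2, and
  Re \<zeta> > 0 puts k into the sector |Im k| \<le> Re k.\<close>

lemma csqrt_deep:
  assumes "Re \<zeta> > 0" "Re \<zeta> \<le> B" "Im \<zeta> \<le> - (B + 2 * r\<^sup>2)" "r \<ge> 1" 
  defines "k \<equiv> csqrt \<zeta>"
  shows "Re k \<ge> r" "Im k \<le> - r" "\<bar>Im k\<bar> \<le> Re k" "norm k \<ge> r"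
proof -
  have "Re \<zeta> > 0" by fact
  note cp = csqrt_parts[OF this refl, folded k_def]
  have n: "(Re k)\<^sup>2 + (Im k)\<^sup>2 = norm \<zeta>"
  proof -
    have "norm \<zeta> = (norm k)\<^sup>2" unfolding k_def by (simp flip: norm_power)
    then show ?thesis by (simp add: cmod_power2)
  qed
  have "norm \<zeta> \<ge> B + 2 * r\<^sup>2" using abs_Im_le_cmod[of \<zeta>] assms by linarith
  then have I: "(Im k)\<^sup>2 \<ge> r\<^sup>2" using cp(3) n assms by linarith
  then have "\<bar>Im k\<bar> \<ge> r" using assms by (metis abs_le_square_iff abs_of_nonneg order_trans zero_le_one)
  have "2 * Re k * Im k < 0" unfolding cp(2) using assms zero_le_power2[of r] by linarith
  then have "Im k < 0" using cp(4) by (simp add: mult_less_0_iff)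
  then show ik: "Im k \<le> - r" using \<open>\<bar>Im k\<bar> \<ge> r\<close> by linarith
  have "(Im k)\<^sup>2 \<le> (Re k)\<^sup>2" using cp(3) assms by linarith
  then show "\<bar>Im k\<bar> \<le> Re k" using cp(4) by (simp flip: abs_le_square_iff)
  then show "Re k \<ge> r" using ik by linarith
  then show "norm k \<ge> r" using complex_Re_le_cmod[of k] by linarith
qed

lemma sqrt_pi_bounds: "sqrt pi \<le> 2" "sqrt pi \<ge> 3/2"
proof -
  show "sqrt pi \<le> 2" by (rule real_le_lsqrt) (use pi_less_4 in auto)
  show "sqrt pi \<ge> 3/2" by (rule real_le_rsqrt) (use pi_gt3 in \<open>simp add: power2_eq_square\<close>)
qed

text \<open>Once |v| is at least 1 and 2 C, the relative error of the asymptotics is at most 1/2;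
  with 3/2 \<le> sqrt pi \<le> 2 the product of |Ai_amp v| and sqrt |v| lies between 1/8 and
  1/2.\<close>

lemma amp_bounds:
  assumes C: "C > 0" "\<And>w. w \<noteq> 0 \<and> Re w \<ge> norm w / 4 \<Longrightarrow>
     norm (Ai_amp w * (2 * of_real (sqrt pi) * csqrt w) - 1) \<le> C / (norm w * sqrt (norm w))"
    and v: "v \<noteq> 0" "Re v \<ge> norm v / 4" "norm v \<ge> 1" "norm v \<ge> 2 * C"
  shows "(norm (Ai_amp v))\<^sup>2 \<le> 1 / (4 * norm v)" "(norm (Ai_amp v))\<^sup>2 \<ge> 1 / (64 * norm v)"
proof -
  let ?q = "norm (Ai_amp v)" and ?s = "sqrt (norm v)"
  have s: "?s > 0" "?s \<ge> 1" using v by auto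
  have "norm v * ?s \<ge> 2 * C" using v s mult_mono[of "2 * C" "norm v" 1 ?s] C by simp
  then have "C / (norm v * ?s) \<le> 1 / 2" using C s v by (simp add: field_simps)
  then have e: "norm (Ai_amp v * (2 * of_real (sqrt pi) * csqrt v) - 1) \<le> 1/2"
    using C(2)[of v] v by linarith
  have n: "norm (Ai_amp v * (2 * of_real (sqrt pi) * csqrt v)) = ?q * (2 * sqrt pi * ?s)"
    by (simp add: norm_mult)
  have up: "?q * (2 * sqrt pi * ?s) \<le> 3/2"
    using e norm_triangle_ineq2[of "Ai_amp v * (2 * of_real (sqrt pi) * csqrt v)" 1] unfolding n by simp
  have lo: "?q * (2 * sqrt pi * ?s) \<ge> 1/2"
    using e norm_triangle_ineq2[of 1 "Ai_amp v * (2 * of_real (sqrt pi) * csqrt v)"] unfolding n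
    by (simp add: norm_minus_commute)
  have "?q * ?s * 3 \<le> ?q * ?s * (2 * sqrt pi)" using sqrt_pi_bounds s by (intro mult_left_mono) auto
  then have u: "?q * ?s \<le> 1/2" using up by (simp add: mult_ac)
  have "?q * ?s * (2 * sqrt pi) \<le> ?q * ?s * 4" using sqrt_pi_bounds s by (intro mult_left_mono) auto
  then have l: "?q * ?s \<ge> 1/8" using lo by (simp add: mult_ac)
  have sq: "(?q * ?s)\<^sup>2 = ?q\<^sup>2 * norm v" by (simp add: power_mult_distrib)
  have "(?q * ?s)\<^sup>2 \<le> (1/2)\<^sup>2" using u s by (intro power_mono) auto
  then show "?q\<^sup>2 \<le> 1 / (4 * norm v)" unfolding sq using v by (auto simp: field_simps power2_eq_square)
  have "(?q * ?s)\<^sup>2 \<ge> (1/8)\<^sup>2" using l by (intro power_mono) auto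
  then show "?q\<^sup>2 \<ge> 1 / (64 * norm v)" unfolding sq using v by (auto simp: field_simps power2_eq_square)
qed

text \<open>Far below the axis the term with the square of \<open>sb z (-\<kappa>)\<close>, called
  \<open>?U\<close> in the proof, dominates \<open>D_alt\<close>: its exponential exceeds the one at
  \<kappa> by a huge factor, and the bounded terms \<open>tP\<close> and \<open>tQ\<close> become
  small with 1 / |k|.\<close>

lemma no_deep_zeros:
  assumes "\<kappa> > 0" "\<eta> > 0" "0 < a" "0 < b"
  shows "\<exists>M f0. f0 > 0 \<and> f0 \<le> 1 \<and> (\<forall>f z. 0 < f \<and> f < f0 \<and> Re z \<in> {a..b} \<and> Im z \<le> - M \<longrightarrow> stark_D \<kappa> \<eta> f z \<noteq> 0)"
proof -
  obtain C where C: "C > 0" "\<And>w. w \<noteq> 0 \<and> Re w \<ge> norm w / 4 \<Longrightarrow>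
     norm (Ai_amp w * (2 * of_real (sqrt pi) * csqrt w) - 1) \<le> C / (norm w * sqrt (norm w))"
    using Ai_amp_asymp by blast
  define B where "B = b + a / 2"
  \<comment> \<open>One summand per estimate: \<open>2 * C\<close> for the amplitudes,
    \<open>90 * \<eta>\<close> for the size of \<open>?U\<close>, \<open>5 * pi / \<eta>\<close> for
    \<open>tP\<close> and \<open>tQ\<close>, \<open>300 / \<kappa>\<close> for the gap between the
    exponentials, and a to dominate \<open>\<kappa> * f\<close>.\<close>
  define r where "r = 1 + 2 * C + 90 * \<eta> + 5 * pi / \<eta> + 300 / \<kappa> + a"
  have p: "0 \<le> 5 * pi / \<eta>" "0 \<le> 300 / \<kappa>" using assms by auto
  have r: "r \<ge> 1" "r \<ge> 2 * C" "r \<ge> 90 * \<eta>" "r \<ge> 5 * pi / \<eta>" "r \<ge> 300 / \<kappa>" "r \<ge> a"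
    using p C(1) assms unfolding r_def by linarith+
  define M where "M = B + 2 * r\<^sup>2"
  \<comment> \<open>Keeps the real parts of z - f \<kappa> and z + f \<kappa> positive when Re z
    \<ge> a.\<close>
  define f0 where "f0 = min 1 (a / (2 * \<kappa>))"
  have "f0 > 0" "f0 \<le> 1" using assms by (auto simp: f0_def)
  moreover have "stark_D \<kappa> \<eta> f z \<noteq> 0" if f: "0 < f" "f < f0" and z: "Re z \<in> {a..b}" "Im z \<le> - M" for f z
  proof -
    interpret stark \<kappa> \<eta> f using assms f by unfold_locales auto
    have f1: "f \<le> 1" "f < a / (2 * \<kappa>)" using f by (auto simp: f0_def)
    then have fk: "\<kappa> * f < a / 2" using assms by (simp add: field_simps)
    note m = mf_facts(1,2) mf_facts(3)[OF f1(1)]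
    define k1 where "k1 = csqrt (z - of_real (f * \<kappa>))"
    define k2 where "k2 = csqrt (z - of_real (f * (-\<kappa>)))"
    have kk: "k1\<^sup>2 = z - of_real (f * \<kappa>)" "k2\<^sup>2 = z - of_real (f * (-\<kappa>))" by (simp_all add: k1_def k2_def)
    have fk0: "\<kappa> * f > 0" using pos by simp
    have zz: "a \<le> Re z" "Re z \<le> b" "Im z \<le> - (B + 2 * r\<^sup>2)" using z by (auto simp: M_def)
    have h: "Re (z - of_real (f * \<kappa>)) = Re z - \<kappa> * f" "Re (z - of_real (f * (-\<kappa>))) = Re z + \<kappa> * f"
      "Im (z - of_real (f * \<kappa>)) = Im z" "Im (z - of_real (f * (-\<kappa>))) = Im z" by simp_all
    have h1: "Re (z - of_real (f * \<kappa>)) > 0" "Re (z - of_real (f * \<kappa>)) \<le> B" "Im (z - of_real (f * \<kappa>)) \<le> - (B + 2 * r\<^sup>2)"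
      and h2: "Re (z - of_real (f * (-\<kappa>))) > 0" "Re (z - of_real (f * (-\<kappa>))) \<le> B" "Im (z - of_real (f * (-\<kappa>))) \<le> - (B + 2 * r\<^sup>2)"
      unfolding h using zz fk fk0 assms(3) by (simp_all add: B_def)
    note K1 = csqrt_deep[OF h1 r(1), folded k1_def] and K2 = csqrt_deep[OF h2 r(1), folded k2_def]
    have R0: "Re k1 > 0" "Re k2 > 0" using K1 K2 r by auto
    let ?b1 = "sb z \<kappa>" and ?b2 = "sb z (-\<kappa>)" and ?c1 = "sc z \<kappa>" and ?c2 = "sc z (-\<kappa>)"
    define g1 where "g1 = - (2/3) * Im (k1 ^ 3) / f"
    define g2 where "g2 = - (2/3) * Im (k2 ^ 3) / f"
    have nexp: "norm (exp (2/3 * \<i> * k ^ 3 / of_real f)) = exp (- (2/3) * Im (k ^ 3) / f)"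
      "norm (exp (- (2/3) * \<i> * k ^ 3 / of_real f)) = exp (- (- (2/3) * Im (k ^ 3) / f))" for k
      by (simp_all add: Re_divide_of_real)
    have form1: "norm ?b1 = exp g1 * norm (Ai_amp (rot6' * k1 * of_real mf))" "norm ?c1 = exp (- g1) * norm (Ai_amp (rot6 * k1 * of_real mf))"
      unfolding sb_sc_form[OF kk(1) R0(1) K1(3)] norm_mult nexp g1_def by simp_all
    have form2: "norm ?b2 = exp g2 * norm (Ai_amp (rot6' * k2 * of_real mf))" "norm ?c2 = exp (- g2) * norm (Ai_amp (rot6 * k2 * of_real mf))"
      unfolding sb_sc_form[OF kk(2) R0(2) K2(3)] norm_mult nexp g2_def by simp_all
    have amp: "(norm (Ai_amp (s * k * of_real mf)))\<^sup>2 \<le> 1 / (4 * (mf * norm k))" "(norm (Ai_amp (s * k * of_real mf)))\<^sup>2 \<ge> 1 / (64 * (mf * norm k))"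
      if k: "Re k > 0" "\<bar>Im k\<bar> \<le> Re k" "norm k \<ge> r" and s: "s \<in> {rot6, rot6'}" for s k
    proof -
      note sec = sector_rot6[OF k(1,2) m(1) s]
      have "mf * norm k \<ge> 1 * r" using k(3) m r by (intro mult_mono) auto
      then have n: "norm (s * k * of_real mf) \<ge> 1" "norm (s * k * of_real mf) \<ge> 2 * C" unfolding sec(4) using r by auto
      show "(norm (Ai_amp (s * k * of_real mf)))\<^sup>2 \<le> 1 / (4 * (mf * norm k))"
        "(norm (Ai_amp (s * k * of_real mf)))\<^sup>2 \<ge> 1 / (64 * (mf * norm k))"
        using amp_bounds[OF C sec(1,2) n] unfolding sec(4) by blast+
    qed
    note amp1 = amp[OF R0(1) K1(3,4)] and amp2 = amp[OF R0(2) K2(3,4)]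
    define X where "X = 1 / norm eW"
    have Xeq: "X = 2 * pi * mf / \<eta>" unfolding X_def eW_def norm_e by simp
    have X: "X > 0" unfolding Xeq using m(1) assms by simp
    have small: "1 / (4 * (mf * norm k)) * X \<le> 1/10" if "norm k \<ge> r" for k :: complex
    proof -
      have kp: "norm k > 0" using that r by linarith
      have "1 / (4 * (mf * norm k)) * X = pi / (2 * \<eta> * norm k)" unfolding Xeq using m(1) assms kp by (simp add: field_simps)
      moreover have "5 * pi / \<eta> \<le> norm k" using that r by linarith
      then have "5 * pi \<le> norm k * \<eta>" using assms by (simp add: field_simps)
      then have "pi / (2 * \<eta> * norm k) \<le> 1/10" using assms kp by (simp add: field_simps)
      ultimately show ?thesis by simp
    qed
    have bc: "norm (b * c) \<le> 1 / (4 * (mf * norm k))"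
      if "norm b = exp g * p" "norm c = exp (- g) * q" "p\<^sup>2 \<le> 1 / (4 * (mf * norm k))" "q\<^sup>2 \<le> 1 / (4 * (mf * norm k))"
      for b c k :: complex and g p q :: real
    proof -
      have "norm (b * c) = p * q * (exp g * exp (- g))" unfolding norm_mult that(1,2) by simp
      also have "\<dots> = p * q" by (simp flip: exp_add)
      also have "\<dots> \<le> (p\<^sup>2 + q\<^sup>2) / 2" using zero_le_power2[of "p - q"] by (simp add: power2_eq_square algebra_simps)
      also have "(x + x') / 2 \<le> y" if "x \<le> y" "x' \<le> y" for x x' y :: real using that by simp
      then have "(p\<^sup>2 + q\<^sup>2) / 2 \<le> 1 / (4 * (mf * norm k))" using that(3,4) by blast
      finally show ?thesis .
    qed
    have P: "norm (tP z) \<le> 1/10"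
    proof -
      have "norm (tP z) = norm (?b1 * ?c1) * X" unfolding tP_def X_def by (simp add: norm_divide norm_mult norm_power)
      also have "\<dots> \<le> 1 / (4 * (mf * norm k1)) * X"
        using bc[OF form1 amp1(1) amp1(1)] X by (intro mult_right_mono) auto
      finally show ?thesis using small[OF K1(4)] by linarith
    qed
    have Q: "norm (tQ z) \<le> 1/10"
    proof -
      have "norm (tQ z) = norm (?b2 * ?c2) * X" unfolding tQ_def X_def by (simp add: norm_divide norm_mult norm_power)
      also have "\<dots> \<le> 1 / (4 * (mf * norm k2)) * X"
        using bc[OF form2 amp2(1) amp2(1)] X by (intro mult_right_mono) auto
      finally show ?thesis using small[OF K2(4)] by linarith
    qed
    have im3: "- Im (k ^ 3) \<ge> 2 * (Re k)\<^sup>2" if "Im k \<le> - r" "\<bar>Im k\<bar> \<le> Re k" for k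
    proof -
      have "(Im k)\<^sup>2 \<le> (Re k)\<^sup>2" using that by (simp add: abs_le_square_iff[symmetric])
      then have ge: "3 * (Re k)\<^sup>2 - (Im k)\<^sup>2 \<ge> 2 * (Re k)\<^sup>2" by linarith
      have "- Im (k ^ 3) = (- Im k) * (3 * (Re k)\<^sup>2 - (Im k)\<^sup>2)"
        by (simp add: power3_eq_cube power2_eq_square algebra_simps)
      moreover have "(- Im k) * (3 * (Re k)\<^sup>2 - (Im k)\<^sup>2) \<ge> 1 * (2 * (Re k)\<^sup>2)" using ge that r by (intro mult_mono) auto
      ultimately show ?thesis by simp
    qed
    have "0 \<le> - Im (k1 ^ 3)" by (rule order_trans[OF _ im3[OF K1(2,3)]]) simp
    then have "0 \<le> (2/3) * (- Im (k1 ^ 3)) / f" using pos by (intro divide_nonneg_pos mult_nonneg_nonneg) auto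
    then have g1: "g1 \<ge> 0" unfolding g1_def by simp
    have nim2: "0 \<le> - Im (k2 ^ 3)" by (rule order_trans[OF _ im3[OF K2(2,3)]]) simp
    let ?U = "airy_rot * ?b2\<^sup>2 / eW" and ?V = "airy_rot * ?b1\<^sup>2 / eW" and ?T = "airy_rot * (?b2 * ?c1)\<^sup>2 / eW\<^sup>2"
    have nU: "norm ?U = (norm ?b2)\<^sup>2 * X" and nV: "norm ?V = (norm ?b1)\<^sup>2 * X"
      unfolding X_def by (simp_all add: norm_divide norm_mult norm_power)
    have T: "norm ?T \<le> norm ?U / 10"
    proof -
      have "norm ?T = norm ?U * ((norm ?c1)\<^sup>2 * X)"
        unfolding nU unfolding X_def by (simp add: norm_divide norm_mult norm_power power_mult_distrib power2_eq_square)
      moreover have "(norm ?c1)\<^sup>2 \<le> 1 / (4 * (mf * norm k1))"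
      proof -
        have "(exp (- g1))\<^sup>2 \<le> 1" using g1 by (simp add: power_le_one)
        then have "(exp (- g1))\<^sup>2 * (norm (Ai_amp (rot6 * k1 * of_real mf)))\<^sup>2 \<le> 1 * (norm (Ai_amp (rot6 * k1 * of_real mf)))\<^sup>2"
          by (intro mult_right_mono) auto
        then show ?thesis unfolding form1 power_mult_distrib using amp1(1)[of rot6] by simp
      qed
      then have "(norm ?c1)\<^sup>2 * X \<le> 1/10" using small[OF K1(4)] X by (meson mult_right_mono less_imp_le order_trans)
      then have "norm ?U * ((norm ?c1)\<^sup>2 * X) \<le> norm ?U * (1/10)" by (intro mult_left_mono) auto
      ultimately show ?thesis by simp
    qed
    have snz: "k1 + k2 \<noteq> 0" using R0 by (metis add_pos_pos less_irrefl plus_complex.sel(1) zero_complex.sel(1))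
    \<comment> \<open>In \<open>k_diff\<close> the term \<open>3/4 * (k1 + k2)\<close> has imaginary
      part at most \<open>- (3/2) * r\<close> and the remainder has modulus at most 1; then
      \<open>\<kappa> * r \<ge> 300\<close> yields the 400.\<close>
    have gdiff: "2 * g1 - 2 * g2 \<le> - 400"
    proof -
      let ?s = "k1 + k2"
      have "norm ?s \<ge> 2 * r" using K1(1) K2(1) complex_Re_le_cmod[of ?s] by simp
      then have "norm ?s ^ 3 \<ge> (2 * r) ^ 3" using r by (intro power_mono) auto
      moreover have "(2 * r) ^ 3 \<ge> (\<kappa> * f)\<^sup>2"
      proof -
        have "(\<kappa> * f)\<^sup>2 \<le> r\<^sup>2" using fk r pos assms by (intro power_mono) auto
        also have "\<dots> \<le> r ^ 3" using r by (intro power_increasing) auto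
        also have "\<dots> \<le> (2 * r) ^ 3" using r by (intro power_mono) auto
        finally show ?thesis .
      qed
      ultimately have le3: "(\<kappa> * f)\<^sup>2 \<le> norm ?s ^ 3" by linarith
      have "norm (of_real ((\<kappa> * f)\<^sup>2) / ?s ^ 3) = (\<kappa> * f)\<^sup>2 / norm ?s ^ 3"
        by (simp add: norm_divide norm_power norm_mult power_mult_distrib)
      also have "\<dots> \<le> 1" using le3 snz by (simp add: divide_le_eq_1)
      finally have "norm (of_real ((\<kappa> * f)\<^sup>2) / ?s ^ 3) \<le> 1" .
      then have i1: "Im (of_real ((\<kappa> * f)\<^sup>2) / ?s ^ 3) \<le> 1" using abs_Im_le_cmod[of "of_real ((\<kappa> * f)\<^sup>2) / ?s ^ 3"] by linarith
      have i2: "Im (3/4 * ?s) \<le> - (3/2) * r" using K1(2) K2(2) by simp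
      have q: "r / 2 \<le> - Im (3/4 * ?s + of_real ((\<kappa> * f)\<^sup>2) / ?s ^ 3)" using i1 i2 r unfolding plus_complex.sel by linarith
      have gim: "Im (- of_real t * y) = t * - Im y" for t y by simp
      have "Im (k1 ^ 3) - Im (k2 ^ 3) = Im (k1 ^ 3 - k2 ^ 3)" by simp
      also have "\<dots> = (2 * \<kappa> * f) * - Im (3/4 * ?s + of_real ((\<kappa> * f)\<^sup>2) / ?s ^ 3)"
        unfolding k_diff(1)[OF kk snz] by (rule gim)
      also have "\<dots> \<ge> (2 * \<kappa> * f) * (r / 2)" using q pos by (intro mult_left_mono) auto
      also have "(2 * \<kappa> * f) * (r / 2) = (\<kappa> * r) * f" by simp
      finally have "(Im (k1 ^ 3) - Im (k2 ^ 3)) / f \<ge> \<kappa> * r" using pos by (simp add: le_divide_eq)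
      moreover have "\<kappa> * r \<ge> 300" using r assms by (simp add: divide_le_eq mult.commute)
      moreover have "2 * g1 - 2 * g2 = - (4/3) * ((Im (k1 ^ 3) - Im (k2 ^ 3)) / f)"
        unfolding g1_def g2_def using pos by (simp add: field_simps)
      moreover have "y \<le> - 400" if "c \<le> x" "300 \<le> c" "y = - (4/3) * x" for c x y :: real using that by simp
      ultimately show ?thesis by blast
    qed
    define e1 where "e1 = exp (2 * g1)"
    define e2 where "e2 = exp (2 * g2)"
    have e0: "e1 > 0" "e2 > 0" by (simp_all add: e1_def e2_def)
    have "exp 400 * e1 \<le> e2" unfolding e1_def e2_def using gdiff by (simp flip: exp_add)
    \<comment> \<open>320 = 16 * 2 * 10: the ratio of the amplitude bounds 1/4 and 1/64, the factor
      2 in \<open>norm k2 \<le> 2 * norm k1\<close>, and the desired 10 in the bound for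
      \<open>?V\<close>.\<close>
    moreover have "(320::real) \<le> exp 400" using exp_ge_add_one_self[of 400] by linarith
    then have "320 * e1 \<le> exp 400 * e1" using e0 by (intro mult_right_mono) auto
    ultimately have e12: "320 * e1 \<le> e2" by linarith
    have b1: "(norm ?b1)\<^sup>2 \<le> e1 * (1 / (4 * (mf * norm k1)))"
      unfolding form1 power_mult_distrib e1_def exp_double using amp1(1)[of rot6'] by (intro mult_left_mono) auto
    have b2: "(norm ?b2)\<^sup>2 \<ge> e2 * (1 / (64 * (mf * norm k2)))"
      unfolding form2 power_mult_distrib e2_def exp_double using amp2(2)[of rot6'] by (intro mult_left_mono) auto
    have k0: "norm k1 > 0" "norm k2 > 0" using K1 K2 r by linarith+
    have k21: "norm k2 \<le> 2 * norm k1"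
    proof -
      have "(norm k2)\<^sup>2 = norm (k1\<^sup>2 + of_real (2 * \<kappa> * f))" unfolding kk norm_power[symmetric] by (simp add: mult_ac add_ac)
      also have "\<dots> \<le> (norm k1)\<^sup>2 + 2 * \<kappa> * f"
        using norm_triangle_ineq[of "k1\<^sup>2" "of_real (2 * \<kappa> * f)"] pos by (simp add: norm_power norm_mult)
      also have "2 * \<kappa> * f \<le> r" using fk r by simp
      also have "r \<le> r * norm k1" using K1(4) r mult_left_mono[of 1 "norm k1" r] by simp
      also have "\<dots> \<le> norm k1 * norm k1" using K1(4) by (intro mult_right_mono) auto
      finally have "(norm k2)\<^sup>2 \<le> (norm k1)\<^sup>2 + norm k1 * norm k1" by simp
      moreover have "x\<^sup>2 + x * x \<le> (2 * x)\<^sup>2" for x :: real by (simp add: power2_eq_square)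
      ultimately have "(norm k2)\<^sup>2 \<le> (2 * norm k1)\<^sup>2" by (rule order_trans)
      then show ?thesis by (rule power2_le_imp_le) auto
    qed
    have V: "norm ?V \<le> norm ?U / 10"
    proof -
      have "e1 * (1 / (4 * (mf * norm k1))) \<le> e2 * (1 / (64 * (mf * norm k2))) / 10"
      proof -
        have "e1 * (640 * norm k2) \<le> e1 * (1280 * norm k1)" using k21 e0 by (intro mult_left_mono) auto
        also have "\<dots> \<le> e2 * 4 * norm k1" using mult_right_mono[OF e12, of "4 * norm k1"] by simp
        finally have "e1 * (640 * norm k2) \<le> e2 * 4 * norm k1" .
        then show ?thesis using k0 m(1) by (simp add: field_simps)
      qed
      also have "\<dots> \<le> (norm ?b2)\<^sup>2 / 10" using b2 by (rule divide_right_mono) simp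
      finally have "(norm ?b1)\<^sup>2 \<le> (norm ?b2)\<^sup>2 / 10" by (rule order_trans[OF b1])
      then show ?thesis unfolding nU nV using X mult_right_mono[of "(norm ?b1)\<^sup>2" "(norm ?b2)\<^sup>2 / 10" X] by simp
    qed
    have U: "norm ?U \<ge> 4"
    proof -
      have "2 * g2 = (4/3) * (- Im (k2 ^ 3)) / f" by (simp add: g2_def)
      moreover have "(4/3) * (- Im (k2 ^ 3)) / f \<ge> (4/3) * (- Im (k2 ^ 3)) / 1"
        using nim2 f1 pos by (intro divide_left_mono) auto
      moreover have "(4/3) * y \<ge> x" if "2 * x \<le> y" "0 \<le> y" for x y :: real using that by simp
      then have "(4/3) * (- Im (k2 ^ 3)) \<ge> (Re k2)\<^sup>2" using im3[OF K2(2,3)] nim2 by blast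
      ultimately have "2 * g2 \<ge> (Re k2)\<^sup>2" by linarith
      then have ee: "e2 \<ge> (Re k2)\<^sup>2" unfolding e2_def using exp_ge_add_one_self[of "2 * g2"] by linarith
      have nk: "norm k2 \<le> 2 * Re k2" using cmod_le[of k2] K2(3) R0 by simp
      have "e2 * (1 / (64 * (mf * norm k2))) * X = e2 * pi / (32 * \<eta> * norm k2)" unfolding Xeq using m(1) assms k0 by (simp add: field_simps)
      also have "\<dots> \<ge> 4"
      proof -
        have "90 * \<eta> \<le> Re k2" using K2 r by linarith
        have "4 * (32 * \<eta> * norm k2) \<le> 4 * (32 * \<eta> * (2 * Re k2))" using nk assms by (intro mult_left_mono) auto
        also have "\<dots> = (256 * \<eta>) * Re k2" by simp
        also have "\<dots> \<le> (3 * Re k2) * Re k2" using \<open>90 * \<eta> \<le> Re k2\<close> R0 by (intro mult_right_mono) auto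
        also have "\<dots> = (Re k2)\<^sup>2 * 3" by (simp add: power2_eq_square)
        also have "\<dots> \<le> e2 * pi" using ee e0 pi_gt3 by (intro mult_mono) auto
        finally show ?thesis using assms k0 by (simp add: le_divide_eq)
      qed
      finally have "4 \<le> e2 * (1 / (64 * (mf * norm k2))) * X" .
      also have "\<dots> \<le> norm ?U" unfolding nU using b2 X by (intro mult_right_mono) auto
      finally show ?thesis .
    qed
    show "stark_D \<kappa> \<eta> f z \<noteq> 0"
    proof
      assume "stark_D \<kappa> \<eta> f z = 0"
      then have "D z = 0" by (simp add: D_def)
      \<comment> \<open>Solving for U gives |U| \<le> 1.21 + 0.31 |U|, which is impossible for |U|
        \<ge> 4.\<close>
      have gen: False if 0: "0 = (1 - P) * (1 - Q) - T - U * (1 + P) - V * (1 - Q)"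
        and b: "norm P \<le> 1/10" "norm Q \<le> 1/10" "norm T \<le> norm U / 10" "norm V \<le> norm U / 10" "norm U \<ge> 4" for P Q T U V :: complex
      proof -
        have "U = (1 - P) * (1 - Q) - T - V * (1 - Q) - U * P" using 0 by (simp add: algebra_simps)
        then have "norm U = norm ((1 - P) * (1 - Q) - T - V * (1 - Q) - U * P)" by (rule arg_cong)
        moreover have "norm (p - q - r - s) \<le> norm p + norm q + norm r + norm s" for p q r s :: complex
          by (rule order_trans[OF norm_triangle_ineq4 add_right_mono[OF order_trans[OF norm_triangle_ineq4 add_right_mono[OF norm_triangle_ineq4]]]])
        ultimately have "norm U \<le> norm ((1 - P) * (1 - Q)) + norm T + norm (V * (1 - Q)) + norm (U * P)"
          by (simp only:)
        moreover have "norm ((1 - P) * (1 - Q)) \<le> 11/10 * (11/10)"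
          unfolding norm_mult using b norm_triangle_ineq4[of 1 P] norm_triangle_ineq4[of 1 Q] by (intro mult_mono) auto
        moreover have "norm (V * (1 - Q)) \<le> norm U / 10 * (11/10)"
          unfolding norm_mult using b norm_triangle_ineq4[of 1 Q] by (intro mult_mono) auto
        moreover have "norm (U * P) \<le> norm U * (1/10)" unfolding norm_mult using b by (intro mult_left_mono) auto
        ultimately show False using b(3,5) by linarith
      qed
      show False by (rule gen[OF _ P Q T V U]) (use \<open>D z = 0\<close> D_alt[of z] in simp)
    qed
  qed
  ultimately show ?thesis by blast
qed

lemma stark_D_entire:
  assumes "\<kappa> > 0" "\<eta> > 0" "f > 0"
  shows "stark_D \<kappa> \<eta> f holomorphic_on S" "\<exists>z. stark_D \<kappa> \<eta> f z \<noteq> 0"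
    "is_resonance \<kappa> \<eta> f z \<longleftrightarrow> Im z < 0 \<and> stark_D \<kappa> \<eta> f z = 0"
proof -
  interpret stark \<kappa> \<eta> f using assms by unfold_locales auto
  show "stark_D \<kappa> \<eta> f holomorphic_on S" "\<exists>z. stark_D \<kappa> \<eta> f z \<noteq> 0"
    "is_resonance \<kappa> \<eta> f z \<longleftrightarrow> Im z < 0 \<and> stark_D \<kappa> \<eta> f z = 0"
    using D_holomorphic D_not_zero_everywhere is_resonance_iff by (simp_all add: D_def)
qed

text \<open>\<open>no_deep_zeros\<close> confines the resonances over [a, b] to a fixed disc about
  -E; their number is then at most the binary logarithm of 2 exp(C / f).\<close>

lemma resonance_count_upper:
  assumes "\<kappa> > 0" "\<eta> > 0" "0 < a" "0 < b"
  shows "\<exists>C f0. C > 0 \<and> f0 > 0 \<and> (\<forall>f. 0 < f \<and> f < f0 \<longrightarrow> resonance_count \<kappa> \<eta> f a b \<le> ennreal (C / f))"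
proof -
  obtain M f0 where f0: "f0 > 0" "f0 \<le> 1" and deep: "\<And>f z. 0 < f \<and> f < f0 \<and> Re z \<in> {a..b} \<and> Im z \<le> - M \<Longrightarrow> stark_D \<kappa> \<eta> f z \<noteq> 0"
    using no_deep_zeros[OF assms] by blast
  obtain E where E: "E > 0" "\<And>f. 0 < f \<and> f \<le> 1 \<Longrightarrow> norm (stark_D \<kappa> \<eta> f (- of_real E)) \<ge> 1 / 2"
    using D_centre[OF assms(1,2)] by blast
  \<comment> \<open>Every resonance considered has distance at most E + b + |M| from -E, one third
    of the radius, as \<open>zero_count_bound\<close> requires.\<close>
  define \<rho> where "\<rho> = 3 * (E + b + \<bar>M\<bar>)"
  have \<rho>: "\<rho> > 0" using E assms by (simp add: \<rho>_def add_pos_nonneg)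
  then have "\<rho> + E > 0" using E by simp
  then obtain C where C: "C > 0" "\<And>f z. 0 < f \<and> f \<le> 1 \<and> norm z \<le> \<rho> + E \<Longrightarrow> norm (stark_D \<kappa> \<eta> f z) \<le> exp (C / f)"
    using D_growth[OF assms(1,2), of "\<rho> + E"] by blast
  have main: "resonance_count \<kappa> \<eta> f a b \<le> ennreal (2 * (1 + C) / f)" if f: "0 < f" "f < f0" for f
  proof -
    have f1: "f \<le> 1" using f f0 by simp
    note ent = stark_D_entire[OF assms(1,2) f(1)]
    let ?D = "stark_D \<kappa> \<eta> f" and ?c = "- complex_of_real E"
    \<comment> \<open>Bounding all finite partial sums suffices for a sum of extended nonnegative
      reals; finiteness of the set of resonances comes out along the way.\<close>
    have "(\<Sum>z\<in>Z. of_nat (resonance_multiplicity \<kappa> \<eta> f z) :: ennreal) \<le> ennreal (2 * (1 + C) / f)"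
      if Z: "finite Z" "Z \<subseteq> {z. is_resonance \<kappa> \<eta> f z \<and> Re z \<in> {a..b}}" for Z
    proof -
      define N where "N = (\<Sum>z\<in>Z. nat (zorder ?D z))"
      have zero: "?D z = 0" if "z \<in> Z" for z using Z that ent(3) by auto
      have near: "norm (?c - z) \<le> \<rho> / 3" if z: "z \<in> Z" for z
      proof -
        have r: "Re z \<in> {a..b}" "Im z < 0" using Z z ent(3) by auto
        have "\<not> Im z \<le> - M" using deep[of f z] f r zero[OF z] by blast
        then have "\<bar>Im z\<bar> \<le> \<bar>M\<bar>" using r by linarith
        moreover have "\<bar>Re z\<bar> \<le> b" using r assms by auto
        moreover have "norm z \<le> \<bar>Re z\<bar> + \<bar>Im z\<bar>" by (rule cmod_le)
        moreover have "norm (?c - z) \<le> E + norm z" using norm_triangle_ineq4[of ?c z] E by simp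
        ultimately have "norm (?c - z) \<le> E + b + \<bar>M\<bar>" by linarith
        then show ?thesis by (simp add: \<rho>_def)
      qed
      have bound: "norm (?D w) \<le> exp (C / f)" if w: "norm (w - ?c) = \<rho>" for w
      proof -
        have "norm w \<le> \<rho> + E" using norm_triangle_ineq[of "w - ?c" ?c] w E by simp
        then show ?thesis using C(2)[of f w] f f1 by blast
      qed
      have half: "norm (?D ?c) \<ge> 1 / 2" using E(2)[of f] f f1 by blast
      have h1: "norm (?D ?c) * 2 ^ N \<le> exp (C / f)"
        unfolding N_def by (rule zero_count_bound[OF ent(1) _ \<rho> bound Z(1) zero near]) (use half in auto)
      have "1 / 2 * 2 ^ N \<le> norm (?D ?c) * 2 ^ N" using half by (intro mult_right_mono) auto
      from order_trans[OF this h1] have "2 ^ N \<le> 2 * exp (C / f)" by simp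
      also have "2 \<le> exp (1 / f)"
      proof -
        have "1 \<le> 1 / f" using f f1 by (simp add: le_divide_eq)
        then show ?thesis using exp_ge_add_one_self[of "1 / f"] by linarith
      qed
      finally have "2 ^ N \<le> exp (1 / f) * exp (C / f)" by simp
      also have "\<dots> = exp ((1 + C) / f)" by (simp add: add_divide_distrib flip: exp_add)
      finally have "ln (2 ^ N) \<le> (1 + C) / f" using ln_le_cancel_iff[of "2 ^ N" "exp ((1 + C) / f)"] by simp
      then have "real N * ln 2 \<le> (1 + C) / f" by (simp add: ln_realpow)
      moreover have "real N * (1/2) \<le> real N * ln 2" using ln2_ge_two_thirds by (intro mult_left_mono) auto
      ultimately have "real N \<le> 2 * ((1 + C) / f)" by linarith
      then have le: "real N \<le> 2 * (1 + C) / f" by (simp only: times_divide_eq_right)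
      have "(\<Sum>z\<in>Z. of_nat (resonance_multiplicity \<kappa> \<eta> f z) :: ennreal) = of_nat N"
        by (simp add: resonance_multiplicity_def N_def)
      also have "\<dots> = ennreal (real N)" by (simp add: ennreal_of_nat_eq_real_of_nat)
      also have "\<dots> \<le> ennreal (2 * (1 + C) / f)" by (rule ennreal_leI[OF le])
      finally show ?thesis .
    qed
    then show ?thesis unfolding resonance_count_def
      by (intro infsum_le_finite_sums nonneg_summable_on_complete) auto
  qed
  show ?thesis by (rule exI[of _ "2 * (1 + C)"], rule exI[of _ f0]) (use C f0 main in auto)
qed

section \<open>Lower bound for the number of resonances\<close>

text \<open>Both sides have the same square since \<open>rot6 * rot6' = 1\<close>. The sign is
  settled by real parts: the principal root of a point in the right half plane satisfies |Im| < Re,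
  and a product of two such numbers has positive real part.\<close>

lemma csqrt_mult_conj_rot:
  assumes k: "Re k > 0" "\<bar>Im k\<bar> \<le> Re k" and m: "m > 0"
  shows "csqrt (rot6' * k * of_real m) * csqrt (rot6 * k * of_real m) = k * of_real m"
proof -
  define u v where "u = csqrt (rot6' * k * of_real m)" and "v = csqrt (rot6 * k * of_real m)"
  have sq: "u\<^sup>2 = rot6' * k * of_real m" "v\<^sup>2 = rot6 * k * of_real m" by (simp_all add: u_def v_def)
  have "Re (rot6' * k * of_real m) > 0" "Re (rot6 * k * of_real m) > 0"
    using sector_rot6(3)[OF k m] by auto
  then have uv: "Re u > 0" "Re v > 0" "(Re u)\<^sup>2 - (Im u)\<^sup>2 > 0" "(Re v)\<^sup>2 - (Im v)\<^sup>2 > 0"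
    unfolding u_def v_def using csqrt_parts(3,4)[OF _ refl] by metis+
  have lt: "\<bar>Im w\<bar> < Re w" if "Re w > 0" "(Re w)\<^sup>2 - (Im w)\<^sup>2 > 0" for w
    using that by (intro power_less_imp_less_base[of "\<bar>Im w\<bar>" 2 "Re w"]) auto
  have "\<bar>Im u * Im v\<bar> < Re u * Re v"
    unfolding abs_mult using lt uv by (intro mult_strict_mono') auto
  then have re: "Re (u * v) > 0" by (simp add: abs_less_iff)
  have "(u * v)\<^sup>2 = (rot6 * rot6') * (k * of_real m)\<^sup>2"
    unfolding power_mult_distrib sq by (simp add: power2_eq_square)
  then have "(u * v)\<^sup>2 = (k * of_real m)\<^sup>2" by (simp add: rot6_facts)
  then have "u * v = k * of_real m \<or> u * v = - (k * of_real m)" by (simp only: power2_eq_iff)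
  moreover have "Re (- (k * of_real m)) < 0" using k m by simp
  ultimately show ?thesis using re unfolding u_def v_def by (metis less_asym)
qed

definition Ai_amp_normalized :: "complex \<Rightarrow> complex" where
  "Ai_amp_normalized v = Ai_amp v * (2 * of_real (sqrt pi) * csqrt v)"

lemma Ai_amp_normalized_square: "(Ai_amp_normalized v)\<^sup>2 = 4 * of_real pi * v * (Ai_amp v)\<^sup>2"
proof -
  have "(complex_of_real (sqrt pi))\<^sup>2 = of_real pi" by (simp flip: of_real_power)
  then show ?thesis by (simp add: Ai_amp_normalized_def power_mult_distrib)
qed

lemma Ai_amp_normalized_tendsto:
  assumes "eventually (\<lambda>n. v n \<noteq> 0 \<and> Re (v n) \<ge> norm (v n) / 4) F" "filterlim (\<lambda>n. norm (v n)) at_top F"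
  shows "((\<lambda>n. Ai_amp_normalized (v n)) \<longlongrightarrow> 1) F"
proof -
  obtain C where C: "C > 0" "\<And>w. w \<noteq> 0 \<and> Re w \<ge> norm w / 4 \<Longrightarrow>
     norm (Ai_amp w * (2 * of_real (sqrt pi) * csqrt w) - 1) \<le> C / (norm w * sqrt (norm w))"
    using Ai_amp_asymp by blast
  have "((\<lambda>x. C / (x * sqrt x)) \<longlongrightarrow> 0) at_top" by real_asymp
  from filterlim_compose[OF this assms(2)]
  have "((\<lambda>n. C / (norm (v n) * sqrt (norm (v n)))) \<longlongrightarrow> 0) F" .
  then have "((\<lambda>n. Ai_amp_normalized (v n) - 1) \<longlongrightarrow> 0) F"
    by (rule Lim_null_comparison[rotated]) (use assms(1) in eventually_elim, auto simp: Ai_amp_normalized_def intro: C(2))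
  then show ?thesis by (simp add: LIM_zero_iff)
qed

context stark
begin

lemma eW_eq: "eW = of_real \<eta> * rot6' / (2 * of_real pi * of_real mf)"
proof -
  have "- \<i> * complex_of_real pi / 6 = - \<i> * of_real (pi / 6)" by simp
  then have "W = of_real (f powr (1/3)) * rot6' / (2 * of_real pi)"
    unfolding W_def stark_W_def rot6'_def by (simp only:)
  moreover have "f powr (1/3) = 1 / mf" unfolding powr_thirds(7) using pos by simp
  ultimately show ?thesis by (simp add: eW_def)
qed

abbreviation (input) "nB k \<equiv> Ai_amp_normalized (rot6' * k * of_real mf)"
abbreviation (input) "nC k \<equiv> Ai_amp_normalized (rot6 * k * of_real mf)"

text \<open>The common form of \<open>tP\<close> and \<open>tQ\<close> after the exponentials have
  cancelled; for fixed k it tends to -i / (2 \<eta> k) as f tends to 0.\<close>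

definition cP :: "complex \<Rightarrow> complex" where "cP k = - \<i> * (nB k * nC k) / (2 * of_real \<eta> * k)"

text \<open>No approximation yet: the Airy functions enter through normalised amplitudes, which tend
  to 1, and explicit exponentials, so the limit can be taken term by term. The exponential of
  \<open>k2 ^ 3 - k1 ^ 3\<close> converges by itself; the last two carry the fast phase.\<close>

lemma D_exact:
  assumes k1: "k1\<^sup>2 = z - of_real (f * \<kappa>)" "Re k1 > 0" "\<bar>Im k1\<bar> \<le> Re k1"
    and k2: "k2\<^sup>2 = z - of_real (f * (-\<kappa>))" "Re k2 > 0" "\<bar>Im k2\<bar> \<le> Re k2"
  shows "D z = (1 - cP k1) * (1 - cP k2)
    + exp (4/3 * \<i> * (k2 ^ 3 - k1 ^ 3) / of_real f) * (nB k2)\<^sup>2 * (nC k1)\<^sup>2 / (4 * (of_real \<eta>)\<^sup>2 * k2 * k1)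
    + exp (4/3 * \<i> * k2 ^ 3 / of_real f) * (nB k2)\<^sup>2 / (2 * of_real \<eta> * k2) * (1 + cP k1)
    + exp (4/3 * \<i> * k1 ^ 3 / of_real f) * (nB k1)\<^sup>2 / (2 * of_real \<eta> * k1) * (1 - cP k2)"
proof -
  have nz: "k1 \<noteq> 0" "k2 \<noteq> 0" using k1 k2 by auto
  have m: "complex_of_real mf \<noteq> 0" using mf_facts(1) by simp
  have e: "complex_of_real \<eta> \<noteq> 0" using pos by simp
  have pi0: "complex_of_real pi \<noteq> 0" by simp
  have r0: "rot6 \<noteq> 0" "rot6' \<noteq> 0" by (simp_all add: rot6_def rot6'_def)
  have bc: "airy_rot\<^sup>2 * (b * c) / eW = cP k"
    if kk: "Re k > 0" "\<bar>Im k\<bar> \<le> Re k" and b: "b = exp (2/3 * \<i> * k ^ 3 / of_real f) * Ai_amp (rot6' * k * of_real mf)"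
      and c: "c = exp (- (2/3) * \<i> * k ^ 3 / of_real f) * Ai_amp (rot6 * k * of_real mf)" for b c k
  proof -
    have k0: "k \<noteq> 0" using kk by auto
    let ?p = "Ai_amp (rot6' * k * of_real mf) * Ai_amp (rot6 * k * of_real mf)"
    have e1: "exp (2/3 * \<i> * k ^ 3 / of_real f) * exp (- (2/3) * \<i> * k ^ 3 / of_real f) = 1"
      by (simp flip: exp_add)
    have "b * c = (exp (2/3 * \<i> * k ^ 3 / of_real f) * exp (- (2/3) * \<i> * k ^ 3 / of_real f)) * ?p"
      unfolding b c by (simp only: mult_ac)
    then have p: "b * c = ?p" unfolding e1 by simp
    have "nB k * nC k = 4 * (of_real (sqrt pi) * of_real (sqrt pi)) * ?p *
        (csqrt (rot6' * k * of_real mf) * csqrt (rot6 * k * of_real mf))"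
      by (simp add: Ai_amp_normalized_def mult_ac)
    also have "complex_of_real (sqrt pi) * of_real (sqrt pi) = of_real pi" by (simp flip: of_real_mult)
    also have "csqrt (rot6' * k * of_real mf) * csqrt (rot6 * k * of_real mf) = k * of_real mf"
      by (rule csqrt_mult_conj_rot[OF kk mf_facts(1)])
    finally have nn: "nB k * nC k = 4 * of_real pi * ?p * (k * of_real mf)" .
    have "airy_rot\<^sup>2 = - (rot6\<^sup>2)" by (simp add: rot6_facts)
    then have "airy_rot\<^sup>2 * rot6 = - (rot6 ^ 3)" by (simp add: power3_eq_cube power2_eq_square)
    then have w: "airy_rot\<^sup>2 * rot6 = - \<i>" by (simp add: rot6_facts)
    have "1 / rot6' = rot6" using rot6_facts(1) r0 by (simp add: divide_eq_eq)
    then have "airy_rot\<^sup>2 * ?p / eW = (airy_rot\<^sup>2 * rot6) * ?p * (2 * of_real pi * of_real mf) / of_real \<eta>"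
      unfolding eW_eq using r0 e by (simp add: divide_eq_eq eq_divide_eq field_simps)
    also have "\<dots> = cP k" unfolding cP_def nn w using e k0 m by (simp add: field_simps)
    finally show ?thesis unfolding p .
  qed
  have P: "tP z = cP k1" unfolding tP_def by (rule bc[OF k1(2,3) sb_sc_form[OF k1]])
  have Q: "tQ z = cP k2" unfolding tQ_def by (rule bc[OF k2(2,3) sb_sc_form[OF k2]])
  have ee: "(exp (2/3 * \<i> * k ^ 3 / of_real f))\<^sup>2 = exp (4/3 * \<i> * k ^ 3 / of_real f)" for k
  proof -
    have "4/3 * \<i> * k ^ 3 / of_real f = 2 * (2/3 * \<i> * k ^ 3 / of_real f)" by simp
    then show ?thesis by (simp only: exp_double)
  qed
  have wr: "airy_rot = - (rot6'\<^sup>2)" by (simp add: rot6_facts)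
  have amp2: "(Ai_amp (r * k * of_real mf))\<^sup>2 = (Ai_amp_normalized (r * k * of_real mf))\<^sup>2 / (4 * of_real pi * (r * k * of_real mf))"
    if "k \<noteq> 0" "r \<noteq> 0" for r k
    unfolding Ai_amp_normalized_square using that m pi0 by simp
  have U: "airy_rot * b\<^sup>2 / eW = - (exp (4/3 * \<i> * k ^ 3 / of_real f) * (nB k)\<^sup>2 / (2 * of_real \<eta> * k))"
    if "k \<noteq> 0" "b = exp (2/3 * \<i> * k ^ 3 / of_real f) * Ai_amp (rot6' * k * of_real mf)" for b k
    unfolding that(2) power_mult_distrib ee amp2[OF that(1) r0(2)] eW_eq wr using that(1) m pi0 r0 e
    by (simp add: field_simps power2_eq_square)
  note U1 = U[OF nz(1) sb_sc_form(1)[OF k1]] and U2 = U[OF nz(2) sb_sc_form(1)[OF k2]]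
  have T: "airy_rot * (sb z (-\<kappa>) * sc z \<kappa>)\<^sup>2 / eW\<^sup>2 =
    - (exp (4/3 * \<i> * (k2 ^ 3 - k1 ^ 3) / of_real f) * (nB k2)\<^sup>2 * (nC k1)\<^sup>2 / (4 * (of_real \<eta>)\<^sup>2 * k2 * k1))"
  proof -
    have ex: "(exp (2/3 * \<i> * k2 ^ 3 / of_real f) * exp (- (2/3) * \<i> * k1 ^ 3 / of_real f))\<^sup>2 = exp (4/3 * \<i> * (k2 ^ 3 - k1 ^ 3) / of_real f)"
    proof -
      have "4/3 * \<i> * (k2 ^ 3 - k1 ^ 3) / of_real f = 2 * (2/3 * \<i> * k2 ^ 3 / of_real f + - (2/3) * \<i> * k1 ^ 3 / of_real f)"
        by (simp add: right_diff_distrib diff_divide_distrib mult.assoc)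
      then show ?thesis by (simp only: exp_double exp_add)
    qed
    have "(sb z (-\<kappa>) * sc z \<kappa>)\<^sup>2 = (exp (2/3 * \<i> * k2 ^ 3 / of_real f) * exp (- (2/3) * \<i> * k1 ^ 3 / of_real f))\<^sup>2 *
       ((Ai_amp (rot6' * k2 * of_real mf))\<^sup>2 * (Ai_amp (rot6 * k1 * of_real mf))\<^sup>2)"
      unfolding sb_sc_form(1)[OF k2] sb_sc_form(2)[OF k1] by (simp only: power_mult_distrib mult_ac)
    also have "\<dots> = exp (4/3 * \<i> * (k2 ^ 3 - k1 ^ 3) / of_real f) * ((nB k2)\<^sup>2 * (nC k1)\<^sup>2) / ((4 * of_real pi)\<^sup>2 * (rot6 * rot6') * (k2 * k1 * (of_real mf)\<^sup>2))"
      unfolding ex amp2[OF nz(2) r0(2)] amp2[OF nz(1) r0(1)] by (simp add: power2_eq_square mult_ac)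
    finally have sq: "(sb z (-\<kappa>) * sc z \<kappa>)\<^sup>2 = exp (4/3 * \<i> * (k2 ^ 3 - k1 ^ 3) / of_real f) * ((nB k2)\<^sup>2 * (nC k1)\<^sup>2) / ((4 * of_real pi)\<^sup>2 * (k2 * k1 * (of_real mf)\<^sup>2))"
      by (simp add: rot6_facts)
    have ew2: "eW\<^sup>2 = - ((of_real \<eta>)\<^sup>2 * airy_rot / (2 * of_real pi * of_real mf)\<^sup>2)"
      unfolding eW_eq by (simp add: power_divide power_mult_distrib rot6_facts)
    show ?thesis unfolding sq ew2 using nz m pi0 e by (simp add: field_simps power2_eq_square)
  qed
  show ?thesis unfolding D_alt P Q T U1 U2 by simp
qed

end

text \<open>Restated outside the locale because f varies along a sequence in the limit
  argument.\<close>

lemma stark_D_exact: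
  assumes "\<kappa> > 0" "\<eta> > 0" "f > 0"
    and k1: "k1\<^sup>2 = z - of_real (f * \<kappa>)" "Re k1 > 0" "\<bar>Im k1\<bar> \<le> Re k1"
    and k2: "k2\<^sup>2 = z - of_real (f * (-\<kappa>))" "Re k2 > 0" "\<bar>Im k2\<bar> \<le> Re k2"
  defines "B \<equiv> \<lambda>k. Ai_amp_normalized (rot6' * k * of_real (f powr (-1/3)))"
    and "C \<equiv> \<lambda>k. Ai_amp_normalized (rot6 * k * of_real (f powr (-1/3)))"
  defines "P \<equiv> \<lambda>k. - \<i> * (B k * C k) / (2 * of_real \<eta> * k)"
  shows "stark_D \<kappa> \<eta> f z = (1 - P k1) * (1 - P k2)
    + exp (4/3 * \<i> * (k2 ^ 3 - k1 ^ 3) / of_real f) * (B k2)\<^sup>2 * (C k1)\<^sup>2 / (4 * (of_real \<eta>)\<^sup>2 * k2 * k1)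
    + exp (4/3 * \<i> * k2 ^ 3 / of_real f) * (B k2)\<^sup>2 / (2 * of_real \<eta> * k2) * (1 + P k1)
    + exp (4/3 * \<i> * k1 ^ 3 / of_real f) * (B k1)\<^sup>2 / (2 * of_real \<eta> * k1) * (1 - P k2)"
proof -
  interpret stark \<kappa> \<eta> f using assms by unfold_locales auto
  show ?thesis using D_exact[OF k1 k2] unfolding D_def cP_def B_def C_def P_def .
qed

section \<open>The limit of the determinant on the scale f around a positive energy\<close>

definition limN :: "real \<Rightarrow> real \<Rightarrow> real \<Rightarrow> complex" where
  "limN \<kappa> \<eta> k = (1 + \<i> / of_real (2 * \<eta> * k))\<^sup>2 + exp (\<i> * of_real (4 * k * \<kappa>)) / (of_real (2 * \<eta> * k))\<^sup>2"

text \<open>\<open>limN\<close> collects the terms of \<open>D_exact\<close> without the fast phase,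
  \<open>limV\<close> those with it. Up to phases, \<open>1 / limN\<close> and
  \<open>limV / limN\<close> are the transmission and reflection amplitudes of the two deltas at
  energy k^2 for f = 0.\<close>

definition limV :: "real \<Rightarrow> real \<Rightarrow> real \<Rightarrow> real" where
  "limV \<kappa> \<eta> k = (cos (2 * k * \<kappa>) + sin (2 * k * \<kappa>) / (2 * \<eta> * k)) / (\<eta> * k)"

text \<open>Unitarity of the scattering matrix of the two delta interactions at \<open>f = 0\<close>.\<close>

lemma limN_limV:
  assumes "\<eta> > 0" "k > 0"
  shows "(norm (limN \<kappa> \<eta> k))\<^sup>2 = 1 + (limV \<kappa> \<eta> k)\<^sup>2"
proof -
  define g where "g = 1 / (2 * \<eta> * k)"
  define c s where "c = cos (2 * k * \<kappa>)" and "s = sin (2 * k * \<kappa>)"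
  have cs: "c * c + s * s = 1" unfolding c_def s_def using sin_cos_squared_add[of "2 * k * \<kappa>"] by (simp add: power2_eq_square)
  have d: "4 * k * \<kappa> = 2 * (2 * k * \<kappa>)" by simp
  have cis4: "exp (\<i> * of_real (4 * k * \<kappa>)) = Complex (c * c - s * s) (2 * s * c)"
  proof -
    have "cis (2 * t) = Complex (cos t * cos t - sin t * sin t) (2 * sin t * cos t)" for t
      by (simp add: complex_eq_iff cos_double sin_double power2_eq_square)
    then show ?thesis unfolding cis_conv_exp[symmetric] d c_def s_def .
  qed
  have g1: "\<i> / of_real (2 * \<eta> * k) = \<i> * of_real g" "1 / (complex_of_real (2 * \<eta> * k))\<^sup>2 = of_real (g * g)"
    by (simp_all add: g_def power2_eq_square)
  have N: "limN \<kappa> \<eta> k = (1 + \<i> * of_real g)\<^sup>2 + Complex (c * c - s * s) (2 * s * c) * of_real (g * g)"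
    unfolding limN_def cis4 g1(1) g1(2)[symmetric] by simp
  have re: "Re (limN \<kappa> \<eta> k) = 1 - g * g + (c * c - s * s) * (g * g)" "Im (limN \<kappa> \<eta> k) = 2 * g + 2 * s * c * (g * g)"
    unfolding N by (simp_all add: power2_eq_square)
  have V: "limV \<kappa> \<eta> k = 2 * g * (c + g * s)"
    unfolding limV_def g_def c_def s_def using assms by (simp add: field_simps)
  show ?thesis unfolding cmod_power2 re V using cs by algebra
qed

text \<open>If the numerator 2 \<eta> k cos(2 k \<kappa>) + sin(2 k \<kappa>) vanished on an
  interval, so would its derivative. Eliminating the sine leaves the cosine times a positive number,
  so sine and cosine would vanish together.\<close>

lemma exists_limV_nonzero:
  assumes "\<kappa> > 0" "\<eta> > 0" "0 < p" "p < q"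
  shows "\<exists>k\<in>{p<..<q}. limV \<kappa> \<eta> k \<noteq> 0"
proof (rule ccontr)
  assume "\<not> ?thesis"
  then have z: "limV \<kappa> \<eta> k = 0" if "k \<in> {p<..<q}" for k using that by blast
  let ?w = "\<lambda>k. 2 * \<eta> * k * cos (2 * k * \<kappa>) + sin (2 * k * \<kappa>)"
  have w0: "?w k = 0" if "k \<in> {p<..<q}" for k
  proof -
    have "k > 0" using that assms by auto
    then have "cos (2 * k * \<kappa>) + sin (2 * k * \<kappa>) / (2 * \<eta> * k) = 0" using z[OF that] assms by (simp add: limV_def)
    then show ?thesis using \<open>k > 0\<close> assms by (simp add: field_simps)
  qed
  define k where "k = (p + q) / 2"
  have k: "k \<in> {p<..<q}" "k > 0" using assms by (auto simp: k_def)
  let ?c = "cos (2 * k * \<kappa>)" and ?s = "sin (2 * k * \<kappa>)"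
  have "(?w has_real_derivative (2 * \<eta> * ?c + 2 * \<eta> * k * (- ?s * (2 * \<kappa>)) + ?c * (2 * \<kappa>))) (at k)"
    by (auto intro!: derivative_eq_intros)
  moreover have "(?w has_real_derivative 0) (at k)"
    by (rule has_field_derivative_transform_within_open[OF DERIV_const[of 0], where S="{p<..<q}"]) (use k w0 in auto)
  ultimately have d: "2 * \<eta> * ?c + 2 * \<eta> * k * (- ?s * (2 * \<kappa>)) + ?c * (2 * \<kappa>) = 0" by (rule DERIV_unique)
  have s: "?s = - (2 * \<eta> * k * ?c)" using w0[OF k(1)] by linarith
  have "?c * (2 * \<eta> + 2 * \<kappa> + 8 * (\<eta> * k)\<^sup>2 * \<kappa>) = 0"
    using d unfolding s by (simp add: algebra_simps power2_eq_square)
  moreover have "2 * \<eta> + 2 * \<kappa> + 8 * (\<eta> * k)\<^sup>2 * \<kappa> > 0" using assms k by (simp add: add_pos_nonneg)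
  ultimately have "?c = 0" by simp
  then have "?s = 0" using s by simp
  then show False using \<open>?c = 0\<close> sin_cos_squared_add[of "2 * k * \<kappa>"] by simp
qed

text \<open>Stated for sequences because the fast phase has a limit \<phi> only along suitable ones.
  At z + f s all other ingredients converge, also when base point and s vary with f.\<close>

lemma D_sequence_limit:
  fixes fs zs :: "nat \<Rightarrow> real" and ss :: "nat \<Rightarrow> complex"
  assumes pos: "\<kappa> > 0" "\<eta> > 0" and fs: "\<And>n. fs n > 0" "fs \<longlonglongrightarrow> 0"
    and zs: "\<And>n. zs n > 0" "zs \<longlonglongrightarrow> x" "x > 0" and ss: "ss \<longlonglongrightarrow> s"
    and ph: "(\<lambda>n. exp (\<i> * of_real (4/3 * sqrt (zs n) ^ 3 / fs n))) \<longlonglongrightarrow> \<phi>"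
  shows "(\<lambda>n. stark_D \<kappa> \<eta> (fs n) (of_real (zs n) + of_real (fs n) * ss n)) \<longlonglongrightarrow>
     limN \<kappa> \<eta> (sqrt x) + \<phi> * of_real (limV \<kappa> \<eta> (sqrt x)) * exp (2 * \<i> * of_real (sqrt x) * s)"
proof -
  define K where "K = complex_of_real (sqrt x)"
  have Kpos: "sqrt x > 0" using zs by simp
  have K0: "K \<noteq> 0" using Kpos by (simp add: K_def)
  \<comment> \<open>\<open>k y n\<close> is the local momentum at the point y, and
    \<open>q n\<close> the one at the real base point, which carries the fast phase.\<close>
  define k where "k y n = csqrt (of_real (zs n) + of_real (fs n) * ss n - of_real (fs n * y))" for y n
  define q where "q n = complex_of_real (sqrt (zs n))" for n
  have ksq: "(k y n)\<^sup>2 = of_real (zs n) + of_real (fs n) * ss n - of_real (fs n * y)" for y n by (simp add: k_def)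
  have kt: "k y \<longlonglongrightarrow> K" for y
  proof -
    have "(\<lambda>n. of_real (zs n) + of_real (fs n) * ss n - of_real (fs n * y)) \<longlonglongrightarrow> of_real x + of_real 0 * s - of_real (0 * y)"
      by (intro tendsto_intros zs fs ss)
    then have "(\<lambda>n. of_real (zs n) + of_real (fs n) * ss n - of_real (fs n * y)) \<longlonglongrightarrow> of_real x" by simp
    moreover have "isCont csqrt (of_real x)" using zs(3) by (intro continuous_at_csqrt) (auto simp: complex_nonpos_Reals_iff)
    ultimately have "k y \<longlonglongrightarrow> csqrt (of_real x)" unfolding k_def by (rule isCont_tendsto_compose[rotated])
    then show ?thesis using zs(3) by (simp add: K_def csqrt_of_real_nonneg)
  qed
  have qt: "q \<longlonglongrightarrow> K" unfolding q_def K_def by (intro tendsto_intros zs)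
  have evk: "\<forall>\<^sub>F n in sequentially. Re (k y n) > 0 \<and> \<bar>Im (k y n)\<bar> \<le> Re (k y n)" for y
  proof -
    have "\<forall>\<^sub>F n in sequentially. dist (k y n) K < sqrt x / 2" by (rule tendstoD[OF kt]) (use Kpos in simp)
    then show ?thesis
    proof eventually_elim
      case (elim n)
      then have "\<bar>Re (k y n - K)\<bar> < sqrt x / 2" "\<bar>Im (k y n - K)\<bar> < sqrt x / 2"
        using abs_Re_le_cmod[of "k y n - K"] abs_Im_le_cmod[of "k y n - K"] unfolding dist_norm by linarith+
      then have "\<bar>Re (k y n) - sqrt x\<bar> < sqrt x / 2" "\<bar>Im (k y n)\<bar> < sqrt x / 2" by (simp_all add: K_def)
      moreover have "u > 0 \<and> \<bar>v\<bar> \<le> u" if "\<bar>u - y\<bar> < y / 2" "\<bar>v\<bar> < y / 2" for u v y :: real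
        using that by arith
      ultimately show ?case by blast
    qed
  qed
  \<comment> \<open>As k^2 - q^2 = f (s - y), the difference of the cubes is of order f; division by
    f leaves the finite limit (3/2) K (s - y).\<close>
  define E where "E y n = (k y n ^ 3 - q n ^ 3) / of_real (fs n)" for y n
  have Et: "E y \<longlonglongrightarrow> 3/2 * K * (s - of_real y)" for y
  proof -
    have "(\<lambda>n. (ss n - of_real y) * ((k y n)\<^sup>2 + k y n * q n + (q n)\<^sup>2) / (k y n + q n)) \<longlonglongrightarrow>
        (s - of_real y) * (K\<^sup>2 + K * K + K\<^sup>2) / (K + K)"
      by (intro tendsto_intros ss kt qt) (use K0 in simp)
    also have "(s - of_real y) * (K\<^sup>2 + K * K + K\<^sup>2) / (K + K) = 3/2 * K * (s - of_real y)"
      using K0 by (simp add: field_simps power2_eq_square)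
    finally show ?thesis
    proof (rule Lim_transform_eventually)
      show "\<forall>\<^sub>F n in sequentially. (ss n - of_real y) * ((k y n)\<^sup>2 + k y n * q n + (q n)\<^sup>2) / (k y n + q n) = E y n"
        using evk[of y]
      proof eventually_elim
        case (elim n)
        have "Re (k y n + q n) > 0" using elim zs(1)[of n] by (simp add: q_def add_pos_pos)
        then have nz: "k y n + q n \<noteq> 0" by (metis less_irrefl zero_complex.sel(1))
        have f0: "complex_of_real (fs n) \<noteq> 0" using fs(1)[of n] by simp
        have "(q n)\<^sup>2 = of_real (zs n)" using zs(1)[of n] by (simp add: q_def flip: of_real_power)
        then have "of_real (fs n) * (ss n - of_real y) = (k y n)\<^sup>2 - (q n)\<^sup>2" unfolding ksq by (simp add: algebra_simps)
        also have "\<dots> = (k y n - q n) * (k y n + q n)" by (simp add: power2_eq_square algebra_simps)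
        finally have "of_real (fs n) * ((ss n - of_real y) * ((k y n)\<^sup>2 + k y n * q n + (q n)\<^sup>2)) =
           (k y n - q n) * ((k y n)\<^sup>2 + k y n * q n + (q n)\<^sup>2) * (k y n + q n)" by (simp add: mult_ac)
        also have "(k y n - q n) * ((k y n)\<^sup>2 + k y n * q n + (q n)\<^sup>2) = k y n ^ 3 - q n ^ 3"
          by (simp add: power2_eq_square power3_eq_cube algebra_simps)
        finally show ?case unfolding E_def using nz f0 by (simp add: frac_eq_eq mult.commute)
      qed
    qed
  qed
  define X where "X y n = exp (4/3 * \<i> * k y n ^ 3 / of_real (fs n))" for y n
  have Xeq: "X y n = exp (\<i> * of_real (4/3 * sqrt (zs n) ^ 3 / fs n)) * exp (4/3 * \<i> * E y n)" for y n
  proof -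
    have "4/3 * \<i> * k y n ^ 3 / of_real (fs n) = \<i> * of_real (4/3 * sqrt (zs n) ^ 3 / fs n) + 4/3 * \<i> * E y n"
      unfolding E_def q_def using fs(1)[of n] by (simp add: field_simps)
    then show ?thesis unfolding X_def by (simp only: exp_add)
  qed
  have Xt: "X y \<longlonglongrightarrow> \<phi> * exp (4/3 * \<i> * (3/2 * K * (s - of_real y)))" for y
    unfolding Xeq[abs_def] by (intro tendsto_intros ph Et)
  define Y where "Y n = exp (4/3 * \<i> * (k (-\<kappa>) n ^ 3 - k \<kappa> n ^ 3) / of_real (fs n))" for n
  have Yeq: "Y n = exp (4/3 * \<i> * (E (-\<kappa>) n - E \<kappa> n))" for n
    unfolding Y_def E_def by (simp add: diff_divide_distrib right_diff_distrib)
  have Yt: "Y \<longlonglongrightarrow> exp (4/3 * \<i> * (3/2 * K * (s - of_real (-\<kappa>)) - 3/2 * K * (s - of_real \<kappa>)))"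
    unfolding Yeq[abs_def] by (intro tendsto_intros Et)
  have mt: "filterlim (\<lambda>n. fs n powr (-1/3)) at_top sequentially"
  proof -
    have "filterlim (\<lambda>t::real. t powr (-1/3)) at_top (at_right 0)" by real_asymp
    moreover have "filterlim fs (at_right 0) sequentially"
      using fs less_imp_neq[OF fs(1), THEN not_sym] by (auto simp: filterlim_at intro!: always_eventually)
    ultimately show ?thesis by (rule filterlim_compose)
  qed
  have amp: "(\<lambda>n. Ai_amp_normalized (r * k y n * of_real (fs n powr (-1/3)))) \<longlonglongrightarrow> 1" if r: "r \<in> {rot6, rot6'}" for r y
  proof (rule Ai_amp_normalized_tendsto)
    have mp: "fs n powr (-1/3) > 0" for n using fs(1)[of n] by simp
    show "\<forall>\<^sub>F n in sequentially. r * k y n * of_real (fs n powr (-1/3)) \<noteq> 0 \<and>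
        norm (r * k y n * of_real (fs n powr (-1/3))) / 4 \<le> Re (r * k y n * of_real (fs n powr (-1/3)))"
      using evk[of y] by eventually_elim (use sector_rot6(1,2)[OF _ _ mp r] in blast)
    have "filterlim (\<lambda>n. norm (k y n) * fs n powr (-1/3)) at_top sequentially"
      by (rule filterlim_tendsto_pos_mult_at_top[OF tendsto_norm[OF kt] _ mt]) (use K0 in simp)
    moreover have "norm (r * k y n * of_real (fs n powr (-1/3))) = norm (k y n) * fs n powr (-1/3)" for n
      using r by (auto simp: norm_mult)
    ultimately show "filterlim (\<lambda>n. norm (r * k y n * of_real (fs n powr (-1/3)))) at_top sequentially" by simp
  qed
  define B where "B y n = Ai_amp_normalized (rot6' * k y n * of_real (fs n powr (-1/3)))" for y n
  define C where "C y n = Ai_amp_normalized (rot6 * k y n * of_real (fs n powr (-1/3)))" for y n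
  have BC: "B y \<longlonglongrightarrow> 1" "C y \<longlonglongrightarrow> 1" for y unfolding B_def C_def by (rule amp, simp)+
  define P where "P y n = - \<i> * (B y n * C y n) / (2 * of_real \<eta> * k y n)" for y n
  have e0: "complex_of_real \<eta> \<noteq> 0" using pos by simp
  have Pt: "P y \<longlonglongrightarrow> - \<i> * (1 * 1) / (2 * of_real \<eta> * K)" for y
    unfolding P_def by (intro tendsto_intros BC kt) (use e0 K0 in simp)
  let ?R = "\<lambda>n. (1 - P \<kappa> n) * (1 - P (-\<kappa>) n)
    + Y n * (B (-\<kappa>) n)\<^sup>2 * (C \<kappa> n)\<^sup>2 / (4 * (of_real \<eta>)\<^sup>2 * k (-\<kappa>) n * k \<kappa> n)
    + X (-\<kappa>) n * (B (-\<kappa>) n)\<^sup>2 / (2 * of_real \<eta> * k (-\<kappa>) n) * (1 + P \<kappa> n)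
    + X \<kappa> n * (B \<kappa> n)\<^sup>2 / (2 * of_real \<eta> * k \<kappa> n) * (1 - P (-\<kappa>) n)"
  let ?g = "- \<i> * (1 * 1) / (2 * of_real \<eta> * K)"
  let ?r = "(1 - ?g) * (1 - ?g)
    + exp (4/3 * \<i> * (3/2 * K * (s - of_real (-\<kappa>)) - 3/2 * K * (s - of_real \<kappa>))) * 1\<^sup>2 * 1\<^sup>2 / (4 * (of_real \<eta>)\<^sup>2 * K * K)
    + (\<phi> * exp (4/3 * \<i> * (3/2 * K * (s - of_real (-\<kappa>))))) * 1\<^sup>2 / (2 * of_real \<eta> * K) * (1 + ?g)
    + (\<phi> * exp (4/3 * \<i> * (3/2 * K * (s - of_real \<kappa>)))) * 1\<^sup>2 / (2 * of_real \<eta> * K) * (1 - ?g)"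
  have "?R \<longlonglongrightarrow> ?r"
    by (intro tendsto_intros Pt Yt Xt BC kt) (use e0 K0 in simp_all)
  moreover have "\<forall>\<^sub>F n in sequentially. ?R n = stark_D \<kappa> \<eta> (fs n) (of_real (zs n) + of_real (fs n) * ss n)"
    using evk[of \<kappa>] evk[of "-\<kappa>"]
  proof eventually_elim
    case (elim n)
    show ?case
      unfolding P_def B_def C_def X_def Y_def
      by (rule stark_D_exact[OF pos fs(1)[of n] ksq[of \<kappa> n] _ _ ksq[of "-\<kappa>" n], symmetric]) (use elim in auto)
  qed
  ultimately have lim: "(\<lambda>n. stark_D \<kappa> \<eta> (fs n) (of_real (zs n) + of_real (fs n) * ss n)) \<longlonglongrightarrow> ?r"
    by (rule Lim_transform_eventually)
  have x1: "4/3 * \<i> * (3/2 * K * (s - of_real (-\<kappa>)) - 3/2 * K * (s - of_real \<kappa>)) = \<i> * of_real (4 * sqrt x * \<kappa>)"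
    by (simp add: K_def field_simps)
  have x2: "4/3 * \<i> * (3/2 * K * (s - of_real (-\<kappa>))) = 2 * \<i> * of_real (sqrt x) * s + \<i> * of_real (2 * sqrt x * \<kappa>)"
    "4/3 * \<i> * (3/2 * K * (s - of_real \<kappa>)) = 2 * \<i> * of_real (sqrt x) * s + - (\<i> * of_real (2 * sqrt x * \<kappa>))"
    by (simp_all add: K_def field_simps)
  let ?c = "cos (2 * sqrt x * \<kappa>)" and ?s = "sin (2 * sqrt x * \<kappa>)"
  have cs: "exp (\<i> * complex_of_real t) = of_real (cos t) + \<i> * of_real (sin t)"
    "exp (- (\<i> * complex_of_real t)) = of_real (cos t) - \<i> * of_real (sin t)" for t
  proof -
    have "exp (\<i> * complex_of_real t) = cis t" "exp (- (\<i> * complex_of_real t)) = cis (- t)"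
      by (simp_all add: cis_conv_exp)
    then show "exp (\<i> * complex_of_real t) = of_real (cos t) + \<i> * of_real (sin t)"
      "exp (- (\<i> * complex_of_real t)) = of_real (cos t) - \<i> * of_real (sin t)"
      by (simp_all add: complex_eq_iff)
  qed
  define g where "g = complex_of_real (1 / (2 * \<eta> * sqrt x))"
  have gK: "?g = - \<i> * g" "1 / (2 * of_real \<eta> * K) = g" "1 / (4 * (of_real \<eta>)\<^sup>2 * K * K) = g * g"
    by (simp_all add: g_def K_def power2_eq_square)
  have "?r = (1 + \<i> * g) * (1 + \<i> * g) + exp (\<i> * of_real (4 * sqrt x * \<kappa>)) * (g * g)
     + \<phi> * exp (2 * \<i> * of_real (sqrt x) * s) * g *
        ((of_real ?c + \<i> * of_real ?s) * (1 - \<i> * g) + (of_real ?c - \<i> * of_real ?s) * (1 + \<i> * g))"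
  proof -
    have "?r = (1 - ?g) * (1 - ?g) + exp (\<i> * of_real (4 * sqrt x * \<kappa>)) * (1 / (4 * (of_real \<eta>)\<^sup>2 * K * K))
      + (\<phi> * (exp (2 * \<i> * of_real (sqrt x) * s) * (of_real ?c + \<i> * of_real ?s))) * (1 / (2 * of_real \<eta> * K)) * (1 + ?g)
      + (\<phi> * (exp (2 * \<i> * of_real (sqrt x) * s) * (of_real ?c - \<i> * of_real ?s))) * (1 / (2 * of_real \<eta> * K)) * (1 - ?g)"
      unfolding x1 x2 exp_add cs by (simp only: power_one mult_1_right times_divide_eq_right)
    also have "\<dots> = (1 + \<i> * g) * (1 + \<i> * g) + exp (\<i> * of_real (4 * sqrt x * \<kappa>)) * (g * g)
     + \<phi> * exp (2 * \<i> * of_real (sqrt x) * s) * g *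
        ((of_real ?c + \<i> * of_real ?s) * (1 - \<i> * g) + (of_real ?c - \<i> * of_real ?s) * (1 + \<i> * g))"
      unfolding gK by (simp add: algebra_simps)
    finally show ?thesis .
  qed
  \<comment> \<open>The two deltas contribute complex conjugate coefficients, so their sum is real;
    this is why \<open>limV\<close> is a real number.\<close>
  also have "(of_real ?c + \<i> * of_real ?s) * (1 - \<i> * g) + (of_real ?c - \<i> * of_real ?s) * (1 + \<i> * g)
     = 2 * (of_real ?c + g * of_real ?s)" by (simp add: algebra_simps)
  also have "\<phi> * exp (2 * \<i> * of_real (sqrt x) * s) * g * (2 * (of_real ?c + g * of_real ?s))
     = \<phi> * of_real (limV \<kappa> \<eta> (sqrt x)) * exp (2 * \<i> * of_real (sqrt x) * s)"
  proof -
    have "limV \<kappa> \<eta> (sqrt x) = (1 / (2 * \<eta> * sqrt x)) * (2 * (?c + (1 / (2 * \<eta> * sqrt x)) * ?s))"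
      unfolding limV_def using pos Kpos by (simp add: field_simps)
    then have "of_real (limV \<kappa> \<eta> (sqrt x)) = g * (2 * (of_real ?c + g * of_real ?s))"
      unfolding g_def by (simp only: of_real_mult of_real_add of_real_numeral)
    then show ?thesis by (simp only: mult_ac)
  qed
  also have "(1 + \<i> * g) * (1 + \<i> * g) + exp (\<i> * of_real (4 * sqrt x * \<kappa>)) * (g * g) = limN \<kappa> \<eta> (sqrt x)"
    unfolding limN_def g_def by (simp add: power2_eq_square)
  finally show ?thesis using lim by simp
qed

text \<open>Along a sequence of counterexamples base points and phases converge after passing to a
  subsequence, and the rescaled determinants tend to h(s) = N + \<phi> V exp(2 i k s). Since |N| >
  |V| > 0, h has a zero in the lower half plane, and a minimum modulus argument on a small circle
  carries it over to D.\<close>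

lemma zero_near_real_point:
  assumes pos: "\<kappa> > 0" "\<eta> > 0" and pq: "0 < p" and V: "\<And>x. x \<in> {p..q} \<Longrightarrow> limV \<kappa> \<eta> (sqrt x) \<noteq> 0"
  shows "\<exists>L f0. L > 0 \<and> f0 > 0 \<and> (\<forall>f t. 0 < f \<and> f < f0 \<and> t \<in> {p..q} \<longrightarrow>
     (\<exists>z. stark_D \<kappa> \<eta> f z = 0 \<and> Im z < 0 \<and> \<bar>Re z - t\<bar> \<le> L * f))"
proof -
  \<comment> \<open>The zero s0 of h satisfies |Re s0| \<le> pi / (2 k) with k \<ge> sqrt p, and the
    zero of D is sought within distance 1 of s0 in the variable s.\<close>
  define L where "L = 1 + pi / (2 * sqrt p)"
  have "pi / (2 * sqrt p) \<ge> 0" using pq by simp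
  then have L: "L > 0" unfolding L_def by linarith
  have "\<exists>f0>0. \<forall>f t. 0 < f \<and> f < f0 \<and> t \<in> {p..q} \<longrightarrow>
     (\<exists>z. stark_D \<kappa> \<eta> f z = 0 \<and> Im z < 0 \<and> \<bar>Re z - t\<bar> \<le> L * f)"
  proof (rule ccontr)
    assume c: "\<not> ?thesis"
    have "\<exists>f t. 0 < f \<and> f < inverse (real (Suc n)) \<and> t \<in> {p..q} \<and>
        (\<forall>z. stark_D \<kappa> \<eta> f z = 0 \<and> Im z < 0 \<longrightarrow> \<bar>Re z - t\<bar> > L * f)" for n
    proof -
      have "inverse (real (Suc n)) > 0" by simp
      with c obtain f t where "0 < f \<and> f < inverse (real (Suc n)) \<and> t \<in> {p..q}"
        "\<not> (\<exists>z. stark_D \<kappa> \<eta> f z = 0 \<and> Im z < 0 \<and> \<bar>Re z - t\<bar> \<le> L * f)" by blast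
      then show ?thesis by (meson not_le)
    qed
    then obtain fs ts where ft: "\<And>n. 0 < fs n" "\<And>n. fs n < inverse (real (Suc n))" "\<And>n. ts n \<in> {p..q}"
      and noz: "\<And>n z. stark_D \<kappa> \<eta> (fs n) z = 0 \<Longrightarrow> Im z < 0 \<Longrightarrow> \<bar>Re z - ts n\<bar> > L * fs n"
      by metis
    have fs0: "fs \<longlonglongrightarrow> 0"
      by (rule tendsto_sandwich[OF _ _ tendsto_const LIMSEQ_inverse_real_of_nat])
         (use ft in \<open>auto intro!: always_eventually less_imp_le\<close>)
    define ph where "ph n = exp (\<i> * of_real (4/3 * sqrt (ts n) ^ 3 / fs n))" for n
    have cK: "compact ({p..q} \<times> sphere (0::complex) 1)" by (intro compact_Times) auto
    have "\<forall>n. (ts n, ph n) \<in> {p..q} \<times> sphere 0 1" using ft(3) by (simp add: ph_def)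
    from cK[unfolded compact_def, THEN spec, THEN mp, OF this] obtain l r where l: "l \<in> {p..q} \<times> sphere 0 1" and r: "strict_mono r" and lr: "((\<lambda>n. (ts n, ph n)) \<circ> r) \<longlonglongrightarrow> l"
      by blast
    define x \<phi> where "x = fst l" and "\<phi> = snd l"
    have x: "x \<in> {p..q}" "x > 0" and \<phi>: "norm \<phi> = 1" using l pq by (auto simp: x_def \<phi>_def)
    have tx: "(\<lambda>n. ts (r n)) \<longlonglongrightarrow> x" and p\<phi>: "(\<lambda>n. ph (r n)) \<longlonglongrightarrow> \<phi>"
      using tendsto_fst[OF lr] tendsto_snd[OF lr] by (simp_all add: x_def \<phi>_def o_def)
    have fr: "(\<lambda>n. fs (r n)) \<longlonglongrightarrow> 0" using LIMSEQ_subseq_LIMSEQ[OF fs0 r] by (simp add: o_def)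
    define k N V where "k = sqrt x" and "N = limN \<kappa> \<eta> k" and "V = limV \<kappa> \<eta> k"
    have k: "k > 0" "k \<ge> sqrt p" using x by (auto simp: k_def)
    have V0: "V \<noteq> 0" unfolding V_def k_def by (rule assms(4)[OF x(1)])
    have NV: "(norm N)\<^sup>2 = 1 + V\<^sup>2" unfolding N_def V_def by (rule limN_limV[OF pos(2) k(1)])
    have NgV: "norm N > \<bar>V\<bar>" by (rule power_less_imp_less_base[of _ 2]) (simp_all add: NV)
    then have N0: "N \<noteq> 0" by auto
    have \<phi>0: "\<phi> \<noteq> 0" using \<phi> by auto
    \<comment> \<open>h(s) = 0 means exp(2 i k s) = w. Since |w| > 1, the solution s0 from the
      principal logarithm has negative imaginary part.\<close>
    define w where "w = - N / (\<phi> * of_real V)"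
    have w0: "w \<noteq> 0" using N0 V0 \<phi>0 by (simp add: w_def)
    have "norm w = norm N / \<bar>V\<bar>" by (simp add: w_def norm_divide norm_mult \<phi>)
    then have w1: "norm w > 1" using NgV V0 by (simp add: less_divide_eq)
    define s0 where "s0 = - \<i> * Ln w / of_real (2 * k)"
    have s0w: "2 * \<i> * of_real k * s0 = Ln w" unfolding s0_def using k by (simp add: field_simps)
    have Res: "Re s0 = Im (Ln w) / (2 * k)" and Ims: "Im s0 = - ln (norm w) / (2 * k)"
      unfolding s0_def using w0 by (simp_all add: Re_divide_of_real Im_divide_of_real)
    have "ln (norm w) > 0" using w1 by (rule ln_gt_zero)
    then have Im0: "Im s0 < 0" unfolding Ims using k by (simp add: divide_neg_pos)
    have Re0: "\<bar>Re s0\<bar> \<le> pi / (2 * sqrt p)"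
    proof -
      have "\<bar>Im (Ln w)\<bar> \<le> pi" using Im_Ln_le_pi[OF w0] mpi_less_Im_Ln[OF w0] by auto
      then have "\<bar>Re s0\<bar> \<le> pi / (2 * k)" unfolding Res using k by (simp add: divide_right_mono)
      also have "\<dots> \<le> pi / (2 * sqrt p)" using k pq by (intro divide_left_mono) auto
      finally show ?thesis .
    qed
    define h where "h s = N + \<phi> * of_real V * exp (2 * \<i> * of_real k * s)" for s
    have h_eq: "h s = N * (1 - exp (2 * \<i> * of_real k * (s - s0)))" for s
    proof -
      have "exp (2 * \<i> * of_real k * s) = exp (2 * \<i> * of_real k * (s - s0)) * exp (Ln w)"
        unfolding s0w[symmetric] exp_add[symmetric] by (simp add: algebra_simps)
      also have "exp (Ln w) = w" using w0 by simp
      finally show ?thesis unfolding h_def w_def using \<phi>0 V0 by (simp add: field_simps)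
    qed
    \<comment> \<open>The 1 serves the real part, \<open>- Im s0 / 2\<close> keeps the disc in the
      lower half plane, and \<open>1 / (2 * k)\<close> is below the spacing pi / k of the zeros of
      h, so that none lies on the circle.\<close>
    define \<rho> where "\<rho> = min 1 (min (- Im s0 / 2) (1 / (2 * k)))"
    have \<rho>: "\<rho> > 0" "\<rho> \<le> 1" "\<rho> \<le> - Im s0 / 2" "\<rho> \<le> 1 / (2 * k)" using Im0 k by (auto simp: \<rho>_def)
    have hnz: "h s \<noteq> 0" if s: "norm (s0 - s) = \<rho>" for s
    proof
      assume "h s = 0"
      then have "exp (2 * \<i> * of_real k * (s - s0)) = 1" unfolding h_eq using N0 by simp
      then obtain m :: int where m: "Re (2 * \<i> * of_real k * (s - s0)) = 0" "Im (2 * \<i> * of_real k * (s - s0)) = of_int (2 * m) * pi"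
        unfolding exp_eq_1 by blast
      have mm: "k * Re (s - s0) = of_int m * pi" "k * Im (s - s0) = 0" using m by simp_all
      have "\<bar>Re (s - s0)\<bar> \<le> \<rho>" using abs_Re_le_cmod[of "s - s0"] s by (simp add: norm_minus_commute)
      then have "k * \<bar>Re (s - s0)\<bar> \<le> k * (1 / (2 * k))" using \<rho>(4) k by (intro mult_left_mono) auto
      then have "\<bar>k * Re (s - s0)\<bar> \<le> 1 / 2" using k by (simp add: abs_mult)
      then have "\<bar>of_int m\<bar> * pi \<le> 1 / 2" unfolding mm by (simp add: abs_mult)
      moreover have "\<bar>of_int m\<bar> * 3 \<le> \<bar>of_int m\<bar> * pi" using pi_gt3 by (intro mult_left_mono) auto
      ultimately have "\<bar>real_of_int m\<bar> < 1" by linarith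
      then have "m = 0" by linarith
      then have "s - s0 = 0" using mm k by (simp add: complex_eq_iff)
      then show False using s \<rho>(1) by simp
    qed
    \<comment> \<open>Minimum modulus principle: were D smaller at s0 than on the whole circle, it
      would have a zero inside, which the choice of the sequence excludes. Only this inequality has
      to survive the limit.\<close>
    have "\<exists>s. norm (s0 - s) = \<rho> \<and> norm (stark_D \<kappa> \<eta> (fs n) (of_real (ts n) + of_real (fs n) * s)) \<le> norm (stark_D \<kappa> \<eta> (fs n) (of_real (ts n) + of_real (fs n) * s0))" for n
    proof (rule ccontr)
      let ?H = "\<lambda>s. stark_D \<kappa> \<eta> (fs n) (of_real (ts n) + of_real (fs n) * s)"
      assume "\<not> ?thesis"
      then have less: "norm (?H s0) < norm (?H s)" if "norm (s0 - s) = \<rho>" for s using that by (auto simp: not_le)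
      have hol: "?H holomorphic_on S" for S
      proof -
        have "(\<lambda>s. of_real (ts n) + of_real (fs n) * s) holomorphic_on S" by (intro holomorphic_intros)
        from holomorphic_on_compose[OF this stark_D_entire(1)[OF pos ft(1)]]
        show ?thesis by (simp add: o_def)
      qed
      obtain s where s: "s \<in> ball s0 \<rho>" "?H s = 0"
        using holomorphic_contract_to_zero[OF holomorphic_on_imp_continuous_on[OF hol] hol \<rho>(1) less] by blast
      have d: "norm (s - s0) < \<rho>" using s(1) by (simp add: dist_norm norm_minus_commute)
      have "Im s - Im s0 < \<rho>" using abs_Im_le_cmod[of "s - s0"] d by simp
      then have Is: "Im s < 0" using \<rho>(3) Im0 by linarith
      have "\<bar>Re s - Re s0\<bar> < 1" using abs_Re_le_cmod[of "s - s0"] d \<rho>(2) by simp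
      then have Rs: "\<bar>Re s\<bar> \<le> L" using Re0 unfolding L_def by linarith
      have "\<bar>Re (of_real (ts n) + of_real (fs n) * s) - ts n\<bar> = fs n * \<bar>Re s\<bar>" using ft(1)[of n] by (simp add: abs_mult)
      also have "\<dots> \<le> fs n * L" using Rs ft(1)[of n] by (intro mult_left_mono) auto
      finally have "\<bar>Re (of_real (ts n) + of_real (fs n) * s) - ts n\<bar> \<le> L * fs n" by (simp add: mult.commute)
      moreover have "Im (of_real (ts n) + of_real (fs n) * s) < 0" using Is ft(1)[of n] by (simp add: mult_pos_neg)
      ultimately show False using noz[OF s(2)] by fastforce
    qed
    then obtain ss where ss: "\<And>n. norm (s0 - ss n) = \<rho>"
      "\<And>n. norm (stark_D \<kappa> \<eta> (fs n) (of_real (ts n) + of_real (fs n) * ss n)) \<le> norm (stark_D \<kappa> \<eta> (fs n) (of_real (ts n) + of_real (fs n) * s0))"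
      by metis
    have "\<forall>n. ss (r n) \<in> sphere s0 \<rho>" using ss(1) by (simp add: dist_norm)
    from compact_sphere[unfolded compact_def, THEN spec, THEN mp, OF this] obtain s r2 where s: "s \<in> sphere s0 \<rho>" and r2: "strict_mono r2" and sr: "((\<lambda>n. ss (r n)) \<circ> r2) \<longlonglongrightarrow> s"
      by blast
    let ?R = "\<lambda>n. r (r2 n)"
    have subR: "(\<lambda>n. X (?R n)) \<longlonglongrightarrow> y" if "(\<lambda>n. X (r n)) \<longlonglongrightarrow> y" for X :: "nat \<Rightarrow> real" and y
      using LIMSEQ_subseq_LIMSEQ[OF that r2] by (simp add: o_def)
    have subC: "(\<lambda>n. X (?R n)) \<longlonglongrightarrow> y" if "(\<lambda>n. X (r n)) \<longlonglongrightarrow> y" for X :: "nat \<Rightarrow> complex" and y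
      using LIMSEQ_subseq_LIMSEQ[OF that r2] by (simp add: o_def)
    have tpos: "ts n > 0" for n using ft(3)[of n] pq by auto
    have lim: "(\<lambda>n. stark_D \<kappa> \<eta> (fs (?R n)) (of_real (ts (?R n)) + of_real (fs (?R n)) * S n)) \<longlonglongrightarrow> h v"
      if "S \<longlonglongrightarrow> v" for S v
      unfolding h_def N_def V_def k_def
      by (rule D_sequence_limit[OF pos ft(1) subR[OF fr] tpos subR[OF tx] x(2) that subC[OF p\<phi>, unfolded ph_def]])
    have l1: "(\<lambda>n. norm (stark_D \<kappa> \<eta> (fs (?R n)) (of_real (ts (?R n)) + of_real (fs (?R n)) * ss (?R n)))) \<longlonglongrightarrow> norm (h s)"
      by (rule tendsto_norm[OF lim]) (use sr in \<open>simp add: o_def\<close>)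
    have l2: "(\<lambda>n. norm (stark_D \<kappa> \<eta> (fs (?R n)) (of_real (ts (?R n)) + of_real (fs (?R n)) * s0))) \<longlonglongrightarrow> norm (h s0)"
      by (rule tendsto_norm[OF lim[OF tendsto_const]])
    have "norm (h s) \<le> norm (h s0)" by (rule LIMSEQ_le[OF l1 l2]) (use ss(2) in blast)
    also have "h s0 = 0" by (simp add: h_eq)
    finally have "h s = 0" by simp
    moreover have "norm (s0 - s) = \<rho>" using s by (simp add: dist_norm)
    ultimately show False using hnz by blast
  qed
  then show ?thesis using L by blast
qed

text \<open>Windows of half-width L f around points spaced by 3 L f are disjoint, and over each lies
  a zero of D; an interval of length 2 \<delta> on which \<open>limV\<close> does not vanish holds
  about 2 \<delta> / (3 L f) such points.\<close>

lemma resonance_count_lower: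
  assumes pos: "\<kappa> > 0" "\<eta> > 0" and ab: "0 < a" "a < b"
  shows "\<exists>c f0. c > 0 \<and> f0 > 0 \<and> (\<forall>f. 0 < f \<and> f < f0 \<longrightarrow> ennreal (c / f) \<le> resonance_count \<kappa> \<eta> f a b)"
proof -
  have "sqrt a < sqrt b" "sqrt a > 0" using ab by auto
  then obtain k where k: "sqrt a < k" "k < sqrt b" "limV \<kappa> \<eta> k \<noteq> 0"
    using exists_limV_nonzero[OF pos, of "sqrt a" "sqrt b"] by auto
  define x0 where "x0 = k\<^sup>2"
  have k0: "k > 0" using k(1) ab real_sqrt_gt_zero[OF ab(1)] by linarith
  have sx0: "sqrt x0 = k" using k0 by (simp add: x0_def)
  have x0: "a < x0" "x0 < b" "x0 > 0"
    using k(1,2) k0 ab real_sqrt_less_iff[of a x0] real_sqrt_less_iff[of x0 b] unfolding sx0 by (auto simp: x0_def)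
  have "isCont (\<lambda>x. limV \<kappa> \<eta> (sqrt x)) x0" unfolding limV_def
    using pos x0 by (intro continuous_intros) auto
  then have "((\<lambda>x. limV \<kappa> \<eta> (sqrt x)) \<longlongrightarrow> limV \<kappa> \<eta> (sqrt x0)) (at x0)" by (simp add: isCont_def)
  then have "\<forall>\<^sub>F x in at x0. limV \<kappa> \<eta> (sqrt x) \<noteq> 0" by (rule tendsto_imp_eventually_ne) (simp add: sx0 k(3))
  then obtain d where d: "d > 0" "\<And>x. x \<noteq> x0 \<Longrightarrow> dist x x0 < d \<Longrightarrow> limV \<kappa> \<eta> (sqrt x) \<noteq> 0"
    unfolding eventually_at by auto
  \<comment> \<open>\<open>\<delta> < d\<close> keeps \<open>limV\<close> nonzero; the interval also
    stays at distance at least \<delta> from a and b, more than the half-width L f of a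
    window.\<close>
  define \<delta> where "\<delta> = min (d / 2) (min (x0 - a) (b - x0) / 2)"
  have \<delta>: "\<delta> > 0" "\<delta> < d" "2 * \<delta> \<le> x0 - a" "2 * \<delta> \<le> b - x0" using d(1) x0 by (auto simp: \<delta>_def min_def)
  let ?p = "x0 - \<delta>" and ?q = "x0 + \<delta>"
  have p0: "0 < ?p" using \<delta> ab by linarith
  have Vnz: "limV \<kappa> \<eta> (sqrt x) \<noteq> 0" if "x \<in> {?p..?q}" for x
  proof (cases "x = x0")
    case False
    have "\<bar>x - x0\<bar> \<le> \<delta>" using that by (auto simp: abs_le_iff)
    then show ?thesis using d(2)[OF False] \<delta>(2) by (simp add: dist_real_def)
  qed (simp add: sx0 k(3))
  obtain L f0 where L: "L > 0" "f0 > 0" and zer: "\<And>f t. 0 < f \<and> f < f0 \<and> t \<in> {?p..?q} \<Longrightarrow>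
     (\<exists>z. stark_D \<kappa> \<eta> f z = 0 \<and> Im z < 0 \<and> \<bar>Re z - t\<bar> \<le> L * f)"
    using zero_near_real_point[OF pos p0 Vnz] by blast
  define f1 where "f1 = min f0 (\<delta> / L)"
  define c where "c = 2 * \<delta> / (3 * L)"
  have "c > 0" "f1 > 0" using L \<delta> by (auto simp: c_def f1_def)
  moreover have "ennreal (c / f) \<le> resonance_count \<kappa> \<eta> f a b" if f: "0 < f" "f < f1" for f
  proof -
    note ent = stark_D_entire[OF pos f(1)]
    have Lf: "L * f < \<delta>" using f L by (simp add: f1_def less_divide_eq mult.commute)
    have Lf0: "L * f > 0" using f L by simp
    \<comment> \<open>The successor counts both ends: the points with index 0 up to the floor of c /
      f all lie in the interval, and n \<ge> c / f.\<close>
    define n where "n = Suc (nat \<lfloor>c / f\<rfloor>)"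
    define t where "t j = ?p + 3 * (L * f) * real j" for j :: nat
    have tj: "t j \<in> {?p..?q}" if "j < n" for j
    proof -
      have "real j \<le> real (nat \<lfloor>c / f\<rfloor>)" using that by (simp add: n_def)
      also have "\<dots> \<le> c / f" using \<open>c > 0\<close> f by (simp add: of_nat_nat)
      finally have "3 * (L * f) * real j \<le> 3 * (L * f) * (c / f)" using Lf0 by (intro mult_left_mono) auto
      also have "\<dots> = 2 * \<delta>" unfolding c_def using f L by (simp add: field_simps)
      finally show ?thesis using Lf0 by (simp add: t_def)
    qed
    have "\<exists>z. stark_D \<kappa> \<eta> f z = 0 \<and> Im z < 0 \<and> \<bar>Re z - t j\<bar> \<le> L * f" if "j < n" for j
      using zer[of f "t j"] tj[OF that] f by (auto simp: f1_def)
    then obtain w where w: "\<And>j. j < n \<Longrightarrow> stark_D \<kappa> \<eta> f (w j) = 0 \<and> Im (w j) < 0 \<and> \<bar>Re (w j) - t j\<bar> \<le> L * f"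
      by metis
    have lt: "Re (w i) < Re (w j)" if "i < j" "j < n" for i j
    proof -
      have "real i + 1 \<le> real j" using that by simp
      then have "3 * (L * f) * (real i + 1) \<le> 3 * (L * f) * real j" using Lf0 by (intro mult_left_mono) auto
      then have "t i + 3 * (L * f) \<le> t j" by (simp add: t_def algebra_simps)
      moreover have "\<bar>Re (w i) - t i\<bar> \<le> L * f" "\<bar>Re (w j) - t j\<bar> \<le> L * f" using w[of i] w[of j] that by auto
      ultimately show ?thesis using Lf0 by (auto simp: abs_le_iff)
    qed
    have inj: "inj_on w {..<n}"
    proof (rule inj_onI)
      fix i j assume ij: "i \<in> {..<n}" "j \<in> {..<n}" "w i = w j"
      then show "i = j" using lt[of i j] lt[of j i] by (cases i j rule: linorder_cases) auto
    qed
    let ?Z = "w ` {..<n}" and ?S = "{z. is_resonance \<kappa> \<eta> f z \<and> Re z \<in> {a..b}}"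
    let ?m = "\<lambda>z. of_nat (resonance_multiplicity \<kappa> \<eta> f z) :: ennreal"
    have sub: "?Z \<subseteq> ?S"
    proof
      fix z assume "z \<in> ?Z"
      then obtain j where j: "j < n" "z = w j" by auto
      have "\<bar>Re z - t j\<bar> \<le> L * f" using w[OF j(1)] j by simp
      then have "Re z \<in> {a..b}" using tj[OF j(1)] Lf \<delta> by (auto simp: abs_le_iff)
      then show "z \<in> ?S" using w[OF j(1)] j ent(3) by simp
    qed
    have one: "1 \<le> ?m z" if "z \<in> ?Z" for z
    proof -
      have "stark_D \<kappa> \<eta> f z = 0" using that w by auto
      then have "zorder (stark_D \<kappa> \<eta> f) z > 0"
        using zorder_exist_zero[OF ent(1)[of UNIV], of z] ent(2) by auto
      then have "1 \<le> resonance_multiplicity \<kappa> \<eta> f z" by (simp add: resonance_multiplicity_def)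
      then have "(of_nat 1 :: ennreal) \<le> ?m z" by (rule of_nat_mono)
      then show ?thesis by simp
    qed
    have "c / f \<le> real n" unfolding n_def using real_nat_ceiling_ge[of "c / f"] by linarith
    then have "ennreal (c / f) \<le> ennreal (real n)" by (rule ennreal_leI)
    also have "\<dots> = (\<Sum>z\<in>?Z. 1)" using inj by (simp add: card_image ennreal_of_nat_eq_real_of_nat)
    also have "\<dots> \<le> sum ?m ?Z" by (rule sum_mono[OF one])
    also have "\<dots> = infsum ?m ?Z" by simp
    also have "\<dots> \<le> infsum ?m ?S"
      by (rule infsum_mono_neutral) (use sub in \<open>auto intro: nonneg_summable_on_complete\<close>)
    finally show ?thesis by (simp add: resonance_count_def)
  qed
  ultimately show ?thesis by blast
qed

theorem theorem1p2:
  fixes \<kappa> \<eta> a b :: real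
  assumes "\<kappa> > 0" and "\<eta> > 0"
    and "0 < a" and "a < b / 2"
  shows "0 < Liminf (at_right 0) (\<lambda>f::real. resonance_count \<kappa> \<eta> f a b / ennreal (1 / f)) \<and>
         Liminf (at_right 0) (\<lambda>f::real. resonance_count \<kappa> \<eta> f a b / ennreal (1 / f))
           \<le> Limsup (at_right 0) (\<lambda>f::real. resonance_count \<kappa> \<eta> f a b / ennreal (1 / f)) \<and>
         Limsup (at_right 0) (\<lambda>f::real. resonance_count \<kappa> \<eta> f a b / ennreal (1 / f)) < \<infinity>"
proof -
  have ab: "a < b" "0 < b" using assms by auto
  obtain c f1 where c: "c > 0" "f1 > 0" "\<And>f. 0 < f \<and> f < f1 \<Longrightarrow> ennreal (c / f) \<le> resonance_count \<kappa> \<eta> f a b"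
    using resonance_count_lower[OF assms(1-3) ab(1)] by blast
  obtain C f2 where C: "C > 0" "f2 > 0" "\<And>f. 0 < f \<and> f < f2 \<Longrightarrow> resonance_count \<kappa> \<eta> f a b \<le> ennreal (C / f)"
    using resonance_count_upper[OF assms(1-3) ab(2)] by blast
  have ev: "eventually (\<lambda>f::real. 0 < f \<and> f < e) (at_right 0)" if "e > 0" for e
    using eventually_at_right_real[OF that] by (auto elim: eventually_mono)
  have q: "ennreal (d / f) / ennreal (1 / f) = ennreal d" if "f > 0" "d > 0" for d f
    using that by (simp add: divide_ennreal)
  have lo: "ennreal c \<le> Liminf (at_right 0) (\<lambda>f::real. resonance_count \<kappa> \<eta> f a b / ennreal (1 / f))"
  proof (rule Liminf_bounded)
    show "\<forall>\<^sub>F f in at_right 0. ennreal c \<le> resonance_count \<kappa> \<eta> f a b / ennreal (1 / f)"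
      using ev[OF c(2)]
    proof eventually_elim
      case (elim f)
      from divide_right_mono_ennreal[OF c(3)[OF elim], of "ennreal (1 / f)"] show ?case using q elim c(1) by simp
    qed
  qed
  have up: "Limsup (at_right 0) (\<lambda>f::real. resonance_count \<kappa> \<eta> f a b / ennreal (1 / f)) \<le> ennreal C"
  proof (rule Limsup_bounded)
    show "\<forall>\<^sub>F f in at_right 0. resonance_count \<kappa> \<eta> f a b / ennreal (1 / f) \<le> ennreal C"
      using ev[OF C(2)]
    proof eventually_elim
      case (elim f)
      from divide_right_mono_ennreal[OF C(3)[OF elim], of "ennreal (1 / f)"] show ?case using q elim C(1) by simp
    qed
  qed
  have "(0::ennreal) < ennreal c" using c(1) by simp
  moreover have "ennreal C < \<infinity>" by simp
  ultimately show ?thesis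
    using less_le_trans[OF _ lo] le_less_trans[OF up] by (simp add: Liminf_le_Limsup)
qed

end
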